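(* Let $\Gamma_1,\Gamma_2$ be two closed conic sets in $\dot T^*\mathbb{R}^n$ and $X_1,X_2$ two closed subsets of $\mathbb{R}^n$ such that $\Sigma:X_1\times X_2\to\mathbb{R}^n$, $\Sigma(x,y)=x+y$, is proper. Then the convolution product of distributions is hypocontinuous from $\mathcal{D}'_{\Gamma_1}(X_1)\times\mathcal{D}'_{\Gamma_2}(X_2)$ to $\mathcal{D}'_\Gamma(X_1+X_2)$, where $$\Gamma=\{(x+y;\eta) : (x;\eta)\in\Gamma_1,\ (y;\eta)\in\Gamma_2\}.$$
   Context: Write $\mathcal{D}(\mathbb{R}^n)=C_c^\infty(\mathbb{R}^n)$, $\dot T^*\mathbb{R}^n=\{(x;\xi)\in\mathbb{R}^n\times\mathbb{R}^n : \xi\neq 0\}$. A subset $\Gamma\subset\dot T^*\mathbb{R}^n$ is a cone (conic) if $(x;\xi)\in\Gamma$ and $\lambda>0$ imply $(x;\lambda\xi)\in\Gamma$. For a cone $\Gamma$, $\mathcal{D}'_\Gamma=\{u\in\mathcal{D}'(\mathbb{R}^n) : \mathrm{WF}(u)\subset\Gamma\}$, with the normal topology: the locally convex topology defined by the seminorms $p_B(u)=\sup_{\phi\in B}|\langle u,\phi\rangle|$, $B$ running over the bounded subsets of $\mathcal{D}(\mathbb{R}^n)$, and $\|u\|_{N,V,\chi}=\sup_{k\in V}(1+|k|)^N|\widehat{u\chi}(k)|$, where $N\ge 0$, $\chi\in\mathcal{D}(\mathbb{R}^n)$ and $V\subset\mathbb{R}^n$ is a closed cone with $(\operatorname{supp}\chi\times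 V)\cap\Gamma=\emptyset$; here $\widehat{w}(k)=\langle w,e^{-ik\cdot x}\rangle$. For a closed $X\subset\mathbb{R}^n$, $\mathcal{D}'_\Gamma(X)$ is the subspace of $u\in\mathcal{D}'_\Gamma$ with $\operatorname{supp}u\subset X$, with the induced topology. The convolution is $u*v=\Sigma_*(u\otimes v)$, i.e. $\langle u*v,\varphi\rangle=\langle u\otimes v,\varphi\circ\Sigma\rangle$ for $\varphi\in\mathcal{D}(\mathbb{R}^n)$, well defined by properness of $\Sigma$ on $X_1\times X_2$. A bilinear map $f:E\times F\to G$ of topological vector spaces is hypocontinuous if for every neighborhood $W$ of zero in $G$: (i) for every bounded $A\subset E$ there is a neighborhood $V$ of zero in $F$ with $f(A\times V)\subset W$; and (ii) for every bounded $B\subset F$ there is a neighborhood $U$ of zero in $E$ with $f(U\times B)\subset W$. *)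

theory Defs
  imports "HOL-Analysis.Analysis"
begin

section \<open>Topological vector spaces of complex-valued functions\<close>

text \<open>Every topological vector space below is a set of complex-valued functions (test functions, or
  distributions seen as functionals on test functions) with pointwise operations.  Its topology is
  given by a family of seminorms.  Seminorms take values in \<^typ>\<open>ennreal\<close>, so that the
  suprema defining them make sense without a prior proof of finiteness, and so that the supremum
  over an empty index set is 0.\<close>

definition seminorm_topology ::
    "('i \<Rightarrow> complex) set \<Rightarrow> (('i \<Rightarrow> complex) \<Rightarrow> ennreal) set \<Rightarrow> ('i \<Rightarrow> complex) topology" where
  "seminorm_topology E P = topology (\<lambda>U. U \<subseteq> E \<and>
     (\<forall>u\<in>U. \<exists>F \<epsilon>. finite F \<and> F \<subseteq> P \<and> (0::real) < \<epsilon> \<and>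
        {v \<in> E. \<forall>p\<in>F. p (\<lambda>i. v i - u i) < ennreal \<epsilon>} \<subseteq> U))"

lemma openin_seminorm_topology:
  "openin (seminorm_topology E P) U \<longleftrightarrow> U \<subseteq> E \<and>
     (\<forall>u\<in>U. \<exists>F \<epsilon>. finite F \<and> F \<subseteq> P \<and> (0::real) < \<epsilon> \<and>
        {v \<in> E. \<forall>p\<in>F. p (\<lambda>i. v i - u i) < ennreal \<epsilon>} \<subseteq> U)"
proof -
  let ?N = "\<lambda>u F \<epsilon>. {v \<in> E. \<forall>p\<in>F. p (\<lambda>i. v i - u i) < ennreal \<epsilon>}"
  let ?L = "\<lambda>U. U \<subseteq> E \<and> (\<forall>u\<in>U. \<exists>F \<epsilon>. finite F \<and> F \<subseteq> P \<and> (0::real) < \<epsilon> \<and> ?N u F \<epsilon> \<subseteq> U)"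
  have "istopology ?L"
    unfolding istopology_def
  proof (intro conjI allI impI)
    fix S T assume S: "?L S" and T: "?L T"
    show "S \<inter> T \<subseteq> E" using S by blast
    show "\<forall>u\<in>S \<inter> T. \<exists>F \<epsilon>. finite F \<and> F \<subseteq> P \<and> (0::real) < \<epsilon> \<and> ?N u F \<epsilon> \<subseteq> S \<inter> T"
    proof
      fix u assume u: "u \<in> S \<inter> T"
      obtain F \<epsilon> where F: "finite F" "F \<subseteq> P" "(0::real) < \<epsilon>" "?N u F \<epsilon> \<subseteq> S"
        using S u by blast
      obtain G \<delta> where G: "finite G" "G \<subseteq> P" "(0::real) < \<delta>" "?N u G \<delta> \<subseteq> T"
        using T u by blast
      have "?N u (F \<union> G) (min \<epsilon> \<delta>) \<subseteq> ?N u F \<epsilon> \<inter> ?N u G \<delta>"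
      proof -
        have "ennreal (min \<epsilon> \<delta>) \<le> ennreal \<epsilon>" "ennreal (min \<epsilon> \<delta>) \<le> ennreal \<delta>"
          by (auto intro: ennreal_leI)
        then have "y < ennreal \<epsilon> \<and> y < ennreal \<delta>" if "y < ennreal (min \<epsilon> \<delta>)" for y
          using that by (meson order.strict_trans2)
        then show ?thesis
          by blast
      qed
      then have "?N u (F \<union> G) (min \<epsilon> \<delta>) \<subseteq> S \<inter> T"
        using F(4) G(4) by blast
      moreover have "finite (F \<union> G)" "F \<union> G \<subseteq> P" "0 < min \<epsilon> \<delta>"
        using F G by auto
      ultimately show "\<exists>F \<epsilon>. finite F \<and> F \<subseteq> P \<and> (0::real) < \<epsilon> \<and> ?N u F \<epsilon> \<subseteq> S \<inter> T"
        by blast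
    qed
  next
    fix \<K> assume K: "\<forall>S\<in>\<K>. ?L S"
    show "\<Union>\<K> \<subseteq> E" using K by blast
    show "\<forall>u\<in>\<Union>\<K>. \<exists>F \<epsilon>. finite F \<and> F \<subseteq> P \<and> (0::real) < \<epsilon> \<and> ?N u F \<epsilon> \<subseteq> \<Union>\<K>"
    proof
      fix u assume "u \<in> \<Union>\<K>"
      then obtain S where S: "S \<in> \<K>" "u \<in> S" by blast
      then obtain F \<epsilon> where "finite F" "F \<subseteq> P" "(0::real) < \<epsilon>" "?N u F \<epsilon> \<subseteq> S"
        using K by meson
      then show "\<exists>F \<epsilon>. finite F \<and> F \<subseteq> P \<and> (0::real) < \<epsilon> \<and> ?N u F \<epsilon> \<subseteq> \<Union>\<K>"
        using S(1) by blast
    qed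
  qed
  then show ?thesis
    by (simp add: seminorm_topology_def topology_inverse')
qed

lemma topspace_seminorm_topology [simp]: "topspace (seminorm_topology E P) = E"
proof (rule antisym)
  show "topspace (seminorm_topology E P) \<subseteq> E"
    using openin_topspace openin_seminorm_topology by blast
  have "\<forall>u\<in>E. \<exists>F \<epsilon>. finite F \<and> F \<subseteq> P \<and> (0::real) < \<epsilon> \<and>
        {v \<in> E. \<forall>p\<in>F. p (\<lambda>i. v i - u i) < ennreal \<epsilon>} \<subseteq> E"
    by (intro ballI exI[of _ "{}"] exI[of _ 1]) auto
  then have "openin (seminorm_topology E P) E"
    by (simp add: openin_seminorm_topology)
  then show "E \<subseteq> topspace (seminorm_topology E P)"
    by (rule openin_subset)
qed

definition zero_nhd :: "('i \<Rightarrow> complex) topology \<Rightarrow> ('i \<Rightarrow> complex) set \<Rightarrow> bool" where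
  "zero_nhd T W \<longleftrightarrow> W \<subseteq> topspace T \<and> (\<exists>U. openin T U \<and> (\<lambda>_. 0) \<in> U \<and> U \<subseteq> W)"

definition tvs_bounded :: "('i \<Rightarrow> complex) topology \<Rightarrow> ('i \<Rightarrow> complex) set \<Rightarrow> bool" where
  "tvs_bounded T A \<longleftrightarrow> A \<subseteq> topspace T \<and>
     (\<forall>W. zero_nhd T W \<longrightarrow> (\<exists>t>0. A \<subseteq> (\<lambda>w i. complex_of_real t * w i) ` W))"

definition bilinear_between ::
    "('i \<Rightarrow> complex) set \<Rightarrow> ('j \<Rightarrow> complex) set \<Rightarrow> ('k \<Rightarrow> complex) set \<Rightarrow>
     (('i \<Rightarrow> complex) \<Rightarrow> ('j \<Rightarrow> complex) \<Rightarrow> ('k \<Rightarrow> complex)) \<Rightarrow> bool" where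
  "bilinear_between E F G f \<longleftrightarrow>
     (\<forall>u\<in>E. \<forall>v\<in>F. f u v \<in> G) \<and>
     (\<forall>u\<in>E. \<forall>u'\<in>E. \<forall>v\<in>F. f (\<lambda>i. u i + u' i) v = (\<lambda>k. f u v k + f u' v k)) \<and>
     (\<forall>u\<in>E. \<forall>v\<in>F. \<forall>v'\<in>F. f u (\<lambda>j. v j + v' j) = (\<lambda>k. f u v k + f u v' k)) \<and>
     (\<forall>c. \<forall>u\<in>E. \<forall>v\<in>F. f (\<lambda>i. c * u i) v = (\<lambda>k. c * f u v k)) \<and>
     (\<forall>c. \<forall>u\<in>E. \<forall>v\<in>F. f u (\<lambda>j. c * v j) = (\<lambda>k. c * f u v k))"

definition hypocontinuous ::
    "('i \<Rightarrow> complex) topology \<Rightarrow> ('j \<Rightarrow> complex) topology \<Rightarrow> ('k \<Rightarrow> complex) topology \<Rightarrow>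
     (('i \<Rightarrow> complex) \<Rightarrow> ('j \<Rightarrow> complex) \<Rightarrow> ('k \<Rightarrow> complex)) \<Rightarrow> bool" where
  "hypocontinuous E F G f \<longleftrightarrow>
     bilinear_between (topspace E) (topspace F) (topspace G) f \<and>
     (\<forall>W. zero_nhd G W \<longrightarrow>
        (\<forall>A. tvs_bounded E A \<longrightarrow> (\<exists>V. zero_nhd F V \<and> (\<forall>u\<in>A. \<forall>v\<in>V. f u v \<in> W))) \<and>
        (\<forall>B. tvs_bounded F B \<longrightarrow> (\<exists>U. zero_nhd E U \<and> (\<forall>u\<in>U. \<forall>v\<in>B. f u v \<in> W))))"


section \<open>Test functions\<close>

primrec iter_partial ::
    "'a list \<Rightarrow> ('a::euclidean_space \<Rightarrow> complex) \<Rightarrow> 'a \<Rightarrow> complex" where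
  "iter_partial [] f = f"
| "iter_partial (b # bs) f = (\<lambda>x. frechet_derivative (iter_partial bs f) (at x) b)"

definition smooth :: "('a::euclidean_space \<Rightarrow> complex) \<Rightarrow> bool" where
  "smooth f \<longleftrightarrow> (\<forall>bs\<in>lists Basis. \<forall>x. iter_partial bs f differentiable (at x))"

definition supp_fun :: "('a::topological_space \<Rightarrow> complex) \<Rightarrow> 'a set" where
  "supp_fun f = closure {x. f x \<noteq> 0}"

definition test_functions :: "('a::euclidean_space \<Rightarrow> complex) set" where
  "test_functions = {\<phi>. smooth \<phi> \<and> compact (supp_fun \<phi>)}"

definition Ck_norm :: "nat \<Rightarrow> ('a::euclidean_space \<Rightarrow> complex) \<Rightarrow> ennreal" where
  "Ck_norm m \<phi> =
     (SUP bs\<in>{bs \<in> lists Basis. length bs \<le> m}. SUP x. ennreal (cmod (iter_partial bs \<phi> x)))"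

definition seminorm_on :: "('i \<Rightarrow> complex) set \<Rightarrow> (('i \<Rightarrow> complex) \<Rightarrow> ennreal) \<Rightarrow> bool" where
  "seminorm_on E p \<longleftrightarrow>
     (\<forall>u\<in>E. p u < \<infinity>) \<and>
     (\<forall>u\<in>E. \<forall>v\<in>E. p (\<lambda>i. u i + v i) \<le> p u + p v) \<and>
     (\<forall>c. \<forall>u\<in>E. p (\<lambda>i. c * u i) = ennreal (cmod c) * p u)"

text \<open>The usual LF topology: the finest locally convex topology for which all inclusions of the
  Frechet spaces of test functions supported in a compact set \<open>K\<close> are continuous.  It is
  generated by all seminorms whose restriction to each of these spaces is continuous.\<close>

definition test_topology :: "('a::euclidean_space \<Rightarrow> complex) topology" where
  "test_topology = seminorm_topology test_functions
     {p. seminorm_on test_functions p \<and>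
         (\<forall>K. compact K \<longrightarrow> (\<exists>m. \<exists>C::real. \<forall>\<phi>\<in>test_functions.
            supp_fun \<phi> \<subseteq> K \<longrightarrow> p \<phi> \<le> ennreal C * Ck_norm m \<phi>))}"


section \<open>Distributions\<close>

text \<open>A distribution is a functional on all functions, normalized to be 0 outside
  \<^const>\<open>test_functions\<close>, so that equality of distributions is equality in HOL.\<close>

definition distributions :: "(('a::euclidean_space \<Rightarrow> complex) \<Rightarrow> complex) set" where
  "distributions = {u.
     (\<forall>\<phi>. \<phi> \<notin> test_functions \<longrightarrow> u \<phi> = 0) \<and>
     (\<forall>\<phi>\<in>test_functions. \<forall>\<psi>\<in>test_functions. u (\<lambda>x. \<phi> x + \<psi> x) = u \<phi> + u \<psi>) \<and>
     (\<forall>c. \<forall>\<phi>\<in>test_functions. u (\<lambda>x. c * \<phi> x) = c * u \<phi>) \<and>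
     continuous_map test_topology euclidean u}"

definition supp_dist :: "(('a::euclidean_space \<Rightarrow> complex) \<Rightarrow> complex) \<Rightarrow> 'a set" where
  "supp_dist u = - \<Union>{U. open U \<and> (\<forall>\<phi>\<in>test_functions. supp_fun \<phi> \<subseteq> U \<longrightarrow> u \<phi> = 0)}"

text \<open>The pairing of a distribution \<open>u\<close> with a smooth function \<open>f\<close> such that
  the intersection of their supports is compact: \<open>u\<close> is applied to \<open>\<theta> f\<close>, where
  \<open>\<theta>\<close> is any test function equal to 1 on a neighbourhood of that intersection
  (the value does not depend on the choice).\<close>

definition dist_pairing ::
    "(('a::euclidean_space \<Rightarrow> complex) \<Rightarrow> complex) \<Rightarrow> ('a \<Rightarrow> complex) \<Rightarrow> complex" where
  "dist_pairing u f =
     (let \<theta> = (SOME \<theta>. \<theta> \<in> test_functions \<and>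
                  (\<exists>U. open U \<and> supp_dist u \<inter> supp_fun f \<subseteq> U \<and> (\<forall>x\<in>U. \<theta> x = 1)))
      in u (\<lambda>x. \<theta> x * f x))"

definition dist_mult ::
    "(('a::euclidean_space \<Rightarrow> complex) \<Rightarrow> complex) \<Rightarrow> ('a \<Rightarrow> complex) \<Rightarrow>
     (('a \<Rightarrow> complex) \<Rightarrow> complex)" where
  "dist_mult u \<psi> = (\<lambda>\<phi>. if \<phi> \<in> test_functions then u (\<lambda>x. \<psi> x * \<phi> x) else 0)"

definition dist_fourier :: "(('a::euclidean_space \<Rightarrow> complex) \<Rightarrow> complex) \<Rightarrow> 'a \<Rightarrow> complex" where
  "dist_fourier w k = dist_pairing w (\<lambda>x. exp (- \<i> * complex_of_real (k \<bullet> x)))"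

definition tensor ::
    "(('a::euclidean_space \<Rightarrow> complex) \<Rightarrow> complex) \<Rightarrow> (('b::euclidean_space \<Rightarrow> complex) \<Rightarrow> complex) \<Rightarrow>
     (('a \<times> 'b \<Rightarrow> complex) \<Rightarrow> complex)" where
  "tensor u v = (\<lambda>f. if f \<in> test_functions then u (\<lambda>x. v (\<lambda>y. f (x, y))) else 0)"

definition convolution ::
    "(('a::euclidean_space \<Rightarrow> complex) \<Rightarrow> complex) \<Rightarrow> (('a \<Rightarrow> complex) \<Rightarrow> complex) \<Rightarrow>
     (('a \<Rightarrow> complex) \<Rightarrow> complex)" where
  "convolution u v =
     (\<lambda>\<phi>. if \<phi> \<in> test_functions then dist_pairing (tensor u v) (\<lambda>(x, y). \<phi> (x + y)) else 0)"


section \<open>Wave front sets and the normal topology\<close>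

definition cotangent_dot :: "('a::euclidean_space \<times> 'a) set" where
  "cotangent_dot = {(x, \<xi>). \<xi> \<noteq> 0}"

definition fibre_conic :: "('a::euclidean_space \<times> 'a) set \<Rightarrow> bool" where
  "fibre_conic \<Gamma> \<longleftrightarrow> (\<forall>x \<xi>. \<forall>c>0. (x, \<xi>) \<in> \<Gamma> \<longrightarrow> (x, c *\<^sub>R \<xi>) \<in> \<Gamma>)"

definition fourier_seminorm ::
    "nat \<Rightarrow> 'a set \<Rightarrow> ('a \<Rightarrow> complex) \<Rightarrow> (('a::euclidean_space \<Rightarrow> complex) \<Rightarrow> complex) \<Rightarrow> ennreal" where
  "fourier_seminorm N V \<psi> u =
     (SUP k\<in>V. ennreal ((1 + norm k) ^ N * cmod (dist_fourier (dist_mult u \<psi>) k)))"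

definition wave_front :: "(('a::euclidean_space \<Rightarrow> complex) \<Rightarrow> complex) \<Rightarrow> ('a \<times> 'a) set" where
  "wave_front u = {(x, \<xi>). \<xi> \<noteq> 0 \<and>
     \<not> (\<exists>\<psi>\<in>test_functions. \<exists>V. \<psi> x \<noteq> 0 \<and> cone V \<and> \<xi> \<in> interior V \<and>
          (\<forall>N. fourier_seminorm N V \<psi> u < \<infinity>))}"

definition dist_wf ::
    "('a::euclidean_space \<times> 'a) set \<Rightarrow> (('a \<Rightarrow> complex) \<Rightarrow> complex) set" where
  "dist_wf \<Gamma> = {u \<in> distributions. wave_front u \<subseteq> \<Gamma>}"

text \<open>The library's \<^const>\<open>cone\<close> requires stability under factors \<open>c \<ge> 0\<close>;
  for closed sets this is the same as stability under factors \<open>c > 0\<close>.\<close>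

definition normal_topology ::
    "('a::euclidean_space \<times> 'a) set \<Rightarrow> (('a \<Rightarrow> complex) \<Rightarrow> complex) topology" where
  "normal_topology \<Gamma> = seminorm_topology (dist_wf \<Gamma>)
     ({(\<lambda>u. SUP \<phi>\<in>B. ennreal (cmod (u \<phi>))) | B. tvs_bounded test_topology B} \<union>
      {fourier_seminorm N V \<psi> | N V \<psi>.
         \<psi> \<in> test_functions \<and> closed V \<and> cone V \<and> (supp_fun \<psi> \<times> V) \<inter> \<Gamma> = {}})"

definition normal_topology_supp ::
    "('a::euclidean_space \<times> 'a) set \<Rightarrow> 'a set \<Rightarrow> (('a \<Rightarrow> complex) \<Rightarrow> complex) topology" where
  "normal_topology_supp \<Gamma> X = subtopology (normal_topology \<Gamma>) {u. supp_dist u \<subseteq> X}"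

end

theory Submission
  imports Defs
begin

text \<open>
  By properness, for each compact \<open>K\<close> there is one test function \<open>\<theta>\<close> on the product with
  \<open>(u * v)(\<phi>) = u(x \<mapsto> v(y \<mapsto> \<theta>(x, y) \<phi>(x + y)))\<close> for all \<open>u\<close>, \<open>v\<close> with supports in
  \<open>X1\<close>, \<open>X2\<close> and all \<open>\<phi>\<close> with support in \<open>K\<close>.  Insert \<open>\<phi>(z) = \<tau>(z) exp(-i k z)\<close>, split
  \<open>\<theta>(x, y) \<tau>(x + y)\<close> by a partition of unity into terms \<open>\<alpha>(x) \<beta>(y) g(x, y)\<close> and expand \<open>g\<close> into
  a rapidly convergent Fourier series.  This writes the Fourier transform of \<open>\<tau>(u * v)\<close> at \<open>k\<close> as a
  finite sum of series \<open>\<Sum>j. c j * F(\<alpha> u)(k + p j) * F(\<beta> v)(k + q j)\<close>, where \<open>F\<close> is the Fourier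
  transform and \<open>(c j)\<close> decays rapidly.

  If \<open>\<kappa>\<close> is a direction such that no \<open>(z, \<kappa>)\<close> with \<open>z\<close> in the support of \<open>\<tau>\<close> lies in the target
  cone, then \<open>(x, \<kappa>) \<notin> \<Gamma>1\<close> or \<open>(y, \<kappa>) \<notin> \<Gamma>2\<close> whenever \<open>x + y\<close> is in this support, so the pieces
  can be chosen such that in each of them \<open>F(\<alpha> u)\<close> or \<open>F(\<beta> v)\<close> decays rapidly near \<open>\<kappa>\<close>.  Shifts \<open>p j\<close>
  that are small compared with \<open>k\<close> do not leave the cone of decay; for the others the decay of \<open>c\<close>
  beats the polynomial growth of the two transforms.  For \<open>u\<close> in a bounded set the series is then
  bounded by seminorms of \<open>v\<close>: if \<open>F(\<alpha> u)\<close> decays, the series is \<open>v\<close> applied to a function in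
  a bounded set of test functions; if \<open>F(\<beta> v)\<close> decays, a Fourier seminorm of \<open>v\<close> enters as well.
  Bounded sets give hypocontinuity, and one-element sets give the bound on the wave front set.
\<close>

section \<open>Smooth functions and bounds on derivatives\<close>

text \<open>The obstacle is uniformity: each estimate must hold for all \<open>u\<close> in a
  bounded set at once, while \<open>v\<close> enters through finitely many seminorms. Boundedness is
  therefore converted into one order and one constant on each compact set and uniform decay in every
  admissible cone (\<open>dist_bounded\<close>), and hypocontinuity into an inequality between
  seminorms (\<open>dominated\<close>). A Fourier series is preferred to a Fourier integral because
  a distribution acts term by term on a rapidly convergent series of waves: no integral is
  interchanged with a distribution, and the frequencies \<open>k + p j\<close>,
  \<open>k + q j\<close> are handled by explicit majorants. The convolution is an iterated pairing
  with \<open>u\<close> outside and \<open>v\<close> inside, so the seminorms given by bounded sets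
  of test functions are treated separately in the two variables, whereas the series of products of
  Fourier transforms is symmetric and serves both. For the wave front set, closedness is used one
  direction at a time: the points of \<open>X1\<close> and \<open>X2\<close> over which a fixed
  direction lies in the cones form closed sets, and properness makes the set of their sums
  closed.\<close>

definition partial :: "'a::euclidean_space \<Rightarrow> ('a \<Rightarrow> complex) \<Rightarrow> 'a \<Rightarrow> complex" where
  "partial b f = (\<lambda>x. frechet_derivative f (at x) b)"

text \<open>The index is shifted: \<open>cdiff n\<close> asserts \<open>n + 1\<close> orders of differentiability.\<close>

primrec cdiff :: "nat \<Rightarrow> ('a::euclidean_space \<Rightarrow> complex) \<Rightarrow> bool" where
  "cdiff 0 f \<longleftrightarrow> (\<forall>x. f differentiable (at x))"
| "cdiff (Suc n) f \<longleftrightarrow> (\<forall>x. f differentiable (at x)) \<and> (\<forall>b\<in>Basis. cdiff n (partial b f))"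

text \<open>Here the index counts derivatives exactly, without the shift of \<open>cdiff\<close>.
  One real bound covers all orders; for \<open>S = UNIV\<close> this is the real-valued form of
  \<open>Ck_norm\<close> (\<open>Ck_norm_le_iff\<close>).\<close>

primrec ck_bounded :: "nat \<Rightarrow> 'a::euclidean_space set \<Rightarrow> real \<Rightarrow> ('a \<Rightarrow> complex) \<Rightarrow> bool" where
  "ck_bounded 0 S c f \<longleftrightarrow> (\<forall>x\<in>S. cmod (f x) \<le> c)"
| "ck_bounded (Suc n) S c f \<longleftrightarrow> (\<forall>x\<in>S. cmod (f x) \<le> c) \<and> (\<forall>b\<in>Basis. ck_bounded n S c (partial b f))"

lemma iter_partial_append: "iter_partial (bs @ cs) f = iter_partial bs (iter_partial cs f)"
  by (induction bs) auto

lemma iter_partial_snoc: "iter_partial (bs @ [b]) f = iter_partial bs (partial b f)"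
  by (simp add: iter_partial_append partial_def)

text \<open>The last entry is split off because \<open>iter_partial\<close> applies it first:
  \<open>bs @ [b]\<close> acts on \<open>f\<close> as \<open>bs\<close> acts on
  \<open>partial b f\<close>, which is the recursion of \<open>cdiff\<close> and
  \<open>ck_bounded\<close>.\<close>

lemma lists_length_Suc_cases:
  "(\<forall>bs\<in>lists B. length bs \<le> Suc n \<longrightarrow> P bs) \<longleftrightarrow>
     P [] \<and> (\<forall>b\<in>B. \<forall>bs\<in>lists B. length bs \<le> n \<longrightarrow> P (bs @ [b]))" (is "?L \<longleftrightarrow> ?R")
proof
  assume ?L
  then show ?R by auto
next
  assume R: ?R
  have "P bs" if "bs \<in> lists B" "length bs \<le> Suc n" for bs
    using that R by (cases bs rule: rev_cases) auto
  then show ?L by auto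
qed

lemma cdiff_iff: "cdiff n f \<longleftrightarrow> (\<forall>bs\<in>lists Basis. length bs \<le> n \<longrightarrow> (\<forall>x. iter_partial bs f differentiable (at x)))"
  by (induction n arbitrary: f) (auto simp: lists_length_Suc_cases iter_partial_snoc)

lemma smooth_iff_cdiff: "smooth f \<longleftrightarrow> (\<forall>n. cdiff n f)"
  by (auto simp: smooth_def cdiff_iff)

lemma ck_bounded_iff: "ck_bounded n S c f \<longleftrightarrow>
    (\<forall>bs\<in>lists Basis. length bs \<le> n \<longrightarrow> (\<forall>x\<in>S. cmod (iter_partial bs f x) \<le> c))"
proof (induction n arbitrary: f)
  case (Suc n)
  then show ?case
    by (subst lists_length_Suc_cases) (simp add: iter_partial_snoc)
qed auto

lemma Ck_norm_le_iff:
  assumes "0 \<le> c"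
  shows "Ck_norm m \<phi> \<le> ennreal c \<longleftrightarrow> ck_bounded m UNIV c \<phi>"
  using assms unfolding Ck_norm_def ck_bounded_iff by (auto simp: SUP_le_iff)

lemma cdiff_differentiable: "cdiff n f \<Longrightarrow> f differentiable (at x)"
  by (cases n) auto

lemma cdiff_Suc_D: "cdiff (Suc n) f \<Longrightarrow> cdiff n f"
  by (induction n arbitrary: f) auto

lemma smooth_differentiable: "smooth f \<Longrightarrow> f differentiable (at x)"
  using smooth_iff_cdiff cdiff_differentiable by blast

lemma smooth_partial: "smooth f \<Longrightarrow> b \<in> Basis \<Longrightarrow> smooth (partial b f)"
  by (metis smooth_iff_cdiff cdiff.simps(2))

lemma smooth_continuous_on: "smooth f \<Longrightarrow> continuous_on S f"
  by (meson smooth_differentiable differentiable_imp_continuous_within continuous_at_imp_continuous_on)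

lemma ck_bounded_SucD: "ck_bounded (Suc m) S c f \<Longrightarrow> ck_bounded m S c f"
  by (auto simp: ck_bounded_iff)

lemma ck_bounded_mono: "ck_bounded m S c f \<Longrightarrow> m' \<le> m \<Longrightarrow> S' \<subseteq> S \<Longrightarrow> c \<le> c' \<Longrightarrow> ck_bounded m' S' c' f"
  unfolding ck_bounded_iff by (meson order_trans subsetD)

lemma ck_bounded_0D: "ck_bounded m S c f \<Longrightarrow> x \<in> S \<Longrightarrow> cmod (f x) \<le> c"
  by (cases m) auto

lemma partial_eqI: "(f has_derivative D) (at x) \<Longrightarrow> partial b f x = D b"
  unfolding partial_def by (metis frechet_derivative_at)

lemma has_derivative_partial:
  "f differentiable (at x) \<Longrightarrow> (f has_derivative (\<lambda>h. \<Sum>b\<in>Basis. of_real (h \<bullet> b) * partial b f x)) (at x)"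
proof -
  assume "f differentiable (at x)"
  then have d: "(f has_derivative frechet_derivative f (at x)) (at x)"
    by (simp add: frechet_derivative_works)
  interpret linear "frechet_derivative f (at x)" using d has_derivative_linear by blast
  have "frechet_derivative f (at x) h = (\<Sum>b\<in>Basis. of_real (h \<bullet> b) * partial b f x)" for h
  proof -
    have "frechet_derivative f (at x) h = frechet_derivative f (at x) (\<Sum>b\<in>Basis. (h \<bullet> b) *\<^sub>R b)"
      by (simp add: euclidean_representation)
    then show ?thesis by (simp add: sum scaleR partial_def scaleR_conv_of_real)
  qed
  then show ?thesis using d by (metis (no_types, lifting) ext)
qed

lemma partial_const [simp]: "partial b (\<lambda>x. c) = (\<lambda>x. 0)"
  by (rule ext) (rule partial_eqI[where D = "\<lambda>_. 0"], simp)

lemma partial_add: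
  assumes "\<And>x. f differentiable (at x)" "\<And>x. g differentiable (at x)"
  shows "partial b (\<lambda>x. f x + g x) = (\<lambda>x. partial b f x + partial b g x)"
proof
  fix x
  have "((\<lambda>x. f x + g x) has_derivative (\<lambda>h. frechet_derivative f (at x) h + frechet_derivative g (at x) h)) (at x)"
    using assms by (intro has_derivative_add) (auto simp: frechet_derivative_works[symmetric])
  then show "partial b (\<lambda>x. f x + g x) x = partial b f x + partial b g x"
    by (simp add: partial_eqI) (simp add: partial_def)
qed

lemma partial_mult:
  assumes "\<And>x. f differentiable (at x)" "\<And>x. g differentiable (at x)"
  shows "partial b (\<lambda>x. f x * g x) = (\<lambda>x. f x * partial b g x + partial b f x * g x)"
proof
  fix x
  have "((\<lambda>x. f x * g x) has_derivative (\<lambda>h. f x * frechet_derivative g (at x) h + frechet_derivative f (at x) h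
    * g x)) (at x)"
    using assms by (intro has_derivative_mult) (auto simp: frechet_derivative_works[symmetric])
  then show "partial b (\<lambda>x. f x * g x) x = f x * partial b g x + partial b f x * g x"
    by (simp add: partial_eqI) (simp add: partial_def)
qed

lemma partial_cmult:
  assumes "\<And>x. f differentiable (at x)"
  shows "partial b (\<lambda>x. c * f x) = (\<lambda>x. c * partial b f x)"
  using partial_mult[of "\<lambda>_. c" f b] assms by simp

lemma cdiff_const [simp]: "cdiff n (\<lambda>x. c)"
  by (induction n arbitrary: c) auto

lemma smooth_const [simp]: "smooth (\<lambda>x. c)"
  by (simp add: smooth_iff_cdiff)

lemma cdiff_add: "cdiff n f \<Longrightarrow> cdiff n g \<Longrightarrow> cdiff n (\<lambda>x. f x + g x)"
  by (induction n arbitrary: f g) (auto simp: partial_add)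

lemma cdiff_mult: "cdiff n f \<Longrightarrow> cdiff n g \<Longrightarrow> cdiff n (\<lambda>x. f x * g x)"
proof (induction n arbitrary: f g)
  case (Suc n)
  then show ?case
    using cdiff_Suc_D[of n f] cdiff_Suc_D[of n g] by (auto simp: partial_mult intro!: cdiff_add)
qed auto

lemma smooth_add: "smooth f \<Longrightarrow> smooth g \<Longrightarrow> smooth (\<lambda>x. f x + g x)"
  by (simp add: smooth_iff_cdiff cdiff_add)

lemma smooth_mult: "smooth f \<Longrightarrow> smooth g \<Longrightarrow> smooth (\<lambda>x. f x * g x)"
  by (simp add: smooth_iff_cdiff cdiff_mult)

lemma smooth_cmult: "smooth f \<Longrightarrow> smooth (\<lambda>x. c * f x)"
  by (intro smooth_mult) auto

lemma smooth_diff: "smooth f \<Longrightarrow> smooth g \<Longrightarrow> smooth (\<lambda>x. f x - g x)"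
  using smooth_add[of f "\<lambda>x. (-1) * g x"] smooth_cmult[of g "-1"] by simp

lemma smooth_sum: "(\<And>i. i \<in> I \<Longrightarrow> smooth (f i)) \<Longrightarrow> smooth (\<lambda>x. \<Sum>i\<in>I. f i x)"
  by (induction I rule: infinite_finite_induct) (auto intro: smooth_add)

lemma smooth_prod: "(\<And>i. i \<in> I \<Longrightarrow> smooth (f i)) \<Longrightarrow> smooth (\<lambda>x. \<Prod>i\<in>I. f i x)"
  by (induction I rule: infinite_finite_induct) (auto intro: smooth_mult)

text \<open>The derivative of \<open>1 / f\<close> contains \<open>1 / f\<close> only
  undifferentiated, as two factors next to a derivative of \<open>f\<close>; the induction
  hypothesis covers these factors at one order less.\<close>

lemma cdiff_inverse: "cdiff n f \<Longrightarrow> (\<And>x. f x \<noteq> 0) \<Longrightarrow> cdiff n (\<lambda>x. inverse (f x))"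
proof (induction n arbitrary: f)
  case 0
  then show ?case by (auto intro: differentiable_inverse)
next
  case (Suc n)
  have "partial b (\<lambda>x. inverse (f x)) = (\<lambda>x. - 1 * (inverse (f x) * partial b f x * inverse (f x)))" for b
  proof
    fix x
    have "f differentiable (at x)" using Suc.prems by auto
    then have "((\<lambda>x. inverse (f x)) has_derivative
      (\<lambda>h. - (inverse (f x) * frechet_derivative f (at x) h * inverse (f x)))) (at x)"
      by (rule Deriv.has_derivative_inverse[OF Suc.prems(2) frechet_derivative_works[THEN iffD1, of f]])
    then show "partial b (\<lambda>x. inverse (f x)) x = - 1 * (inverse (f x) * partial b f x * inverse (f x))"
      by (simp add: partial_eqI) (simp add: partial_def)
  qed
  moreover have "cdiff n (\<lambda>x. inverse (f x))" using Suc cdiff_Suc_D by blast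
  ultimately show ?case
    using Suc.prems
    by (simp only: cdiff.simps) (intro conjI ballI allI cdiff_mult cdiff_const differentiable_inverse; simp)
qed

lemma smooth_inverse: "smooth f \<Longrightarrow> (\<And>x. f x \<noteq> 0) \<Longrightarrow> smooth (\<lambda>x. inverse (f x))"
  by (simp add: smooth_iff_cdiff cdiff_inverse)

lemma partial_affine:
  fixes A :: "'a::euclidean_space \<Rightarrow> 'b::euclidean_space"
  assumes "bounded_linear A" "\<And>x. f differentiable (at x)"
  shows "partial b (\<lambda>x. f (A x + a)) = (\<lambda>x. \<Sum>i\<in>Basis. of_real (A b \<bullet> i) * partial i f (A x + a))"
    and "(\<lambda>x. f (A x + a)) differentiable (at x)"
proof -
  have "((\<lambda>x. f (A x + a)) has_derivative (\<lambda>h. \<Sum>i\<in>Basis. of_real (A h \<bullet> i) * partial i f (A x + a))) (at x)" for x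
  proof -
    have "((\<lambda>x. A x + a) has_derivative A) (at x)"
      using has_derivative_add[OF bounded_linear_imp_has_derivative[OF assms(1)] has_derivative_const[of a]] by simp
    from has_derivative_compose[OF this has_derivative_partial[OF assms(2)]] show ?thesis .
  qed
  then show "partial b (\<lambda>x. f (A x + a)) = (\<lambda>x. \<Sum>i\<in>Basis. of_real (A b \<bullet> i) * partial i f (A x + a))"
    "(\<lambda>x. f (A x + a)) differentiable (at x)"
    using partial_eqI by (blast, blast intro: differentiableI)
qed

lemma cdiff_sum: "(\<And>i. i \<in> I \<Longrightarrow> cdiff n (f i)) \<Longrightarrow> cdiff n (\<lambda>x. \<Sum>i\<in>I. f i x)"
  by (induction I rule: infinite_finite_induct) (auto intro: cdiff_add)

lemma cdiff_affine:
  assumes "bounded_linear A"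
  shows "cdiff n f \<Longrightarrow> cdiff n (\<lambda>x. f (A x + a))"
  by (induction n arbitrary: f) (auto simp: partial_affine[OF assms] intro!: cdiff_sum cdiff_mult)

lemma smooth_affine: "bounded_linear A \<Longrightarrow> smooth f \<Longrightarrow> smooth (\<lambda>x. f (A x + a))"
  by (simp add: smooth_iff_cdiff cdiff_affine)

lemma smooth_linear: "bounded_linear A \<Longrightarrow> smooth f \<Longrightarrow> smooth (\<lambda>x. f (A x))"
  using smooth_affine[of A f 0] by simp

text \<open>Linear maps sending basis vectors to basis vectors or to zero do not increase derivative bounds;
  this covers \<open>fst\<close>, \<open>snd\<close>, addition, and the inclusions of the factors of a product.\<close>

definition basis_map :: "('a::euclidean_space \<Rightarrow> 'b::euclidean_space) \<Rightarrow> bool" where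
  "basis_map A \<longleftrightarrow> bounded_linear A \<and> A ` Basis \<subseteq> insert 0 Basis"

lemma partial_basis_map:
  assumes "basis_map A" "\<And>x. f differentiable (at x)" "b \<in> Basis"
  shows "partial b (\<lambda>x. f (A x + a)) = (if A b = 0 then (\<lambda>x. 0) else (\<lambda>x. partial (A b) f (A x + a)))"
proof (cases "A b = 0")
  case True
  then show ?thesis using assms by (simp add: partial_affine basis_map_def)
next
  case False
  then have "A b \<in> Basis" using assms by (auto simp: basis_map_def)
  then show ?thesis using assms False
    by (auto simp: partial_affine basis_map_def inner_Basis if_distrib[of of_real] if_distrib[of "\<lambda>x. x * _"] cong:
      if_cong)
qed

lemma ck_bounded_zero: "0 \<le> c \<Longrightarrow> ck_bounded m S c (\<lambda>x. 0)"
  by (induction m) auto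

lemma ck_bounded_basis_map:
  assumes A: "basis_map A" "0 \<le> c"
  shows "smooth f \<Longrightarrow> (\<And>x. x \<in> S \<Longrightarrow> A x + a \<in> T) \<Longrightarrow> ck_bounded m T c f \<Longrightarrow> ck_bounded m S c (\<lambda>x. f (A x + a))"
proof (induction m arbitrary: f)
  case (Suc m)
  have "ck_bounded m S c (partial b (\<lambda>x. f (A x + a)))" if b: "b \<in> Basis" for b
  proof (cases "A b = 0")
    case True
    then show ?thesis using A Suc.prems b by (simp add: partial_basis_map smooth_differentiable ck_bounded_zero)
  next
    case False
    then have "A b \<in> Basis" using A b by (auto simp: basis_map_def)
    then have "ck_bounded m S c (\<lambda>x. partial (A b) f (A x + a))"
      using Suc by (auto intro!: Suc.IH smooth_partial)
    then show ?thesis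
      using A Suc.prems b False by (simp add: partial_basis_map smooth_differentiable)
  qed
  then show ?case using Suc.prems by auto
qed auto

lemma ck_bounded_add:
  "smooth f \<Longrightarrow> smooth g \<Longrightarrow> ck_bounded m S c f \<Longrightarrow> ck_bounded m S d g \<Longrightarrow> ck_bounded m S (c + d) (\<lambda>x. f x + g x)"
proof (induction m arbitrary: f g)
  case 0
  then show ?case by (auto intro!: norm_triangle_le add_mono)
next
  case (Suc m)
  then show ?case
    by (auto simp: partial_add smooth_differentiable smooth_partial intro!: norm_triangle_le add_mono)
qed

text \<open>The product rule replaces one product by two, each bounded at order \<open>m\<close>;
  one doubling per derivative gives \<open>2^m\<close>.\<close>

lemma ck_bounded_mult:
  "0 \<le> c \<Longrightarrow> 0 \<le> d \<Longrightarrow> smooth f \<Longrightarrow> smooth g \<Longrightarrow> ck_bounded m S c f \<Longrightarrow> ck_bounded m S d g \<Longrightarrow>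
    ck_bounded m S (2^m * c * d) (\<lambda>x. f x * g x)"
proof (induction m arbitrary: f g)
  case 0
  then show ?case by (auto simp: norm_mult intro: mult_mono)
next
  case (Suc m)
  have "ck_bounded m S (2^m * c * d + 2^m * c * d) (\<lambda>x. f x * partial b g x + partial b f x * g x)" if "b \<in> Basis" for b
    using Suc.prems that ck_bounded_SucD[OF Suc.prems(5)] ck_bounded_SucD[OF Suc.prems(6)]
    by (intro ck_bounded_add Suc.IH smooth_mult) (auto simp: smooth_partial)
  moreover have "cmod (f x * g x) \<le> 2 * 2^m * c * d" if "x \<in> S" for x
  proof -
    have "cmod (f x * g x) \<le> c * d" using Suc.prems that by (auto simp: norm_mult intro: mult_mono)
    also have "\<dots> \<le> 2^Suc m * (c * d)"
      using Suc.prems one_le_power[of "2::real" "Suc m"] mult_right_mono[of 1 "2^Suc m" "c*d"] by simp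
    finally show ?thesis by (simp add: mult.assoc)
  qed
  ultimately show ?case using Suc.prems by (auto simp: partial_mult smooth_differentiable mult_ac)
qed

lemma ck_bounded_cmult:
  "smooth f \<Longrightarrow> ck_bounded m S c f \<Longrightarrow> ck_bounded m S (cmod a * c) (\<lambda>x. a * f x)"
proof (induction m arbitrary: f)
  case 0
  then show ?case by (auto simp: norm_mult intro: mult_left_mono)
next
  case (Suc m)
  then show ?case
    by (auto simp: partial_cmult smooth_differentiable smooth_partial norm_mult intro: mult_left_mono)
qed

lemma smooth_ck_bounded_compact: "smooth f \<Longrightarrow> compact K \<Longrightarrow> \<exists>c\<ge>0. ck_bounded m K c f"
proof (induction m arbitrary: f)
  case 0
  have "bounded (f ` K)" by (intro compact_imp_bounded compact_continuous_image smooth_continuous_on 0)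
  then obtain c where "\<forall>y\<in>f`K. norm y \<le> c" using bounded_iff by blast
  then show ?case by (intro exI[of _ "max c 0"]) auto
next
  case (Suc m)
  then have "\<forall>b\<in>Basis. \<exists>c\<ge>0. ck_bounded m K c (partial b f)" using smooth_partial by blast
  then obtain C where C: "\<And>b. b \<in> Basis \<Longrightarrow> 0 \<le> C b \<and> ck_bounded m K (C b) (partial b f)" by metis
  obtain c where c: "0 \<le> c" "ck_bounded m K c f" using Suc by blast
  let ?c = "c + sum C Basis"
  have pos: "0 \<le> sum C Basis" using C by (intro sum_nonneg) auto
  have "C b \<le> ?c" if "b \<in> Basis" for b
    using member_le_sum[of b Basis C] C c that by fastforce
  then have "ck_bounded m K ?c (partial b f)" if "b \<in> Basis" for b
    using C[OF that] that by (auto intro: ck_bounded_mono)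
  moreover have "cmod (f x) \<le> ?c" if "x \<in> K" for x
    using ck_bounded_0D[OF c(2) that] pos by linarith
  ultimately show ?case
    using c pos by (intro exI[of _ ?c]) auto
qed

section \<open>Supports and the algebra of test functions\<close>

lemma supp_fun_closed [simp]: "closed (supp_fun f)"
  by (simp add: supp_fun_def)

lemma not_in_supp_fun: "x \<notin> supp_fun f \<Longrightarrow> f x = 0"
  using closure_subset[of "{x. f x \<noteq> 0}"] by (auto simp: supp_fun_def)

lemma supp_fun_subset: "closed K \<Longrightarrow> (\<And>x. x \<notin> K \<Longrightarrow> f x = 0) \<Longrightarrow> supp_fun f \<subseteq> K"
  unfolding supp_fun_def by (rule closure_minimal) auto

lemma partial_locally_zero: "open U \<Longrightarrow> x \<in> U \<Longrightarrow> (\<And>y. y \<in> U \<Longrightarrow> f y = 0) \<Longrightarrow> partial b f x = 0"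
proof -
  assume a: "open U" "x \<in> U" "\<And>y. y \<in> U \<Longrightarrow> f y = 0"
  have "(f has_derivative (\<lambda>_. 0)) (at x)"
    by (rule has_derivative_transform_within_open[of "\<lambda>_. 0" _ x UNIV U]) (use a in auto)
  then show ?thesis by (rule partial_eqI)
qed

lemma supp_fun_partial: "supp_fun (partial b f) \<subseteq> supp_fun f"
  by (rule supp_fun_subset)
     (auto intro!: partial_locally_zero[of "- supp_fun f"] simp: not_in_supp_fun open_Compl)

text \<open>Derivatives vanish off the support as well, so a bound on \<open>K\<close> is a bound
  everywhere.\<close>

lemma ck_bounded_supp: "0 \<le> c \<Longrightarrow> supp_fun f \<subseteq> K \<Longrightarrow> ck_bounded m K c f \<Longrightarrow> ck_bounded m S c f"
proof (induction m arbitrary: f)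
  case 0
  then show ?case by (metis ck_bounded.simps(1) norm_zero not_in_supp_fun subsetD)
next
  case (Suc m)
  then have "cmod (f x) \<le> c" for x
    by (metis ck_bounded.simps(2) norm_zero not_in_supp_fun subsetD)
  then show ?case using Suc supp_fun_partial by (metis ck_bounded.simps(2) order_trans)
qed

lemma test_functionsI: "smooth f \<Longrightarrow> supp_fun f \<subseteq> K \<Longrightarrow> compact K \<Longrightarrow> f \<in> test_functions"
  unfolding test_functions_def using closed_Int_compact[of "supp_fun f" K] by (auto simp: Int_absorb2)

lemma test_functions_smooth: "f \<in> test_functions \<Longrightarrow> smooth f"
  by (simp add: test_functions_def)

lemma test_functions_compact: "f \<in> test_functions \<Longrightarrow> compact (supp_fun f)"
  by (simp add: test_functions_def)

lemma test_functions_partial: "f \<in> test_functions \<Longrightarrow> b \<in> Basis \<Longrightarrow> partial b f \<in> test_functions"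
  by (meson smooth_partial supp_fun_partial test_functionsI test_functions_compact test_functions_smooth)

lemma test_functions_zero [simp]: "(\<lambda>x. 0) \<in> test_functions"
  by (rule test_functionsI[of _ "{}"]) (auto simp: supp_fun_def)

lemma supp_fun_mult: "supp_fun (\<lambda>x. f x * g x) \<subseteq> supp_fun f \<inter> supp_fun g"
  by (rule supp_fun_subset) (auto simp: not_in_supp_fun)

lemma supp_fun_add: "supp_fun (\<lambda>x. f x + g x) \<subseteq> supp_fun f \<union> supp_fun g"
  by (rule supp_fun_subset) (auto simp: not_in_supp_fun)

lemma supp_fun_cmult: "supp_fun (\<lambda>x. c * g x) \<subseteq> supp_fun g"
  by (rule supp_fun_subset) (auto simp: not_in_supp_fun)

lemma test_functions_mult: "f \<in> test_functions \<Longrightarrow> smooth g \<Longrightarrow> (\<lambda>x. f x * g x) \<in> test_functions"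
  using supp_fun_mult[of f g]
  by (intro test_functionsI[of _ "supp_fun f"]) (auto simp: test_functions_def smooth_mult)

lemma test_functions_mult': "smooth f \<Longrightarrow> g \<in> test_functions \<Longrightarrow> (\<lambda>x. f x * g x) \<in> test_functions"
  using test_functions_mult[of g f] by (simp add: mult.commute)

lemma test_functions_add: "f \<in> test_functions \<Longrightarrow> g \<in> test_functions \<Longrightarrow> (\<lambda>x. f x + g x) \<in> test_functions"
  by (rule test_functionsI[OF _ supp_fun_add]) (auto simp: test_functions_def smooth_add)

lemma test_functions_cmult: "f \<in> test_functions \<Longrightarrow> (\<lambda>x. c * f x) \<in> test_functions"
  by (rule test_functions_mult') auto

lemma test_functions_diff: "f \<in> test_functions \<Longrightarrow> g \<in> test_functions \<Longrightarrow> (\<lambda>x. f x - g x) \<in> test_functions"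
  using test_functions_add[OF _ test_functions_cmult[of g "-1"]] by simp

lemma test_functions_sum: "(\<And>i. i \<in> I \<Longrightarrow> f i \<in> test_functions) \<Longrightarrow> (\<lambda>x. \<Sum>i\<in>I. f i x) \<in> test_functions"
  by (induction I rule: infinite_finite_induct) (auto intro: test_functions_add)

lemma test_function_ck_bounded: "f \<in> test_functions \<Longrightarrow> \<exists>c\<ge>0. ck_bounded m UNIV c f"
  using smooth_ck_bounded_compact[of f "supp_fun f" m] ck_bounded_supp[of _ f "supp_fun f" m UNIV]
  by (auto simp: test_functions_def)

section \<open>Cutoff functions\<close>

text \<open>The factor \<open>t ^ k\<close> closes the family under differentiation.\<close>

definition exp_bump :: "nat \<Rightarrow> real \<Rightarrow> real" where
  "exp_bump k t = (if t > 0 then exp (- 1 / t) / t ^ k else 0)"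

lemma exp_bump_at_right_0: "((\<lambda>t. exp (- 1 / t) / t ^ k) \<longlongrightarrow> (0::real)) (at_right 0)"
proof -
  have "((\<lambda>s. s ^ k / exp s) \<longlongrightarrow> (0::real)) at_top"
    by (rule tendsto_power_div_exp_0)
  then have "((\<lambda>t. inverse t ^ k / exp (inverse t)) \<longlongrightarrow> (0::real)) (at_right 0)"
    by (rule filterlim_compose[OF _ filterlim_inverse_at_top_right])
  then show ?thesis
    by (simp add: field_simps exp_minus)
qed

text \<open>Away from 0 this is the quotient rule. At 0 the right-hand difference quotient is
  \<open>exp (- 1 / h) / h ^ (k + 1)\<close>, the next member of the family, which tends to
  0.\<close>

lemma exp_bump_has_derivative:
  "(exp_bump k has_real_derivative (exp_bump (k + 2) t - of_nat k * exp_bump (k + 1) t)) (at t)"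
proof -
  consider "t < 0" | "t > 0" | "t = 0" by linarith
  then show ?thesis
  proof cases
    case 1
    have "((\<lambda>_. 0) has_real_derivative 0) (at t)" by simp
    then have "(exp_bump k has_real_derivative 0) (at t)"
      by (rule has_field_derivative_transform_within_open[of _ _ _ "{..<0}"]) (use 1 in \<open>auto simp: exp_bump_def\<close>)
    then show ?thesis using 1 by (simp add: exp_bump_def)
  next
    case 2
    have d: "((\<lambda>t. exp (- 1 / t)) has_real_derivative exp (- 1 / t) / t ^ 2) (at t)"
      using 2 by (auto intro!: derivative_eq_intros simp: field_simps power2_eq_square)
    have "((\<lambda>t. exp (- 1 / t) / t ^ k) has_real_derivative
        (exp (- 1 / t) / t ^ 2 * t ^ k - exp (- 1 / t) * (of_nat k * t ^ (k - 1))) / (t ^ k * t ^ k)) (at t)"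
      using DERIV_divide[OF d DERIV_pow[of k t], simplified] 2 by simp
    moreover have "(exp (- 1 / t) / t ^ 2 * t ^ k - exp (- 1 / t) * (of_nat k * t ^ (k - 1))) / (t ^ k * t ^ k)
        = exp_bump (k + 2) t - of_nat k * exp_bump (k + 1) t"
      using 2 by (cases k) (auto simp: exp_bump_def field_simps power2_eq_square)
    ultimately have "((\<lambda>t. exp (- 1 / t) / t ^ k) has_real_derivative
        exp_bump (k + 2) t - of_nat k * exp_bump (k + 1) t) (at t)"
      by simp
    then show ?thesis
      by (rule has_field_derivative_transform_within_open[of _ _ _ "{0<..}"]) (use 2 in \<open>auto simp: exp_bump_def\<close>)
  next
    case 3
    have "((\<lambda>h. exp_bump k h / h) \<longlongrightarrow> 0) (at_right 0)"
    proof -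
      have "\<forall>\<^sub>F h in at_right 0. exp (- 1 / h) / h ^ (Suc k) = exp_bump k h / h"
        by (auto simp: eventually_at_filter exp_bump_def)
      from iffD1[OF tendsto_cong[OF this] exp_bump_at_right_0] show ?thesis .
    qed
    moreover have "((\<lambda>h. exp_bump k h / h) \<longlongrightarrow> 0) (at_left 0)"
      by (rule tendsto_eventually) (auto simp: eventually_at_filter exp_bump_def)
    ultimately have "((\<lambda>h. exp_bump k h / h) \<longlongrightarrow> 0) (at 0)"
      by (simp add: filterlim_split_at)
    then have "(exp_bump k has_real_derivative 0) (at 0)"
      by (simp add: DERIV_def exp_bump_def)
    then show ?thesis using 3 by (simp add: exp_bump_def)
  qed
qed

lemma cdiff_exp_bump: "cdiff n (\<lambda>t. complex_of_real (exp_bump k t))"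
proof (induction n arbitrary: k)
  have der: "((\<lambda>t. complex_of_real (exp_bump k t)) has_derivative
     (\<lambda>h. h *\<^sub>R of_real (exp_bump (k + 2) t - of_nat k * exp_bump (k + 1) t))) (at t)" for k t
    using has_vector_derivative_of_real[OF exp_bump_has_derivative[of k t]]
    by (simp add: has_vector_derivative_def)
  {
    case 0
    show ?case using der by (auto intro: differentiableI)
  next
    case (Suc n)
    have "partial 1 (\<lambda>t. complex_of_real (exp_bump k t)) =
        (\<lambda>t. of_real (exp_bump (k + 2) t) + (- of_nat k) * of_real (exp_bump (k + 1) t))"
      using partial_eqI[OF der] by fastforce
    moreover have "cdiff n (\<lambda>t. complex_of_real (exp_bump (k + 2) t) + (- of_nat k) * of_real (exp_bump (k + 1) t))"
      by (intro cdiff_add cdiff_mult Suc.IH cdiff_const)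
    ultimately show ?case
      using der by (auto intro: differentiableI)
  }
qed

text \<open>The classical smooth step, rising from 0 to 1 on the unit interval. The denominator
  never vanishes because \<open>t\<close> or \<open>1 - t\<close> is positive.\<close>

definition smooth_step :: "real \<Rightarrow> real" where
  "smooth_step t = exp_bump 0 t * inverse (exp_bump 0 t + exp_bump 0 (1 - t))"

lemma exp_bump_0_add_pos: "exp_bump 0 t + exp_bump 0 (1 - t) > 0"
  by (auto simp: exp_bump_def intro: add_pos_pos)

lemma smooth_smooth_step: "smooth (\<lambda>t. complex_of_real (smooth_step t))"
proof -
  have 1: "smooth (\<lambda>t. complex_of_real (exp_bump 0 t))" by (simp add: smooth_iff_cdiff cdiff_exp_bump)
  have 2: "smooth (\<lambda>t. complex_of_real (exp_bump 0 (1 - t)))"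
    using smooth_affine[OF bounded_linear_minus[OF bounded_linear_ident] 1, of 1] by simp
  have 3: "complex_of_real (exp_bump 0 t) + complex_of_real (exp_bump 0 (1 - t)) \<noteq> 0" for t
    using exp_bump_0_add_pos[of t] by (metis of_real_add of_real_eq_0_iff less_irrefl)
  show ?thesis
    unfolding smooth_step_def of_real_mult of_real_inverse of_real_add
    by (intro smooth_mult smooth_inverse smooth_add 1 2 3)
qed

lemma smooth_step_range: "0 \<le> smooth_step t" "smooth_step t \<le> 1"
proof -
  have "exp_bump 0 t \<ge> 0" "exp_bump 0 (1 - t) \<ge> 0" by (auto simp: exp_bump_def)
  then show "0 \<le> smooth_step t" "smooth_step t \<le> 1"
    using exp_bump_0_add_pos[of t] by (auto simp: smooth_step_def field_simps divide_le_eq)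
qed

lemma smooth_step_0: "t \<le> 0 \<Longrightarrow> smooth_step t = 0"
  and smooth_step_1: "t \<ge> 1 \<Longrightarrow> smooth_step t = 1"
  by (auto simp: smooth_step_def exp_bump_def)

lemma cutoff_ball:
  fixes x0 :: "'a::euclidean_space"
  assumes "0 < \<epsilon>"
  obtains \<psi> U where "\<psi> \<in> test_functions" "supp_fun \<psi> \<subseteq> cball x0 \<epsilon>" "open U" "x0 \<in> U"
    "\<And>x. x \<in> U \<Longrightarrow> \<psi> x = 1" "\<And>x. cmod (\<psi> x) \<le> 1"
proof -
  \<comment> \<open>In each coordinate the cutoff vanishes at distance \<open>2 * r\<close> and
    beyond. Where it does not vanish, the absolute coordinates of \<open>x - x0\<close> therefore
    sum to at most \<open>DIM('a) * (2 * r) = \<epsilon>\<close>, and the norm is at most this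
    sum.\<close>
  define r where "r = \<epsilon> / (2 * DIM('a))"
  have r: "r > 0" using assms by (simp add: r_def)
  define \<eta> where "\<eta> t = complex_of_real (smooth_step (2 - t)) * complex_of_real (smooth_step (2 + t))" for t :: real
  have \<eta>: "smooth \<eta>"
    using smooth_mult[OF smooth_affine[OF bounded_linear_minus[OF bounded_linear_ident] smooth_smooth_step, of 2]
        smooth_affine[OF bounded_linear_ident smooth_smooth_step, of 2]]
    by (simp add: \<eta>_def[abs_def] add.commute)
  have \<eta>1: "\<eta> t = 1" if "\<bar>t\<bar> \<le> 1" for t using that by (simp add: \<eta>_def smooth_step_1)
  have \<eta>0: "\<eta> t = 0" if "\<bar>t\<bar> \<ge> 2" for t using that by (cases "t \<ge> 0") (auto simp: \<eta>_def smooth_step_0)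
  have \<eta>b: "cmod (\<eta> t) \<le> 1" for t
    by (auto simp: \<eta>_def norm_mult smooth_step_range intro!: mult_le_one)
  define \<psi> where "\<psi> x = (\<Prod>b\<in>Basis. \<eta> ((1/r) *\<^sub>R (x \<bullet> b) + (- (1/r) * (x0 \<bullet> b))))" for x :: 'a
  have \<psi>_eq: "\<psi> x = (\<Prod>b\<in>Basis. \<eta> (((x - x0) \<bullet> b) / r))" for x
    by (simp add: \<psi>_def inner_diff_left diff_divide_distrib)
  have sm: "smooth \<psi>"
    unfolding \<psi>_def[abs_def]
    by (intro smooth_prod smooth_affine \<eta>) (intro bounded_linear_intros)
  have supp: "supp_fun \<psi> \<subseteq> cball x0 \<epsilon>"
  proof (rule supp_fun_subset)
    fix x assume "x \<notin> cball x0 \<epsilon>"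
    then have n: "norm (x - x0) > \<epsilon>" by (simp add: dist_norm norm_minus_commute)
    have "\<exists>b\<in>Basis. \<bar>(x - x0) \<bullet> b\<bar> \<ge> 2 * r"
    proof (rule ccontr)
      assume "\<not> ?thesis"
      then have "(\<Sum>b\<in>Basis. \<bar>(x - x0) \<bullet> b\<bar>) \<le> of_nat DIM('a) * (2 * r)"
        by (intro sum_bounded_above) auto
      then have "norm (x - x0) \<le> of_nat DIM('a) * (2 * r)" using norm_le_l1 order_trans by blast
      then show False using n by (simp add: r_def)
    qed
    then obtain b where "b \<in> Basis" "\<bar>(x - x0) \<bullet> b\<bar> \<ge> 2 * r" by blast
    then have "\<eta> (((x - x0) \<bullet> b) / r) = 0" using r by (intro \<eta>0) (simp add: field_simps)
    then show "\<psi> x = 0" unfolding \<psi>_eq using \<open>b \<in> Basis\<close> by (auto intro: prod_zero)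
  qed simp
  have one: "\<psi> x = 1" if "x \<in> ball x0 r" for x
  proof -
    have "\<bar>(x - x0) \<bullet> b\<bar> \<le> r" if "b \<in> Basis" for b
      using Basis_le_norm[OF that, of "x - x0"] \<open>x \<in> ball x0 r\<close> by (auto simp: dist_norm norm_minus_commute)
    then show ?thesis unfolding \<psi>_eq using r by (intro prod.neutral ballI \<eta>1) (auto simp: field_simps)
  qed
  have bd: "cmod (\<psi> x) \<le> 1" for x
    unfolding \<psi>_eq prod_norm[symmetric] by (intro prod_le_1) (simp add: \<eta>b)
  show thesis
    by (rule that[of \<psi> "ball x0 r"]) (use sm supp one bd r in \<open>auto intro: test_functionsI\<close>)
qed

text \<open>Telescoping: a new index \<open>j\<close> adds \<open>\<psi> j\<close> times the product
  of \<open>1 - \<psi> i\<close> over the indices already present. The identity involves no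
  division, unlike a normalized partition of unity.\<close>

lemma one_minus_prod_expansion:
  assumes "finite I" "\<And>i. i \<in> I \<Longrightarrow> smooth (\<psi> i)"
  shows "\<exists>G. (\<forall>i\<in>I. smooth (G i)) \<and> (\<forall>x. 1 - (\<Prod>i\<in>I. 1 - \<psi> i x) = (\<Sum>i\<in>I. \<psi> i x * G i x))"
  using assms
proof (induction I rule: finite_induct)
  case (insert j I)
  then obtain G where G: "\<forall>i\<in>I. smooth (G i)" "\<forall>x. 1 - (\<Prod>i\<in>I. 1 - \<psi> i x) = (\<Sum>i\<in>I. \<psi> i x * G i x)"
    by auto
  define P where "P x = (\<Prod>i\<in>I. 1 - \<psi> i x)" for x
  have "smooth P" unfolding P_def[abs_def] using insert by (intro smooth_prod smooth_diff) auto
  moreover have "1 - (\<Prod>i\<in>insert j I. 1 - \<psi> i x) = (\<Sum>i\<in>insert j I. \<psi> i x * (G(j := P)) i x)" for x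
  proof -
    have "(\<Sum>i\<in>I. \<psi> i x * (G(j := P)) i x) = (\<Sum>i\<in>I. \<psi> i x * G i x)"
      using insert by (intro sum.cong) auto
    then show ?thesis using insert.hyps G(2)[rule_format, of x, symmetric] by (simp add: P_def algebra_simps)
  qed
  ultimately show ?case using G(1) by (intro exI[of _ "G(j := P)"]) auto
qed auto

text \<open>Near a point of \<open>K\<close> some chosen \<open>\<psi> x\<close> equals 1, so the
  product of the factors \<open>1 - \<psi> x\<close> vanishes there. The multipliers
  \<open>G x\<close> are only smooth; a term \<open>\<psi> x * G x\<close> keeps every property of
  \<open>\<psi> x\<close> that survives multiplication by smooth functions. This is the
  local-to-global device for cutoffs, supports, wave front sets and the pieces of the
  convolution.\<close>

lemma smooth_localization:
  assumes "compact K" "\<And>x. x \<in> K \<Longrightarrow> smooth (\<psi> x) \<and> (\<exists>U. open U \<and> x \<in> U \<and> (\<forall>y\<in>U. \<psi> x y = 1))"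
  obtains F G U where "finite F" "F \<subseteq> K" "\<And>x. x \<in> F \<Longrightarrow> smooth (G x)" "open U" "K \<subseteq> U"
    "\<And>y. y \<in> U \<Longrightarrow> (\<Sum>x\<in>F. \<psi> x y * G x y) = 1"
proof -
  obtain U where U: "\<And>x. x \<in> K \<Longrightarrow> open (U x) \<and> x \<in> U x \<and> (\<forall>y\<in>U x. \<psi> x y = 1)"
    using assms(2) by metis
  obtain F where F: "F \<subseteq> K" "finite F" "K \<subseteq> (\<Union>x\<in>F. U x)"
    by (rule compactE_image[OF assms(1), of K U]) (use U in auto)
  obtain G where G: "\<forall>i\<in>F. smooth (G i)" "\<forall>x. 1 - (\<Prod>i\<in>F. 1 - \<psi> i x) = (\<Sum>i\<in>F. \<psi> i x * G i x)"
    using one_minus_prod_expansion[OF F(2), of \<psi>] assms(2) F(1) by auto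
  show thesis
  proof (rule that[of F G "\<Union>x\<in>F. U x"])
    fix y assume "y \<in> (\<Union>x\<in>F. U x)"
    then obtain x where "x \<in> F" "y \<in> U x" by blast
    then have "(\<Prod>i\<in>F. 1 - \<psi> i y) = 0" using U F by (intro prod_zero) auto
    then show "(\<Sum>x\<in>F. \<psi> x y * G x y) = 1" using G(2)[rule_format, of y] by simp
  next
    show "open (\<Union>x\<in>F. U x)" using U F(1) by (intro open_UN) blast
  qed (use F G(1) in auto)
qed

lemma cutoff_compact:
  fixes K :: "'a::euclidean_space set"
  assumes "compact K" "open O'" "K \<subseteq> O'"
  obtains \<theta> U where "\<theta> \<in> test_functions" "supp_fun \<theta> \<subseteq> O'" "open U" "K \<subseteq> U" "\<And>x. x \<in> U \<Longrightarrow> \<theta> x = 1"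
proof -
  have "\<exists>\<psi>. \<psi> \<in> test_functions \<and> supp_fun \<psi> \<subseteq> O' \<and> (\<exists>U. open U \<and> x \<in> U \<and> (\<forall>y\<in>U. \<psi> y = 1))" if "x \<in> K" for x
  proof -
    have "\<exists>\<epsilon>>0. cball x \<epsilon> \<subseteq> O'"
      using assms(3) that by (intro bspec[OF iffD1[OF open_contains_cball assms(2)]]) auto
    then obtain \<epsilon> where e: "\<epsilon> > 0" "cball x \<epsilon> \<subseteq> O'" by auto
    obtain \<psi> U where p: "\<psi> \<in> test_functions" "supp_fun \<psi> \<subseteq> cball x \<epsilon>" "open U" "x \<in> U" "\<And>y. y \<in> U \<Longrightarrow> \<psi> y = 1"
      by (rule cutoff_ball[OF e(1), of x]) auto
    show ?thesis
      by (rule exI[of _ \<psi>], intro conjI exI[of _ U] ballI) (use p e in auto)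
  qed
  then obtain \<psi> where \<psi>: "\<And>x. x \<in> K \<Longrightarrow> \<psi> x \<in> test_functions \<and> supp_fun (\<psi> x) \<subseteq> O' \<and>
    (\<exists>U. open U \<and> x \<in> U \<and> (\<forall>y\<in>U. \<psi> x y = 1))"
    by metis
  obtain F G U where F: "finite F" "F \<subseteq> K" "\<And>x. x \<in> F \<Longrightarrow> smooth (G x)" "open U" "K \<subseteq> U"
      "\<And>y. y \<in> U \<Longrightarrow> (\<Sum>x\<in>F. \<psi> x y * G x y) = 1"
  proof (rule smooth_localization[of K \<psi>])
    show "smooth (\<psi> x) \<and> (\<exists>U. open U \<and> x \<in> U \<and> (\<forall>y\<in>U. \<psi> x y = 1))" if "x \<in> K" for x
      using \<psi>[OF that] test_functions_smooth by auto
  qed (use assms in auto)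
  have "supp_fun (\<lambda>y. \<Sum>x\<in>F. \<psi> x y * G x y) \<subseteq> (\<Union>x\<in>F. supp_fun (\<psi> x))"
    by (rule supp_fun_subset) (use F in \<open>auto intro!: closed_UN sum.neutral simp: not_in_supp_fun\<close>)
  also have "\<dots> \<subseteq> O'" using \<psi> F by blast
  finally show thesis
    using F \<psi> by (intro that[of "\<lambda>y. \<Sum>x\<in>F. \<psi> x y * G x y" U]) (auto intro!: test_functions_sum test_functions_mult)
qed

section \<open>Linear functionals on test functions\<close>

text \<open>The algebraic part of being a distribution. Arguments about supports and pairings rest
  on it alone, so they apply to \<open>tensor u v\<close> and \<open>dist_mult u \<psi>\<close>
  directly.\<close>

definition test_functional :: "(('a::euclidean_space \<Rightarrow> complex) \<Rightarrow> complex) \<Rightarrow> bool" where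
  "test_functional u \<longleftrightarrow> (\<forall>\<phi>. \<phi> \<notin> test_functions \<longrightarrow> u \<phi> = 0) \<and>
     (\<forall>\<phi>\<in>test_functions. \<forall>\<psi>\<in>test_functions. u (\<lambda>x. \<phi> x + \<psi> x) = u \<phi> + u \<psi>) \<and>
     (\<forall>c. \<forall>\<phi>\<in>test_functions. u (\<lambda>x. c * \<phi> x) = c * u \<phi>)"

lemma test_functional_add: "test_functional u \<Longrightarrow> \<phi> \<in> test_functions \<Longrightarrow> \<psi> \<in> test_functions \<Longrightarrow> u (\<lambda>x. \<phi> x + \<psi> x) = u \<phi> + u \<psi>"
  by (simp add: test_functional_def)

lemma test_functional_cmult: "test_functional u \<Longrightarrow> \<phi> \<in> test_functions \<Longrightarrow> u (\<lambda>x. c * \<phi> x) = c * u \<phi>"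
  by (simp add: test_functional_def)

lemma test_functional_zero: "test_functional u \<Longrightarrow> u (\<lambda>x. 0) = 0"
  using test_functional_cmult[of u "\<lambda>_. 0" 0] by simp

lemma test_functional_diff: "test_functional u \<Longrightarrow> \<phi> \<in> test_functions \<Longrightarrow> \<psi> \<in> test_functions \<Longrightarrow>
  u (\<lambda>x. \<phi> x - \<psi> x) = u \<phi> - u \<psi>"
  using test_functional_add[of u \<phi> "\<lambda>x. -1 * \<psi> x"] test_functional_cmult[of u \<psi> "-1"] test_functions_cmult[of \<psi> "-1"]
    by simp

lemma test_functional_sum:
  "test_functional u \<Longrightarrow> (\<And>i. i \<in> I \<Longrightarrow> f i \<in> test_functions) \<Longrightarrow> u (\<lambda>x. \<Sum>i\<in>I. f i x) = (\<Sum>i\<in>I. u (f i))"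
proof (induction I rule: infinite_finite_induct)
  case (insert i I)
  then show ?case
    using test_functional_add[of u "f i" "\<lambda>x. \<Sum>i\<in>I. f i x"] test_functions_sum[of I f] by simp
qed (simp_all add: test_functional_zero)

lemma distributions_test_functional: "u \<in> distributions \<Longrightarrow> test_functional u"
  by (simp add: distributions_def test_functional_def)

text \<open>\<open>supp_dist\<close> says only that each point off the support has a neighbourhood
  on which \<open>u\<close> vanishes. A finite partition of unity on the compact support of
  \<open>\<phi>\<close> glues these neighbourhoods together.\<close>

lemma test_functional_off_support:
  assumes u: "test_functional u" and \<phi>: "\<phi> \<in> test_functions" and disj: "supp_fun \<phi> \<inter> supp_dist u = {}"
  shows "u \<phi> = 0"
proof -
  let ?K = "supp_fun \<phi>"
  have K: "compact ?K" using \<phi> by (rule test_functions_compact)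
  \<comment> \<open>The last conjunct ranges over all smooth \<open>G\<close>, since the multipliers
    of the partition of unity are known only afterwards.\<close>
  have "\<exists>\<psi>. smooth \<psi> \<and> (\<exists>U. open U \<and> x \<in> U \<and> (\<forall>y\<in>U. \<psi> y = 1)) \<and> (\<forall>G. smooth G \<longrightarrow> u (\<lambda>y. \<psi> y * G y) = 0)"
    if "x \<in> ?K" for x
  proof -
    have "x \<notin> supp_dist u" using disj that by blast
    then obtain V where V: "open V" "x \<in> V" "\<And>\<phi>. \<phi> \<in> test_functions \<Longrightarrow> supp_fun \<phi> \<subseteq> V \<Longrightarrow> u \<phi> = 0"
      by (auto simp: supp_dist_def)
    obtain \<theta> U where \<theta>: "\<theta> \<in> test_functions" "supp_fun \<theta> \<subseteq> V" "open U" "{x} \<subseteq> U" "\<And>y. y \<in> U \<Longrightarrow> \<theta> y = 1"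
      by (rule cutoff_compact[of "{x}" V]) (use V in auto)
    have "u (\<lambda>y. \<theta> y * G y) = 0" if "smooth G" for G
      using \<theta> that supp_fun_mult[of \<theta> G] by (intro V(3) test_functions_mult) auto
    then show ?thesis
      by (intro exI[of _ \<theta>] conjI exI[of _ U]) (use \<theta> test_functions_smooth in auto)
  qed
  then have "\<forall>x\<in>?K. \<exists>\<psi>. smooth \<psi> \<and> (\<exists>U. open U \<and> x \<in> U \<and> (\<forall>y\<in>U. \<psi> y = 1)) \<and> (\<forall>G. smooth G \<longrightarrow> u (\<lambda>y. \<psi> y * G y) = 0)"
    by (rule ballI)
  from bchoice[OF this] obtain \<psi> where \<psi>: "\<And>x. x \<in> ?K \<Longrightarrow> smooth (\<psi> x) \<and> (\<exists>U. open U \<and> x \<in> U \<and> (\<forall>y\<in>U. \<psi> x y = 1))"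
    "\<And>x G. x \<in> ?K \<Longrightarrow> smooth G \<Longrightarrow> u (\<lambda>y. \<psi> x y * G y) = 0" by auto
  obtain F G U where F: "finite F" "F \<subseteq> ?K" "\<And>x. x \<in> F \<Longrightarrow> smooth (G x)" "open U" "?K \<subseteq> U"
      "\<And>y. y \<in> U \<Longrightarrow> (\<Sum>x\<in>F. \<psi> x y * G x y) = 1"
    by (rule smooth_localization[OF K \<psi>(1)]) (assumption, rule that)
  have "\<phi> = (\<lambda>y. \<Sum>x\<in>F. \<psi> x y * (G x y * \<phi> y))"
  proof
    fix y
    have "(\<Sum>x\<in>F. \<psi> x y * (G x y * \<phi> y)) = (\<Sum>x\<in>F. \<psi> x y * G x y) * \<phi> y"
      by (simp add: sum_distrib_right mult.assoc)
    also have "\<dots> = \<phi> y" using F(5,6) not_in_supp_fun[of y \<phi>] by fastforce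
    finally show "\<phi> y = (\<Sum>x\<in>F. \<psi> x y * (G x y * \<phi> y))" ..
  qed
  then have "u \<phi> = u (\<lambda>y. \<Sum>x\<in>F. \<psi> x y * (G x y * \<phi> y))" by (rule arg_cong)
  also have "\<dots> = (\<Sum>x\<in>F. u (\<lambda>y. \<psi> x y * (G x y * \<phi> y)))"
    using F \<psi>(1) \<phi> by (intro test_functional_sum u test_functions_mult') auto
  also have "\<dots> = 0"
  proof (intro sum.neutral ballI)
    fix x assume "x \<in> F"
    then show "u (\<lambda>y. \<psi> x y * (G x y * \<phi> y)) = 0"
      using F(2,3) \<phi> by (intro \<psi>(2)[of x "\<lambda>y. G x y * \<phi> y"] smooth_mult) (auto simp: test_functions_smooth)
  qed
  finally show ?thesis .
qed

section \<open>Seminorm topologies\<close>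

text \<open>The triangle inequality in the form that the topology uses. The difference
  \<open>v - u\<close> may leave \<open>E\<close>, so the definition applies to
  \<open>dist_wf \<Gamma>\<close> without an argument about wave front sets of differences.\<close>

definition subadditive_on :: "('i \<Rightarrow> complex) set \<Rightarrow> (('i \<Rightarrow> complex) \<Rightarrow> ennreal) \<Rightarrow> bool" where
  "subadditive_on E p \<longleftrightarrow> (\<forall>u\<in>E. \<forall>v\<in>E. p v \<le> p (\<lambda>i. v i - u i) + p u)"

lemma openin_seminorm_ball:
  assumes P: "\<And>p. p \<in> F \<Longrightarrow> subadditive_on E p" and F: "finite F" "F \<subseteq> P"
  shows "openin (seminorm_topology E P) {v \<in> E. \<forall>p\<in>F. p v < ennreal \<epsilon>}"
  unfolding openin_seminorm_topology
proof (intro conjI ballI)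
  fix u assume u: "u \<in> {v \<in> E. \<forall>p\<in>F. p v < ennreal \<epsilon>}"
  \<comment> \<open>The values are extended reals, so the gap between \<open>p u\<close> and
    \<open>\<epsilon>\<close> is produced as a positive real, one for all of \<open>F\<close>,
    instead of by subtraction.\<close>
  have "\<exists>\<delta>>0. \<forall>p\<in>F. p u + ennreal \<delta> \<le> ennreal \<epsilon>"
    using F(1) u
  proof (induction F rule: finite_induct)
    case empty
    show ?case by (intro exI[of _ 1]) auto
  next
    case (insert p F)
    then obtain \<delta> where \<delta>: "\<delta> > 0" "\<forall>q\<in>F. q u + ennreal \<delta> \<le> ennreal \<epsilon>" by auto
    have "p u < ennreal \<epsilon>" using insert.prems by auto
    then obtain r where r: "p u = ennreal r" "0 \<le> r" "r < \<epsilon>"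
      by (cases "p u") (auto simp: ennreal_less_iff)
    have "q u + ennreal (min \<delta> (\<epsilon> - r)) \<le> ennreal \<epsilon>" if "q \<in> F" for q
      using \<delta>(2) that by (meson add_left_mono ennreal_leI min.cobounded1 order_trans)
    moreover have "p u + ennreal (min \<delta> (\<epsilon> - r)) \<le> ennreal \<epsilon>"
      using r \<delta>(1) by (auto simp: ennreal_plus[symmetric] simp del: ennreal_plus intro!: ennreal_leI)
    ultimately show ?case using \<delta>(1) r by (intro exI[of _ "min \<delta> (\<epsilon> - r)"]) auto
  qed
  then obtain \<delta> where \<delta>: "\<delta> > 0" "\<forall>p\<in>F. p u + ennreal \<delta> \<le> ennreal \<epsilon>" by blast
  have "{v \<in> E. \<forall>p\<in>F. p (\<lambda>i. v i - u i) < ennreal \<delta>} \<subseteq> {v \<in> E. \<forall>p\<in>F. p v < ennreal \<epsilon>}"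
  proof safe
    fix v p assume v: "v \<in> E" "\<forall>p\<in>F. p (\<lambda>i. v i - u i) < ennreal \<delta>" and p: "p \<in> F"
    have "p v \<le> p (\<lambda>i. v i - u i) + p u" using P[OF p] u v by (auto simp: subadditive_on_def)
    also have "\<dots> < ennreal \<delta> + p u"
    proof -
      have "p u < top" using u p by (auto intro: order.strict_trans)
      then show ?thesis using v(2) p by (simp add: ennreal_add_left_cancel_less add.commute)
    qed
    also have "\<dots> \<le> ennreal \<epsilon>" using bspec[OF \<delta>(2) p] by (subst add.commute)
    finally show "p v < ennreal \<epsilon>" .
  qed
  then show "\<exists>G \<delta>. finite G \<and> G \<subseteq> P \<and> (0::real) < \<delta> \<and>
      {v \<in> E. \<forall>p\<in>G. p (\<lambda>i. v i - u i) < ennreal \<delta>} \<subseteq> {v \<in> E. \<forall>p\<in>F. p v < ennreal \<epsilon>}"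
    using F \<delta>(1) by blast
qed auto

lemma zero_nhd_seminorm_ball:
  assumes "\<And>p. p \<in> F \<Longrightarrow> subadditive_on E p" "\<And>p. p \<in> F \<Longrightarrow> p (\<lambda>_. 0) = 0"
    and "finite F" "F \<subseteq> P" "(\<lambda>_. 0) \<in> E \<inter> S" "0 < \<epsilon>"
  shows "zero_nhd (subtopology (seminorm_topology E P) S) ({v \<in> E. \<forall>p\<in>F. p v < ennreal \<epsilon>} \<inter> S)"
proof -
  let ?B = "{v \<in> E. \<forall>p\<in>F. p v < ennreal \<epsilon>} \<inter> S"
  have "openin (subtopology (seminorm_topology E P) S) ?B"
    using openin_subtopology_Int[OF openin_seminorm_ball[OF assms(1,3,4), of \<epsilon>], of S] .
  moreover have "p (\<lambda>_. 0) < ennreal \<epsilon>" if "p \<in> F" for p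
    using assms(2)[OF that] assms(6) by simp
  then have "(\<lambda>_. 0) \<in> ?B" using assms(5) by auto
  ultimately show ?thesis unfolding zero_nhd_def by (intro conjI exI[of _ ?B]) auto
qed

lemma zero_nhd_seminormD:
  assumes "zero_nhd (subtopology (seminorm_topology E P) S) W"
  obtains F \<epsilon> where "finite F" "F \<subseteq> P" "(0::real) < \<epsilon>" "{v \<in> E. \<forall>p\<in>F. p v < ennreal \<epsilon>} \<inter> S \<subseteq> W"
proof -
  obtain U where U: "openin (subtopology (seminorm_topology E P) S) U" "(\<lambda>_. 0) \<in> U" "U \<subseteq> W"
    using assms by (auto simp: zero_nhd_def)
  then obtain T where T: "openin (seminorm_topology E P) T" "U = T \<inter> S"
    by (auto simp: openin_subtopology)
  have "\<forall>u\<in>T. \<exists>F \<epsilon>. finite F \<and> F \<subseteq> P \<and> (0::real) < \<epsilon> \<and> {v \<in> E. \<forall>p\<in>F. p (\<lambda>i. v i - u i) < ennreal \<epsilon>} \<subseteq> T"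
    using T(1) unfolding openin_seminorm_topology by (rule conjunct2)
  then have "\<exists>F \<epsilon>. finite F \<and> F \<subseteq> P \<and> (0::real) < \<epsilon> \<and> {v \<in> E. \<forall>p\<in>F. p (\<lambda>i. v i - 0) < ennreal \<epsilon>} \<subseteq> T"
    using U(2) T(2) by (elim bspec) simp
  then obtain F \<epsilon> where F: "finite F" "F \<subseteq> P" "(0::real) < \<epsilon>" "{v \<in> E. \<forall>p\<in>F. p v < ennreal \<epsilon>} \<subseteq> T"
    by auto
  show thesis by (rule that[OF F(1-3)]) (use F(4) T U in auto)
qed

text \<open>The unit ball of \<open>p\<close> is a neighbourhood of zero, and the factor by which it
  absorbs \<open>A\<close> is the bound.\<close>

lemma tvs_bounded_seminorm:
  assumes A: "tvs_bounded (subtopology (seminorm_topology E P) S) A" and p: "p \<in> P" "subadditive_on E p" "p (\<lambda>_. 0) = 0"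
    and h: "\<And>t u. u \<in> E \<Longrightarrow> 0 < t \<Longrightarrow> p (\<lambda>i. complex_of_real t * u i) \<le> ennreal t * p u"
    and 0: "(\<lambda>_. 0) \<in> E \<inter> S"
  shows "\<exists>C\<ge>0. \<forall>u\<in>A. p u \<le> ennreal C"
proof -
  have "zero_nhd (subtopology (seminorm_topology E P) S) ({v \<in> E. \<forall>q\<in>{p}. q v < ennreal 1} \<inter> S)"
    by (rule zero_nhd_seminorm_ball) (use p 0 in auto)
  then obtain t where t: "t > 0" "A \<subseteq> (\<lambda>w i. complex_of_real t * w i) ` ({v \<in> E. \<forall>q\<in>{p}. q v < ennreal 1} \<inter> S)"
    using A unfolding tvs_bounded_def by blast
  have "p u \<le> ennreal t" if u: "u \<in> A" for u
  proof -
    obtain w where w: "u = (\<lambda>i. complex_of_real t * w i)" "w \<in> E" "p w < 1" using subsetD[OF t(2) u] by auto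
    have "p u \<le> ennreal t * p w" using h[OF w(2) t(1)] w(1) by simp
    also have "\<dots> \<le> ennreal t * 1" using w(3) by (intro mult_left_mono) auto
    finally show ?thesis by simp
  qed
  then show ?thesis using t(1) by (intro exI[of _ t]) auto
qed

section \<open>Bounded sets of test functions and continuity of distributions\<close>

text \<open>The classical description of the bounded sets of the LF space;
  \<open>tvs_bounded_test_iff\<close> is the equivalence with boundedness in
  \<open>test_topology\<close>.\<close>

definition bounded_tests :: "('a::euclidean_space \<Rightarrow> complex) set \<Rightarrow> bool" where
  "bounded_tests B \<longleftrightarrow> B \<subseteq> test_functions \<and> (\<exists>K. compact K \<and> (\<forall>\<phi>\<in>B. supp_fun \<phi> \<subseteq> K)) \<and>
     (\<forall>m. \<exists>c. \<forall>\<phi>\<in>B. ck_bounded m UNIV c \<phi>)"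

text \<open>The norm of \<open>\<phi>\<close> is replaced by an arbitrary bound \<open>c\<close> for
  it, which keeps extended reals out of the estimates.\<close>

definition dist_bound :: "(('a::euclidean_space \<Rightarrow> complex) \<Rightarrow> complex) \<Rightarrow> 'a set \<Rightarrow> nat \<Rightarrow> real \<Rightarrow> bool" where
  "dist_bound u K m C \<longleftrightarrow> (\<forall>\<phi>\<in>test_functions. \<forall>c. supp_fun \<phi> \<subseteq> K \<longrightarrow> ck_bounded m UNIV c \<phi> \<longrightarrow> cmod (u \<phi>) \<le> C * c)"

definition test_seminorms :: "(('a::euclidean_space \<Rightarrow> complex) \<Rightarrow> ennreal) set" where
  "test_seminorms = {p. seminorm_on test_functions p \<and>
         (\<forall>K. compact K \<longrightarrow> (\<exists>m. \<exists>C::real. \<forall>\<phi>\<in>test_functions.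
            supp_fun \<phi> \<subseteq> K \<longrightarrow> p \<phi> \<le> ennreal C * Ck_norm m \<phi>))}"

lemma test_topology_eq: "test_topology = subtopology (seminorm_topology test_functions test_seminorms) UNIV"
  by (simp add: test_topology_def test_seminorms_def)

lemma test_seminormsI:
  assumes "seminorm_on test_functions p"
    and "\<And>K. compact K \<Longrightarrow> \<exists>m. \<exists>C::real. \<forall>\<phi>\<in>test_functions. supp_fun \<phi> \<subseteq> K \<longrightarrow> p \<phi> \<le> ennreal C * Ck_norm m \<phi>"
  shows "p \<in> test_seminorms"
  using assms by (simp add: test_seminorms_def)

lemma test_seminormsD:
  assumes "p \<in> test_seminorms"
  shows "seminorm_on test_functions p"
    and "compact K \<Longrightarrow> \<exists>m. \<exists>C::real. \<forall>\<phi>\<in>test_functions. supp_fun \<phi> \<subseteq> K \<longrightarrow> p \<phi> \<le> ennreal C * Ck_norm m \<phi>"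
  using assms by (simp_all add: test_seminorms_def)

lemma seminorm_on_subadditive:
  assumes "seminorm_on E p" "\<And>u v. u \<in> E \<Longrightarrow> v \<in> E \<Longrightarrow> (\<lambda>i. v i - u i) \<in> E"
  shows "subadditive_on E p"
  unfolding subadditive_on_def
proof (intro ballI)
  fix u v assume uv: "u \<in> E" "v \<in> E"
  have "\<forall>x\<in>E. \<forall>y\<in>E. p (\<lambda>i. x i + y i) \<le> p x + p y" using assms(1) by (simp add: seminorm_on_def)
  from bspec[OF bspec[OF this assms(2)[OF uv]] uv(1)]
  show "p v \<le> p (\<lambda>i. v i - u i) + p u" by simp
qed

lemma seminorm_on_zero: "seminorm_on E p \<Longrightarrow> (\<lambda>_. 0) \<in> E \<Longrightarrow> p (\<lambda>_. 0) = 0"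
proof -
  assume "seminorm_on E p" "(\<lambda>_. 0) \<in> E"
  then have "p (\<lambda>i. 0 * 0) = ennreal (cmod 0) * p (\<lambda>_. 0)"
    unfolding seminorm_on_def by (elim conjE allE[of _ 0] bspec)
  then show ?thesis by simp
qed

lemma test_seminorm_facts:
  assumes "p \<in> test_seminorms"
  shows "subadditive_on test_functions p" "p (\<lambda>_. 0) = 0"
    "u \<in> test_functions \<Longrightarrow> p (\<lambda>i. c * u i) = ennreal (cmod c) * p u"
  using test_seminormsD(1)[OF assms] seminorm_on_subadditive[of test_functions p] seminorm_on_zero[of test_functions p]
  by (auto simp: test_functions_diff seminorm_on_def)

lemma tvs_bounded_test_seminorm:
  assumes "tvs_bounded test_topology B" "p \<in> test_seminorms"
  shows "\<exists>C\<ge>0. \<forall>\<phi>\<in>B. p \<phi> \<le> ennreal C"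
  by (rule tvs_bounded_seminorm[OF assms(1)[unfolded test_topology_eq]])
     (use assms(2) test_seminorm_facts[OF assms(2)] in auto)

lemma Ck_norm_test_seminorm: "Ck_norm m \<in> (test_seminorms :: (('a::euclidean_space \<Rightarrow> complex) \<Rightarrow> ennreal) set)"
proof -
  have fin: "\<exists>c\<ge>0. Ck_norm m \<phi> = ennreal c \<and> ck_bounded m UNIV c \<phi>" if \<phi>: "\<phi> \<in> test_functions" for \<phi> :: "'a \<Rightarrow> complex"
  proof -
    obtain c where c: "c \<ge> 0" "ck_bounded m UNIV c \<phi>" using test_function_ck_bounded[OF \<phi>] by blast
    then have "Ck_norm m \<phi> \<le> ennreal c" by (simp add: Ck_norm_le_iff)
    then have "Ck_norm m \<phi> \<noteq> top" using ennreal_less_top le_less_trans by (metis less_irrefl)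
    then obtain d where "d \<ge> 0" "Ck_norm m \<phi> = ennreal d" by (cases "Ck_norm m \<phi>") auto
    then show ?thesis by (intro exI[of _ d]) (simp flip: Ck_norm_le_iff)
  qed
  have add: "Ck_norm m (\<lambda>x. \<phi> x + \<psi> x) \<le> Ck_norm m \<phi> + Ck_norm m \<psi>"
    if \<phi>: "\<phi> \<in> test_functions" and \<psi>: "\<psi> \<in> test_functions" for \<phi> \<psi> :: "'a \<Rightarrow> complex"
  proof -
    obtain c d where "c \<ge> 0" "Ck_norm m \<phi> = ennreal c" "ck_bounded m UNIV c \<phi>"
      "d \<ge> 0" "Ck_norm m \<psi> = ennreal d" "ck_bounded m UNIV d \<psi>" using fin[OF \<phi>] fin[OF \<psi>] by auto
    then show ?thesis using \<phi> \<psi>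
      by (simp add: ennreal_plus[symmetric] Ck_norm_le_iff ck_bounded_add test_functions_smooth del: ennreal_plus)
  qed
  have mult: "Ck_norm m (\<lambda>x. a * \<phi> x) \<le> ennreal (cmod a) * Ck_norm m \<phi>"
    if \<phi>: "\<phi> \<in> test_functions" for \<phi> :: "'a \<Rightarrow> complex" and a
  proof -
    obtain c where "c \<ge> 0" "Ck_norm m \<phi> = ennreal c" "ck_bounded m UNIV c \<phi>" using fin[OF \<phi>] by auto
    then show ?thesis using \<phi>
      by (simp add: ennreal_mult[symmetric] Ck_norm_le_iff ck_bounded_cmult test_functions_smooth)
  qed
  \<comment> \<open>The reverse inequality is the first one applied to the factor
    \<open>inverse a\<close> and the function \<open>a * \<phi>\<close>.\<close>
  have mult_eq: "Ck_norm m (\<lambda>x. a * \<phi> x) = ennreal (cmod a) * Ck_norm m \<phi>"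
    if \<phi>: "\<phi> \<in> test_functions" for \<phi> :: "'a \<Rightarrow> complex" and a
  proof (cases "a = 0")
    case True
    then show ?thesis using mult[OF \<phi>, of 0] by simp
  next
    case False
    have "Ck_norm m (\<lambda>x. inverse a * (a * \<phi> x)) \<le> ennreal (cmod (inverse a)) * Ck_norm m (\<lambda>x. a * \<phi> x)"
      by (rule mult[OF test_functions_cmult[OF \<phi>]])
    moreover have "(\<lambda>x. inverse a * (a * \<phi> x)) = \<phi>" using False by (simp add: mult.assoc[symmetric])
    ultimately have "ennreal (cmod a) * Ck_norm m \<phi> \<le>
      ennreal (cmod a) * (ennreal (cmod (inverse a)) * Ck_norm m (\<lambda>x. a * \<phi> x))"
      by (intro mult_left_mono) auto
    also have "\<dots> = Ck_norm m (\<lambda>x. a * \<phi> x)"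
      using False by (simp add: mult.assoc[symmetric] ennreal_mult[symmetric] norm_inverse)
    finally show ?thesis using mult[OF \<phi>, of a] by simp
  qed
  have "seminorm_on test_functions (Ck_norm m :: ('a \<Rightarrow> complex) \<Rightarrow> ennreal)"
    unfolding seminorm_on_def
  proof (intro conjI ballI allI)
    fix \<phi> :: "'a \<Rightarrow> complex" assume "\<phi> \<in> test_functions"
    then show "Ck_norm m \<phi> < \<infinity>" using fin[of \<phi>] by auto
  qed (use add mult_eq in auto)
  then show ?thesis
    by (rule test_seminormsI) (intro exI[of _ m] exI[of _ 1], simp)
qed

text \<open>Otherwise there are \<open>\<phi> j\<close> in \<open>B\<close> and points
  \<open>x j\<close> with \<open>norm (x j) > j\<close> and
  \<open>\<phi> j (x j) \<noteq> 0\<close>. The weights \<open>w j\<close> make the weighted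
  supremum over the points \<open>x j\<close> at least \<open>j\<close> on \<open>\<phi> j\<close>.
  A compact set contains \<open>x j\<close> for finitely many \<open>j\<close> only, so this
  supremum is a continuous seminorm of the LF topology that is unbounded on
  \<open>B\<close>.\<close>

lemma tvs_bounded_common_support:
  fixes B :: "('a::euclidean_space \<Rightarrow> complex) set"
  assumes B: "tvs_bounded test_topology B"
  obtains R where "\<And>\<phi> x. \<phi> \<in> B \<Longrightarrow> norm x > R \<Longrightarrow> \<phi> x = 0"
proof (rule ccontr)
  assume "\<not> thesis"
  then have "\<And>j::nat. \<exists>\<phi> x. \<phi> \<in> B \<and> norm x > real j \<and> \<phi> x \<noteq> 0" using that by meson
  then obtain \<phi> x where \<phi>x: "\<And>j::nat. \<phi> j \<in> B \<and> norm (x j) > real j \<and> \<phi> j (x j) \<noteq> 0" by metis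
  define w where "w j = real j / cmod (\<phi> j (x j))" for j
  have w: "w j \<ge> 0" for j by (simp add: w_def)
  define p where "p \<psi> = (SUP j. ennreal (w j * cmod (\<psi> (x j))))" for \<psi> :: "'a \<Rightarrow> complex"
  have bd: "\<exists>C\<ge>0. \<forall>\<psi>\<in>test_functions. supp_fun \<psi> \<subseteq> K \<longrightarrow> p \<psi> \<le> ennreal C * Ck_norm 0 \<psi>" if K: "compact K" for K
  proof -
    obtain r where r: "\<And>y. y \<in> K \<Longrightarrow> norm y \<le> r" using compact_imp_bounded[OF K] by (auto simp: bounded_iff)
    define C where "C = (\<Sum>j\<in>{j. real j \<le> r}. w j)"
    have fin: "finite {j. real j \<le> r}" by (rule finite_subset[of _ "{..nat \<lceil>r\<rceil>}"]) (auto, linarith)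
    have C: "w j \<le> C" if "real j \<le> r" for j unfolding C_def by (rule member_le_sum) (use that w fin in auto)
    have C0: "C \<ge> 0" unfolding C_def using w by (intro sum_nonneg) auto
    have "p \<psi> \<le> ennreal C * Ck_norm 0 \<psi>" if \<psi>: "\<psi> \<in> test_functions" "supp_fun \<psi> \<subseteq> K" for \<psi>
      unfolding p_def
    proof (rule SUP_least)
      fix j
      have 1: "ennreal (cmod (\<psi> (x j))) \<le> Ck_norm 0 \<psi>"
        by (auto simp: Ck_norm_def intro: SUP_upper2)
      show "ennreal (w j * cmod (\<psi> (x j))) \<le> ennreal C * Ck_norm 0 \<psi>"
      proof (cases "real j \<le> r")
        case True
        then have "ennreal (w j * cmod (\<psi> (x j))) \<le> ennreal C * ennreal (cmod (\<psi> (x j)))"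
          using C C0 w by (simp add: ennreal_mult[symmetric] mult_right_mono ennreal_leI)
        also have "\<dots> \<le> ennreal C * Ck_norm 0 \<psi>" by (intro mult_left_mono 1) auto
        finally show ?thesis .
      next
        case False
        then have "x j \<notin> supp_fun \<psi>" using r[of "x j"] \<phi>x[of j] \<psi>(2)
          by (meson dual_order.strict_trans2 linorder_not_le order.strict_implies_order subsetD)
        then show ?thesis by (simp add: not_in_supp_fun)
      qed
    qed
    then show ?thesis using C0 by blast
  qed
  have "p \<in> test_seminorms"
  proof -
    have "p \<psi> < \<infinity>" if \<psi>: "\<psi> \<in> test_functions" for \<psi>
    proof -
      obtain C where "p \<psi> \<le> ennreal C * Ck_norm 0 \<psi>" using bd[OF test_functions_compact[OF \<psi>]] \<psi> by blast
      moreover have "Ck_norm 0 \<psi> < \<infinity>" using test_seminormsD(1)[OF Ck_norm_test_seminorm[of 0]] \<psi>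
        unfolding seminorm_on_def by blast
      ultimately show ?thesis using ennreal_mult_less_top by (metis ennreal_less_top infinity_ennreal_def le_less_trans)
    qed
    moreover have "p (\<lambda>i. u i + v i) \<le> p u + p v" for u v
      unfolding p_def
    proof (rule SUP_least)
      fix j
      have "ennreal (w j * cmod (u (x j) + v (x j))) \<le> ennreal (w j * cmod (u (x j))) + ennreal (w j * cmod (v (x j)))"
        using w by (simp add: ennreal_plus[symmetric] distrib_left[symmetric] mult_left_mono norm_triangle_ineq del:
          ennreal_plus)
      also have "\<dots> \<le> (SUP j. ennreal (w j * cmod (u (x j)))) + (SUP j. ennreal (w j * cmod (v (x j))))"
        by (intro add_mono SUP_upper) auto
      finally show "ennreal (w j * cmod (u (x j) + v (x j))) \<le> \<dots>" .
    qed
    moreover have "p (\<lambda>i. c * u i) = ennreal (cmod c) * p u" for c u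
      unfolding p_def SUP_mult_left_ennreal using w
      by (simp add: norm_mult ennreal_mult[symmetric] mult_ac)
    ultimately have "seminorm_on test_functions p" by (simp add: seminorm_on_def)
    then show ?thesis
    proof (rule test_seminormsI)
      fix K :: "'a set" assume "compact K"
      from bd[OF this] show "\<exists>m. \<exists>C::real. \<forall>\<phi>\<in>test_functions. supp_fun \<phi> \<subseteq> K \<longrightarrow> p \<phi> \<le> ennreal C * Ck_norm m \<phi>"
        by blast
    qed
  qed
  then obtain C where C: "C \<ge> 0" "\<And>\<psi>. \<psi> \<in> B \<Longrightarrow> p \<psi> \<le> ennreal C" using tvs_bounded_test_seminorm[OF B] by metis
  obtain j :: nat where j: "real j > C" using reals_Archimedean2 by blast
  have "ennreal (real j) = ennreal (w j * cmod (\<phi> j (x j)))" using \<phi>x[of j] by (simp add: w_def)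
  also have "\<dots> \<le> p (\<phi> j)" unfolding p_def by (rule SUP_upper2[of j]) auto
  also have "\<dots> \<le> ennreal C" using C \<phi>x by blast
  finally show False using j C by (simp add: ennreal_le_iff)
qed

lemma tvs_bounded_imp_bounded_tests:
  fixes B :: "('a::euclidean_space \<Rightarrow> complex) set"
  assumes B: "tvs_bounded test_topology B"
  shows "bounded_tests B"
  unfolding bounded_tests_def
proof (intro conjI allI)
  show "B \<subseteq> test_functions" using B by (simp add: tvs_bounded_def test_topology_def)
  obtain R where R: "\<And>\<phi> x. \<phi> \<in> B \<Longrightarrow> norm x > R \<Longrightarrow> \<phi> x = 0" using tvs_bounded_common_support[OF B] by blast
  show "\<exists>K. compact K \<and> (\<forall>\<phi>\<in>B. supp_fun \<phi> \<subseteq> K)"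
  proof (intro exI[of _ "cball 0 R"] conjI ballI supp_fun_subset)
    fix \<phi> and x :: 'a assume "\<phi> \<in> B" "x \<notin> cball 0 R"
    then show "\<phi> x = 0" using R by simp
  qed auto
  fix m
  obtain C where C: "C \<ge> 0" "\<And>\<phi>. \<phi> \<in> B \<Longrightarrow> Ck_norm m \<phi> \<le> ennreal C"
    using tvs_bounded_test_seminorm[OF B Ck_norm_test_seminorm] by metis
  then show "\<exists>c. \<forall>\<phi>\<in>B. ck_bounded m UNIV c \<phi>"
    by (intro exI[of _ C]) (auto simp: Ck_norm_le_iff)
qed

lemma bounded_tests_seminorm:
  assumes "bounded_tests B" "p \<in> test_seminorms"
  obtains C where "C \<ge> 0" "\<And>\<phi>. \<phi> \<in> B \<Longrightarrow> p \<phi> \<le> ennreal C"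
proof -
  obtain K where K: "compact K" "\<And>\<phi>. \<phi> \<in> B \<Longrightarrow> supp_fun \<phi> \<subseteq> K" using assms(1) by (auto simp: bounded_tests_def)
  have "\<exists>m. \<exists>C::real. \<forall>\<phi>\<in>test_functions. supp_fun \<phi> \<subseteq> K \<longrightarrow> p \<phi> \<le> ennreal C * Ck_norm m \<phi>"
    by (rule test_seminormsD(2)[OF assms(2) K(1)])
  then obtain m and C :: real where mC: "\<forall>\<phi>\<in>test_functions. supp_fun \<phi> \<subseteq> K \<longrightarrow> p \<phi> \<le> ennreal C * Ck_norm m \<phi>"
    by auto
  obtain c where c: "\<forall>\<phi>\<in>B. ck_bounded m UNIV c \<phi>" using assms(1) unfolding bounded_tests_def by blast
  have "p \<phi> \<le> ennreal (\<bar>C\<bar> * \<bar>c\<bar>)" if "\<phi> \<in> B" for \<phi>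
  proof -
    have "Ck_norm m \<phi> \<le> ennreal \<bar>c\<bar>"
      using ck_bounded_mono[OF bspec[OF c that], of m UNIV "\<bar>c\<bar>"] by (simp add: Ck_norm_le_iff)
    moreover have "p \<phi> \<le> ennreal C * Ck_norm m \<phi>" using mC K(2) that assms(1) by (auto simp: bounded_tests_def)
    moreover have "ennreal C \<le> ennreal \<bar>C\<bar>" by (simp add: ennreal_leI)
    ultimately have "p \<phi> \<le> ennreal \<bar>C\<bar> * ennreal \<bar>c\<bar>" by (meson mult_mono order_trans zero_le)
    then show ?thesis by (simp add: ennreal_mult)
  qed
  then show thesis by (intro that[of "\<bar>C\<bar> * \<bar>c\<bar>"]) auto
qed

lemma bounded_tests_imp_tvs_bounded:
  fixes B :: "('a::euclidean_space \<Rightarrow> complex) set"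
  assumes B: "bounded_tests B"
  shows "tvs_bounded test_topology B"
  unfolding tvs_bounded_def
proof (intro conjI allI impI)
  show "B \<subseteq> topspace test_topology" using B by (simp add: bounded_tests_def test_topology_def)
  fix W :: "('a \<Rightarrow> complex) set" assume "zero_nhd test_topology W"
  then obtain F \<epsilon> where F: "finite F" "F \<subseteq> test_seminorms" "(0::real) < \<epsilon>"
    "{v \<in> test_functions. \<forall>p\<in>F. p v < ennreal \<epsilon>} \<inter> UNIV \<subseteq> W"
    unfolding test_topology_eq by (rule zero_nhd_seminormD)
  have "\<forall>p\<in>F. \<exists>C\<ge>0. \<forall>\<phi>\<in>B. p \<phi> \<le> ennreal C"
    using F(2) bounded_tests_seminorm[OF B] by (metis subsetD)
  then obtain C where C: "\<And>p. p \<in> F \<Longrightarrow> C p \<ge> 0 \<and> (\<forall>\<phi>\<in>B. p \<phi> \<le> ennreal (C p))" by metis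
  define S where "S = sum C F"
  have S: "C p \<le> S" if "p \<in> F" for p unfolding S_def by (rule member_le_sum) (use that C F(1) in auto)
  have S0: "S \<ge> 0" unfolding S_def using C by (intro sum_nonneg) auto
  \<comment> \<open>With this \<open>t\<close>, \<open>p (\<phi> / t)\<close> is at most
    \<open>C p * \<epsilon> / (S + 1) < \<epsilon>\<close> for all \<open>p\<close> in
    \<open>F\<close> simultaneously.\<close>
  define t where "t = (S + 1) / \<epsilon>"
  have t: "t > 0" using S0 F(3) by (simp add: t_def)
  show "\<exists>t>0. B \<subseteq> (\<lambda>w i. complex_of_real t * w i) ` W"
  proof (intro exI conjI subsetI)
    fix \<phi> assume \<phi>: "\<phi> \<in> B"
    then have \<phi>t: "\<phi> \<in> test_functions" using B by (auto simp: bounded_tests_def)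
    define w where "w = (\<lambda>i. complex_of_real (1/t) * \<phi> i)"
    have "p w < ennreal \<epsilon>" if "p \<in> F" for p
    proof -
      have "p w = ennreal (1/t) * p \<phi>"
        unfolding w_def using test_seminorm_facts(3)[OF _ \<phi>t, of p "complex_of_real (1/t)"] that F(2) t
          by (auto simp: norm_divide)
      also have "\<dots> \<le> ennreal (1/t) * ennreal (C p)" using C that \<phi> by (intro mult_left_mono) auto
      also have "\<dots> = ennreal (C p / t)" using t C that by (simp add: ennreal_mult[symmetric])
      also have "\<dots> < ennreal \<epsilon>"
      proof (rule ennreal_lessI)
        have "C p * \<epsilon> < \<epsilon> * (S + 1)" using S[OF that] F(3) by simp
        then show "C p / t < \<epsilon>" using S0 F(3) by (simp add: t_def divide_less_eq)
      qed (use F(3) in auto)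
      finally show ?thesis .
    qed
    moreover have "w \<in> test_functions" unfolding w_def by (rule test_functions_cmult[OF \<phi>t])
    ultimately have "w \<in> W" using F(4) by auto
    moreover have "\<phi> = (\<lambda>i. complex_of_real t * w i)" unfolding w_def using t by auto
    ultimately show "\<phi> \<in> (\<lambda>w i. complex_of_real t * w i) ` W" by blast
  qed (rule t)
qed

lemma dist_boundD: "dist_bound u K m C \<Longrightarrow> \<phi> \<in> test_functions \<Longrightarrow> supp_fun \<phi> \<subseteq> K \<Longrightarrow> ck_bounded m UNIV c \<phi> \<Longrightarrow>
  cmod (u \<phi>) \<le> C * c"
  by (simp add: dist_bound_def)

text \<open>Continuity at 0 bounds \<open>u\<close> by 1 on a ball of finitely many seminorms. On
  functions supported in \<open>K\<close> each of them is controlled by some \<open>Ck_norm\<close>;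
  the largest order and the sum of the constants serve for all.\<close>

lemma distribution_dist_bound:
  fixes u :: "('a::euclidean_space \<Rightarrow> complex) \<Rightarrow> complex"
  assumes u: "u \<in> distributions" and K: "compact K"
  obtains m C where "0 \<le> C" "dist_bound u K m C"
proof -
  have lin: "test_functional u" using u by (rule distributions_test_functional)
  have "openin test_topology {\<phi> \<in> topspace test_topology. u \<phi> \<in> ball 0 1}"
    using u by (intro openin_continuous_map_preimage) (auto simp: distributions_def)
  then have "zero_nhd test_topology {\<phi> \<in> topspace test_topology. u \<phi> \<in> ball 0 1}"
    unfolding zero_nhd_def
    by (intro conjI exI[of _ "{\<phi> \<in> topspace test_topology. u \<phi> \<in> ball 0 1}"])
       (auto simp: test_topology_def test_functional_zero[OF lin])
  then obtain F \<epsilon> where F: "finite F" "F \<subseteq> test_seminorms" "(0::real) < \<epsilon>"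
    "{v \<in> test_functions. \<forall>p\<in>F. p v < ennreal \<epsilon>} \<inter> UNIV \<subseteq> {\<phi> \<in> topspace test_topology. u \<phi> \<in> ball 0 1}"
    unfolding test_topology_eq by (rule zero_nhd_seminormD)
  have "\<forall>p\<in>F. \<exists>m. \<exists>C::real. \<forall>\<phi>\<in>test_functions. supp_fun \<phi> \<subseteq> K \<longrightarrow> p \<phi> \<le> ennreal C * Ck_norm m \<phi>"
    using F(2) K test_seminormsD(2) by blast
  then obtain M C where MC: "\<And>p \<phi>. p \<in> F \<Longrightarrow> \<phi> \<in> test_functions \<Longrightarrow> supp_fun \<phi> \<subseteq> K \<Longrightarrow> p \<phi> \<le> ennreal (C p) * Ck_norm (M p) \<phi>"
    by metis
  define m where "m = Max (insert 0 (M ` F))"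
  define D where "D = (\<Sum>p\<in>F. \<bar>C p\<bar>) + 1"
  have m: "M p \<le> m" if "p \<in> F" for p unfolding m_def using F(1) that by (intro Max_ge) auto
  have D: "\<bar>C p\<bar> \<le> D - 1" if "p \<in> F" for p unfolding D_def using member_le_sum[of p F "\<lambda>p. \<bar>C p\<bar>"] F(1) that by auto
  have D0: "D \<ge> 1" unfolding D_def by (simp add: sum_nonneg)
  have small: "cmod (u \<phi>) \<le> 1"
    if \<phi>: "\<phi> \<in> test_functions" "supp_fun \<phi> \<subseteq> K" "ck_bounded m UNIV c \<phi>" "c \<ge> 0" "D * c \<le> \<epsilon>/2" for \<phi> c
  proof -
    have "p \<phi> < ennreal \<epsilon>" if p: "p \<in> F" for p
    proof -
      have "p \<phi> \<le> ennreal (C p) * Ck_norm (M p) \<phi>" using MC p \<phi> by blast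
      also have "\<dots> \<le> ennreal D * ennreal c"
      proof (rule mult_mono)
        show "ennreal (C p) \<le> ennreal D" using D[OF p] by (intro ennreal_leI) linarith
        show "Ck_norm (M p) \<phi> \<le> ennreal c" using ck_bounded_mono[OF \<phi>(3) m[OF p]] \<phi>(4) by (simp add: Ck_norm_le_iff)
      qed auto
      also have "\<dots> = ennreal (D * c)" using \<phi>(4) D0 by (simp add: ennreal_mult)
      also have "\<dots> < ennreal \<epsilon>" using \<phi>(5) F(3) by (intro ennreal_lessI) auto
      finally show ?thesis .
    qed
    then have "u \<phi> \<in> ball 0 1" using F(4) \<phi>(1) by blast
    then show ?thesis by simp
  qed
  have "dist_bound u K m (2 * D / \<epsilon>)"
    unfolding dist_bound_def
  proof (intro ballI allI impI)
    fix \<phi> c assume \<phi>: "\<phi> \<in> test_functions" "supp_fun \<phi> \<subseteq> K" "ck_bounded m UNIV c \<phi>"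
    \<comment> \<open>The bound \<open>c\<close> may be 0, which rules out rescaling by it. A larger
      \<open>d\<close> is used, and \<open>dense_ge\<close> lets it decrease to
      \<open>c\<close>.\<close>
    have "cmod (u \<phi>) \<le> 2 * D / \<epsilon> * d" if d: "d > c" for d
    proof -
      have c0: "c \<ge> 0" using ck_bounded_0D[OF \<phi>(3), of 0] by (meson UNIV_I norm_ge_zero order_trans)
      define s where "s = \<epsilon> / (2 * D * d)"
      have s: "s > 0" using F(3) D0 d c0 by (auto simp: s_def)
      have "cmod (u (\<lambda>x. of_real s * \<phi> x)) \<le> 1"
      proof (rule small)
        show "(\<lambda>x. of_real s * \<phi> x) \<in> test_functions" by (rule test_functions_cmult[OF \<phi>(1)])
        show "supp_fun (\<lambda>x. of_real s * \<phi> x) \<subseteq> K" using supp_fun_cmult \<phi>(2) by (rule order_trans)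
        show "ck_bounded m UNIV (s * d) (\<lambda>x. of_real s * \<phi> x)"
          using ck_bounded_cmult[OF test_functions_smooth[OF \<phi>(1)] ck_bounded_mono[OF \<phi>(3), of m UNIV d], of
            "of_real s"] s d by auto
        show "0 \<le> s * d" "D * (s * d) \<le> \<epsilon> / 2" using s d c0 D0 F(3) by (auto simp: s_def)
      qed
      then have "s * cmod (u \<phi>) \<le> 1" using s by (simp add: test_functional_cmult[OF lin \<phi>(1)] norm_mult)
      then have "cmod (u \<phi>) \<le> 1 / s" using s by (simp add: field_simps)
      then show ?thesis by (simp add: s_def)
    qed
    moreover have pos: "(2 * D / \<epsilon>) > 0" using D0 F(3) by simp
    ultimately have "cmod (u \<phi>) / (2 * D / \<epsilon>) \<le> d" if "d > c" for d
      using that unfolding pos_divide_le_eq[OF pos] mult.commute[of d] by blast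
    then have "cmod (u \<phi>) / (2 * D / \<epsilon>) \<le> c" by (rule dense_ge)
    then show "cmod (u \<phi>) \<le> 2 * D / \<epsilon> * c" unfolding pos_divide_le_eq[OF pos] by (simp add: mult_ac)
  qed
  then show thesis using D0 F(3) by (intro that[of "2 * D / \<epsilon>" m]) auto
qed

text \<open>The modulus of \<open>u\<close> is itself one of the seminorms that generate
  \<open>test_topology\<close>, so the preimage of an open set contains, around each of its points,
  a ball of this single seminorm.\<close>

lemma distributionsI:
  fixes u :: "('a::euclidean_space \<Rightarrow> complex) \<Rightarrow> complex"
  assumes lin: "test_functional u" and bd: "\<And>K. compact K \<Longrightarrow> \<exists>m C. dist_bound u K m C"
  shows "u \<in> distributions"
proof -
  define p where "p \<phi> = ennreal (cmod (u \<phi>))" for \<phi>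
  have "\<exists>m. \<exists>C::real. \<forall>\<phi>\<in>test_functions. supp_fun \<phi> \<subseteq> K \<longrightarrow> p \<phi> \<le> ennreal C * Ck_norm m \<phi>" if K: "compact K" for K
  proof -
    obtain m C where mC: "dist_bound u K m C" using bd[OF K] by blast
    have "p \<phi> \<le> ennreal \<bar>C\<bar> * Ck_norm m \<phi>" if "\<phi> \<in> test_functions" "supp_fun \<phi> \<subseteq> K" for \<phi>
    proof (cases "Ck_norm m \<phi>")
      case (real c)
      then have "cmod (u \<phi>) \<le> C * c" using that by (intro dist_boundD[OF mC]) (auto simp flip: Ck_norm_le_iff)
      also have "\<dots> \<le> \<bar>C\<bar> * c" using real by (intro mult_right_mono) auto
      finally show ?thesis using real by (simp add: p_def ennreal_mult[symmetric] ennreal_leI)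
    next
      case top
      then show ?thesis using test_seminormsD(1)[OF Ck_norm_test_seminorm[of m]] that(1) by (auto simp: seminorm_on_def)
    qed
    then show ?thesis by blast
  qed
  moreover have "seminorm_on test_functions p"
    using lin by (auto simp: seminorm_on_def p_def test_functional_add test_functional_cmult norm_mult ennreal_mult
        simp flip: ennreal_plus intro!: ennreal_leI norm_triangle_ineq)
  ultimately have p: "p \<in> test_seminorms" by (intro test_seminormsI) auto
  have "openin test_topology {\<phi> \<in> topspace test_topology. u \<phi> \<in> V}" if V: "open V" for V
    unfolding test_topology_eq subtopology_UNIV openin_seminorm_topology
  proof (intro conjI ballI)
    fix \<phi> assume \<phi>: "\<phi> \<in> {\<phi> \<in> topspace (seminorm_topology test_functions test_seminorms). u \<phi> \<in> V}"
    then have "\<exists>\<epsilon>>0. ball (u \<phi>) \<epsilon> \<subseteq> V" using iffD1[OF open_contains_ball V] by auto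
    then obtain \<epsilon> where e: "\<epsilon> > 0" "ball (u \<phi>) \<epsilon> \<subseteq> V" by auto
    have "{v \<in> test_functions. \<forall>p\<in>{p}. p (\<lambda>i. v i - \<phi> i) < ennreal \<epsilon>} \<subseteq>
      {\<phi> \<in> topspace (seminorm_topology test_functions test_seminorms). u \<phi> \<in> V}"
      using \<phi> e by (auto simp: p_def test_functional_diff[OF lin] ennreal_less_iff dist_norm norm_minus_commute
        subset_iff)
    then show "\<exists>F \<epsilon>. finite F \<and> F \<subseteq> test_seminorms \<and> (0::real) < \<epsilon> \<and>
      {v \<in> test_functions. \<forall>p\<in>F. p (\<lambda>i. v i - \<phi> i) < ennreal \<epsilon>} \<subseteq>
       {\<phi> \<in> topspace (seminorm_topology test_functions test_seminorms). u \<phi> \<in> V}"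
      using p e(1) by (intro exI[of _ "{p}"] exI[of _ \<epsilon>]) auto
  qed auto
  then have "continuous_map test_topology euclidean u"
    by (auto simp: continuous_map_def)
  then show ?thesis using lin by (auto simp: distributions_def test_functional_def)
qed

section \<open>Pairing in one variable\<close>

lemma linear_combination_bound:
  fixes c :: "'a::euclidean_space \<Rightarrow> complex" and M :: real
  assumes "\<And>b. b \<in> Basis \<Longrightarrow> cmod (c b) \<le> M"
  shows "cmod (\<Sum>b\<in>Basis. of_real (h \<bullet> b) * c b) \<le> (DIM('a) * M) * norm h"
proof -
  have "cmod (\<Sum>b\<in>Basis. of_real (h \<bullet> b) * c b) \<le> (\<Sum>b\<in>(Basis::'a set). norm h * M)"
  proof (rule sum_norm_le)
    fix b :: 'a assume b: "b \<in> Basis"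
    have "cmod (of_real (h \<bullet> b) * c b) \<le> \<bar>h \<bullet> b\<bar> * cmod (c b)" by (simp add: norm_mult)
    also have "\<dots> \<le> norm h * M" using b assms Basis_le_norm by (intro mult_mono) auto
    finally show "cmod (of_real (h \<bullet> b) * c b) \<le> norm h * M" .
  qed
  then show ?thesis by (simp add: mult_ac)
qed

lemma onorm_partial_le:
  fixes c :: "'a::euclidean_space \<Rightarrow> complex" and M :: real
  assumes "\<And>b. b \<in> Basis \<Longrightarrow> cmod (c b) \<le> M"
  shows "onorm (\<lambda>h. \<Sum>b\<in>Basis. of_real (h \<bullet> b) * c b) \<le> DIM('a) * M"
  using linear_combination_bound[OF assms] by (intro onorm_le)

lemma smooth_lipschitz:
  fixes f :: "'a::euclidean_space \<Rightarrow> complex" and M :: real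
  assumes "smooth f" "ck_bounded 1 UNIV M f"
  shows "cmod (f y - f x) \<le> (DIM('a) * M) * norm (y - x)"
proof (rule differentiable_bound[of UNIV])
  fix z
  show "(f has_derivative (\<lambda>h. \<Sum>b\<in>Basis. of_real (h \<bullet> b) * partial b f z)) (at z within UNIV)"
    using has_derivative_partial smooth_differentiable assms(1) by auto
  show "onorm (\<lambda>h. \<Sum>b\<in>Basis. of_real (h \<bullet> b) * partial b f z) \<le> DIM('a) * M"
    using assms(2) by (intro onorm_partial_le) auto
qed auto

lemma smooth_taylor2:
  fixes f :: "'a::euclidean_space \<Rightarrow> complex" and M :: real
  assumes f: "smooth f" "ck_bounded 2 UNIV M f"
  shows "cmod (f (x + h) - f x - (\<Sum>b\<in>Basis. of_real (h \<bullet> b) * partial b f x)) \<le> (DIM('a) * (DIM('a) * M)) * norm h ^ 2"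
proof -
  have M: "M \<ge> 0" using ck_bounded_0D[OF f(2), of x] by (meson UNIV_I norm_ge_zero order_trans)
  have "norm (f (x + h) - f x - (\<lambda>z h. \<Sum>b\<in>Basis. of_real (h \<bullet> b) * partial b f z) x (x + h - x))
      \<le> norm (x + h - x) * (DIM('a) * (DIM('a) * M * norm h))"
  proof (rule differentiable_bound_linearization[of x "x + h" "cball x (norm h)"])
    fix z assume z: "z \<in> cball x (norm h)"
    show "(f has_derivative (\<lambda>h. \<Sum>b\<in>Basis. of_real (h \<bullet> b) * partial b f z)) (at z within cball x (norm h))"
      using has_derivative_partial smooth_differentiable f(1) has_derivative_at_withinI by blast
    have "cmod (partial b f z - partial b f x) \<le> (DIM('a) * M) * norm h" if "b \<in> Basis" for b
    proof -
      have "cmod (partial b f z - partial b f x) \<le> (DIM('a) * M) * norm (z - x)"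
        using f that by (intro smooth_lipschitz smooth_partial) (auto simp: numeral_2_eq_2)
      also have "\<dots> \<le> (DIM('a) * M) * norm h"
        using z M by (intro mult_left_mono) (auto simp: dist_norm norm_minus_commute)
      finally show ?thesis .
    qed
    from onorm_partial_le[OF this]
    show "onorm ((\<lambda>h. \<Sum>b\<in>Basis. of_real (h \<bullet> b) * partial b f z) - (\<lambda>h. \<Sum>b\<in>Basis. of_real (h \<bullet> b) * partial b f x))
        \<le> DIM('a) * (DIM('a) * M * norm h)"
      by (simp add: fun_diff_def sum_subtractf[symmetric] right_diff_distrib[symmetric])
  next
    fix t :: real assume "t \<in> {0..1}"
    then show "x + t *\<^sub>R (x + h - x) \<in> cball x (norm h)"
      by (auto simp: dist_norm intro: mult_left_le_one_le)
  qed auto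
  then show ?thesis by (simp add: power2_eq_square mult_ac)
qed

lemma basis_map_id: "basis_map (\<lambda>x. x)"
  by (auto simp: basis_map_def bounded_linear_ident)

lemma partial_translate:
  assumes "smooth f" "b \<in> Basis"
  shows "partial b (\<lambda>z. f (z + a)) = (\<lambda>z. partial b f (z + a))"
  using partial_basis_map[OF basis_map_id, of f b a] assms by (auto simp: smooth_differentiable)

lemma smooth_translate: "smooth f \<Longrightarrow> smooth (\<lambda>z. f (z + a))"
  by (rule smooth_affine[OF bounded_linear_ident])

lemma partial_diff:
  assumes "smooth f" "smooth g"
  shows "partial b (\<lambda>x. f x - g x) = (\<lambda>x. partial b f x - partial b g x)"
  using partial_add[of f "\<lambda>x. -1 * g x" b] partial_cmult[of g b "-1"] assms smooth_cmult[of g "-1"]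
  by (simp add: smooth_differentiable)

lemma ck_bounded_translation_diff:
  fixes f :: "'a::euclidean_space \<Rightarrow> complex" and M t :: real
  shows "smooth f \<Longrightarrow> ck_bounded (Suc m) UNIV M f \<Longrightarrow> ck_bounded m UNIV ((DIM('a) * M) * norm a) (\<lambda>z. f (z + a) - f z)"
proof (induction m arbitrary: f)
  case 0
  have "cmod (f (x + a) - f x) \<le> (DIM('a) * M) * norm a" for x
    using smooth_lipschitz[of f M "x + a" x] 0 by simp
  then show ?case by auto
next
  case (Suc m)
  have "cmod (f (x + a) - f x) \<le> (DIM('a) * M) * norm a" for x
    using smooth_lipschitz[of f M "x + a" x] Suc.prems by simp
  moreover have "ck_bounded m UNIV (DIM('a) * M * norm a) (partial b (\<lambda>z. f (z + a) - f z))" if "b \<in> Basis" for b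
    using Suc.IH[of "partial b f"] Suc.prems that
    by (simp add: partial_diff partial_translate smooth_translate smooth_partial)
  ultimately show ?case by simp
qed

lemma smooth_taylor2_basis:
  fixes f :: "'a::euclidean_space \<Rightarrow> complex" and M t :: real
  assumes "smooth f" "ck_bounded 2 UNIV M f" "b \<in> Basis"
  shows "cmod (f (x + t *\<^sub>R b) - f x - of_real t * partial b f x) \<le> (DIM('a) * (DIM('a) * M)) * t ^ 2"
proof -
  have "(\<Sum>i\<in>Basis. of_real ((t *\<^sub>R b) \<bullet> i) * partial i f x) =
    (\<Sum>i\<in>Basis. if i = b then of_real t * partial i f x else 0)"
    using assms(3) by (intro sum.cong) (auto simp: inner_Basis)
  also have "\<dots> = of_real t * partial b f x" using assms(3) by simp
  finally show ?thesis using smooth_taylor2[OF assms(1,2), of x "t *\<^sub>R b"] assms(3) by simp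
qed

text \<open>Taylor's formula in direction \<open>b\<close> is applied to the first difference
  \<open>G\<close> in direction \<open>b'\<close>, whose derivatives up to order 2 are of size
  \<open>t\<close>; the error is of order \<open>t^3\<close>. Expanding \<open>partial b G x\<close>
  in direction \<open>b'\<close> costs another \<open>t * t^2\<close>.\<close>

lemma second_difference_bound:
  fixes f :: "'a::euclidean_space \<Rightarrow> complex" and M t :: real
  assumes f: "smooth f" "ck_bounded 3 UNIV M f" and b: "b \<in> Basis" "b' \<in> Basis" and t: "t > 0"
  shows "cmod (f (x + t *\<^sub>R b + t *\<^sub>R b') - f (x + t *\<^sub>R b) - f (x + t *\<^sub>R b') + f x - of_real (t^2)
    * partial b' (partial b f) x)
    \<le> (DIM('a) * (DIM('a) * M) * (DIM('a) + 1)) * t ^ 3"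
proof -
  define n :: real where "n = DIM('a)"
  define G where "G = (\<lambda>z. f (z + t *\<^sub>R b') - f z)"
  define A where "A = partial b' (partial b f) x"
  have "norm (t *\<^sub>R b') = t" using b t by simp
  then have G: "smooth G" "ck_bounded 2 UNIV (n * M * t) G"
    unfolding G_def using ck_bounded_translation_diff[OF f(1), of 2 M "t *\<^sub>R b'"] f
    by (auto intro: smooth_diff smooth_translate simp: n_def)
  have 1: "cmod (G (x + t *\<^sub>R b) - G x - of_real t * partial b G x) \<le> (n * (n * (n * M * t))) * t ^ 2"
    using smooth_taylor2_basis[OF G b(1)] unfolding n_def .
  have pG: "partial b G x = partial b f (x + t *\<^sub>R b') - partial b f x"
    unfolding G_def using f b by (simp add: partial_diff partial_translate smooth_translate)
  have "cmod (partial b f (x + t *\<^sub>R b') - partial b f x - of_real t * A) \<le> (n * (n * M)) * t ^ 2"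
    unfolding A_def n_def using f b by (intro smooth_taylor2_basis smooth_partial) (auto simp: eval_nat_numeral)
  then have "cmod (of_real t * (partial b G x - of_real t * A)) \<le> t * ((n * (n * M)) * t ^ 2)"
    using t unfolding norm_mult pG by (simp add: mult_left_mono)
  then have "cmod ((G (x + t *\<^sub>R b) - G x - of_real t * partial b G x) + of_real t * (partial b G x - of_real t * A))
     \<le> (n * (n * (n * M * t))) * t ^ 2 + t * ((n * (n * M)) * t ^ 2)"
    using 1 by (intro norm_triangle_le add_mono)
  also have "\<dots> = (n * (n * M) * (n + 1)) * t ^ 3" by (simp add: algebra_simps power2_eq_square power3_eq_cube)
  also have "(G (x + t *\<^sub>R b) - G x - of_real t * partial b G x) + of_real t * (partial b G x - of_real t * A)
    = f (x + t *\<^sub>R b + t *\<^sub>R b') - f (x + t *\<^sub>R b) - f (x + t *\<^sub>R b') + f x - of_real (t^2) * A"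
    by (simp add: G_def algebra_simps power2_eq_square)
  finally show ?thesis by (simp add: A_def n_def add.commute)
qed

text \<open>The mixed second difference is symmetric in \<open>b\<close> and \<open>b'\<close>, so
  the two derivatives differ by at most a constant times \<open>t^3 / t^2\<close> for every
  \<open>t > 0\<close>. The interchange is needed to differentiate
  \<open>slice_remainder\<close>.\<close>

lemma partial_commute:
  fixes f :: "'a::euclidean_space \<Rightarrow> complex"
  assumes f: "f \<in> test_functions" and b: "b \<in> Basis" "b' \<in> Basis"
  shows "partial b' (partial b f) = partial b (partial b' f)"
proof
  fix x
  obtain M where M: "ck_bounded 3 UNIV M f" using test_function_ck_bounded[OF f] by blast
  have sm: "smooth f" using f by (rule test_functions_smooth)
  define C where "C = DIM('a) * (DIM('a) * M) * (DIM('a) + 1)"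
  define D where "D = cmod (partial b' (partial b f) x - partial b (partial b' f) x)"
  have "D \<le> 2 * C * t" if t: "t > 0" for t
  proof -
    let ?d = "\<lambda>b b'. f (x + t *\<^sub>R b + t *\<^sub>R b') - f (x + t *\<^sub>R b) - f (x + t *\<^sub>R b') + f x - of_real (t^2)
      * partial b' (partial b f) x"
    have "cmod (?d b' b - ?d b b') \<le> C * t^3 + C * t^3"
      using second_difference_bound[OF sm M b t, of x] second_difference_bound[OF sm M b(2,1) t, of x]
      unfolding C_def by (rule order_trans[OF norm_triangle_ineq4 add_mono, rotated])
    also have "?d b' b - ?d b b' = of_real (t^2) * (partial b' (partial b f) x - partial b (partial b' f) x)"
      by (simp add: algebra_simps)
    finally have "cmod (of_real (t^2)) * D \<le> C * t^3 + C * t^3"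
      unfolding D_def norm_mult .
    moreover have "cmod (of_real (t^2)) = t^2" unfolding norm_of_real by simp
    ultimately have "t^2 * D \<le> t^2 * (2 * C * t)"
      by (simp only: power2_eq_square power3_eq_cube) (simp only: algebra_simps)
    then show ?thesis using t by (simp only: mult_le_cancel_left_pos zero_less_power)
  qed
  then have ev: "\<forall>\<^sub>F t in at_right 0. D \<le> 2 * C * t" by (auto simp: eventually_at_filter)
  have "((\<lambda>t. 2 * C * t) \<longlongrightarrow> 2 * C * 0) (at_right 0)" by (intro tendsto_intros)
  from tendsto_lowerbound[OF this ev] have "D \<le> 0" by simp
  then show "partial b' (partial b f) x = partial b (partial b' f) x" by (simp add: D_def)
qed

section \<open>Slices of functions on a product and differentiation under a distribution\<close>

lemma basis_map_Pair0: "basis_map (\<lambda>y. (0, y))" "basis_map (\<lambda>x. (x, 0))"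
  by (auto simp: basis_map_def Basis_prod_def intro!: bounded_linear_intros)

lemma Pair_Basis [simp]: "b \<in> Basis \<Longrightarrow> (b, 0) \<in> Basis" "b \<in> Basis \<Longrightarrow> (0, b) \<in> Basis"
  by (auto simp: Basis_prod_def)

context
  fixes f :: "'a::euclidean_space \<times> 'b::euclidean_space \<Rightarrow> complex"
  assumes f: "smooth f"
begin

lemma smooth_slice: "smooth (\<lambda>y. f (x, y))"
proof -
  have "smooth (\<lambda>y. f ((0, y) + (x, 0)))"
    using basis_map_Pair0 f by (intro smooth_affine) (auto simp: basis_map_def)
  then show ?thesis by simp
qed

lemma partial_slice: "b \<in> Basis \<Longrightarrow> partial b (\<lambda>y. f (x, y)) = (\<lambda>y. partial (0, b) f (x, y))"
  using partial_basis_map[OF basis_map_Pair0(1), of f b "(x, 0)"] f by (auto simp: smooth_differentiable zero_prod_def)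

lemma ck_bounded_slice: "0 \<le> c \<Longrightarrow> ck_bounded m UNIV c f \<Longrightarrow> ck_bounded m UNIV c (\<lambda>y. f (x, y))"
  using ck_bounded_basis_map[OF basis_map_Pair0(1) _ f, of c UNIV "(x, 0)" UNIV] by simp

end

lemma supp_fun_slice:
  assumes "f \<in> test_functions"
  shows "supp_fun (\<lambda>y. f (x, y)) \<subseteq> snd ` supp_fun f"
proof (rule supp_fun_subset)
  show "closed (snd ` supp_fun f)"
    using test_functions_compact[OF assms] by (intro compact_imp_closed compact_continuous_image continuous_intros)
  fix y assume "y \<notin> snd ` supp_fun f"
  then have "(x, y) \<notin> supp_fun f" by force
  then show "f (x, y) = 0" by (rule not_in_supp_fun)
qed

lemma test_functions_slice:
  assumes "f \<in> test_functions"
  shows "(\<lambda>y. f (x, y)) \<in> test_functions"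
  using assms by (intro test_functionsI[OF smooth_slice supp_fun_slice])
     (auto intro!: compact_continuous_image continuous_intros simp: test_functions_def)

text \<open>The first-order Taylor remainder in \<open>x\<close>, regarded as a function of
  \<open>y\<close>: \<open>v\<close> applied to it is the error made in differentiating the pairing
  of \<open>v\<close> with the slices of \<open>f\<close>.\<close>

definition slice_remainder :: "('a::euclidean_space \<times> 'b::euclidean_space \<Rightarrow> complex) \<Rightarrow> 'a \<Rightarrow> 'a \<Rightarrow> 'b \<Rightarrow> complex" where
  "slice_remainder f x h = (\<lambda>y. f (x + h, y) - f (x, y) - (\<Sum>b\<in>Basis. of_real (h \<bullet> b) * partial (b, 0) f (x, y)))"

lemma slice_remainder_test_functions:
  assumes f: "f \<in> test_functions"
  shows "slice_remainder f x h \<in> test_functions" "supp_fun (slice_remainder f x h) \<subseteq> snd ` supp_fun f"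
proof -
  show "slice_remainder f x h \<in> test_functions"
    unfolding slice_remainder_def
    by (intro test_functions_diff test_functions_sum test_functions_cmult test_functions_slice f
      test_functions_partial Pair_Basis)
  show "supp_fun (slice_remainder f x h) \<subseteq> snd ` supp_fun f"
  proof (rule supp_fun_subset)
    show "closed (snd ` supp_fun f)"
      using test_functions_compact[OF f] by (intro compact_imp_closed compact_continuous_image continuous_intros)
    fix y assume y: "y \<notin> snd ` supp_fun f"
    have 1: "(z, y) \<notin> supp_fun f" for z using y by force
    then have "(z, y) \<notin> supp_fun (partial (b, 0) f)" for z b using supp_fun_partial by blast
    then show "slice_remainder f x h y = 0" using 1 by (simp add: slice_remainder_def not_in_supp_fun)
  qed
qed

text \<open>Symmetry of second derivatives lets a derivative in \<open>y\<close> pass the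
  first-order term in \<open>x\<close>. Bounds of all orders on the remainder thereby reduce to
  order 0.\<close>

lemma partial_slice_remainder:
  assumes f: "f \<in> test_functions" and b: "b \<in> Basis"
  shows "partial b (slice_remainder f x h) = slice_remainder (partial (0, b) f) x h"
proof -
  have sm: "smooth f" "\<And>i. i \<in> Basis \<Longrightarrow> smooth (partial i f)"
    using f by (auto simp: test_functions_smooth smooth_partial)
  have sum: "partial b (\<lambda>y. \<Sum>i\<in>I. of_real (h \<bullet> i) * partial (i, 0) f (x, y))
      = (\<lambda>y. \<Sum>i\<in>I. of_real (h \<bullet> i) * partial (0, b) (partial (i, 0) f) (x, y))" if "finite I" "I \<subseteq> Basis" for I
    using that
  proof (induction I rule: finite_induct)
    case (insert i I)
    then have "smooth (\<lambda>y. partial (i, 0) f (x, y))" "smooth (\<lambda>y. \<Sum>i\<in>I. of_real (h \<bullet> i) * partial (i, 0) f (x, y))"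
      by (auto intro!: smooth_slice sm smooth_sum smooth_cmult)
    then show ?case using insert b sm
      by (simp add: partial_add partial_cmult smooth_differentiable smooth_cmult partial_slice)
  qed auto
  have "partial b (slice_remainder f x h) = (\<lambda>y. partial (0, b) f (x + h, y) - partial (0, b) f (x, y)
     - (\<Sum>i\<in>Basis. of_real (h \<bullet> i) * partial (0, b) (partial (i, 0) f) (x, y)))"
    unfolding slice_remainder_def
    using sm b by (simp add: partial_diff smooth_diff smooth_slice smooth_sum smooth_cmult sum partial_slice)
  also have "\<dots> = slice_remainder (partial (0, b) f) x h"
    unfolding slice_remainder_def
    using b f by (intro ext arg_cong2[of _ _ _ _ "(-)"] refl sum.cong) (auto simp: partial_commute)
  finally show ?thesis .
qed

lemma slice_remainder_bound:
  fixes f :: "'a::euclidean_space \<times> 'b::euclidean_space \<Rightarrow> complex"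
  shows "f \<in> test_functions \<Longrightarrow> \<exists>C. \<forall>x h. ck_bounded m UNIV (C * norm h ^ 2) (slice_remainder f x h)"
proof (induction m arbitrary: f)
  case (0 f)
  obtain M where M: "ck_bounded 2 UNIV M f" using test_function_ck_bounded[OF 0] by blast
  have "cmod (slice_remainder f x h y) \<le> (DIM('a \<times> 'b) * (DIM('a \<times> 'b) * M)) * norm h ^ 2" for x h y
  proof -
    have "(\<Sum>b\<in>Basis. of_real ((h, 0::'b) \<bullet> b) * partial b f (x, y)) =
      (\<Sum>b\<in>Basis. of_real (h \<bullet> b) * partial (b, 0) f (x, y))"
      by (simp add: Basis_prod_def sum.union_disjoint sum.reindex inj_on_def image_iff disjoint_iff)
    then show ?thesis
      using smooth_taylor2[OF test_functions_smooth[OF 0] M, of "(x, y)" "(h, 0)"]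
      by (simp add: slice_remainder_def norm_Pair)
  qed
  then show ?case by auto
next
  case (Suc m f)
  obtain C0 where C0: "\<And>x h. ck_bounded m UNIV (C0 * norm h ^ 2) (slice_remainder f x h)" using Suc.IH[OF Suc.prems]
    by blast
  have "\<forall>b\<in>Basis. \<exists>C. \<forall>x h. ck_bounded m UNIV (C * norm h ^ 2) (slice_remainder (partial (0, b) f) x h)"
    using Suc.IH test_functions_partial[OF Suc.prems] by simp
  from bchoice[OF this] obtain C where C: "\<And>b x h. b \<in> Basis \<Longrightarrow>
    ck_bounded m UNIV (C b * norm h ^ 2) (slice_remainder (partial (0, b) f) x h)"
    by auto
  define D where "D = Max (insert C0 (C ` Basis))"
  have D: "C0 \<le> D" "\<And>b. b \<in> Basis \<Longrightarrow> C b \<le> D" unfolding D_def by (rule Max_ge; simp)+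
  have "ck_bounded (Suc m) UNIV (D * norm h ^ 2) (slice_remainder f x h)" for x h
  proof -
    have "ck_bounded m UNIV (D * norm h ^ 2) (slice_remainder f x h)"
      by (rule ck_bounded_mono[OF C0[of h x]]) (auto intro: mult_right_mono D)
    moreover have "ck_bounded m UNIV (D * norm h ^ 2) (slice_remainder (partial (0, b) f) x h)" if "b \<in> Basis" for b
      using C[OF that, of h x] mult_right_mono[OF D(2)[OF that], of "norm h ^ 2"]
      by (auto intro: ck_bounded_mono)
    ultimately show ?thesis using Suc.prems by (auto simp: partial_slice_remainder intro: ck_bounded_0D)
  qed
  then show ?case by blast
qed

text \<open>A distribution has finite order \<open>m\<close> on the compact projection of the
  support, and the remainder is of size \<open>norm h ^ 2\<close> together with its derivatives up
  to order \<open>m\<close>.\<close>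

lemma pairing_has_derivative:
  fixes f :: "'a::euclidean_space \<times> 'b::euclidean_space \<Rightarrow> complex"
  assumes v: "v \<in> distributions" and f: "f \<in> test_functions"
  shows "((\<lambda>x. v (\<lambda>y. f (x, y))) has_derivative (\<lambda>h. \<Sum>b\<in>Basis. of_real (h \<bullet> b) * v (\<lambda>y. partial (b, 0) f (x, y))))
    (at x)"
  unfolding has_derivative_at
proof
  let ?D = "\<lambda>h. \<Sum>b\<in>Basis. of_real (h \<bullet> b) * v (\<lambda>y. partial (b, 0) f (x, y))"
  show "bounded_linear ?D"
    by (intro bounded_linear_sum bounded_linear_mult_const bounded_linear_compose[OF bounded_linear_of_real]
      bounded_linear_inner_left)
  have K: "compact (snd ` supp_fun f)"
    using test_functions_compact[OF f] by (intro compact_continuous_image continuous_intros)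
  obtain m C where mC: "0 \<le> C" "dist_bound v (snd ` supp_fun f) m C"
    by (rule distribution_dist_bound[OF v K])
  obtain D where D: "\<And>x h. ck_bounded m UNIV (D * norm h ^ 2) (slice_remainder f x h)"
    using slice_remainder_bound[OF f] by blast
  have lin: "test_functional v" using v by (rule distributions_test_functional)
  have "v (slice_remainder f x h) = v (\<lambda>y. f (x + h, y)) - v (\<lambda>y. f (x, y)) - ?D h" for h
    unfolding slice_remainder_def
    by (simp add: test_functional_diff[OF lin] test_functional_sum[OF lin] test_functional_cmult[OF lin]
        test_functions_diff test_functions_slice f test_functions_sum test_functions_cmult test_functions_partial)
  then have bd: "norm (v (\<lambda>y. f (x + h, y)) - v (\<lambda>y. f (x, y)) - ?D h) \<le> C * (D * norm h ^ 2)" for h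
    using dist_boundD[OF mC(2) slice_remainder_test_functions[OF f] D] by metis
  show "(\<lambda>h. norm (v (\<lambda>y. f (x + h, y)) - v (\<lambda>y. f (x, y)) - ?D h) / norm h) \<midarrow>0\<rightarrow> 0"
  proof (rule tendsto_sandwich[of "\<lambda>_. 0" _ _ "\<lambda>h. C * D * norm h"])
    show "\<forall>\<^sub>F h in at 0. norm (v (\<lambda>y. f (x + h, y)) - v (\<lambda>y. f (x, y)) - ?D h) / norm h \<le> C * D * norm h"
      using bd by (intro always_eventually allI) (auto simp: divide_le_eq power2_eq_square mult_ac)
    show "((\<lambda>h. C * D * norm h) \<longlongrightarrow> 0) (at 0)"
      by (auto intro!: tendsto_eq_intros)
  qed auto
qed

lemma partial_pairing:
  fixes f :: "'a::euclidean_space \<times> 'b::euclidean_space \<Rightarrow> complex"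
  assumes v: "v \<in> distributions" and f: "f \<in> test_functions" and b: "b \<in> Basis"
  shows "partial b (\<lambda>x. v (\<lambda>y. f (x, y))) = (\<lambda>x. v (\<lambda>y. partial (b, 0) f (x, y)))"
proof
  fix x
  have "(\<Sum>i\<in>Basis. of_real (b \<bullet> i) * v (\<lambda>y. partial (i, 0) f (x, y))) =
    (\<Sum>i\<in>Basis. if i = b then v (\<lambda>y. partial (i, 0) f (x, y)) else 0)"
    using b by (intro sum.cong) (auto simp: inner_Basis)
  then show "partial b (\<lambda>x. v (\<lambda>y. f (x, y))) x = v (\<lambda>y. partial (b, 0) f (x, y))"
    using partial_eqI[OF pairing_has_derivative[OF v f], of b x] b by simp
qed

lemma cdiff_pairing:
  fixes f :: "'a::euclidean_space \<times> 'b::euclidean_space \<Rightarrow> complex"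
  assumes v: "v \<in> distributions"
  shows "f \<in> test_functions \<Longrightarrow> cdiff n (\<lambda>x. v (\<lambda>y. f (x, y)))"
proof (induction n arbitrary: f)
  case 0
  then show ?case using pairing_has_derivative[OF v] by (auto intro: differentiableI)
next
  case (Suc n)
  have "(\<lambda>x. v (\<lambda>y. f (x, y))) differentiable (at x)" for x
    using pairing_has_derivative[OF v Suc.prems] by (rule differentiableI)
  moreover have "cdiff n (partial b (\<lambda>x. v (\<lambda>y. f (x, y))))" if "b \<in> Basis" for b
    unfolding partial_pairing[OF v Suc.prems that] using Suc.prems that by (intro Suc.IH test_functions_partial) auto
  ultimately show ?case by simp
qed

lemma test_functions_pairing:
  fixes f :: "'a::euclidean_space \<times> 'b::euclidean_space \<Rightarrow> complex"
  assumes v: "v \<in> distributions" and f: "f \<in> test_functions"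
  shows "(\<lambda>x. v (\<lambda>y. f (x, y))) \<in> test_functions" "supp_fun (\<lambda>x. v (\<lambda>y. f (x, y))) \<subseteq> fst ` supp_fun f"
proof -
  have K: "compact (fst ` supp_fun f)"
    using test_functions_compact[OF f] by (intro compact_continuous_image continuous_intros)
  show s: "supp_fun (\<lambda>x. v (\<lambda>y. f (x, y))) \<subseteq> fst ` supp_fun f"
  proof (rule supp_fun_subset)
    fix x assume "x \<notin> fst ` supp_fun f"
    then have "(x, y) \<notin> supp_fun f" for y by force
    then show "v (\<lambda>y. f (x, y)) = 0"
      using test_functional_zero[OF distributions_test_functional[OF v]] by (simp add: not_in_supp_fun)
  qed (use K in \<open>rule compact_imp_closed\<close>)
  show "(\<lambda>x. v (\<lambda>y. f (x, y))) \<in> test_functions"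
    by (rule test_functionsI[OF _ s K]) (simp add: smooth_iff_cdiff cdiff_pairing[OF v f])
qed

text \<open>The \<open>m\<close> derivatives in \<open>x\<close> pass to \<open>f\<close>, and
  \<open>v\<close>, of order \<open>m'\<close>, spends \<open>m'\<close> further derivatives in
  \<open>y\<close>.\<close>

lemma ck_bounded_pairing:
  fixes f :: "'a::euclidean_space \<times> 'b::euclidean_space \<Rightarrow> complex"
  assumes v: "v \<in> distributions" and C: "dist_bound v K m' C" and c: "0 \<le> c"
  shows "f \<in> test_functions \<Longrightarrow> snd ` supp_fun f \<subseteq> K \<Longrightarrow> ck_bounded (m + m') UNIV c f \<Longrightarrow>
    ck_bounded m UNIV (C * c) (\<lambda>x. v (\<lambda>y. f (x, y)))"
proof (induction m arbitrary: f)
  have *: "cmod (v (\<lambda>y. f (x, y))) \<le> C * c"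
    if "f \<in> test_functions" "snd ` supp_fun f \<subseteq> K" "ck_bounded m' UNIV c f" for f and x :: 'a
    using that supp_fun_slice[OF that(1), of x] c
    by (intro dist_boundD[OF C] test_functions_slice ck_bounded_slice test_functions_smooth) auto
  {
    case 0
    then show ?case using * by simp
  next
    case (Suc m)
    have "ck_bounded m' UNIV c f" by (rule ck_bounded_mono[OF Suc.prems(3)]) auto
    moreover have "ck_bounded m UNIV (C * c) (\<lambda>x. v (\<lambda>y. partial (b, 0) f (x, y)))" if "b \<in> Basis" for b
      using Suc.prems that supp_fun_partial[of "(b, 0)" f]
      by (intro Suc.IH test_functions_partial) auto
    ultimately show ?case using * Suc.prems by (simp add: partial_pairing[OF v])
  }
qed

section \<open>The convolution of distributions\<close>

definition proper_add :: "'a::euclidean_space set \<Rightarrow> 'a set \<Rightarrow> bool" where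
  "proper_add X1 X2 \<longleftrightarrow> closed X1 \<and> closed X2 \<and> proper_map (top_of_set (X1 \<times> X2)) euclidean (\<lambda>(x, y). x + y)"

definition add_preimage :: "'a::euclidean_space set \<Rightarrow> 'a set \<Rightarrow> 'a set \<Rightarrow> ('a \<times> 'a) set" where
  "add_preimage X1 X2 K = {(x, y). x \<in> X1 \<and> y \<in> X2 \<and> x + y \<in> K}"

lemma compact_add_preimage:
  assumes "proper_add X1 X2" "compact K"
  shows "compact (add_preimage X1 X2 K)"
proof -
  have "compactin (top_of_set (X1 \<times> X2)) {z \<in> topspace (top_of_set (X1 \<times> X2)). (\<lambda>(x, y). x + y) z \<in> K}"
    using assms by (intro compactin_proper_map_preimage[of _ euclidean]) (auto simp: proper_add_def)
  also have "{z \<in> topspace (top_of_set (X1 \<times> X2)). (\<lambda>(x, y). x + y) z \<in> K} = add_preimage X1 X2 K"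
    by (auto simp: add_preimage_def)
  finally show ?thesis by (simp add: compactin_subtopology)
qed

text \<open>Proper maps are closed. This is the use of properness besides compact preimages: it
  serves for the support of the convolution and for its wave front set.\<close>

lemma closed_add_image:
  assumes "proper_add X1 X2" "closed C" "C \<subseteq> X1 \<times> X2"
  shows "closed ((\<lambda>(x, y). x + y) ` C)"
proof -
  have "closedin (top_of_set (X1 \<times> X2)) C" using assms(2,3) by (simp add: closed_subset)
  then show ?thesis
    using assms(1) unfolding proper_add_def proper_map_def closed_map_def by auto
qed

lemma basis_map_add: "basis_map (\<lambda>z. fst z + snd z)"
  by (auto simp: basis_map_def Basis_prod_def intro!: bounded_linear_intros)

lemma smooth_add_comp: "smooth \<phi> \<Longrightarrow> smooth (\<lambda>(x, y). \<phi> (x + y))"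
  using smooth_linear[OF conjunct1[OF basis_map_add[unfolded basis_map_def]]] by (simp add: case_prod_unfold)

lemma ck_bounded_add_comp: "smooth \<phi> \<Longrightarrow> 0 \<le> c \<Longrightarrow> ck_bounded m UNIV c \<phi> \<Longrightarrow> ck_bounded m UNIV c (\<lambda>(x, y). \<phi> (x + y))"
  using ck_bounded_basis_map[OF basis_map_add, of c \<phi> UNIV 0 UNIV m] by (simp add: case_prod_unfold)

lemma supp_fun_add_comp:
  fixes \<phi> :: "'a::euclidean_space \<Rightarrow> complex"
  shows "supp_fun (\<lambda>(x, y). \<phi> (x + y)) \<subseteq> {(x, y). x + y \<in> supp_fun \<phi>}"
proof (rule supp_fun_subset)
  have "continuous_on UNIV (\<lambda>z::'a \<times> 'a. fst z + snd z)" by (intro continuous_intros)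
  then have "closed ((\<lambda>z::'a \<times> 'a. fst z + snd z) -` supp_fun \<phi>)" by (rule closed_vimage[OF supp_fun_closed])
  then show "closed {(x, y). x + y \<in> supp_fun \<phi>}" by (simp add: vimage_def case_prod_unfold)
qed (auto simp: not_in_supp_fun)

section \<open>Tensor products and pairings with smooth functions\<close>

lemma tensor_functional:
  assumes u: "test_functional u" and v: "v \<in> distributions"
  shows "test_functional (tensor u v)"
proof -
  note lin = distributions_test_functional[OF v]
  show ?thesis
    unfolding test_functional_def
  proof (intro conjI ballI allI)
    fix f g :: "'a \<times> 'b \<Rightarrow> complex" assume fg: "f \<in> test_functions" "g \<in> test_functions"
    show "tensor u v (\<lambda>x. f x + g x) = tensor u v f + tensor u v g"
      using fg by (simp add: tensor_def test_functions_add test_functional_add[OF lin] test_functions_slice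
          test_functional_add[OF u] test_functions_pairing[OF v])
  next
    fix c and f :: "'a \<times> 'b \<Rightarrow> complex" assume "f \<in> test_functions"
    then show "tensor u v (\<lambda>x. c * f x) = c * tensor u v f"
      by (simp add: tensor_def test_functions_cmult test_functional_cmult[OF lin] test_functions_slice
          test_functional_cmult[OF u] test_functions_pairing[OF v])
  qed (simp add: tensor_def)
qed

text \<open>\<open>P\<close> collects the \<open>x\<close> over which the support of
  \<open>f\<close> meets \<open>X2\<close>. For other \<open>x\<close> the slice misses the support
  of \<open>v\<close>, so the inner pairing is a test function supported in \<open>P\<close>, and
  \<open>P\<close> misses \<open>X1\<close>.\<close>

lemma tensor_off_support:
  fixes f :: "'a::euclidean_space \<times> 'b::euclidean_space \<Rightarrow> complex"
  assumes u: "u \<in> distributions" "supp_dist u \<subseteq> X1" and v: "v \<in> distributions" "supp_dist v \<subseteq> X2"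
    and X: "closed X1" "closed X2"
    and f: "f \<in> test_functions" "supp_fun f \<inter> X1 \<times> X2 = {}"
  shows "tensor u v f = 0"
proof -
  define P where "P = fst ` (supp_fun f \<inter> UNIV \<times> X2)"
  have P: "compact P"
    unfolding P_def using X test_functions_compact[OF f(1)]
    by (intro compact_continuous_image continuous_intros compact_Int_closed closed_Times) auto
  have "supp_fun (\<lambda>x. v (\<lambda>y. f (x, y))) \<subseteq> P"
  proof (rule supp_fun_subset)
    fix x assume x: "x \<notin> P"
    have "supp_fun (\<lambda>y. f (x, y)) \<subseteq> {y. (x, y) \<in> supp_fun f}"
    proof (rule supp_fun_subset)
      have "continuous_on UNIV (\<lambda>y::'b. (x, y))" by (intro continuous_intros)
      then have "closed ((\<lambda>y. (x, y)) -` supp_fun f)" by (rule closed_vimage[OF supp_fun_closed])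
      then show "closed {y. (x, y) \<in> supp_fun f}" by (simp add: vimage_def)
    qed (auto simp: not_in_supp_fun)
    moreover have "{y. (x, y) \<in> supp_fun f} \<inter> X2 = {}" using x by (force simp: P_def)
    ultimately have "supp_fun (\<lambda>y. f (x, y)) \<inter> supp_dist v = {}" using v(2) by blast
    then show "v (\<lambda>y. f (x, y)) = 0"
      by (rule test_functional_off_support[OF distributions_test_functional[OF v(1)] test_functions_slice[OF f(1)]])
  qed (use P compact_imp_closed in blast)
  moreover have "P \<inter> X1 = {}" using f(2) by (auto simp: P_def)
  ultimately have "supp_fun (\<lambda>x. v (\<lambda>y. f (x, y))) \<inter> supp_dist u = {}" using u(2) by blast
  then have "u (\<lambda>x. v (\<lambda>y. f (x, y))) = 0"
    by (rule test_functional_off_support[OF distributions_test_functional[OF u(1)] test_functions_pairing(1)[OF v(1)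
      f(1)]])
  then show ?thesis using f(1) by (simp add: tensor_def)
qed

lemma supp_dist_tensor:
  assumes "u \<in> distributions" "supp_dist u \<subseteq> X1" "v \<in> distributions" "supp_dist v \<subseteq> X2" "closed X1" "closed X2"
  shows "supp_dist (tensor u v) \<subseteq> X1 \<times> X2"
proof -
  have "open (- (X1 \<times> X2))" using assms by (intro open_Compl closed_Times)
  moreover have "\<forall>f\<in>test_functions. supp_fun f \<subseteq> - (X1 \<times> X2) \<longrightarrow> tensor u v f = 0"
    using tensor_off_support[OF assms] by blast
  ultimately show ?thesis unfolding supp_dist_def by blast
qed

text \<open>The cutoff chosen by \<open>SOME\<close> and \<open>\<theta>\<close> both equal 1 near
  \<open>supp_dist u \<inter> supp_fun f\<close>, so their products with \<open>f\<close> differ by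
  a test function whose support misses \<open>supp_dist u\<close>. The given \<open>\<theta>\<close>
  also shows that the choice is not void.\<close>

lemma dist_pairing_eq:
  assumes u: "test_functional u" and f: "smooth f" and K: "compact K" "supp_dist u \<inter> supp_fun f \<subseteq> K"
    and \<theta>: "\<theta> \<in> test_functions" "open U" "K \<subseteq> U" "\<And>x. x \<in> U \<Longrightarrow> \<theta> x = 1"
  shows "dist_pairing u f = u (\<lambda>x. \<theta> x * f x)"
proof -
  let ?P = "\<lambda>\<theta>. \<theta> \<in> test_functions \<and> (\<exists>U. open U \<and> supp_dist u \<inter> supp_fun f \<subseteq> U \<and> (\<forall>x\<in>U. \<theta> x = 1))"
  define \<eta> where "\<eta> = (SOME \<theta>. ?P \<theta>)"
  have "?P \<theta>" using \<theta> K by (intro conjI exI[of _ U]) auto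
  then have "?P \<eta>" unfolding \<eta>_def by (rule someI[of ?P])
  then obtain V where \<eta>: "\<eta> \<in> test_functions" "open V" "supp_dist u \<inter> supp_fun f \<subseteq> V" "\<forall>x\<in>V. \<eta> x = 1" by auto
  have t: "(\<lambda>x. \<eta> x * f x) \<in> test_functions" "(\<lambda>x. \<theta> x * f x) \<in> test_functions"
    using \<eta> \<theta> f by (auto intro: test_functions_mult)
  have "supp_fun (\<lambda>x. \<eta> x * f x - \<theta> x * f x) \<subseteq> supp_fun f \<inter> - (U \<inter> V)"
    by (rule supp_fun_subset) (use \<eta> \<theta> in \<open>auto intro!: closed_Int simp: not_in_supp_fun\<close>)
  moreover have "supp_dist u \<inter> supp_fun f \<subseteq> U \<inter> V" using K(2) \<theta> \<eta> by blast
  ultimately have "supp_fun (\<lambda>x. \<eta> x * f x - \<theta> x * f x) \<inter> supp_dist u = {}" by blast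
  then have "u (\<lambda>x. \<eta> x * f x - \<theta> x * f x) = 0"
    by (rule test_functional_off_support[OF u test_functions_diff[OF t]])
  then show ?thesis
    using t by (simp add: dist_pairing_def \<eta>_def[symmetric] Let_def test_functional_diff[OF u])
qed

section \<open>Convolution as an iterated pairing with one cutoff\<close>

definition dist_on :: "'a::euclidean_space set \<Rightarrow> (('a \<Rightarrow> complex) \<Rightarrow> complex) set" where
  "dist_on X = {u \<in> distributions. supp_dist u \<subseteq> X}"

lemma convolution_eq:
  assumes X: "proper_add X1 X2" and u: "u \<in> dist_on X1" and v: "v \<in> dist_on X2" and \<phi>: "\<phi> \<in> test_functions"
    and K: "supp_fun \<phi> \<subseteq> K" "compact K"
    and \<theta>: "\<theta> \<in> test_functions" "open U" "add_preimage X1 X2 K \<subseteq> U" "\<And>x. x \<in> U \<Longrightarrow> \<theta> x = 1"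
  shows "convolution u v \<phi> = u (\<lambda>x. v (\<lambda>y. \<theta> (x, y) * \<phi> (x + y)))"
proof -
  have X': "closed X1" "closed X2" using X by (auto simp: proper_add_def)
  have uv: "u \<in> distributions" "supp_dist u \<subseteq> X1" "v \<in> distributions" "supp_dist v \<subseteq> X2"
    using u v by (auto simp: dist_on_def)
  have "dist_pairing (tensor u v) (\<lambda>(x, y). \<phi> (x + y)) = tensor u v (\<lambda>z. \<theta> z * (\<lambda>(x, y). \<phi> (x + y)) z)"
  proof (rule dist_pairing_eq)
    show "compact (add_preimage X1 X2 K)" by (rule compact_add_preimage[OF X K(2)])
    show "supp_dist (tensor u v) \<inter> supp_fun (\<lambda>(x, y). \<phi> (x + y)) \<subseteq> add_preimage X1 X2 K"
      using supp_dist_tensor[OF uv X'] supp_fun_add_comp[of \<phi>] K(1) by (fastforce simp: add_preimage_def)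
    show "test_functional (tensor u v)" by (intro tensor_functional distributions_test_functional uv)
    show "smooth (\<lambda>(x, y). \<phi> (x + y))" by (intro smooth_add_comp test_functions_smooth \<phi>)
  qed (use \<theta> in auto)
  moreover have "(\<lambda>z. \<theta> z * (\<lambda>(x, y). \<phi> (x + y)) z) \<in> test_functions"
    using \<theta>(1) \<phi> by (intro test_functions_mult smooth_add_comp test_functions_smooth)
  ultimately show ?thesis using \<phi> by (simp add: convolution_def tensor_def)
qed

text \<open>The cutoff depends on \<open>X1\<close>, \<open>X2\<close> and \<open>K\<close> alone.
  Its independence of \<open>u\<close>, \<open>v\<close> and \<open>\<phi>\<close> is what makes
  different convolutions comparable, in linearity as well as in uniform bounds.\<close>

lemma convolution_cutoff:
  assumes X: "proper_add X1 X2" and K: "compact K"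
  obtains \<theta> where "\<theta> \<in> test_functions"
    "\<And>u v \<phi>. u \<in> dist_on X1 \<Longrightarrow> v \<in> dist_on X2 \<Longrightarrow> \<phi> \<in> test_functions \<Longrightarrow> supp_fun \<phi> \<subseteq> K \<Longrightarrow>
      convolution u v \<phi> = u (\<lambda>x. v (\<lambda>y. \<theta> (x, y) * \<phi> (x + y)))"
proof -
  obtain \<theta> U where \<theta>: "\<theta> \<in> test_functions" "open U" "add_preimage X1 X2 K \<subseteq> U" "\<And>x. x \<in> U \<Longrightarrow> \<theta> x = 1"
    by (rule cutoff_compact[OF compact_add_preimage[OF X K] open_UNIV subset_UNIV]) (rule that)
  show thesis
    by (rule that[OF \<theta>(1)]) (rule convolution_eq[OF X _ _ _ _ K \<theta>])
qed

lemma test_functions_kernel: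
  "\<theta> \<in> test_functions \<Longrightarrow> \<phi> \<in> test_functions \<Longrightarrow> (\<lambda>z. \<theta> z * (\<lambda>(x, y). \<phi> (x + y)) z) \<in> test_functions"
  by (intro test_functions_mult smooth_add_comp test_functions_smooth)

lemma ck_bounded_kernel:
  fixes \<theta> :: "'a::euclidean_space \<times> 'a \<Rightarrow> complex"
  assumes "\<theta> \<in> test_functions"
  obtains D where "0 \<le> D" "\<And>\<phi> c. \<phi> \<in> test_functions \<Longrightarrow> ck_bounded m UNIV c \<phi> \<Longrightarrow>
    ck_bounded m UNIV (D * c) (\<lambda>z. \<theta> z * (\<lambda>(x, y). \<phi> (x + y)) z)"
proof -
  obtain d where d: "0 \<le> d" "ck_bounded m UNIV d \<theta>" using test_function_ck_bounded[OF assms] by blast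
  show thesis
  proof (rule that[of "2^m * d"])
    fix \<phi> :: "'a \<Rightarrow> complex" and c assume \<phi>: "\<phi> \<in> test_functions" "ck_bounded m UNIV c \<phi>"
    then have "0 \<le> c" using ck_bounded_0D by (meson UNIV_I norm_ge_zero order_trans)
    then show "ck_bounded m UNIV (2^m * d * c) (\<lambda>z. \<theta> z * (\<lambda>(x, y). \<phi> (x + y)) z)"
      using d \<phi> assms by (intro ck_bounded_mult ck_bounded_add_comp smooth_add_comp test_functions_smooth) auto
  qed (use d in auto)
qed

lemma supp_fun_kernel_pairing:
  assumes "v \<in> distributions" "\<theta> \<in> test_functions" "\<phi> \<in> test_functions"
  shows "supp_fun (\<lambda>x. v (\<lambda>y. \<theta> (x, y) * \<phi> (x + y))) \<subseteq> fst ` supp_fun \<theta>"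
  using test_functions_pairing(2)[OF assms(1) test_functions_kernel[OF assms(2,3)]]
    supp_fun_mult[of \<theta> "\<lambda>(x, y). \<phi> (x + y)"] by auto

lemma kernel_pairing_test_function:
  assumes "v \<in> distributions" "\<theta> \<in> test_functions" "\<phi> \<in> test_functions"
  shows "(\<lambda>x. v (\<lambda>y. \<theta> (x, y) * \<phi> (x + y))) \<in> test_functions"
  using test_functions_pairing(1)[OF assms(1) test_functions_kernel[OF assms(2,3)]] by simp

lemma kernel_pairing_bound:
  fixes \<theta> :: "'a::euclidean_space \<times> 'a \<Rightarrow> complex"
  assumes \<theta>: "\<theta> \<in> test_functions"
  obtains D where "0 \<le> D" "\<And>v \<phi> c C. v \<in> distributions \<Longrightarrow> dist_bound v (snd ` supp_fun \<theta>) m' C \<Longrightarrow>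
    \<phi> \<in> test_functions \<Longrightarrow> ck_bounded (m + m') UNIV c \<phi> \<Longrightarrow>
    ck_bounded m UNIV (C * (D * c)) (\<lambda>x. v (\<lambda>y. \<theta> (x, y) * \<phi> (x + y)))"
proof -
  obtain D where D: "0 \<le> D" "\<And>\<phi> c. \<phi> \<in> test_functions \<Longrightarrow> ck_bounded (m + m') UNIV c \<phi> \<Longrightarrow>
    ck_bounded (m + m') UNIV (D * c) (\<lambda>z. \<theta> z * (\<lambda>(x, y). \<phi> (x + y)) z)"
    by (rule ck_bounded_kernel[OF \<theta>]) (rule that)
  show thesis
  proof (rule that[OF D(1)])
    fix v and \<phi> :: "'a \<Rightarrow> complex" and c C
    assume *: "v \<in> distributions" "dist_bound v (snd ` supp_fun \<theta>) m' C" "\<phi> \<in> test_functions"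
      "ck_bounded (m + m') UNIV c \<phi>"
    have "0 \<le> c" using ck_bounded_0D[OF *(4)] by (meson UNIV_I norm_ge_zero order_trans)
    then have "ck_bounded m UNIV (C * (D * c)) (\<lambda>x. v (\<lambda>y. (\<lambda>z. \<theta> z * (\<lambda>(x, y). \<phi> (x + y)) z) (x, y)))"
      using * D supp_fun_mult[of \<theta> "\<lambda>(x, y). \<phi> (x + y)"] \<theta>
      by (intro ck_bounded_pairing test_functions_kernel) auto
    then show "ck_bounded m UNIV (C * (D * c)) (\<lambda>x. v (\<lambda>y. \<theta> (x, y) * \<phi> (x + y)))" by simp
  qed
qed

lemma convolution_distribution:
  assumes X: "proper_add X1 X2" and u: "u \<in> dist_on X1" and v: "v \<in> dist_on X2"
  shows "convolution u v \<in> distributions"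
proof (rule distributionsI)
  have ud: "u \<in> distributions" and vd: "v \<in> distributions" using u v by (auto simp: dist_on_def)
  note ul = distributions_test_functional[OF ud] and vl = distributions_test_functional[OF vd]
  show "test_functional (convolution u v)"
    unfolding test_functional_def
  proof (intro conjI ballI allI)
    fix \<phi> \<psi> :: "'a \<Rightarrow> complex" assume \<phi>: "\<phi> \<in> test_functions" and \<psi>: "\<psi> \<in> test_functions"
    \<comment> \<open>A common cutoff for \<open>\<phi>\<close>, \<open>\<psi>\<close> and their sum
      requires a compact set that contains both supports.\<close>
    have K: "compact (supp_fun \<phi> \<union> supp_fun \<psi>)" using \<phi> \<psi> by (auto simp: test_functions_def)
    obtain \<theta> where \<theta>: "\<theta> \<in> test_functions"
      "\<And>u v \<phi>'. u \<in> dist_on X1 \<Longrightarrow> v \<in> dist_on X2 \<Longrightarrow> \<phi>' \<in> test_functions \<Longrightarrow> supp_fun \<phi>' \<subseteq> supp_fun \<phi> \<union> supp_fun \<psi> \<Longrightarrow>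
        convolution u v \<phi>' = u (\<lambda>x. v (\<lambda>y. \<theta> (x, y) * \<phi>' (x + y)))"
      by (rule convolution_cutoff[OF X K]) (rule that)
    have "v (\<lambda>y. \<theta> (x, y) * (\<phi> (x + y) + \<psi> (x + y))) = v (\<lambda>y. \<theta> (x, y) * \<phi> (x + y)) + v (\<lambda>y. \<theta> (x, y) * \<psi> (x + y))"
      for x
      using test_functional_add[OF vl test_functions_slice[OF test_functions_kernel[OF \<theta>(1) \<phi>]]
        test_functions_slice[OF test_functions_kernel[OF \<theta>(1) \<psi>]], of x x]
      by (simp add: distrib_left)
    then show "convolution u v (\<lambda>x. \<phi> x + \<psi> x) = convolution u v \<phi> + convolution u v \<psi>"
      using test_functional_add[OF ul kernel_pairing_test_function[OF vd \<theta>(1) \<phi>] kernel_pairing_test_function[OF vd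
        \<theta>(1) \<psi>]]
      by (simp add: \<theta>(2) u v \<phi> \<psi> test_functions_add supp_fun_add)
  next
    fix c and \<phi> :: "'a \<Rightarrow> complex" assume \<phi>: "\<phi> \<in> test_functions"
    obtain \<theta> where \<theta>: "\<theta> \<in> test_functions"
      "\<And>u v \<phi>'. u \<in> dist_on X1 \<Longrightarrow> v \<in> dist_on X2 \<Longrightarrow> \<phi>' \<in> test_functions \<Longrightarrow> supp_fun \<phi>' \<subseteq> supp_fun \<phi> \<Longrightarrow>
        convolution u v \<phi>' = u (\<lambda>x. v (\<lambda>y. \<theta> (x, y) * \<phi>' (x + y)))"
      by (rule convolution_cutoff[OF X test_functions_compact[OF \<phi>]]) (rule that)
    have "v (\<lambda>y. \<theta> (x, y) * (c * \<phi> (x + y))) = c * v (\<lambda>y. \<theta> (x, y) * \<phi> (x + y))" for x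
      using test_functional_cmult[OF vl test_functions_slice[OF test_functions_kernel[OF \<theta>(1) \<phi>]], of c x]
      by (simp add: mult.left_commute)
    then show "convolution u v (\<lambda>x. c * \<phi> x) = c * convolution u v \<phi>"
      using test_functional_cmult[OF ul kernel_pairing_test_function[OF vd \<theta>(1) \<phi>], of c]
      by (simp add: \<theta>(2) u v \<phi> test_functions_cmult supp_fun_cmult)
  qed (simp add: convolution_def)
  fix K :: "'a set" assume K: "compact K"
  obtain \<theta> where \<theta>: "\<theta> \<in> test_functions"
    "\<And>u v \<phi>. u \<in> dist_on X1 \<Longrightarrow> v \<in> dist_on X2 \<Longrightarrow> \<phi> \<in> test_functions \<Longrightarrow> supp_fun \<phi> \<subseteq> K \<Longrightarrow>
      convolution u v \<phi> = u (\<lambda>x. v (\<lambda>y. \<theta> (x, y) * \<phi> (x + y)))"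
    by (rule convolution_cutoff[OF X K]) (rule that)
  have c: "compact (fst ` supp_fun \<theta>)" "compact (snd ` supp_fun \<theta>)"
    using test_functions_compact[OF \<theta>(1)] by (auto intro!: compact_continuous_image continuous_intros)
  obtain m C where mC: "0 \<le> C" "dist_bound u (fst ` supp_fun \<theta>) m C" by (rule distribution_dist_bound[OF ud c(1)])
  obtain m' C' where mC': "0 \<le> C'" "dist_bound v (snd ` supp_fun \<theta>) m' C'" by (rule distribution_dist_bound[OF vd c(2)])
  obtain D where D: "0 \<le> D" "\<And>v \<phi> c C. v \<in> distributions \<Longrightarrow> dist_bound v (snd ` supp_fun \<theta>) m' C \<Longrightarrow>
    \<phi> \<in> test_functions \<Longrightarrow> ck_bounded (m + m') UNIV c \<phi> \<Longrightarrow>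
    ck_bounded m UNIV (C * (D * c)) (\<lambda>x. v (\<lambda>y. \<theta> (x, y) * \<phi> (x + y)))"
    by (rule kernel_pairing_bound[OF \<theta>(1)]) (rule that)
  have "dist_bound (convolution u v) K (m + m') (C * C' * D)"
    unfolding dist_bound_def
  proof (intro ballI allI impI)
    fix \<phi> c assume \<phi>: "\<phi> \<in> test_functions" "supp_fun \<phi> \<subseteq> K" "ck_bounded (m + m') UNIV c \<phi>"
    have "cmod (u (\<lambda>x. v (\<lambda>y. \<theta> (x, y) * \<phi> (x + y)))) \<le> C * (C' * (D * c))"
      by (rule dist_boundD[OF mC(2) kernel_pairing_test_function[OF vd \<theta>(1) \<phi>(1)] supp_fun_kernel_pairing[OF vd \<theta>(1)
        \<phi>(1)] D(2)[OF vd mC'(2) \<phi>(1,3)]])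
    then show "cmod (convolution u v \<phi>) \<le> C * C' * D * c"
      using \<theta>(2)[OF u v \<phi>(1,2)] by (simp add: mult.assoc)
  qed
  then show "\<exists>m C. dist_bound (convolution u v) K m C" by blast
qed

lemma supp_dist_convolution:
  assumes X: "proper_add X1 X2" and u: "u \<in> dist_on X1" and v: "v \<in> dist_on X2"
  shows "supp_dist (convolution u v) \<subseteq> {x + y | x y. x \<in> X1 \<and> y \<in> X2}"
proof -
  let ?S = "{x + y | x y. x \<in> X1 \<and> y \<in> X2}"
  have "?S = (\<lambda>(x, y). x + y) ` (X1 \<times> X2)" by auto
  moreover have "closed ((\<lambda>(x, y). x + y) ` (X1 \<times> X2))"
    using X by (intro closed_add_image[OF X] closed_Times) (auto simp: proper_add_def)
  ultimately have op: "open (- ?S)" by (simp add: open_Compl)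
  have "convolution u v \<phi> = 0" if \<phi>: "\<phi> \<in> test_functions" "supp_fun \<phi> \<subseteq> - ?S" for \<phi>
  proof -
    have "add_preimage X1 X2 (supp_fun \<phi>) \<subseteq> {}" using \<phi>(2) by (auto simp: add_preimage_def)
    \<comment> \<open>With an empty preimage the zero function counts as a cutoff, with
      \<open>{}\<close> as the open set on which it equals 1.\<close>
    then have "convolution u v \<phi> = u (\<lambda>x. v (\<lambda>y. (\<lambda>_. 0) (x, y) * \<phi> (x + y)))"
      using \<phi> by (intro convolution_eq[OF X u v, of _ "supp_fun \<phi>" _ "{}"]) (auto simp: test_functions_compact)
    then show ?thesis
      using u v by (simp add: dist_on_def test_functional_zero distributions_test_functional)
  qed
  then show ?thesis using op unfolding supp_dist_def by blast
qed

section \<open>Waves and Fourier coefficients of test functions\<close>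

definition wave :: "'a::euclidean_space \<Rightarrow> 'a \<Rightarrow> complex" where
  "wave k x = exp (- \<i> * complex_of_real (k \<bullet> x))"

lemma wave_add: "wave (k + l) x = wave k x * wave l x"
  by (simp add: wave_def inner_add_left distrib_left exp_add[symmetric])

lemma wave_0 [simp]: "wave 0 x = 1"
  by (simp add: wave_def)

lemma wave_add_right: "wave k (x + y) = wave k x * wave k y"
  by (simp add: wave_def inner_add_right distrib_left exp_add[symmetric])

lemma wave_scaleR: "wave k (c *\<^sub>R x) = wave (c *\<^sub>R k) x"
  by (simp add: wave_def)

lemma wave_Pair: "wave (p, q) (x, y) = wave p x * wave q y"
  by (simp add: wave_def inner_prod_def distrib_left exp_add[symmetric])

lemma norm_wave [simp]: "cmod (wave k x) = 1"
  by (simp add: wave_def)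

lemma wave_has_derivative: "(wave k has_derivative (\<lambda>h. - \<i> * complex_of_real (k \<bullet> h) * wave k x)) (at x)"
proof -
  have "((\<lambda>x. - \<i> * complex_of_real (k \<bullet> x)) has_derivative (\<lambda>h. - \<i> * complex_of_real (k \<bullet> h))) (at x)"
    by (intro bounded_linear_imp_has_derivative bounded_linear_const_mult bounded_linear_compose[OF
      bounded_linear_of_real] bounded_linear_inner_right)
  from has_derivative_compose[OF this DERIV_exp[unfolded has_field_derivative_def]] show ?thesis
    unfolding wave_def[abs_def] by (simp only: mult.commute)
qed

lemma partial_wave: "partial b (wave k) = (\<lambda>x. (- \<i> * complex_of_real (k \<bullet> b)) * wave k x)"
  by (rule ext) (rule partial_eqI[OF wave_has_derivative])

lemma smooth_wave: "smooth (wave k)"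
proof -
  have "cdiff n (wave k)" for n
  proof (induction n)
    case 0
    then show ?case using wave_has_derivative by (auto intro: differentiableI)
  next
    case (Suc n)
    then have "cdiff n (partial b (wave k))" for b unfolding partial_wave by (intro cdiff_mult cdiff_const)
    then show ?case using wave_has_derivative by (auto intro: differentiableI)
  qed
  then show ?thesis by (simp add: smooth_iff_cdiff)
qed

lemma ck_bounded_wave: "ck_bounded m S ((1 + norm k) ^ m) (wave k)"
proof (induction m)
  case (Suc m)
  have "ck_bounded m S ((1 + norm k) ^ Suc m) (partial b (wave k))" if "b \<in> Basis" for b
  proof -
    have "cmod (- \<i> * complex_of_real (k \<bullet> b)) * (1 + norm k) ^ m \<le> (1 + norm k) * (1 + norm k) ^ m"
      using Basis_le_norm[OF that, of k] by (intro mult_right_mono) (auto simp: norm_mult)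
    then show ?thesis unfolding partial_wave
      by (intro ck_bounded_mono[OF ck_bounded_cmult[OF smooth_wave Suc.IH]]) auto
  qed
  then show ?case using one_le_power[of "1 + norm k" "Suc m"] by (simp del: power_Suc)
qed auto

section \<open>Fourier transforms of test functions\<close>

lemma test_function_integrable: "f \<in> test_functions \<Longrightarrow> integrable lborel f"
proof -
  assume f: "f \<in> test_functions"
  have "integrable lborel (\<lambda>x. indicator (supp_fun f) x *\<^sub>R f x)"
    using f by (intro borel_integrable_compact smooth_continuous_on) (auto simp: test_functions_def)
  moreover have "(\<lambda>x. indicator (supp_fun f) x *\<^sub>R f x) = f"
    by (auto simp: indicator_def not_in_supp_fun)
  ultimately show ?thesis by simp
qed

lemma lborel_integral_translate:
  fixes f :: "'a::euclidean_space \<Rightarrow> complex"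
  assumes "f \<in> borel_measurable borel"
  shows "(\<integral>x. f (a + x) \<partial>lborel) = (\<integral>x. f x \<partial>lborel)"
proof -
  have "(\<integral>x. f x \<partial>lborel) = (\<integral>x. f x \<partial>distr lborel borel ((+) a))" by (simp only: lborel_distr_plus)
  also have "\<dots> = (\<integral>x. f (a + x) \<partial>lborel)" using assms by (intro integral_distr) auto
  finally show ?thesis ..
qed

lemma smooth_borel_measurable: "smooth f \<Longrightarrow> f \<in> borel_measurable borel"
  by (intro borel_measurable_continuous_onI smooth_continuous_on)

text \<open>The difference quotients \<open>s n\<close> have integral zero by translation invariance
  and converge to the derivative. Dominated convergence stands in for the fundamental theorem of
  calculus along lines followed by Fubini's theorem.\<close>

lemma integral_partial_eq_0:
  fixes f :: "'a::euclidean_space \<Rightarrow> complex"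
  assumes f: "f \<in> test_functions" and b: "b \<in> Basis"
  shows "(\<integral>x. partial b f x \<partial>lborel) = 0"
proof -
  have sm: "smooth f" using f by (rule test_functions_smooth)
  obtain M where M: "ck_bounded 2 UNIV M f" "0 \<le> M" using test_function_ck_bounded[OF f] by blast
  obtain R where R: "\<And>x. x \<in> supp_fun f \<Longrightarrow> norm x \<le> R"
    using compact_imp_bounded[OF test_functions_compact[OF f]] by (auto simp: bounded_iff)
  define s where "s n x = of_nat (Suc n) * (f ((1 / real (Suc n)) *\<^sub>R b + x) - f x)" for n x
  define L where "L = DIM('a) * M"
  have meas: "f \<in> borel_measurable borel" by (rule smooth_borel_measurable[OF sm])
  have "(\<lambda>n. \<integral>x. s n x \<partial>lborel) \<longlonglongrightarrow> (\<integral>x. partial b f x \<partial>lborel)"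
  \<comment> \<open>The steps have length at most 1, so all quotients vanish outside the ball of
    radius \<open>R + 1\<close>; inside it they are bounded by the Lipschitz constant
    \<open>L\<close>.\<close>
  proof (rule integral_dominated_convergence[where w = "\<lambda>x. indicator (cball 0 (R + 1)) x *\<^sub>R L"])
    show "partial b f \<in> borel_measurable lborel"
      using smooth_borel_measurable[OF smooth_partial[OF sm b]] by simp
    show "s n \<in> borel_measurable lborel" for n
      unfolding s_def using meas by measurable
    show "integrable lborel (\<lambda>x. indicator (cball 0 (R + 1)) x *\<^sub>R L)"
      by (rule borel_integrable_compact) auto
    show "AE x in lborel. (\<lambda>n. s n x) \<longlonglongrightarrow> partial b f x"
    proof (rule AE_I2)
      fix x
      define C where "C = DIM('a) * (DIM('a) * M)"
      have bd: "norm (s n x - partial b f x) \<le> C * (1 / real (Suc n))" for n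
      proof -
        let ?t = "1 / real (Suc n)"
        have "cmod (f (x + ?t *\<^sub>R b) - f x - of_real ?t * partial b f x) \<le> C * ?t ^ 2"
          unfolding C_def by (rule smooth_taylor2_basis[OF sm M(1) b])
        then have "real (Suc n) * cmod (f (x + ?t *\<^sub>R b) - f x - of_real ?t * partial b f x) \<le>
          real (Suc n) * (C * ?t ^ 2)"
          by (intro mult_left_mono) auto
        also have "real (Suc n) * (C * ?t ^ 2) = C * ?t" by (simp add: power2_eq_square del: of_nat_Suc)
        also have "real (Suc n) * cmod (f (x + ?t *\<^sub>R b) - f x - of_real ?t * partial b f x)
          = cmod (of_nat (Suc n) * (f (x + ?t *\<^sub>R b) - f x - of_real ?t * partial b f x))"
          by (simp only: norm_mult norm_of_nat)
        also have "of_nat (Suc n) * (f (x + ?t *\<^sub>R b) - f x - of_real ?t * partial b f x) = s n x - partial b f x"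
        proof -
          have "of_nat (Suc n) * (complex_of_real ?t * partial b f x) = partial b f x"
            by (simp add: field_simps del: of_nat_Suc)
          then show ?thesis unfolding s_def by (simp only: right_diff_distrib add.commute[of x])
        qed
        finally show ?thesis .
      qed
      have "(\<lambda>n. C * (1 / real (Suc n))) \<longlonglongrightarrow> C * 0"
        by (intro tendsto_intros) (use LIMSEQ_inverse_real_of_nat in \<open>simp add: inverse_eq_divide\<close>)
      then have "(\<lambda>n. s n x - partial b f x) \<longlonglongrightarrow> 0"
        using Lim_null_comparison[OF always_eventually[OF allI[OF bd]]] by simp
      then show "(\<lambda>n. s n x) \<longlonglongrightarrow> partial b f x"
        by (rule LIM_zero_cancel)
    qed
    show "AE x in lborel. norm (s n x) \<le> indicator (cball 0 (R + 1)) x *\<^sub>R L" for n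
    proof (rule AE_I2)
      fix x
      let ?t = "1 / real (Suc n)"
      show "norm (s n x) \<le> indicator (cball 0 (R + 1)) x *\<^sub>R L"
      proof (cases "norm x \<le> R + 1")
        case True
        have "cmod (f (?t *\<^sub>R b + x) - f x) \<le> L * norm ((?t *\<^sub>R b + x) - x)"
          unfolding L_def by (rule smooth_lipschitz[OF sm ck_bounded_mono[OF M(1)]]) auto
        also have "\<dots> = L * ?t" using b by simp
        finally have "real (Suc n) * cmod (f (?t *\<^sub>R b + x) - f x) \<le> real (Suc n) * (L * ?t)"
          by (intro mult_left_mono) auto
        then have "norm (s n x) \<le> L" unfolding s_def norm_mult norm_of_nat by simp
        then show ?thesis using True by simp
      next
        case False
        have "norm x - norm (?t *\<^sub>R b) \<le> norm (?t *\<^sub>R b + x)" by (metis add.commute norm_diff_ineq)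
        moreover have "norm (?t *\<^sub>R b) \<le> 1" using b by simp
        ultimately have "norm (?t *\<^sub>R b + x) > R" using False by linarith
        then have "?t *\<^sub>R b + x \<notin> supp_fun f" "x \<notin> supp_fun f" using R False by fastforce+
        then show ?thesis using False by (simp add: s_def not_in_supp_fun)
      qed
    qed
  qed
  moreover have "(\<integral>x. s n x \<partial>lborel) = 0" for n
  proof -
    let ?a = "(1 / real (Suc n)) *\<^sub>R b"
    have i: "integrable lborel f" by (rule test_function_integrable[OF f])
    have "integrable lborel (\<lambda>x. f (?a + x))"
    proof -
      have "integrable (distr lborel borel ((+) ?a)) f" using i by (simp only: lborel_distr_plus)
      then show ?thesis using meas by (subst (asm) integrable_distr_eq) auto
    qed
    then show ?thesis unfolding s_def using i lborel_integral_translate[OF meas, of ?a] by simp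
  qed
  ultimately show ?thesis by (simp add: LIMSEQ_const_iff)
qed

definition fourier :: "('a::euclidean_space \<Rightarrow> complex) \<Rightarrow> 'a \<Rightarrow> complex" where
  "fourier g k = (\<integral>x. g x * wave k x \<partial>lborel)"

lemma fourier_partial:
  assumes g: "g \<in> test_functions" and b: "b \<in> Basis"
  shows "fourier (partial b g) k = \<i> * of_real (k \<bullet> b) * fourier g k"
proof -
  have t: "(\<lambda>x. g x * wave k x) \<in> test_functions" "(\<lambda>x. partial b g x * wave k x) \<in> test_functions"
    using g b by (auto intro!: test_functions_mult smooth_wave test_functions_partial)
  have "partial b (\<lambda>x. g x * wave k x) = (\<lambda>x. (- \<i> * of_real (k \<bullet> b)) * (g x * wave k x) + partial b g x * wave k x)"
    using smooth_differentiable[OF test_functions_smooth[OF g]] smooth_differentiable[OF smooth_wave]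
    by (subst partial_mult) (auto simp: partial_wave algebra_simps)
  then have "0 = (\<integral>x. (- \<i> * of_real (k \<bullet> b)) * (g x * wave k x) + partial b g x * wave k x \<partial>lborel)"
    using integral_partial_eq_0[OF t(1) b] by simp
  also have "\<dots> = (- \<i> * of_real (k \<bullet> b)) * fourier g k + fourier (partial b g) k"
    unfolding fourier_def using test_function_integrable[OF t(1)] test_function_integrable[OF t(2)] by simp
  finally show ?thesis by (simp add: algebra_simps add_eq_0_iff)
qed

lemma fourier_diff:
  assumes "f \<in> test_functions" "g \<in> test_functions"
  shows "fourier (\<lambda>x. f x - g x) k = fourier f k - fourier g k"
  unfolding fourier_def left_diff_distrib using assms
  by (intro Bochner_Integration.integral_diff test_function_integrable test_functions_mult smooth_wave)

text \<open>Subtracting the second derivative in direction \<open>b\<close> from a test function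
  yields a test function and multiplies the Fourier transform by
  \<open>1 + (k \<bullet> b)^2\<close>.\<close>

lemma fourier_decay_operator:
  assumes "finite I" "I \<subseteq> Basis" "g \<in> test_functions"
  shows "\<exists>g'\<in>test_functions. \<forall>k. fourier g' k = of_real (\<Prod>b\<in>I. 1 + (k \<bullet> b)^2) * fourier g k"
  using assms
proof (induction I rule: finite_induct)
  case (insert b I)
  then obtain g' where g': "g' \<in> test_functions" "\<And>k. fourier g' k = of_real (\<Prod>b\<in>I. 1 + (k \<bullet> b)^2) * fourier g k"
    by auto
  have b: "b \<in> Basis" using insert by simp
  define h where "h = (\<lambda>x. g' x - partial b (partial b g') x)"
  have "h \<in> test_functions" unfolding h_def by (intro test_functions_diff test_functions_partial g' b)
  moreover have "fourier h k = of_real (\<Prod>b\<in>insert b I. 1 + (k \<bullet> b)^2) * fourier g k" for k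
    using insert b unfolding h_def
    by (simp add: fourier_diff fourier_partial test_functions_partial g' algebra_simps power2_eq_square)
  ultimately show ?case by blast
qed auto

text \<open>The weight is a product over the coordinates, since sums over the lattice then factor
  into one-dimensional series; \<open>one_add_norm_le_prod\<close> converts it into powers of the
  norm.\<close>

lemma fourier_decay:
  fixes g :: "'a::euclidean_space \<Rightarrow> complex"
  assumes g: "g \<in> test_functions"
  obtains C where "\<And>k. cmod (fourier g k) * (\<Prod>b\<in>Basis. 1 + (k \<bullet> b)^2) ^ N \<le> C"
proof -
  have "\<exists>g'\<in>test_functions. \<forall>k. fourier g' k = of_real (\<Prod>b\<in>Basis. 1 + (k \<bullet> b)^2) ^ N * fourier g k"
  proof (induction N)
    case 0
    then show ?case using g by auto
  next
    case (Suc N)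
    then obtain g' where g': "g' \<in> test_functions"
      "\<And>k. fourier g' k = of_real (\<Prod>b\<in>Basis. 1 + (k \<bullet> b)^2) ^ N * fourier g k" by blast
    from fourier_decay_operator[OF finite_Basis subset_refl g'(1)] show ?case
      unfolding g'(2) by (simp add: mult.assoc)
  qed
  then obtain g' where g': "g' \<in> test_functions"
    "\<And>k. fourier g' k = of_real (\<Prod>b\<in>Basis. 1 + (k \<bullet> b)^2) ^ N * fourier g k" by blast
  have "cmod (fourier g k) * (\<Prod>b\<in>Basis. 1 + (k \<bullet> b)^2) ^ N \<le> (\<integral>x. cmod (g' x) \<partial>lborel)" for k
  proof -
    have "0 \<le> (\<Prod>b\<in>Basis. 1 + (k \<bullet> b)^2)" by (intro prod_nonneg) auto
    then have "cmod (fourier g k) * (\<Prod>b\<in>Basis. 1 + (k \<bullet> b)^2) ^ N = cmod (fourier g' k)"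
      unfolding g'(2) norm_mult norm_power norm_of_real by simp
    also have "\<dots> \<le> (\<integral>x. cmod (g' x * wave k x) \<partial>lborel)"
      unfolding fourier_def by (rule integral_norm_bound)
    finally show ?thesis by (simp add: norm_mult)
  qed
  then show thesis by (rule that)
qed

text \<open>Decay is expressed by summability and not pointwise in the frequency, so repeated
  frequencies are harmless: the same amplitudes serve with the pairs \<open>(p j, q j)\<close>, with
  their shifted components and with rescaled frequencies.\<close>

definition rapid :: "(nat \<Rightarrow> complex) \<Rightarrow> (nat \<Rightarrow> 'a::real_normed_vector) \<Rightarrow> bool" where
  "rapid c p \<longleftrightarrow> (\<forall>N. summable (\<lambda>j. cmod (c j) * (1 + norm (p j)) ^ N))"

text \<open>Extensional functions on \<open>Basis\<close>, the form in which
  \<open>prod_sum_PiE\<close> and \<open>abs_summable_on_prod_PiE\<close> factor sums of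
  products.\<close>

definition lattice :: "('a::euclidean_space \<Rightarrow> int) set" where
  "lattice = PiE Basis (\<lambda>_. UNIV)"

definition lattice_vec :: "('a::euclidean_space \<Rightarrow> int) \<Rightarrow> 'a" where
  "lattice_vec m = (\<Sum>b\<in>Basis. of_int (m b) *\<^sub>R b)"

lemma lattice_vec_inner: "b \<in> Basis \<Longrightarrow> lattice_vec m \<bullet> b = of_int (m b)"
  unfolding lattice_vec_def by simp

lemma abs_summable_int_inverse_square: "Infinite_Set_Sum.abs_summable_on (\<lambda>j::int. 1 / (1 + (real_of_int j)^2)) UNIV"
proof -
  have "Infinite_Set_Sum.abs_summable_on (\<lambda>n::nat. 1 / (1 + (real n)^2)) UNIV"
    unfolding abs_summable_on_nat_iff'
  proof (rule summable_comparison_test')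
    show "summable (\<lambda>n. inverse (real n ^ 2))" by (rule inverse_power_summable) auto
    show "norm (norm (1 / (1 + (real n)^2))) \<le> inverse (real n ^ 2)" if "n \<ge> 1" for n
      using that zero_le_power2[of "real n"] by (simp add: inverse_eq_divide frac_le add_nonneg_pos)
  qed
  then have 1: "Infinite_Set_Sum.abs_summable_on (\<lambda>j::int. 1 / (1 + (real_of_int j)^2)) (range int)"
    and 2: "Infinite_Set_Sum.abs_summable_on (\<lambda>j::int. 1 / (1 + (real_of_int j)^2)) (range (\<lambda>n. - int n))"
    by (auto intro!: abs_summable_on_reindex)
  have "UNIV = range int \<union> range (\<lambda>n. - int n)"
    by (auto, metis int_cases2 rangeI)
  then show ?thesis using abs_summable_on_union[OF 1 2] by simp
qed

text \<open>In one coordinate \<open>1 + \<bar>t\<bar> \<le> 2 * (1 + t^2)\<close>, and a product of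
  factors \<open>1 + \<bar>t\<bar>\<close> dominates 1 plus the sum of the absolute values.\<close>

lemma one_add_norm_le_prod:
  fixes k :: "'a::euclidean_space"
  shows "1 + norm k \<le> 2 ^ DIM('a) * (\<Prod>b\<in>Basis. 1 + (k \<bullet> b)^2)"
proof -
  have gen: "1 + (\<Sum>b\<in>I. \<bar>k \<bullet> b\<bar>) \<le> (\<Prod>b\<in>I. 2 * (1 + (k \<bullet> b)^2))" if "finite I" for I
    using that
  proof (induction I rule: finite_induct)
    case (insert b I)
    have t: "1 + \<bar>k \<bullet> b\<bar> \<le> 2 * (1 + (k \<bullet> b)^2)"
    proof -
      have "2 * \<bar>k \<bullet> b\<bar> \<le> 1 + (k \<bullet> b)^2"
        using zero_le_power2[of "\<bar>k \<bullet> b\<bar> - 1"] by (simp add: power2_eq_square algebra_simps)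
      then show ?thesis using zero_le_power2[of "k \<bullet> b"] by (simp only: distrib_left)
    qed
    have "1 + (\<Sum>b\<in>insert b I. \<bar>k \<bullet> b\<bar>) \<le> (1 + \<bar>k \<bullet> b\<bar>) * (1 + (\<Sum>b\<in>I. \<bar>k \<bullet> b\<bar>))"
      using insert by (simp add: algebra_simps sum_nonneg)
    also have "\<dots> \<le> (2 * (1 + (k \<bullet> b)^2)) * (\<Prod>b\<in>I. 2 * (1 + (k \<bullet> b)^2))"
      by (intro mult_mono t insert.IH) (auto simp: sum_nonneg add_nonneg_nonneg)
    finally show ?case using insert by simp
  qed simp
  have "1 + norm k \<le> 1 + (\<Sum>b\<in>Basis. \<bar>k \<bullet> b\<bar>)" using norm_le_l1[of k] by simp
  also have "\<dots> \<le> (\<Prod>b\<in>Basis. 2 * (1 + (k \<bullet> b)^2))" by (rule gen) simp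
  also have "\<dots> = 2 ^ DIM('a) * (\<Prod>b\<in>Basis. 1 + (k \<bullet> b)^2)" by (simp only: prod.distrib prod_constant)
  finally show ?thesis .
qed

lemma countable_lattice: "countable (lattice :: ('a::euclidean_space \<Rightarrow> int) set)"
  unfolding lattice_def by (intro countable_PiE) auto

lemma infinite_lattice: "infinite (lattice :: ('a::euclidean_space \<Rightarrow> int) set)"
proof
  assume fin: "finite (lattice :: ('a \<Rightarrow> int) set)"
  obtain b :: 'a where b: "b \<in> Basis" using nonempty_Basis by blast
  have "UNIV \<subseteq> (\<lambda>m. m b) ` (lattice :: ('a \<Rightarrow> int) set)"
  proof
    fix i :: int
    have "restrict (\<lambda>_. i) Basis \<in> lattice" by (auto simp: lattice_def)
    then show "i \<in> (\<lambda>m. m b) ` (lattice :: ('a \<Rightarrow> int) set)" using b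
      by (intro image_eqI[of _ _ "restrict (\<lambda>_. i) Basis"]) auto
  qed
  then show False using fin by (meson finite_imageI finite_subset infinite_UNIV_int)
qed

definition lattice_enum :: "nat \<Rightarrow> 'a::euclidean_space \<Rightarrow> int" where
  "lattice_enum = from_nat_into lattice"

lemma bij_lattice_enum: "bij_betw lattice_enum UNIV lattice"
  unfolding lattice_enum_def by (rule bij_betw_from_nat_into[OF countable_lattice infinite_lattice])

text \<open>The product weight is used at order \<open>N + 1\<close>: \<open>N\<close> factors
  absorb the power of the norm, and the last one leaves a summable product of inverse squares. The
  frequencies carry a minus sign because \<open>wave k\<close> is \<open>exp(-i k x)\<close> and the
  inversion formula needs the conjugate waves.\<close>

lemma rapid_fourier:
  fixes g :: "'a::euclidean_space \<Rightarrow> complex"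
  assumes g: "g \<in> test_functions"
  shows "rapid (\<lambda>j. a * fourier g (lattice_vec (lattice_enum j))) (\<lambda>j. - (lattice_vec (lattice_enum j) :: 'a))"
  unfolding rapid_def
proof
  fix N
  define P where "P k = (\<Prod>b\<in>Basis. 1 + (k \<bullet> b)^2)" for k :: 'a
  have P: "P k > 0" for k unfolding P_def by (intro prod_pos) (auto simp: add_pos_nonneg)
  obtain C where C: "\<And>k. cmod (fourier g k) * P k ^ (Suc N) \<le> C" using fourier_decay[OF g, of "Suc N"] unfolding P_def
    by blast
  define Q where "Q m = (\<Prod>b\<in>(Basis::'a set). 1 / (1 + (real_of_int (m b))^2))" for m :: "'a \<Rightarrow> int"
  have "Infinite_Set_Sum.abs_summable_on Q lattice"
    unfolding Q_def lattice_def by (intro abs_summable_on_prod_PiE abs_summable_int_inverse_square) auto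
  then have "Infinite_Set_Sum.abs_summable_on (\<lambda>j. Q (lattice_enum j)) UNIV"
    using abs_summable_on_reindex_bij_betw[OF bij_lattice_enum, of Q] by simp
  then have "summable (\<lambda>j. norm (Q (lattice_enum j)))" by (simp add: abs_summable_on_nat_iff')
  then have S: "summable (\<lambda>j. (cmod a * (2 ^ DIM('a)) ^ N * C) * norm (Q (lattice_enum j)))" by (rule summable_mult)
  show "summable (\<lambda>j. cmod (a * fourier g (lattice_vec (lattice_enum j)))
    * (1 + norm (- (lattice_vec (lattice_enum j) :: 'a))) ^ N)"
  proof (rule summable_comparison_test'[OF S])
    fix j :: nat
    define k where "k = (lattice_vec (lattice_enum j) :: 'a)"
    have Q: "Q (lattice_enum j) = 1 / P k"
      unfolding Q_def P_def k_def by (simp add: lattice_vec_inner prod_dividef)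
    have "(1 + norm k) ^ N \<le> (2 ^ DIM('a) * P k) ^ N"
      unfolding P_def by (intro power_mono one_add_norm_le_prod) auto
    then have "cmod (fourier g k) * (1 + norm k) ^ N \<le> cmod (fourier g k) * ((2 ^ DIM('a)) ^ N * P k ^ N)"
      by (intro mult_left_mono) (auto simp: power_mult_distrib)
    also have "\<dots> = (2 ^ DIM('a)) ^ N * (cmod (fourier g k) * P k ^ Suc N) * (1 / P k)" using P[of k] by simp
    also have "\<dots> \<le> (2 ^ DIM('a)) ^ N * C * (1 / P k)" using C P[of k] by (intro mult_right_mono mult_left_mono) auto
    finally have "cmod a * (cmod (fourier g k) * (1 + norm k) ^ N) \<le> cmod a * ((2 ^ DIM('a)) ^ N * C * (1 / P k))"
      by (intro mult_left_mono) auto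
    then show "norm (cmod (a * fourier g (lattice_vec (lattice_enum j)))
      * (1 + norm (- (lattice_vec (lattice_enum j) :: 'a))) ^ N)
       \<le> (cmod a * (2 ^ DIM('a)) ^ N * C) * norm (Q (lattice_enum j))"
      using P[of k] unfolding Q norm_minus_cancel k_def[symmetric] by (simp add: norm_mult mult.assoc)
  qed
qed

section \<open>Fourier expansion of test functions\<close>

text \<open>The powers of \<open>(1 + cos t) / 2\<close>, divided by their means, are nonnegative trigonometric polynomials
  that form an approximate identity, and their Fourier coefficients tend to 1.\<close>

definition trig_kernel :: "nat \<Rightarrow> real \<Rightarrow> real" where
  "trig_kernel N t = ((1 + cos t) / 2) ^ N"

text \<open>With \<open>z = exp(i t / 2)\<close> the kernel is
  \<open>((z + 1/z) / 2) ^ (2 * N)\<close>, because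
  \<open>(1 + cos t) / 2 = cos (t / 2) ^ 2\<close>; these are the coefficients of its binomial
  expansion. They vanish for \<open>\<bar>m\<bar> > N\<close>, and \<open>trig_coeff N 0\<close> is
  the mean of the kernel.\<close>

definition trig_coeff :: "nat \<Rightarrow> int \<Rightarrow> real" where
  "trig_coeff N m = real ((2 * N) choose (N + nat \<bar>m\<bar>)) / 4 ^ N"

lemma trig_kernel_nonneg: "0 \<le> trig_kernel N t"
proof -
  have "0 \<le> 1 + cos t" using cos_ge_minus_one[of t] by linarith
  then show ?thesis by (simp add: trig_kernel_def)
qed

lemma trig_kernel_expansion:
  "complex_of_real (trig_kernel N t) =
    (\<Sum>m\<in>{- int N..int N}. of_real (trig_coeff N m) * exp (\<i> * of_real (of_int m * t)))"
proof -
  define z where "z = exp (\<i> * complex_of_real (t / 2))"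
  define w where "w = exp (- (\<i> * complex_of_real (t / 2)))"
  have zw: "z * w = 1" by (simp add: z_def w_def exp_add[symmetric])
  have "complex_of_real ((1 + cos t) / 2) = ((z + w) / 2) ^ 2"
  proof -
    have "(z + w) / 2 = cos (complex_of_real (t / 2))" by (simp add: z_def w_def cos_exp_eq)
    also have "\<dots> = complex_of_real (cos (t / 2))" by (rule cos_of_real)
    finally have "((z + w) / 2) ^ 2 = complex_of_real (cos (t / 2) ^ 2)" by simp
    moreover have "cos (t / 2) ^ 2 = (1 + cos t) / 2" using cos_double_cos[of "t / 2"] by simp
    ultimately show ?thesis by simp
  qed
  then have "complex_of_real (trig_kernel N t) = ((z + w) / 2) ^ (2 * N)"
    unfolding trig_kernel_def of_real_power by (simp add: power_mult)
  also have "\<dots> = (\<Sum>l\<le>2*N. of_nat ((2*N) choose l) * z ^ l * w ^ (2*N - l)) / 4 ^ N"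
    unfolding power_divide binomial_ring[of z w "2 * N"] by (simp add: power_mult)
  also have "\<dots> = (\<Sum>l\<le>2*N. of_real (trig_coeff N (int l - int N)) * exp (\<i> * of_real (of_int (int l - int N) * t)))"
    unfolding sum_divide_distrib
  proof (rule sum.cong[OF refl])
    fix l assume l: "l \<in> {..2 * N}"
    have c: "(2*N) choose l = (2*N) choose (N + nat \<bar>int l - int N\<bar>)"
    proof (cases "l \<ge> N")
      case True
      then have "N + nat \<bar>int l - int N\<bar> = l" by simp
      then show ?thesis by (simp only:)
    next
      case False
      then have "N + nat \<bar>int l - int N\<bar> = 2 * N - l" by (simp add: nat_diff_distrib)
      then show ?thesis using binomial_symmetric[of l "2*N"] l by (simp only:)
    qed
    have "z ^ l * w ^ (2*N - l) =
      exp (of_nat l * (\<i> * complex_of_real (t / 2)) + of_nat (2*N - l) * (- (\<i> * complex_of_real (t / 2))))"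
      unfolding z_def w_def exp_add exp_of_nat_mult ..
    also have "of_nat l * (\<i> * complex_of_real (t / 2)) + of_nat (2*N - l) * (- (\<i> * complex_of_real (t / 2))) =
      \<i> * of_real (of_int (int l - int N) * t)"
      using l by (simp add: of_nat_diff field_simps)
    finally show "of_nat ((2*N) choose l) * z ^ l * w ^ (2*N - l) / 4 ^ N =
      of_real (trig_coeff N (int l - int N)) * exp (\<i> * of_real (of_int (int l - int N) * t))"
      by (simp add: trig_coeff_def c[symmetric] mult.assoc)
  qed
  also have "\<dots> = (\<Sum>m\<in>{- int N..int N}. of_real (trig_coeff N m) * exp (\<i> * of_real (of_int m * t)))"
    by (rule sum.reindex_bij_witness[where i = "\<lambda>m. nat (m + int N)" and j = "\<lambda>l. int l - int N"]) auto
  finally show ?thesis .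
qed

lemma trig_coeff_pos: "0 < trig_coeff N 0"
  by (simp add: trig_coeff_def)

lemma trig_coeff_bounds: "trig_coeff N m \<le> trig_coeff N 0" "0 \<le> trig_coeff N m"
  using binomial_maximum'[of N "N + nat \<bar>m\<bar>"] by (auto simp: trig_coeff_def intro!: divide_right_mono)

text \<open>Consecutive coefficients have the ratio \<open>(N - k) / (N + k + 1)\<close>, which
  tends to 1; for fixed \<open>m\<close> only finitely many such factors occur.\<close>

lemma trig_coeff_ratio_tendsto: "(\<lambda>N. trig_coeff N m / trig_coeff N 0) \<longlonglongrightarrow> 1"
proof -
  have nat: "(\<lambda>N. trig_coeff N (int k) / trig_coeff N 0) \<longlonglongrightarrow> 1" for k
  proof (induction k)
    case 0
    have "(\<lambda>N. trig_coeff N (int 0) / trig_coeff N 0) = (\<lambda>N. 1)" using trig_coeff_pos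
      by (auto simp: fun_eq_iff less_imp_neq[symmetric])
    then show ?case by simp
  next
    case (Suc k)
    have "(\<lambda>N. trig_coeff N (int k) / trig_coeff N 0 * ((real N - real k) / (real N + real k + 1))) \<longlonglongrightarrow> 1 * 1"
    proof (intro tendsto_mult Suc)
      have "(\<lambda>N. 1 - (2 * real k + 1) * inverse (real (Suc (N + k)))) \<longlonglongrightarrow> 1 - (2 * real k + 1) * 0"
        by (intro tendsto_intros LIMSEQ_ignore_initial_segment[OF LIMSEQ_inverse_real_of_nat])
      moreover have "1 - (2 * real k + 1) * inverse (real (Suc (N + k))) = (real N - real k) / (real N + real k + 1)"
        for N
        by (simp add: field_simps)
      ultimately show "(\<lambda>N. (real N - real k) / (real N + real k + 1)) \<longlonglongrightarrow> 1" by simp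
    qed
    moreover have "\<forall>\<^sub>F N in sequentially. trig_coeff N (int k) / trig_coeff N 0
      * ((real N - real k) / (real N + real k + 1)) = trig_coeff N (int (Suc k)) / trig_coeff N 0"
      using eventually_ge_at_top[of "Suc k"]
    proof eventually_elim
      case (elim N)
      have "Suc (N + k) * ((2 * N) choose Suc (N + k)) = (2 * N - (N + k)) * ((2 * N) choose (N + k))"
        unfolding binomial_absorption binomial_absorb_comp ..
      then have "real (Suc (N + k)) * real ((2 * N) choose Suc (N + k)) =
        real (2 * N - (N + k)) * real ((2 * N) choose (N + k))"
        by (metis of_nat_mult)
      then have "real ((2 * N) choose Suc (N + k)) =
        real ((2 * N) choose (N + k)) * ((real N - real k) / (real N + real k + 1))"
        using elim by (simp add: field_simps of_nat_diff)
      then have "trig_coeff N (int (Suc k)) = trig_coeff N (int k) * ((real N - real k) / (real N + real k + 1))"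
        by (simp add: trig_coeff_def nat_add_distrib)
      then show ?case by simp
    qed
    ultimately show ?case using Lim_transform_eventually by fastforce
  qed
  show ?thesis using nat[of "nat \<bar>m\<bar>"] by (simp add: trig_coeff_def)
qed

text \<open>A recursion for the means, needed for the second moment: from \<open>N\<close> to
  \<open>N + 1\<close> the mean drops by exactly the fraction
  \<open>1 / (2 * N + 2)\<close>.\<close>

lemma trig_coeff_Suc: "trig_coeff (Suc N) 0 * (2 * real N + 2) = trig_coeff N 0 * (2 * real N + 1)"
proof -
  have "Suc N * (Suc (Suc (2 * N)) choose Suc N) = Suc N * (2 * (Suc (2 * N) choose N))"
    using binomial_absorption[of N "Suc (Suc (2 * N))"] by (simp del: binomial_Suc_Suc)
  then have "Suc (Suc (2 * N)) choose Suc N = 2 * (Suc (2 * N) choose N)" by (simp only: mult_cancel1) simp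
  moreover have "Suc N * (Suc (2 * N) choose N) = Suc (2 * N) * ((2 * N) choose N)"
    using binomial_absorb_comp[of "Suc (2 * N)" N] by (simp del: binomial_Suc_Suc)
  ultimately have "Suc N * (Suc (Suc (2 * N)) choose Suc N) = 2 * (Suc (2 * N) * ((2 * N) choose N))"
    by (simp only: mult.left_commute)
  then have "real (Suc N) * real (Suc (Suc (2 * N)) choose Suc N) = 2 * (real (Suc (2 * N)) * real ((2 * N) choose N))"
    by (metis of_nat_mult of_nat_numeral)
  then have "real (Suc (Suc (2 * N)) choose Suc N) * (2 * real N + 2) =
    4 * (real ((2 * N) choose N) * (2 * real N + 1))"
    by (simp add: algebra_simps del: binomial_Suc_Suc)
  moreover have "trig_coeff (Suc N) 0 = real (Suc (Suc (2 * N)) choose Suc N) / (4 * 4 ^ N)"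
    by (simp add: trig_coeff_def del: binomial_Suc_Suc)
  moreover have "trig_coeff N 0 = real ((2 * N) choose N) / 4 ^ N" by (simp add: trig_coeff_def)
  ultimately show ?thesis by simp
qed

lemma trig_kernel_integral:
  "(\<integral>\<^sup>+t. ennreal (trig_kernel N t) * indicator {-pi..pi} t \<partial>lborel) = ennreal (2 * pi * trig_coeff N 0)"
proof -
  define M where "M = {- int N..int N} - {0}"
  define F where "F t = trig_coeff N 0 * t + (\<Sum>m\<in>M. trig_coeff N m * (sin (of_int m * t) / of_int m))" for t
  have K: "trig_kernel N t = trig_coeff N 0 + (\<Sum>m\<in>M. trig_coeff N m * cos (of_int m * t))" for t
  proof -
    have "trig_kernel N t = Re (complex_of_real (trig_kernel N t))" by simp
    also have "\<dots> = (\<Sum>m\<in>{- int N..int N}. trig_coeff N m * cos (of_int m * t))"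
      unfolding trig_kernel_expansion by (simp add: Re_exp)
    also have "\<dots> = trig_coeff N 0 + (\<Sum>m\<in>M. trig_coeff N m * cos (of_int m * t))"
      unfolding M_def by (subst sum.remove[of _ 0]) auto
    finally show ?thesis .
  qed
  have "(\<integral>\<^sup>+t. ennreal (trig_kernel N t) * indicator {-pi..pi} t \<partial>lborel) = F pi - F (- pi)"
  proof (rule nn_integral_FTC_Icc)
    show "trig_kernel N \<in> borel_measurable borel"
      unfolding trig_kernel_def[abs_def] by measurable
    show "(F has_real_derivative trig_kernel N t) (at t)" for t
      unfolding F_def[abs_def] K
      by (rule derivative_eq_intros DERIV_sum refl | simp add: M_def mult.commute)+
  qed (auto simp: trig_kernel_nonneg)
  also have "F pi - F (- pi) = 2 * pi * trig_coeff N 0"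
    unfolding F_def by (simp add: sin_int_times_real mult.commute[of _ pi])
  finally show ?thesis .
qed

text \<open>Since \<open>sin (t / 2) ^ 2 = 1 - cos (t / 2) ^ 2\<close>, the integrand is the
  difference of two consecutive kernels, and the value is the drop of the means. Up to constants
  this is the second moment, which measures concentration at 0.\<close>

lemma trig_kernel_square_integral:
  "(\<integral>\<^sup>+t. ennreal (sin (t / 2) ^ 2 * trig_kernel N t) * indicator {-pi..pi} t \<partial>lborel) =
    ennreal (2 * pi * trig_coeff N 0 / (2 * real N + 2))"
proof -
  have m: "trig_kernel N \<in> borel_measurable borel" for N
    unfolding trig_kernel_def[abs_def] by measurable
  have eq: "sin (t / 2) ^ 2 * trig_kernel N t + trig_kernel (Suc N) t = trig_kernel N t" for t
  proof -
    have "cos (t / 2) ^ 2 = (1 + cos t) / 2" using cos_double_cos[of "t / 2"] by simp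
    then have "trig_kernel (Suc N) t = cos (t / 2) ^ 2 * trig_kernel N t" by (simp add: trig_kernel_def)
    then have "sin (t / 2) ^ 2 * trig_kernel N t + trig_kernel (Suc N) t =
      (sin (t / 2) ^ 2 + cos (t / 2) ^ 2) * trig_kernel N t"
      by (simp only: distrib_right)
    then show ?thesis by simp
  qed
  let ?I = "\<integral>\<^sup>+t. ennreal (sin (t / 2) ^ 2 * trig_kernel N t) * indicator {-pi..pi} t \<partial>lborel"
  \<comment> \<open>Nonnegative integrals do not subtract well, so the integral of the kernel for
    \<open>N + 1\<close> is added on both sides and cancelled at the end.\<close>
  have "?I + ennreal (2 * pi * trig_coeff (Suc N) 0)
      = (\<integral>\<^sup>+t. ennreal (sin (t / 2) ^ 2 * trig_kernel N t) * indicator {-pi..pi} t + ennreal (trig_kernel (Suc N) t) *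
        indicator {-pi..pi} t \<partial>lborel)"
    unfolding trig_kernel_integral[symmetric] using m by (intro nn_integral_add[symmetric]) auto
  also have "\<dots> = (\<integral>\<^sup>+t. ennreal (trig_kernel N t) * indicator {-pi..pi} t \<partial>lborel)"
    by (intro nn_integral_cong) (simp add: distrib_right[symmetric] ennreal_plus[symmetric] trig_kernel_nonneg eq del:
      ennreal_plus)
  also have "\<dots> = ennreal (2 * pi * trig_coeff N 0)" by (rule trig_kernel_integral)
  also have "2 * pi * trig_coeff N 0 = 2 * pi * trig_coeff N 0 / (2 * real N + 2) + 2 * pi * trig_coeff (Suc N) 0"
  proof -
    have "trig_coeff (Suc N) 0 = trig_coeff N 0 * (2 * real N + 1) / (2 * real N + 2)"
      using trig_coeff_Suc[of N] by (simp add: field_simps)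
    then show ?thesis by (simp add: field_simps)
  qed
  also have "ennreal \<dots> = ennreal (2 * pi * trig_coeff N 0 / (2 * real N + 2)) + ennreal (2 * pi * trig_coeff (Suc N) 0)"
    using trig_coeff_pos[of N] trig_coeff_pos[of "Suc N"] by (intro ennreal_plus) auto
  finally show ?thesis by (simp add: add.commute[of _ "ennreal (2 * pi * trig_coeff (Suc N) 0)"])
qed

section \<open>The approximate identity in several variables\<close>

definition box_kernel :: "nat \<Rightarrow> 'a::euclidean_space \<Rightarrow> real" where
  "box_kernel N z = (\<Prod>b\<in>Basis. trig_kernel N (z \<bullet> b) * indicator {-pi..pi} (z \<bullet> b))"

lemma box_kernel_nonneg: "0 \<le> box_kernel N z"
  unfolding box_kernel_def by (intro prod_nonneg) (auto simp: trig_kernel_nonneg)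

lemma trig_kernel_measurable [measurable]: "trig_kernel N \<in> borel_measurable borel"
  unfolding trig_kernel_def[abs_def] by measurable

lemma box_kernel_measurable [measurable]: "(box_kernel N :: 'a::euclidean_space \<Rightarrow> real) \<in> borel_measurable borel"
  unfolding box_kernel_def[abs_def] by measurable

lemma box_kernel_nn_integral:
  "(\<integral>\<^sup>+z. ennreal (box_kernel N (z::'a::euclidean_space)) \<partial>lborel) = ennreal ((2 * pi * trig_coeff N 0) ^ DIM('a))"
proof -
  have "ennreal (box_kernel N z) = (\<Prod>b\<in>Basis. ennreal (trig_kernel N (z \<bullet> b)) * indicator {-pi..pi} (z \<bullet> b))"
    for z :: 'a
    unfolding box_kernel_def
    by (subst prod_ennreal[symmetric]) (auto simp: trig_kernel_nonneg indicator_def intro!: prod.cong)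
  then have "(\<integral>\<^sup>+z. ennreal (box_kernel N (z::'a)) \<partial>lborel) =
    (\<integral>\<^sup>+z. (\<Prod>b\<in>Basis. ennreal (trig_kernel N ((z::'a) \<bullet> b)) * indicator {-pi..pi} (z \<bullet> b)) \<partial>lborel)"
    by (intro nn_integral_cong)
  also have "\<dots> = (\<Prod>b\<in>(Basis::'a set). ennreal (2 * pi * trig_coeff N 0))"
    by (subst nn_integral_lborel_prod[of "\<lambda>b x. ennreal (trig_kernel N x) * indicator {-pi..pi} x"]) (auto simp:
      trig_kernel_integral)
  finally show ?thesis using trig_coeff_pos[of N] by (simp add: ennreal_power)
qed

lemma box_kernel_square_nn_integral:
  assumes b: "b \<in> (Basis :: 'a::euclidean_space set)"
  shows "(\<integral>\<^sup>+z. ennreal (sin ((z \<bullet> b) / 2) ^ 2 * box_kernel N z) \<partial>lborel) =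
    ennreal ((2 * pi * trig_coeff N 0) ^ DIM('a) / (2 * real N + 2))"
proof -
  let ?c = "\<lambda>i t. (if i = b then sin (t / 2) ^ 2 else 1) :: real"
  let ?f = "\<lambda>i t. ennreal (?c i t * trig_kernel N t) * indicator {-pi..pi} t"
  have "ennreal (sin ((z \<bullet> b) / 2) ^ 2 * box_kernel N z) = (\<Prod>i\<in>Basis. ?f i (z \<bullet> i))" for z
  proof -
    have "sin ((z \<bullet> b) / 2) ^ 2 = (\<Prod>i\<in>Basis. ?c i (z \<bullet> i))" using b by (subst prod.remove[of _ b]) auto
    then have "sin ((z \<bullet> b) / 2) ^ 2 * box_kernel N z =
      (\<Prod>i\<in>Basis. ?c i (z \<bullet> i) * (trig_kernel N (z \<bullet> i) * indicator {-pi..pi} (z \<bullet> i)))"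
      by (simp only: box_kernel_def prod.distrib)
    also have "ennreal \<dots> = (\<Prod>i\<in>Basis. ennreal (?c i (z \<bullet> i) * (trig_kernel N (z \<bullet> i) * indicator {-pi..pi} (z \<bullet> i))))"
      by (rule prod_ennreal[symmetric]) (auto simp: trig_kernel_nonneg)
    also have "\<dots> = (\<Prod>i\<in>Basis. ?f i (z \<bullet> i))"
      by (intro prod.cong) (auto simp: indicator_def)
    finally show ?thesis .
  qed
  then have "(\<integral>\<^sup>+z. ennreal (sin ((z \<bullet> b) / 2) ^ 2 * box_kernel N z) \<partial>lborel) =
    (\<integral>\<^sup>+z. (\<Prod>i\<in>Basis. ?f i (z \<bullet> i)) \<partial>lborel)"
    by simp
  also have "\<dots> = (\<Prod>i\<in>(Basis::'a set). \<integral>\<^sup>+t. ?f i t \<partial>lborel)"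
    by (rule nn_integral_lborel_prod) auto
  also have "\<dots> = (\<Prod>i\<in>(Basis::'a set). ennreal ((2 * pi * trig_coeff N 0) * (if i =
    b then 1 / (2 * real N + 2) else 1)))"
    by (intro prod.cong) (auto simp: trig_kernel_integral trig_kernel_square_integral)
  also have "\<dots> = ennreal (\<Prod>i\<in>(Basis::'a set). (2 * pi * trig_coeff N 0) * (if i = b then 1 / (2 * real N + 2) else 1))"
    using trig_coeff_pos[of N] by (intro prod_ennreal) auto
  also have "(\<Prod>i\<in>(Basis::'a set). (2 * pi * trig_coeff N 0) * (if i = b then 1 / (2 * real N + 2) else 1)) =
    (2 * pi * trig_coeff N 0) ^ DIM('a) / (2 * real N + 2)"
    using b by (simp add: prod.distrib)
  finally show ?thesis .
qed

lemma box_kernel_integral: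
  "integrable lborel (box_kernel N :: 'a::euclidean_space \<Rightarrow> real)"
  "(\<integral>z. box_kernel N (z::'a) \<partial>lborel) = (2 * pi * trig_coeff N 0) ^ DIM('a)"
  using nn_integral_eq_integrable[of "box_kernel N"
    lborel "(2 * pi * trig_coeff N 0) ^ DIM('a)"] box_kernel_nn_integral[of N, where 'a='a]
    trig_coeff_pos[of N] by (auto simp: box_kernel_nonneg)

lemma box_kernel_square_integral:
  assumes b: "b \<in> (Basis :: 'a::euclidean_space set)"
  shows "integrable lborel (\<lambda>z. sin ((z \<bullet> b) / 2) ^ 2 * box_kernel N z)"
  "(\<integral>z. sin ((z \<bullet> b) / 2) ^ 2 * box_kernel N z \<partial>lborel) = (2 * pi * trig_coeff N 0) ^ DIM('a) / (2 * real N + 2)"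
  using nn_integral_eq_integrable[of "\<lambda>z. sin ((z \<bullet> b) / 2) ^ 2 * box_kernel N z"
    lborel "(2 * pi * trig_coeff N 0) ^ DIM('a) / (2 * real N + 2)"]
    box_kernel_square_nn_integral[OF b, of N] trig_coeff_pos[of N] by (auto simp: box_kernel_nonneg)

text \<open>A crude form of \<open>2 * y / pi \<le> sin y\<close>. Up to \<open>pi / 3\<close> the
  derivative of \<open>sin\<close> is at least 1/2; beyond it \<open>sin y\<close> is at least 1/2
  and \<open>y / 4\<close> at most 1/2. Squaring at \<open>y = \<bar>t\<bar> / 2\<close> gives the
  constant 64 of \<open>square_le_sin_square\<close>.\<close>

lemma quarter_le_sin:
  assumes "0 \<le> y" "y \<le> pi / 2"
  shows "y / 4 \<le> sin y"
proof (cases "y \<le> pi / 3")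
  case True
  have "sin 0 - 0 / 4 \<le> sin y - y / 4"
  proof (rule DERIV_nonneg_imp_nondecreasing[OF assms(1)])
    fix x assume x: "0 \<le> x" "x \<le> y"
    have "cos (pi / 3) \<le> cos x" using x True by (intro cos_monotone_0_pi_le) auto
    then have "0 \<le> cos x - 1 / 4" by (simp add: cos_60)
    moreover have "((\<lambda>x. sin x - x / 4) has_real_derivative cos x - 1 / 4) (at x)"
      by (auto intro!: derivative_eq_intros)
    ultimately show "\<exists>D. ((\<lambda>x. sin x - x / 4) has_real_derivative D) (at x) \<and> 0 \<le> D" by blast
  qed
  then show ?thesis by simp
next
  case False
  have "sin (pi / 6) \<le> sin y" using False assms by (intro sin_monotone_2pi_le) auto
  moreover have "y / 4 \<le> 1 / 2" using assms pi_less_4 by linarith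
  ultimately show ?thesis by (simp add: sin_30)
qed

lemma square_le_sin_square:
  assumes "\<bar>t\<bar> \<le> pi"
  shows "t ^ 2 \<le> 64 * sin (t / 2) ^ 2"
proof -
  have "\<bar>t\<bar> / 8 \<le> sin (\<bar>t\<bar> / 2)" using quarter_le_sin[of "\<bar>t\<bar> / 2"] assms by simp
  then have "(\<bar>t\<bar> / 8) ^ 2 \<le> sin (\<bar>t\<bar> / 2) ^ 2" by (intro power_mono) auto
  also have "sin (\<bar>t\<bar> / 2) ^ 2 = sin (t / 2) ^ 2" by (cases "t \<ge> 0") auto
  finally show ?thesis by (simp add: power_divide)
qed

text \<open>From \<open>(\<bar>t\<bar> - \<delta>)^2 \<ge> 0\<close> follows
  \<open>\<bar>t\<bar> \<le> \<delta> + t^2 / \<delta>\<close> in each coordinate: the first moment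
  is traded for the total mass and the integrals with \<open>sin\<close> squared, both known
  exactly. Outside the box the kernel is 0.\<close>

lemma norm_box_kernel_bound:
  fixes z :: "'a::euclidean_space"
  assumes "\<delta> > 0"
  shows "norm z * box_kernel N z \<le> (\<Sum>b\<in>Basis. \<delta> * box_kernel N z + 64 / \<delta> * (sin ((z \<bullet> b) / 2) ^ 2 * box_kernel N z))"
proof (cases "\<forall>b\<in>Basis. \<bar>z \<bullet> b\<bar> \<le> pi")
  case True
  have "norm z \<le> (\<Sum>b\<in>Basis. \<bar>z \<bullet> b\<bar>)" by (rule norm_le_l1)
  also have "\<dots> \<le> (\<Sum>b\<in>Basis. \<delta> + 64 / \<delta> * sin ((z \<bullet> b) / 2) ^ 2)"
  proof (rule sum_mono)
    fix b :: 'a assume b: "b \<in> Basis"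
    have "0 \<le> (\<bar>z \<bullet> b\<bar> - \<delta>)^2" by simp
    also have "\<dots> = (z \<bullet> b)^2 + \<delta> * \<delta> - 2 * (\<delta> * \<bar>z \<bullet> b\<bar>)"
      by (simp add: power2_diff) (simp add: power2_eq_square)
    finally have "\<delta> * \<bar>z \<bullet> b\<bar> \<le> \<delta> * \<delta> + (z \<bullet> b)^2"
      using mult_nonneg_nonneg[of \<delta> "\<bar>z \<bullet> b\<bar>"] assms by linarith
    also have "\<dots> \<le> \<delta> * \<delta> + 64 * sin ((z \<bullet> b) / 2) ^ 2" using square_le_sin_square True b by simp
    finally show "\<bar>z \<bullet> b\<bar> \<le> \<delta> + 64 / \<delta> * sin ((z \<bullet> b) / 2) ^ 2" using assms
      by (simp add: field_simps)
  qed
  finally have "norm z * box_kernel N z \<le> (\<Sum>b\<in>Basis. \<delta> + 64 / \<delta> * sin ((z \<bullet> b) / 2) ^ 2) * box_kernel N z"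
    by (intro mult_right_mono box_kernel_nonneg)
  then show ?thesis by (simp add: sum_distrib_right distrib_right mult.assoc)
next
  case False
  then obtain b where b: "b \<in> Basis" "z \<bullet> b \<notin> {-pi..pi}" by fastforce
  then have "box_kernel N z = 0"
    unfolding box_kernel_def by (intro prod_zero bexI[of _ b]) auto
  then show ?thesis by simp
qed

lemma box_kernel_approximation:
  fixes g :: "'a::euclidean_space \<Rightarrow> complex"
  assumes g: "g \<in> test_functions"
  shows "(\<lambda>N. (\<integral>z. g (x - z) * of_real (box_kernel N z) \<partial>lborel) / of_real ((2 * pi * trig_coeff N 0) ^ DIM('a))) \<longlonglongrightarrow> g x"
proof -
  obtain M where M: "ck_bounded 1 UNIV M g" "0 \<le> M" using test_function_ck_bounded[OF g] by blast
  define L where "L = DIM('a) * M"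
  have L: "0 \<le> L" using M by (simp add: L_def)
  have sm: "smooth g" using g by (rule test_functions_smooth)
  note [measurable] = smooth_borel_measurable[OF sm]
  have bound: "norm ((\<integral>z. g (x - z) * of_real (box_kernel N z) \<partial>lborel) / of_real
    ((2 * pi * trig_coeff N 0) ^ DIM('a)) - g x)
      \<le> 33 * L * DIM('a) * (1 / sqrt (real N + 1))" for N
  proof -
    \<comment> \<open>This \<open>\<delta>\<close> balances the two terms:
      \<open>64 / \<delta>\<close> times \<open>1 / (2 * N + 2)\<close> equals
      \<open>32 * \<delta>\<close>, which together with the first \<open>\<delta>\<close> gives the
      factor 33 of the rate.\<close>
    define \<delta> where "\<delta> = 1 / sqrt (real N + 1)"
    define W where "W = (2 * pi * trig_coeff N 0) ^ DIM('a)"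
    let ?K = "box_kernel N :: 'a \<Rightarrow> real"
    have \<delta>: "\<delta> > 0" "1 / \<delta> / (2 * real N + 2) = \<delta> / 2"
      by (auto simp: \<delta>_def field_simps)
    have W: "W > 0" unfolding W_def using trig_coeff_pos[of N] by simp
    have iK: "integrable lborel ?K" "integral\<^sup>L lborel ?K = W" unfolding W_def by (rule box_kernel_integral)+
    let ?B = "\<lambda>z::'a. L * (\<Sum>b\<in>Basis. \<delta> * ?K z + 64 / \<delta> * (sin ((z \<bullet> b) / 2) ^ 2 * ?K z))"
    have iB: "integrable lborel ?B"
      by (intro integrable_mult_right Bochner_Integration.integrable_sum Bochner_Integration.integrable_add
        box_kernel_integral box_kernel_square_integral)
    have h: "norm ((g (x - z) - g x) * of_real (?K z)) \<le> ?B z" for z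
    proof -
      have "cmod (g (x - z) - g x) \<le> L * norm (x - z - x)" unfolding L_def by (rule smooth_lipschitz[OF sm M(1)])
      then have "norm ((g (x - z) - g x) * of_real (?K z)) \<le> (L * norm z) * ?K z"
        unfolding norm_mult by (auto simp: box_kernel_nonneg intro: mult_right_mono)
      also have "\<dots> \<le> ?B z" using mult_left_mono[OF norm_box_kernel_bound[OF \<delta>(1), of z N] L] by (simp add: mult.assoc)
      finally show ?thesis .
    qed
    have ih: "integrable lborel (\<lambda>z. (g (x - z) - g x) * of_real (?K z))"
      by (rule Bochner_Integration.integrable_bound[OF iB]) (use h in \<open>auto intro: order_trans[OF _ abs_ge_self]\<close>)
    have iK': "integrable lborel (\<lambda>z. g x * complex_of_real (?K z))"
      using iK(1) by (intro integrable_mult_right integrable_of_real)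
    have "(\<integral>z. g (x - z) * of_real (?K z) \<partial>lborel) =
      (\<integral>z. (g (x - z) - g x) * of_real (?K z) + g x * of_real (?K z) \<partial>lborel)"
      by (simp add: algebra_simps)
    also have "\<dots> = (\<integral>z. (g (x - z) - g x) * of_real (?K z) \<partial>lborel) + g x * of_real W"
      using ih iK' iK by simp
    finally have eq: "(\<integral>z. g (x - z) * of_real (?K z) \<partial>lborel) / of_real W - g x =
      (\<integral>z. (g (x - z) - g x) * of_real (?K z) \<partial>lborel) / of_real W"
      using W by (simp add: field_simps)
    have "norm (\<integral>z. (g (x - z) - g x) * of_real (?K z) \<partial>lborel) \<le> (\<integral>z. ?B z \<partial>lborel)"
      using iB h by (rule Bochner_Integration.integral_norm_bound_integral[OF ih])
    also have "\<dots> = L * (\<Sum>b\<in>(Basis::'a set). \<delta> * W + 64 / \<delta> * (W / (2 * real N + 2)))"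
      by (simp add: box_kernel_integral box_kernel_square_integral W_def)
    also have "\<dots> = L * DIM('a) * (\<delta> * W + 64 * W * (1 / \<delta> / (2 * real N + 2)))" by simp
    also have "\<dots> = W * (33 * L * DIM('a) * \<delta>)" unfolding \<delta>(2) by simp
    finally have "norm (\<integral>z. (g (x - z) - g x) * of_real (?K z) \<partial>lborel) / W \<le> 33 * L * DIM('a) * \<delta>"
      using W by (simp add: divide_le_eq mult.commute)
    then show ?thesis using W by (simp only: W_def[symmetric] eq norm_divide norm_of_real \<delta>_def[symmetric] abs_of_pos)
  qed
  have "(\<lambda>N. 33 * L * DIM('a) * (1 / sqrt (real N + 1))) \<longlonglongrightarrow> 33 * L * DIM('a) * 0"
  proof (intro tendsto_intros)
    have "(\<lambda>N. sqrt (inverse (real (Suc N)))) \<longlonglongrightarrow> sqrt 0" by (intro tendsto_real_sqrt LIMSEQ_inverse_real_of_nat)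
    then show "(\<lambda>N. 1 / sqrt (real N + 1)) \<longlonglongrightarrow> 0" by (simp add: inverse_eq_divide real_sqrt_divide add.commute)
  qed
  then have lim0: "(\<lambda>N. 33 * L * DIM('a) * (1 / sqrt (real N + 1))) \<longlonglongrightarrow> 0" by simp
  show ?thesis
    by (rule LIM_zero_cancel[OF Lim_null_comparison[OF always_eventually[OF allI[OF bound]] lim0]])
qed

section \<open>Fourier series of a test function\<close>

lemma box_kernel_expansion:
  fixes z :: "'a::euclidean_space"
  assumes "\<And>b. b \<in> Basis \<Longrightarrow> \<bar>z \<bullet> b\<bar> \<le> pi"
  shows "complex_of_real (box_kernel N z) =
    (\<Sum>m\<in>PiE Basis (\<lambda>_. {- int N..int N}). of_real (\<Prod>b\<in>Basis. trig_coeff N (m b)) * wave (- lattice_vec m) z)"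
proof -
  have "complex_of_real (box_kernel N z) = (\<Prod>b\<in>Basis. complex_of_real (trig_kernel N (z \<bullet> b)))"
  proof -
    have "- pi \<le> z \<bullet> b \<and> z \<bullet> b \<le> pi" if "b \<in> Basis" for b using assms[OF that] by linarith
    then show ?thesis unfolding box_kernel_def of_real_prod by (intro prod.cong) auto
  qed
  also have "\<dots> = (\<Prod>b\<in>Basis. \<Sum>m\<in>{- int N..int N}. of_real (trig_coeff N m) * exp (\<i> * of_real (of_int m * (z \<bullet> b))))"
    by (simp only: trig_kernel_expansion)
  also have "\<dots> = (\<Sum>m\<in>PiE Basis (\<lambda>_. {- int N..int N}). \<Prod>b\<in>Basis. of_real (trig_coeff N (m b))
    * exp (\<i> * of_real (of_int (m b) * (z \<bullet> b))))"
    by (rule prod_sum_PiE) auto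
  also have "\<dots> = (\<Sum>m\<in>PiE Basis (\<lambda>_. {- int N..int N}). of_real (\<Prod>b\<in>Basis. trig_coeff N (m b)) * wave (- lattice_vec m)
    z)"
  proof (rule sum.cong[OF refl])
    fix m :: "'a \<Rightarrow> int"
    have "(\<Prod>b\<in>Basis. exp (\<i> * of_real (of_int (m b) * (z \<bullet> b)))) = exp (\<Sum>b\<in>Basis. \<i> * of_real (of_int (m b) * (z \<bullet> b)))"
      by (simp add: exp_sum)
    also have "(\<Sum>b\<in>Basis. \<i> * complex_of_real (of_int (m b) * (z \<bullet> b))) = - \<i> * of_real ((- lattice_vec m) \<bullet> z)"
      by (simp add: lattice_vec_def inner_sum_left sum_distrib_left inner_commute[of z] sum_negf)
    finally show "(\<Prod>b\<in>Basis. of_real (trig_coeff N (m b)) * exp (\<i> * of_real (of_int (m b) * (z \<bullet> b)))) =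
      of_real (\<Prod>b\<in>Basis. trig_coeff N (m b)) * wave (- lattice_vec m) z"
      by (simp add: prod.distrib wave_def)
  qed
  finally show ?thesis .
qed

lemma integral_reflect_translate:
  fixes f :: "'a::euclidean_space \<Rightarrow> complex"
  assumes "f \<in> borel_measurable borel"
  shows "(\<integral>z. f (x - z) \<partial>lborel) = (\<integral>y. f y \<partial>lborel)"
proof -
  have "(\<integral>y. f y \<partial>lborel) = (\<integral>y. f y \<partial>distr lborel borel (\<lambda>z. x - z))"
    using lborel_affine[of "-1" x] by (simp add: density_1)
  also have "\<dots> = (\<integral>z. f (x - z) \<partial>lborel)" using assms by (intro integral_distr) auto
  finally show ?thesis ..
qed

text \<open>Differences of points of the unit ball have coordinates at most 2, hence below
  \<open>pi\<close>; there the kernel, cut to the box, is the trigonometric polynomial itself and no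
  other period interferes. The normalized convolution with \<open>g\<close> is the Fourier series
  damped by the factors \<open>\<rho> N m\<close>. It tends to \<open>g x\<close>, while the factors
  tend to 1.\<close>

lemma fourier_expansion_unit:
  fixes g :: "'a::euclidean_space \<Rightarrow> complex"
  assumes g: "g \<in> test_functions" and supp: "supp_fun g \<subseteq> cball 0 1" and x: "x \<in> cball 0 1"
  shows "g x = (\<Sum>j. (fourier g (lattice_vec (lattice_enum j)) / of_real ((2 * pi) ^ DIM('a)))
    * wave (- lattice_vec (lattice_enum j)) x)"
proof -
  let ?e = "lattice_enum :: nat \<Rightarrow> 'a \<Rightarrow> int"
  let ?n = "DIM('a)"
  define c where "c m = fourier g (lattice_vec m) / of_real ((2 * pi) ^ ?n) * wave (- lattice_vec m) x" for m
  define \<rho> where "\<rho> N m = (\<Prod>b\<in>(Basis::'a set). trig_coeff N (m b) / trig_coeff N 0)" for N and m :: "'a \<Rightarrow> int"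
  define J where "J N = PiE (Basis::'a set) (\<lambda>_. {- int N..int N})" for N
  have sm: "smooth g" using g by (rule test_functions_smooth)
  note [measurable] = smooth_borel_measurable[OF sm]
  have J: "finite (J N)" "J N \<subseteq> lattice" for N unfolding J_def lattice_def by (auto intro: finite_PiE)
  have \<rho>_out: "\<rho> N m = 0" if m: "m \<in> lattice" "m \<notin> J N" for N m
  proof -
    obtain b where b: "b \<in> Basis" "m b \<notin> {- int N..int N}"
      using m unfolding J_def lattice_def by (auto simp: PiE_iff)
    then have "trig_coeff N (m b) = 0" by (auto simp: trig_coeff_def intro!: binomial_eq_0)
    then show ?thesis unfolding \<rho>_def using b by (intro prod_zero) auto
  qed
  have approx: "(\<integral>z. g (x - z) * of_real (box_kernel N z) \<partial>lborel) / of_real ((2 * pi * trig_coeff N 0) ^ ?n) =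
    (\<Sum>j. of_real (\<rho> N (?e j)) * c (?e j))" for N
  proof -
    have eq: "g (x - z) * of_real (box_kernel N z) =
      (\<Sum>m\<in>J N. of_real (\<Prod>b\<in>Basis. trig_coeff N (m b)) * wave (- lattice_vec m) x * (g (x - z) * wave (lattice_vec m)
      (x - z)))" for z
    proof (cases "x - z \<in> supp_fun g")
      case True
      then have "norm (x - z) \<le> 1" using supp by auto
      then have "norm z \<le> 2" using x norm_triangle_ineq4[of x "x - z"] by simp
      then have zb: "\<bar>z \<bullet> b\<bar> \<le> pi" if "b \<in> Basis" for b
        using Basis_le_norm[OF that, of z] pi_ge_two by linarith
      have e: "complex_of_real (box_kernel N z) =
        (\<Sum>m\<in>J N. of_real (\<Prod>b\<in>Basis. trig_coeff N (m b)) * wave (- lattice_vec m) z)"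
        unfolding J_def by (rule box_kernel_expansion) (rule zb)
      have w: "wave (- lattice_vec m) x * wave (lattice_vec m) (x - z) = wave (- lattice_vec m) z" for m
        by (simp add: wave_def exp_add[symmetric] inner_diff_right algebra_simps)
      show ?thesis
        unfolding e sum_distrib_left w[symmetric] by (intro sum.cong refl) (simp only: mult.assoc mult.left_commute)
    qed (simp add: not_in_supp_fun)
    have i: "integrable lborel (\<lambda>z. g (x - z) * wave k (x - z))" for k
    proof -
      have "integrable (distr lborel borel (\<lambda>z. x - z)) (\<lambda>y. g y * wave k y)"
        using test_function_integrable[OF test_functions_mult[OF g smooth_wave]] lborel_affine[of "-1" x]
          by (simp add: density_1)
      then show ?thesis
        by (subst (asm) integrable_distr_eq) (auto intro!: smooth_borel_measurable smooth_mult sm smooth_wave)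
    qed
    have "(\<integral>z. g (x - z) * of_real (box_kernel N z) \<partial>lborel) =
      (\<Sum>m\<in>J N. of_real (\<Prod>b\<in>Basis. trig_coeff N (m b)) * wave (- lattice_vec m) x * (\<integral>z. g (x - z) * wave (lattice_vec
      m) (x - z) \<partial>lborel))"
      unfolding eq using i by (simp add: Bochner_Integration.integral_sum)
    also have "\<dots> = (\<Sum>m\<in>J N. of_real (\<Prod>b\<in>Basis. trig_coeff N (m b)) * wave (- lattice_vec m) x
      * fourier g (lattice_vec m))"
      using integral_reflect_translate[OF smooth_borel_measurable[OF smooth_mult[OF sm smooth_wave]]]
      by (simp add: fourier_def)
    finally have "(\<integral>z. g (x - z) * of_real (box_kernel N z) \<partial>lborel) / of_real ((2 * pi * trig_coeff N 0) ^ ?n)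
      = (\<Sum>m\<in>J N. of_real (\<Prod>b\<in>Basis. trig_coeff N (m b)) * wave (- lattice_vec m) x * fourier g (lattice_vec m) /
        of_real ((2 * pi * trig_coeff N 0) ^ ?n))"
      by (simp add: sum_divide_distrib)
    also have "\<dots> = (\<Sum>m\<in>J N. of_real (\<rho> N m) * c m)"
    proof (rule sum.cong[OF refl])
      fix m
      have "\<rho> N m = (\<Prod>b\<in>Basis. trig_coeff N (m b)) / trig_coeff N 0 ^ ?n"
        by (simp add: \<rho>_def prod_dividef)
      then show "of_real (\<Prod>b\<in>Basis. trig_coeff N (m b)) * wave (- lattice_vec m) x * fourier g (lattice_vec m) /
        of_real ((2 * pi * trig_coeff N 0) ^ ?n) = of_real (\<rho> N m) * c m"
        by (simp add: c_def power_mult_distrib mult_ac)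
    qed
    also have "\<dots> = (\<Sum>j\<in>{j. ?e j \<in> J N}. of_real (\<rho> N (?e j)) * c (?e j))"
    proof (rule sum.reindex_bij_betw[symmetric])
      show "bij_betw ?e {j. ?e j \<in> J N} (J N)"
        using bij_lattice_enum[where 'a = 'a] J(2)[of N] unfolding bij_betw_def inj_on_def by (auto simp: image_iff)
    qed
    also have "\<dots> = (\<Sum>j. of_real (\<rho> N (?e j)) * c (?e j))"
    proof (rule suminf_finite[symmetric])
      show "finite {j. ?e j \<in> J N}"
        using finite_vimageI[OF J(1), of ?e] bij_lattice_enum[where 'a = 'a] by (auto simp: bij_betw_def vimage_def)
      fix j assume "j \<notin> {j. ?e j \<in> J N}"
      moreover have "?e j \<in> lattice" using bij_lattice_enum[where 'a = 'a] by (auto simp: bij_betw_def)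
      ultimately show "of_real (\<rho> N (?e j)) * c (?e j) = 0" using \<rho>_out by simp
    qed
    finally show ?thesis .
  qed
  \<comment> \<open>Tannery's theorem: the damping factors are bounded by 1 and tend to 1, and the
    undamped series converges absolutely by \<open>rapid_fourier\<close>.\<close>
  have "(\<lambda>N. \<Sum>j. of_real (\<rho> N (?e j)) * c (?e j)) \<longlonglongrightarrow> (\<Sum>j. c (?e j))"
  proof -
    have "rapid (\<lambda>j. 1 / of_real ((2 * pi) ^ ?n) * fourier g (lattice_vec (?e j))) (\<lambda>j. - (lattice_vec (?e j) :: 'a))"
      by (rule rapid_fourier[OF g])
    then have "summable (\<lambda>j. cmod (1 / of_real ((2 * pi) ^ ?n) * fourier g (lattice_vec (?e j)))
      * (1 + norm (- (lattice_vec (?e j) :: 'a))) ^ 0)"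
      unfolding rapid_def by blast
    then have S: "summable (\<lambda>j. cmod (c (?e j)))" by (simp add: c_def norm_mult norm_divide)
    have \<rho>1: "norm (\<rho> N m) \<le> 1" for N m
      unfolding \<rho>_def prod_norm[symmetric] using trig_coeff_bounds[of N] trig_coeff_pos[of N]
      by (intro prod_le_1) auto
    have lim: "(\<lambda>N. of_real (\<rho> N (?e j)) * c (?e j)) \<longlonglongrightarrow> c (?e j)" for j
    proof -
      have "(\<lambda>N. \<rho> N (?e j)) \<longlonglongrightarrow> (\<Prod>b\<in>(Basis::'a set). 1)"
        unfolding \<rho>_def by (intro tendsto_prod trig_coeff_ratio_tendsto)
      from tendsto_mult[OF tendsto_of_real[OF this] tendsto_const[of "c (?e j)"]] show ?thesis by simp
    qed
    have bd: "eventually (\<lambda>(j, N). norm (of_real (\<rho> N (?e j)) * c (?e j)) \<le> cmod (c (?e j))) (at_top \<times>\<^sub>F sequentially)"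
      using \<rho>1 by (intro always_eventually) (auto simp: norm_mult intro!: mult_left_le_one_le)
    show ?thesis
      using tannerys_theorem[of "\<lambda>j N. of_real (\<rho> N (?e j)) * c (?e j)", OF lim bd S] by simp
  qed
  moreover have "(\<lambda>N. \<Sum>j. of_real (\<rho> N (?e j)) * c (?e j)) \<longlonglongrightarrow> g x"
    using box_kernel_approximation[OF g, of x] unfolding approx .
  ultimately show ?thesis unfolding c_def by (rule LIMSEQ_unique[rotated])
qed

lemma rapid_scale:
  assumes "rapid c p" "0 < s" "s \<le> 1"
  shows "rapid c (\<lambda>j. s *\<^sub>R p j)"
  unfolding rapid_def
proof
  fix N
  show "summable (\<lambda>j. cmod (c j) * (1 + norm (s *\<^sub>R p j)) ^ N)"
  proof (rule summable_comparison_test')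
    show "summable (\<lambda>j. cmod (c j) * (1 + norm (p j)) ^ N)" using assms(1) by (simp add: rapid_def)
    show "norm (cmod (c j) * (1 + norm (s *\<^sub>R p j)) ^ N) \<le> cmod (c j) * (1 + norm (p j)) ^ N" for j
      using assms(2,3) by (auto intro!: mult_left_mono power_mono mult_left_le_one_le)
  qed
qed

lemma fourier_expansion:
  fixes g :: "'a::euclidean_space \<Rightarrow> complex"
  assumes g: "g \<in> test_functions"
  obtains c p where "rapid c (p :: nat \<Rightarrow> 'a)" "\<And>x. norm x \<le> R \<Longrightarrow> g x = (\<Sum>j. c j * wave (p j) x)"
proof -
  obtain R' where R': "\<And>x. x \<in> supp_fun g \<Longrightarrow> norm x \<le> R'"
    using compact_imp_bounded[OF test_functions_compact[OF g]] by (auto simp: bounded_iff)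
  \<comment> \<open>Dilation by \<open>\<mu>\<close> fits both the support of \<open>g\<close> and
    the ball of radius \<open>R\<close> into the unit ball. Since \<open>\<mu> \<ge> 1\<close>, the
    frequencies do not grow and \<open>rapid_scale\<close> applies.\<close>
  define \<mu> where "\<mu> = max 1 (max R R')"
  have \<mu>: "\<mu> \<ge> 1" "R \<le> \<mu>" "R' \<le> \<mu>" by (auto simp: \<mu>_def)
  define h where "h = (\<lambda>x. g (\<mu> *\<^sub>R x))"
  have supp: "supp_fun h \<subseteq> cball 0 1"
  proof (rule supp_fun_subset)
    fix x :: 'a assume "x \<notin> cball 0 1"
    then have "norm x > 1" by simp
    then have "norm (\<mu> *\<^sub>R x) > \<mu>" using \<mu> by simp
    then have "\<not> norm (\<mu> *\<^sub>R x) \<le> R'" using \<mu> by linarith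
    then have "\<mu> *\<^sub>R x \<notin> supp_fun g" using R' by blast
    then show "h x = 0" by (simp add: h_def not_in_supp_fun)
  qed simp
  have "smooth h" unfolding h_def by (rule smooth_linear[OF bounded_linear_scaleR_right test_functions_smooth[OF g]])
  then have h: "h \<in> test_functions" using supp compact_cball by (rule test_functionsI)
  define c where "c j = 1 / of_real ((2 * pi) ^ DIM('a)) * fourier h (lattice_vec (lattice_enum j))" for j
  define q where "q j = - (lattice_vec (lattice_enum j) :: 'a)" for j
  have "rapid c q" unfolding c_def q_def by (rule rapid_fourier[OF h])
  then have "rapid c (\<lambda>j. (1 / \<mu>) *\<^sub>R q j)" using \<mu> by (intro rapid_scale) auto
  moreover have "g x = (\<Sum>j. c j * wave ((1 / \<mu>) *\<^sub>R q j) x)" if x: "norm x \<le> R" for x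
  proof -
    have "norm ((1 / \<mu>) *\<^sub>R x) \<le> 1" using x \<mu> by (simp add: divide_le_eq)
    then have "h ((1 / \<mu>) *\<^sub>R x) = (\<Sum>j. c j * wave (q j) ((1 / \<mu>) *\<^sub>R x))"
      using fourier_expansion_unit[OF h supp, of "(1 / \<mu>) *\<^sub>R x"] by (simp add: c_def q_def)
    then show ?thesis using \<mu> by (simp add: h_def wave_scaleR)
  qed
  ultimately show thesis by (rule that)
qed

section \<open>Superpositions of waves\<close>

definition wave_series :: "(nat \<Rightarrow> complex) \<Rightarrow> (nat \<Rightarrow> 'a) \<Rightarrow> 'a::euclidean_space \<Rightarrow> complex" where
  "wave_series d p x = (\<Sum>j. d j * wave (p j) x)"

lemma rapid_summable: "rapid d p \<Longrightarrow> summable (\<lambda>j. cmod (d j) * (1 + norm (p j)) ^ N)"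
  by (simp add: rapid_def)

lemma rapid_summable_wave:
  assumes "rapid d p"
  shows "summable (\<lambda>j. cmod (d j))" "summable (\<lambda>j. d j * wave (p j) x)"
proof -
  show 1: "summable (\<lambda>j. cmod (d j))" using rapid_summable[OF assms, of 0] by simp
  show "summable (\<lambda>j. d j * wave (p j) x)"
    by (rule summable_norm_cancel) (simp add: norm_mult 1)
qed

lemma norm_wave_series_le:
  assumes "rapid d p"
  shows "cmod (wave_series d p x) \<le> (\<Sum>j. cmod (d j))"
proof -
  have "summable (\<lambda>j. norm (d j * wave (p j) x))" using rapid_summable_wave(1)[OF assms] by (simp add: norm_mult)
  from summable_norm[OF this] show ?thesis by (simp add: wave_series_def norm_mult)
qed

text \<open>The powers of the norm lost to growing factors are regained from summability at order
  \<open>M + N\<close>. This covers shifts of the frequencies by a fixed \<open>k\<close> and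
  multiplication by the Fourier transform of a localized distribution.\<close>

lemma rapid_comparison:
  assumes "rapid c p" "\<And>j. cmod (d j) \<le> C * (cmod (c j) * (1 + norm (p j)) ^ M)" "0 \<le> C"
    and "\<And>j. 1 + norm (q j) \<le> D * (1 + norm (p j))"
  shows "rapid d q"
  unfolding rapid_def
proof
  fix N
  show "summable (\<lambda>j. cmod (d j) * (1 + norm (q j)) ^ N)"
  proof (rule summable_comparison_test')
    show "summable (\<lambda>j. C * D ^ N * (cmod (c j) * (1 + norm (p j)) ^ (M + N)))"
      by (intro summable_mult rapid_summable assms)
    fix j
    have "cmod (d j) * (1 + norm (q j)) ^ N \<le> (C * (cmod (c j) * (1 + norm (p j)) ^ M)) * (D * (1 + norm (p j))) ^ N"
      using assms by (intro mult_mono power_mono) auto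
    then show "norm (cmod (d j) * (1 + norm (q j)) ^ N) \<le> C * D ^ N * (cmod (c j) * (1 + norm (p j)) ^ (M + N))"
      by (simp add: power_mult_distrib power_add mult_ac)
  qed
qed

lemma rapid_partial:
  assumes "rapid d p" "b \<in> Basis"
  shows "rapid (\<lambda>j. (- \<i> * complex_of_real (p j \<bullet> b)) * d j) p"
proof (rule rapid_comparison[OF assms(1), where M = 1 and C = 1 and D = 1])
  fix j
  have "\<bar>p j \<bullet> b\<bar> * cmod (d j) \<le> (1 + norm (p j)) * cmod (d j)"
    using Basis_le_norm[OF assms(2), of "p j"] by (intro mult_right_mono) auto
  then show "cmod ((- \<i> * complex_of_real (p j \<bullet> b)) * d j) \<le> 1 * (cmod (d j) * (1 + norm (p j)) ^ 1)"
    by (simp add: norm_mult mult.commute)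
qed auto

lemma suminf_tail_tendsto_0:
  fixes f :: "nat \<Rightarrow> real"
  assumes "summable f"
  shows "(\<lambda>n. \<Sum>j. f (j + n)) \<longlonglongrightarrow> 0"
proof -
  have "(\<lambda>n. suminf f - (\<Sum>j<n. f j)) \<longlonglongrightarrow> suminf f - suminf f"
    by (intro tendsto_intros summable_LIMSEQ assms)
  then show ?thesis by (simp add: suminf_minus_initial_segment[OF assms])
qed

text \<open>The differentiated terms are dominated by a summable sequence times
  \<open>norm h\<close>, uniformly in \<open>x\<close>, so their tails converge uniformly.\<close>

lemma wave_series_has_derivative:
  fixes p :: "nat \<Rightarrow> 'a::euclidean_space"
  assumes "rapid d p"
  shows "(wave_series d p has_derivative (\<lambda>h. \<Sum>j. d j * (- \<i> * complex_of_real (p j \<bullet> h) * wave (p j) x))) (at x)"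
proof -
  let ?f = "\<lambda>j x. d j * wave (p j) x"
  let ?f' = "\<lambda>j x h. d j * (- \<i> * complex_of_real (p j \<bullet> h) * wave (p j) x)"
  let ?S = "\<lambda>j. cmod (d j) * (1 + norm (p j))"
  have S: "summable ?S" using rapid_summable[OF assms, of 1] by simp
  have bd: "norm (?f' j x h) \<le> ?S j * norm h" for j x h
  proof -
    have "cmod (d j) * \<bar>p j \<bullet> h\<bar> \<le> cmod (d j) * ((1 + norm (p j)) * norm h)"
      using Cauchy_Schwarz_ineq2[of "p j" h] by (intro mult_left_mono) (auto simp: distrib_right add_increasing)
    then show ?thesis by (simp add: norm_mult mult.assoc)
  qed
  have sum': "summable (\<lambda>j. ?f' j x h)" for x h
    by (rule summable_comparison_test'[OF summable_mult2[OF S, of "norm h"]]) (rule bd)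
  have "\<exists>g. \<forall>x\<in>UNIV. (\<lambda>j. ?f j x) sums g x \<and> (g has_derivative (\<lambda>h. \<Sum>j. ?f' j x h)) (at x within UNIV)"
  proof (rule has_derivative_series[where f' = ?f' and x = 0 and l = "\<Sum>n. ?f n 0"])
    show "(?f n has_derivative ?f' n x) (at x within UNIV)" for n x
      using has_derivative_mult_right[OF wave_has_derivative] by simp
    fix e :: real assume e: "e > 0"
    have "eventually (\<lambda>n. (\<Sum>j. ?S (j + n)) < e) sequentially"
      using order_tendstoD(2)[OF suminf_tail_tendsto_0[OF S] e] .
    then show "\<forall>\<^sub>F n in sequentially. \<forall>x\<in>UNIV. \<forall>h. norm ((\<Sum>i<n. ?f' i x h) - (\<Sum>j. ?f' j x h)) \<le> e * norm h"
    proof eventually_elim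
      case (elim n)
      show ?case
      proof (intro ballI allI)
        fix x h :: 'a
        have Sn: "summable (\<lambda>j. ?S (j + n) * norm h)" by (rule summable_mult2[OF summable_ignore_initial_segment[OF S]])
        have sn: "summable (\<lambda>j. norm (?f' (j + n) x h))"
          by (rule summable_comparison_test'[OF Sn]) (unfold real_norm_def abs_norm_cancel, rule bd)
        have "norm ((\<Sum>i<n. ?f' i x h) - (\<Sum>j. ?f' j x h)) = norm (\<Sum>j. ?f' (j + n) x h)"
          by (simp only: suminf_minus_initial_segment[OF sum'] norm_minus_commute)
        also have "\<dots> \<le> (\<Sum>j. norm (?f' (j + n) x h))" by (rule summable_norm[OF sn])
        also have "\<dots> \<le> (\<Sum>j. ?S (j + n) * norm h)" by (rule suminf_le[OF bd sn Sn])
        also have "\<dots> = (\<Sum>j. ?S (j + n)) * norm h"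
          by (rule suminf_mult2[OF summable_ignore_initial_segment[OF S], symmetric])
        also have "\<dots> \<le> e * norm h" using elim by (intro mult_right_mono) auto
        finally show "norm ((\<Sum>i<n. ?f' i x h) - (\<Sum>j. ?f' j x h)) \<le> e * norm h" .
      qed
    qed
  next
    show "(\<lambda>n. ?f n 0) sums (\<Sum>n. ?f n 0)" by (rule summable_sums[OF rapid_summable_wave(2)[OF assms]])
  qed auto
  then obtain g where g: "\<And>x. (\<lambda>j. ?f j x) sums g x" "\<And>x. (g has_derivative (\<lambda>h. \<Sum>j. ?f' j x h)) (at x)" by auto
  have "g = wave_series d p" using sums_unique[OF g(1)] by (auto simp: wave_series_def)
  then show ?thesis using g(2) by simp
qed

lemma partial_wave_series:
  assumes "rapid d p"
  shows "partial b (wave_series d p) = wave_series (\<lambda>j. (- \<i> * complex_of_real (p j \<bullet> b)) * d j) p"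
proof
  fix x
  show "partial b (wave_series d p) x = wave_series (\<lambda>j. (- \<i> * complex_of_real (p j \<bullet> b)) * d j) p x"
    unfolding partial_eqI[OF wave_series_has_derivative[OF assms]] wave_series_def by (simp only: mult_ac)
qed

lemma smooth_wave_series:
  assumes "rapid d p"
  shows "smooth (wave_series d p)"
proof -
  have "cdiff n (wave_series d p)" if "rapid d p" for n d
    using that
  proof (induction n arbitrary: d)
    case 0
    then show ?case using wave_series_has_derivative by (auto intro: differentiableI)
  next
    case (Suc n)
    have "cdiff n (partial b (wave_series d p))" if "b \<in> Basis" for b
      unfolding partial_wave_series[OF Suc.prems] by (rule Suc.IH[OF rapid_partial[OF Suc.prems that]])
    then show ?case using wave_series_has_derivative[OF Suc.prems] by (auto intro: differentiableI)
  qed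
  then show ?thesis using assms by (simp add: smooth_iff_cdiff)
qed

lemma ck_bounded_wave_series:
  "rapid d p \<Longrightarrow> ck_bounded m UNIV (\<Sum>j. cmod (d j) * (1 + norm (p j)) ^ m) (wave_series d p)"
proof (induction m arbitrary: d)
  case 0
  then show ?case using norm_wave_series_le by auto
next
  case (Suc m)
  let ?d = "\<lambda>b j. (- \<i> * complex_of_real (p j \<bullet> b)) * d j"
  have "cmod (wave_series d p x) \<le> (\<Sum>j. cmod (d j) * (1 + norm (p j)) ^ Suc m)" for x
  proof (rule order_trans[OF norm_wave_series_le[OF Suc.prems] suminf_le])
    show "cmod (d j) \<le> cmod (d j) * (1 + norm (p j)) ^ Suc m" for j
      using mult_left_mono[OF one_le_power[of "1 + norm (p j)" "Suc m"], of "cmod (d j)"] by simp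
  qed (rule rapid_summable_wave(1)[OF Suc.prems], rule rapid_summable[OF Suc.prems])
  moreover have "ck_bounded m UNIV (\<Sum>j. cmod (d j) * (1 + norm (p j)) ^ Suc m) (partial b (wave_series d p))"
    if b: "b \<in> Basis" for b
    unfolding partial_wave_series[OF Suc.prems]
  proof (rule ck_bounded_mono[OF Suc.IH[OF rapid_partial[OF Suc.prems b]]])
    show "(\<Sum>j. cmod (?d b j) * (1 + norm (p j)) ^ m) \<le> (\<Sum>j. cmod (d j) * (1 + norm (p j)) ^ Suc m)"
    proof (rule suminf_le)
      fix j
      have "\<bar>p j \<bullet> b\<bar> * (cmod (d j) * (1 + norm (p j)) ^ m) \<le> (1 + norm (p j)) * (cmod (d j) * (1 + norm (p j)) ^ m)"
        using Basis_le_norm[OF b, of "p j"] by (intro mult_right_mono) auto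
      then show "cmod (?d b j) * (1 + norm (p j)) ^ m \<le> cmod (d j) * (1 + norm (p j)) ^ Suc m"
        by (simp add: norm_mult mult_ac)
    qed (rule rapid_summable[OF rapid_partial[OF Suc.prems b]], rule rapid_summable[OF Suc.prems])
  qed auto
  ultimately show ?case by simp
qed

text \<open>The Fourier transform of \<open>\<alpha> u\<close> without the choice hidden in
  \<open>dist_pairing\<close>; \<open>dist_fourier_eq\<close> identifies the two.\<close>

definition local_ft :: "(('a::euclidean_space \<Rightarrow> complex) \<Rightarrow> complex) \<Rightarrow> ('a \<Rightarrow> complex) \<Rightarrow> 'a \<Rightarrow> complex" where
  "local_ft u \<alpha> k = u (\<lambda>x. \<alpha> x * wave k x)"

lemma test_functions_wave: "\<alpha> \<in> test_functions \<Longrightarrow> (\<lambda>x. \<alpha> x * wave k x) \<in> test_functions"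
  by (intro test_functions_mult smooth_wave)

lemma test_functions_wave_series: "\<alpha> \<in> test_functions \<Longrightarrow> rapid d p \<Longrightarrow> (\<lambda>x. \<alpha> x * wave_series d p x) \<in> test_functions"
  by (intro test_functions_mult smooth_wave_series)

lemma ck_bounded_times_wave_series:
  assumes \<alpha>: "\<alpha> \<in> test_functions"
  obtains C where "0 \<le> C"
    "\<And>d p. rapid d p \<Longrightarrow> ck_bounded m UNIV (C * (\<Sum>j. cmod (d j) * (1 + norm (p j)) ^ m)) (\<lambda>x. \<alpha> x * wave_series d p x)"
proof -
  obtain c where c: "0 \<le> c" "ck_bounded m UNIV c \<alpha>" using test_function_ck_bounded[OF \<alpha>] by blast
  show thesis
  proof (rule that[of "2^m * c"])
    fix d and p :: "nat \<Rightarrow> 'a" assume d: "rapid d p"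
    show "ck_bounded m UNIV (2^m * c * (\<Sum>j. cmod (d j) * (1 + norm (p j)) ^ m)) (\<lambda>x. \<alpha> x * wave_series d p x)"
      by (intro ck_bounded_mult c test_functions_smooth[OF \<alpha>] smooth_wave_series ck_bounded_wave_series d
        suminf_nonneg rapid_summable) auto
  qed (use c in auto)
qed

lemma rapid_offset: "rapid d p \<Longrightarrow> rapid (\<lambda>j. d (j + n)) (\<lambda>j. p (j + n))"
  unfolding rapid_def by (auto intro: summable_ignore_initial_segment[where f =
    "\<lambda>j. cmod (d j) * (1 + norm (p j)) ^ _"])

text \<open>The tails of the series, multiplied by \<open>\<alpha>\<close>, tend to 0 with all
  derivatives up to the order of \<open>u\<close> on the support of \<open>\<alpha>\<close>.\<close>

lemma distribution_wave_series_sums: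
  assumes u: "u \<in> distributions" and \<alpha>: "\<alpha> \<in> test_functions" and d: "rapid d p"
  shows "(\<lambda>j. d j * local_ft u \<alpha> (p j)) sums u (\<lambda>x. \<alpha> x * wave_series d p x)"
proof -
  have lin: "test_functional u" using u by (rule distributions_test_functional)
  obtain m C where mC: "0 \<le> C" "dist_bound u (supp_fun \<alpha>) m C"
    by (rule distribution_dist_bound[OF u test_functions_compact[OF \<alpha>]])
  obtain D where D: "0 \<le> D"
    "\<And>d p. rapid d p \<Longrightarrow> ck_bounded m UNIV (D * (\<Sum>j. cmod (d j) * (1 + norm (p j)) ^ m)) (\<lambda>x. \<alpha> x * wave_series d p x)"
    using ck_bounded_times_wave_series[OF \<alpha>, of m] by blast
  let ?T = "\<lambda>n. \<Sum>j. cmod (d (j + n)) * (1 + norm (p (j + n))) ^ m"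
  have bound: "norm (u (\<lambda>x. \<alpha> x * wave_series d p x) - (\<Sum>j<n. d j * local_ft u \<alpha> (p j))) \<le> C * (D * ?T n)" for n
  proof -
    have "(\<lambda>x. \<alpha> x * wave_series d p x) =
      (\<lambda>x. (\<Sum>j<n. d j * (\<alpha> x * wave (p j) x)) + \<alpha> x * wave_series (\<lambda>j. d (j + n)) (\<lambda>j. p (j + n)) x)"
      unfolding wave_series_def suminf_minus_initial_segment[OF rapid_summable_wave(2)[OF d]]
      by (simp add: right_diff_distrib sum_distrib_left mult_ac)
    then have "u (\<lambda>x. \<alpha> x * wave_series d p x) =
      u (\<lambda>x. (\<Sum>j<n. d j * (\<alpha> x * wave (p j) x)) + \<alpha> x * wave_series (\<lambda>j. d (j + n)) (\<lambda>j. p (j + n)) x)"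
      by (rule arg_cong)
    also have "\<dots> = (\<Sum>j<n. d j * local_ft u \<alpha> (p j)) + u (\<lambda>x. \<alpha> x * wave_series (\<lambda>j. d (j + n)) (\<lambda>j. p (j + n)) x)"
      using test_functional_sum[OF lin, of "{..<n}" "\<lambda>j x. d j * (\<alpha> x * wave (p j) x)"]
      by (subst test_functional_add[OF lin])
         (simp_all add: test_functions_wave_series[OF \<alpha> rapid_offset[OF d]] test_functions_sum test_functions_cmult
           test_functions_wave[OF \<alpha>] test_functional_cmult[OF lin] local_ft_def)
    finally have "norm (u (\<lambda>x. \<alpha> x * wave_series d p x) - (\<Sum>j<n. d j * local_ft u \<alpha> (p j))) =
      cmod (u (\<lambda>x. \<alpha> x * wave_series (\<lambda>j. d (j + n)) (\<lambda>j. p (j + n)) x))"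
      by simp
    also have "\<dots> \<le> C * (D * ?T n)"
      using supp_fun_mult[of \<alpha> "wave_series (\<lambda>j. d (j + n)) (\<lambda>j. p (j + n))"]
      by (intro dist_boundD[OF mC(2)] test_functions_wave_series[OF \<alpha>] D(2) rapid_offset[OF d]) auto
    finally show ?thesis .
  qed
  have "(\<lambda>n. C * (D * ?T n)) \<longlonglongrightarrow> C * (D * 0)"
    by (intro tendsto_intros suminf_tail_tendsto_0[OF rapid_summable[OF d]])
  then have lim0: "(\<lambda>n. C * (D * ?T n)) \<longlonglongrightarrow> 0" by simp
  have "(\<lambda>n. u (\<lambda>x. \<alpha> x * wave_series d p x) - (\<Sum>j<n. d j * local_ft u \<alpha> (p j))) \<longlonglongrightarrow> 0"
    by (rule Lim_null_comparison[OF always_eventually[OF allI[OF bound]] lim0])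
  from tendsto_diff[OF tendsto_const[of "u (\<lambda>x. \<alpha> x * wave_series d p x)"] this]
  show ?thesis unfolding sums_def by simp
qed

section \<open>Near and far frequencies\<close>

text \<open>One order and one constant on each compact set for all members of \<open>A\<close>: the
  form in which boundedness of a set of distributions enters the estimates.\<close>

definition equicontinuous :: "(('a::euclidean_space \<Rightarrow> complex) \<Rightarrow> complex) set \<Rightarrow> bool" where
  "equicontinuous A \<longleftrightarrow> A \<subseteq> distributions \<and> (\<forall>K. compact K \<longrightarrow> (\<exists>m. \<exists>C\<ge>0. \<forall>u\<in>A. dist_bound u K m C))"

lemma equicontinuousD:
  assumes "equicontinuous A" "compact K"
  obtains m C where "0 \<le> C" "\<And>u. u \<in> A \<Longrightarrow> dist_bound u K m C"
proof -
  have "\<exists>m. \<exists>C\<ge>0. \<forall>u\<in>A. dist_bound u K m C" using assms by (simp add: equicontinuous_def)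
  then show thesis using that by auto
qed

lemma equicontinuous_local_ft:
  assumes A: "equicontinuous A" and \<alpha>: "\<alpha> \<in> test_functions"
  obtains M C where "0 \<le> C" "\<And>u k. u \<in> A \<Longrightarrow> cmod (local_ft u \<alpha> k) \<le> C * (1 + norm k) ^ M"
proof -
  obtain m C where mC: "0 \<le> C" "\<And>u. u \<in> A \<Longrightarrow> dist_bound u (supp_fun \<alpha>) m C"
    by (rule equicontinuousD[OF A test_functions_compact[OF \<alpha>]]) (rule that)
  obtain c where c: "0 \<le> c" "ck_bounded m UNIV c \<alpha>" using test_function_ck_bounded[OF \<alpha>] by blast
  show thesis
  proof (rule that[of "C * (2 ^ m * c)" m])
    fix u k assume u: "u \<in> A"
    have "cmod (local_ft u \<alpha> k) \<le> C * (2 ^ m * c * (1 + norm k) ^ m)"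
      unfolding local_ft_def
    proof (rule dist_boundD[OF mC(2)[OF u] test_functions_wave[OF \<alpha>]])
      show "supp_fun (\<lambda>x. \<alpha> x * wave k x) \<subseteq> supp_fun \<alpha>" using supp_fun_mult[of \<alpha> "wave k"] by simp
      show "ck_bounded m UNIV (2 ^ m * c * (1 + norm k) ^ m) (\<lambda>x. \<alpha> x * wave k x)"
        by (intro ck_bounded_mult c ck_bounded_wave smooth_wave test_functions_smooth[OF \<alpha>]) auto
    qed
    then show "cmod (local_ft u \<alpha> k) \<le> C * (2 ^ m * c) * (1 + norm k) ^ m" by (simp add: mult.assoc)
  qed (use mC c in auto)
qed

text \<open>The directions within \<open>\<epsilon>\<close> of the unit vector
  \<open>\<kappa>\<close>, multiplied through by \<open>norm k\<close>: this avoids division,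
  includes 0 and makes the cone closed.\<close>

definition cone_nbhd :: "'a::euclidean_space \<Rightarrow> real \<Rightarrow> 'a set" where
  "cone_nbhd \<kappa> \<epsilon> = {k. norm (k - norm k *\<^sub>R \<kappa>) \<le> \<epsilon> * norm k}"

text \<open>The opening is divided by 4 so that the deviations add up:
  \<open>\<epsilon> / 4 * norm k\<close> from \<open>k\<close> and twice \<open>norm p\<close> from
  the shift give at most \<open>3 / 4 * \<epsilon> * norm k\<close>, while
  \<open>norm (k + p)\<close> is still at least \<open>3 / 4 * norm k\<close>.\<close>

lemma cone_nbhd_near:
  assumes \<kappa>: "norm \<kappa> = 1" and \<epsilon>: "0 < \<epsilon>" "\<epsilon> \<le> 1" and k: "k \<in> cone_nbhd \<kappa> (\<epsilon> / 4)" and p: "norm p \<le> \<epsilon> / 4 * norm k"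
  shows "k + p \<in> cone_nbhd \<kappa> \<epsilon>" "1 + norm k \<le> 2 * (1 + norm (k + p))"
proof -
  have "\<epsilon> / 4 * norm k \<le> 1 / 4 * norm k" using \<epsilon> by (intro mult_right_mono) auto
  then have p1: "norm p \<le> 1 / 4 * norm k" using p by linarith
  have n: "norm k - norm p \<le> norm (k + p)" by (rule norm_diff_ineq)
  have "norm ((k + p) - norm (k + p) *\<^sub>R \<kappa>) = norm ((k - norm k *\<^sub>R \<kappa>) + (p + (norm k - norm (k + p)) *\<^sub>R \<kappa>))"
    by (simp add: algebra_simps)
  also have "\<dots> \<le> norm (k - norm k *\<^sub>R \<kappa>) + (norm p + \<bar>norm k - norm (k + p)\<bar>)"
    using norm_triangle_ineq[of "k - norm k *\<^sub>R \<kappa>" "p + (norm k - norm (k + p)) *\<^sub>R \<kappa>"]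
      norm_triangle_ineq[of p "(norm k - norm (k + p)) *\<^sub>R \<kappa>"] \<kappa> by simp
  also have "\<bar>norm k - norm (k + p)\<bar> \<le> norm p" using norm_triangle_ineq[of k p] n by linarith
  finally have 1: "norm ((k + p) - norm (k + p) *\<^sub>R \<kappa>) \<le> \<epsilon> * (3 / 4 * norm k)"
    using k p by (simp add: cone_nbhd_def)
  also have "\<dots> \<le> \<epsilon> * norm (k + p)" using n p1 \<epsilon> by (intro mult_left_mono) linarith+
  finally show "k + p \<in> cone_nbhd \<kappa> \<epsilon>" by (simp add: cone_nbhd_def)
  have "3 / 4 * norm k \<le> norm (k + p)" using n p1 by linarith
  then show "1 + norm k \<le> 2 * (1 + norm (k + p))" unfolding distrib_left using norm_ge_zero[of k] by linarith
qed

lemma far_frequency: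
  assumes "0 < \<epsilon>" "\<epsilon> \<le> 1" "\<not> norm p \<le> \<epsilon> / 4 * norm k"
  shows "1 + norm k \<le> 8 / \<epsilon> * (1 + norm p)"
proof -
  have "\<epsilon> * norm k < 4 * norm p" using assms(3) by (simp add: field_simps not_le)
  then have "\<epsilon> * (1 + norm k) \<le> 8 * (1 + norm p)" unfolding distrib_left using assms(2) norm_ge_zero[of p] by linarith
  then show ?thesis using assms(1) by (simp add: field_simps)
qed

lemma one_add_norm_add_le: "1 + norm (k + p) \<le> (1 + norm k) * (1 + norm p)"
  using norm_triangle_ineq[of k p] mult_nonneg_nonneg[OF norm_ge_zero[of k] norm_ge_zero[of p]]
  unfolding distrib_left distrib_right mult_1 mult_1_right by linarith

text \<open>A shift \<open>p\<close> that is small compared with \<open>k\<close> keeps \<open>k + p\<close> in the cone of decay; a large one is paid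
  for by powers of its norm.\<close>

lemma near_far_bound:
  assumes \<kappa>: "norm \<kappa> = 1" and \<epsilon>: "0 < \<epsilon>" "\<epsilon> \<le> 1"
    and C: "0 \<le> C1" "0 \<le> C2" "\<And>k. a k \<le> C1 * (1 + norm k) ^ M" "\<And>k. k \<in> cone_nbhd \<kappa> \<epsilon> \<Longrightarrow> (1 + norm k) ^ N * a k \<le> C2"
    and a: "\<And>k. 0 \<le> a k"
    and k: "k \<in> cone_nbhd \<kappa> (\<epsilon> / 4)"
  shows "(1 + norm k) ^ N * a (k + p) \<le> (2 ^ N * C2 + C1 * (8 / \<epsilon>) ^ (N + M)) * (1 + norm p) ^ (N + M + M)"
proof (cases "norm p \<le> \<epsilon> / 4 * norm k")
  case True
  note near = cone_nbhd_near[OF \<kappa> \<epsilon> k True]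
  have "(1 + norm k) ^ N * a (k + p) \<le> (2 * (1 + norm (k + p))) ^ N * a (k + p)"
    using near(2) a by (intro mult_right_mono power_mono) auto
  also have "\<dots> = 2 ^ N * ((1 + norm (k + p)) ^ N * a (k + p))" by (simp only: power_mult_distrib mult.assoc)
  also have "\<dots> \<le> 2 ^ N * C2" using C(4)[OF near(1)] by simp
  also have "\<dots> \<le> (2 ^ N * C2 + C1 * (8 / \<epsilon>) ^ (N + M)) * 1" using C \<epsilon> by simp
  also have "\<dots> \<le> (2 ^ N * C2 + C1 * (8 / \<epsilon>) ^ (N + M)) * (1 + norm p) ^ (N + M + M)"
    using C \<epsilon> by (intro mult_left_mono one_le_power add_nonneg_nonneg mult_nonneg_nonneg) auto
  finally show ?thesis .
next
  case False
  note far = far_frequency[OF \<epsilon> False]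
  have "(1 + norm k) ^ N * a (k + p) \<le> (1 + norm k) ^ N * (C1 * ((1 + norm k) * (1 + norm p)) ^ M)"
    using C(1) by (intro mult_left_mono order_trans[OF C(3)] power_mono one_add_norm_add_le) auto
  also have "\<dots> = C1 * (1 + norm k) ^ (N + M) * (1 + norm p) ^ M" by (simp only: power_mult_distrib power_add mult_ac)
  also have "\<dots> \<le> C1 * (8 / \<epsilon> * (1 + norm p)) ^ (N + M) * (1 + norm p) ^ M"
    using far C(1) by (intro mult_right_mono mult_left_mono power_mono) auto
  also have "\<dots> = C1 * (8 / \<epsilon>) ^ (N + M) * (1 + norm p) ^ (N + M + M)"
    by (simp only: power_mult_distrib power_add mult_ac)
  also have "\<dots> \<le> (2 ^ N * C2 + C1 * (8 / \<epsilon>) ^ (N + M)) * (1 + norm p) ^ (N + M + M)"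
    using C by (intro mult_right_mono) auto
  finally show ?thesis .
qed

text \<open>The value of the tensor product of \<open>u\<close> and \<open>v\<close> on \<open>\<alpha>(x) \<beta>(y) g(x, y) exp(-i k (x + y))\<close>, where \<open>g\<close> is the
  superposition of the waves with frequencies \<open>(p j, q j)\<close> and amplitudes \<open>c j\<close>.\<close>

definition bilinear_series :: "(nat \<Rightarrow> complex) \<Rightarrow> (nat \<Rightarrow> 'a) \<Rightarrow> (nat \<Rightarrow> 'a) \<Rightarrow> ('a \<Rightarrow> complex) \<Rightarrow> ('a \<Rightarrow> complex) \<Rightarrow>
    (('a::euclidean_space \<Rightarrow> complex) \<Rightarrow> complex) \<Rightarrow> (('a \<Rightarrow> complex) \<Rightarrow> complex) \<Rightarrow> 'a \<Rightarrow> complex" where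
  "bilinear_series c p q \<alpha> \<beta> u v k = (\<Sum>j. c j * (local_ft u \<alpha> (k + p j) * local_ft v \<beta> (k + q j)))"

lemma bilinear_series_swap: "bilinear_series c p q \<alpha> \<beta> u v = bilinear_series c q p \<beta> \<alpha> v u"
  by (simp add: bilinear_series_def mult.commute fun_eq_iff)

definition test_sup :: "('a::euclidean_space \<Rightarrow> complex) set \<Rightarrow> (('a \<Rightarrow> complex) \<Rightarrow> complex) \<Rightarrow> ennreal" where
  "test_sup B v = (SUP \<phi>\<in>B. ennreal (cmod (v \<phi>)))"

lemma test_sup_upper: "\<phi> \<in> B \<Longrightarrow> ennreal (cmod (v \<phi>)) \<le> test_sup B v"
  unfolding test_sup_def by (rule SUP_upper)

text \<open>A majorant \<open>T m\<close> common to all pairs in \<open>S\<close> bounds the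
  derivatives up to order \<open>m\<close> uniformly, and the factor \<open>\<beta>\<close> fixes
  the support.\<close>

lemma bounded_tests_wave_series:
  fixes \<beta> :: "'a::euclidean_space \<Rightarrow> complex"
  assumes \<beta>: "\<beta> \<in> test_functions" and T: "\<And>m. summable (T m)"
    and DQ: "\<And>D Q m j. (D, Q) \<in> S \<Longrightarrow> cmod (D j) * (1 + norm (Q j)) ^ m \<le> T m j"
  shows "bounded_tests ((\<lambda>(D, Q) x. \<beta> x * wave_series D Q x) ` S)"
    and "\<And>D Q. (D, Q) \<in> S \<Longrightarrow> rapid D Q"
proof -
  show rap: "rapid D Q" if "(D, Q) \<in> S" for D Q
    unfolding rapid_def
  proof
    fix m
    show "summable (\<lambda>j. cmod (D j) * (1 + norm (Q j)) ^ m)"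
      by (rule summable_comparison_test'[OF T[of m]]) (use DQ[OF that] in auto)
  qed
  show "bounded_tests ((\<lambda>(D, Q) x. \<beta> x * wave_series D Q x) ` S)"
    unfolding bounded_tests_def
  proof (intro conjI allI)
    show "(\<lambda>(D, Q) x. \<beta> x * wave_series D Q x) ` S \<subseteq> test_functions"
      using test_functions_wave_series[OF \<beta> rap] by auto
    have "supp_fun \<phi> \<subseteq> supp_fun \<beta>" if \<phi>: "\<phi> \<in> (\<lambda>(D, Q) x. \<beta> x * wave_series D Q x) ` S" for \<phi>
    proof -
      obtain D Q where "\<phi> = (\<lambda>x. \<beta> x * wave_series D Q x)" using \<phi> by auto
      then show ?thesis using supp_fun_mult[of \<beta> "wave_series D Q"] by simp
    qed
    then show "\<exists>K. compact K \<and> (\<forall>\<phi>\<in>(\<lambda>(D, Q) x. \<beta> x * wave_series D Q x) ` S. supp_fun \<phi> \<subseteq> K)"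
      using test_functions_compact[OF \<beta>] by (intro exI[of _ "supp_fun \<beta>"]) auto
    fix m
    obtain C where C: "0 \<le> C"
      "\<And>d p. rapid d p \<Longrightarrow>
      ck_bounded m UNIV (C * (\<Sum>j. cmod (d j) * (1 + norm (p j)) ^ m)) (\<lambda>x. \<beta> x * wave_series d p x)"
      using ck_bounded_times_wave_series[OF \<beta>, of m] by blast
    have "ck_bounded m UNIV (C * suminf (T m)) (\<lambda>x. \<beta> x * wave_series D Q x)" if DQS: "(D, Q) \<in> S" for D Q
    proof (rule ck_bounded_mono[OF C(2)[OF rap[OF DQS]]])
      show "C * (\<Sum>j. cmod (D j) * (1 + norm (Q j)) ^ m) \<le> C * suminf (T m)"
        by (intro mult_left_mono C suminf_le DQ[OF DQS] rapid_summable[OF rap[OF DQS]] T)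
    qed auto
    then show "\<exists>c. \<forall>\<phi>\<in>(\<lambda>(D, Q) x. \<beta> x * wave_series D Q x) ` S. ck_bounded m UNIV c \<phi>"
      by (intro exI[of _ "C * suminf (T m)"]) auto
  qed
qed

lemma norm_snd_le_Pair: "norm (q::'a::euclidean_space) \<le> norm (p::'a, q)" "norm p \<le> norm (p, q)"
  using norm_snd_le[of q p] norm_fst_le[of p q] by auto

lemma sums_mult_cancel:
  fixes a :: complex
  shows "a \<noteq> 0 \<Longrightarrow> (\<lambda>j. a * f j) sums s \<Longrightarrow> f sums (s / a)"
  using sums_divide[of "\<lambda>j. a * f j" s a] by simp

text \<open>The Fourier transform of \<open>\<alpha> u\<close> and the weight
  \<open>(1 + norm k) ^ N\<close> go into the coefficients \<open>D u k\<close>, so that the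
  weighted series is \<open>v\<close> applied to \<open>\<beta>\<close> times a wave series. Over
  all \<open>u\<close> in \<open>A\<close> and all \<open>k\<close> in the smaller cone these
  functions form the bounded set \<open>B\<close>.\<close>

lemma bilinear_series_decaying_left:
  fixes c :: "nat \<Rightarrow> complex" and p q :: "nat \<Rightarrow> 'a::euclidean_space"
  assumes \<kappa>: "norm \<kappa> = 1" and \<epsilon>: "0 < \<epsilon>" "\<epsilon> \<le> 1" and c: "rapid c (\<lambda>j. (p j, q j))"
    and \<alpha>: "\<alpha> \<in> test_functions" and \<beta>: "\<beta> \<in> test_functions" and A: "equicontinuous A"
    and dec: "\<And>N. \<exists>C\<ge>0. \<forall>u\<in>A. \<forall>k\<in>cone_nbhd \<kappa> \<epsilon>. (1 + norm k) ^ N * cmod (local_ft u \<alpha> k) \<le> C"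
  obtains B where "bounded_tests B" "\<And>u v k. u \<in> A \<Longrightarrow> v \<in> distributions \<Longrightarrow> k \<in> cone_nbhd \<kappa> (\<epsilon> / 4) \<Longrightarrow>
    ennreal ((1 + norm k) ^ N * cmod (bilinear_series c p q \<alpha> \<beta> u v k)) \<le> test_sup B v"
proof -
  obtain M C1 where C1: "0 \<le> C1" "\<And>u k. u \<in> A \<Longrightarrow> cmod (local_ft u \<alpha> k) \<le> C1 * (1 + norm k) ^ M"
    by (rule equicontinuous_local_ft[OF A \<alpha>]) (rule that)
  have "\<forall>N. \<exists>C. 0 \<le> C \<and> (\<forall>u\<in>A. \<forall>k\<in>cone_nbhd \<kappa> \<epsilon>. (1 + norm k) ^ N * cmod (local_ft u \<alpha> k) \<le> C)" using dec by blast
  from choice[OF this] obtain C2 where C2: "\<And>N. 0 \<le> C2 N"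
    "\<And>N u k. u \<in> A \<Longrightarrow> k \<in> cone_nbhd \<kappa> \<epsilon> \<Longrightarrow> (1 + norm k) ^ N * cmod (local_ft u \<alpha> k) \<le> C2 N"
    by auto
  define D where "D u k j = complex_of_real ((1 + norm k) ^ N) * (c j * local_ft u \<alpha> (k + p j))" for u k j
  define S where "S = {(D u k, \<lambda>j. k + q j) | u k. u \<in> A \<and> k \<in> cone_nbhd \<kappa> (\<epsilon> / 4)}"
  \<comment> \<open>The waves have frequencies \<open>k + q j\<close>, so \<open>m\<close>
    derivatives cost \<open>(1 + norm k) ^ m\<close>; the decay of the first transform is therefore
    used at order \<open>N + m\<close>. The constant is that of
    \<open>near_far_bound\<close>.\<close>
  define E where "E m = 2 ^ (N + m) * C2 (N + m) + C1 * (8 / \<epsilon>) ^ (N + m + M)" for m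
  define T where "T m j = E m * (cmod (c j) * (1 + norm (p j, q j)) ^ (N + m + M + M + m))" for m j
  have E: "E m \<ge> 0" for m unfolding E_def using C1 C2 \<epsilon> by (intro add_nonneg_nonneg mult_nonneg_nonneg) auto
  have T: "summable (T m)" for m
    unfolding T_def by (intro summable_mult rapid_summable[OF c])
  have DQ: "cmod (D' j) * (1 + norm (Q j)) ^ m \<le> T m j" if S: "(D', Q) \<in> S" for D' Q m j
  proof -
    obtain u k where uk: "D' = D u k" "Q = (\<lambda>j. k + q j)" "u \<in> A" "k \<in> cone_nbhd \<kappa> (\<epsilon> / 4)" using S
      by (auto simp: S_def)
    let ?r = "1 + norm (p j, q j)"
    have "(1 + norm k) ^ (N + m) * cmod (local_ft u \<alpha> (k + p j)) \<le> E m * (1 + norm (p j)) ^ (N + m + M + M)"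
      unfolding E_def
      by (rule near_far_bound[OF \<kappa> \<epsilon>, where a = "\<lambda>k. cmod (local_ft u \<alpha> k)"]) (use C1 C2 uk in auto)
    also have "\<dots> \<le> E m * ?r ^ (N + m + M + M)"
      using E norm_snd_le_Pair by (intro mult_left_mono power_mono add_left_mono) auto
    finally have 1: "(1 + norm k) ^ (N + m) * cmod (local_ft u \<alpha> (k + p j)) \<le> E m * ?r ^ (N + m + M + M)" .
    have "(1 + norm (k + q j)) ^ m \<le> ((1 + norm k) * ?r) ^ m"
      using norm_snd_le_Pair by (intro power_mono order_trans[OF one_add_norm_add_le] mult_left_mono add_left_mono) auto
    then have "cmod (D' j) * (1 + norm (Q j)) ^ m \<le> cmod (D' j) * ((1 + norm k) * ?r) ^ m"
      unfolding uk by (intro mult_left_mono) auto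
    also have "\<dots> = cmod (c j) * ?r ^ m * ((1 + norm k) ^ (N + m) * cmod (local_ft u \<alpha> (k + p j)))"
      unfolding uk D_def norm_mult norm_of_real by (simp add: power_mult_distrib power_add mult_ac)
    also have "\<dots> \<le> cmod (c j) * ?r ^ m * (E m * ?r ^ (N + m + M + M))"
      by (intro mult_left_mono 1) auto
    also have "\<dots> = T m j" unfolding T_def by (simp only: power_add mult_ac)
    finally show ?thesis .
  qed
  have ser1: "bounded_tests ((\<lambda>(D, Q) x. \<beta> x * wave_series D Q x) ` S)"
    by (rule bounded_tests_wave_series(1)[where T = T and S = S, OF \<beta> T]) (rule DQ)
  have ser2: "rapid D' Q" if "(D', Q) \<in> S" for D' Q
    by (rule bounded_tests_wave_series(2)[where T = T and S = S, OF \<beta> T _ that]) (rule DQ)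
  show thesis
  proof (rule that[OF ser1])
    fix u v :: "('a \<Rightarrow> complex) \<Rightarrow> complex" and k assume u: "u \<in> A" and v: "v \<in> distributions"
      and k: "k \<in> cone_nbhd \<kappa> (\<epsilon> / 4)"
    have S: "(D u k, \<lambda>j. k + q j) \<in> S" using u k by (auto simp: S_def)
    note sums = distribution_wave_series_sums[OF v \<beta> ser2[OF S]]
    let ?\<phi> = "\<lambda>x. \<beta> x * wave_series (D u k) (\<lambda>j. k + q j) x"
    have K: "complex_of_real ((1 + norm k) ^ N) \<noteq> 0" unfolding of_real_eq_0_iff using norm_ge_zero[of k]
      by (simp add: add_nonneg_eq_0_iff)
    have "(\<lambda>j. complex_of_real ((1 + norm k) ^ N) * (c j * (local_ft u \<alpha> (k + p j) * local_ft v \<beta> (k + q j)))) sums v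
      ?\<phi>"
      using sums by (simp add: D_def mult.assoc)
    then have "(\<lambda>j. c j * (local_ft u \<alpha> (k + p j) * local_ft v \<beta> (k + q j))) sums
      (v ?\<phi> / complex_of_real ((1 + norm k) ^ N))"
      by (rule sums_mult_cancel[OF K])
    then have "bilinear_series c p q \<alpha> \<beta> u v k = v ?\<phi> / complex_of_real ((1 + norm k) ^ N)"
      unfolding bilinear_series_def by (rule sums_unique[symmetric])
    then have "(1 + norm k) ^ N * cmod (bilinear_series c p q \<alpha> \<beta> u v k) = cmod (v ?\<phi>)"
      using K by (simp add: norm_divide norm_power del: of_real_power)
    also have "ennreal \<dots> \<le> test_sup ((\<lambda>(D, Q) x. \<beta> x * wave_series D Q x) ` S) v"
      by (rule test_sup_upper) (use S in force)
    finally show "ennreal ((1 + norm k) ^ N * cmod (bilinear_series c p q \<alpha> \<beta> u v k)) \<le>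
      test_sup ((\<lambda>(D, Q) x. \<beta> x * wave_series D Q x) ` S) v" .
  qed
qed

definition local_decay :: "nat \<Rightarrow> 'a set \<Rightarrow> ('a \<Rightarrow> complex) \<Rightarrow> (('a::euclidean_space \<Rightarrow> complex) \<Rightarrow> complex) \<Rightarrow> ennreal" where
  "local_decay N V \<psi> u = (SUP k\<in>V. ennreal ((1 + norm k) ^ N * cmod (local_ft u \<psi> k)))"

lemma local_decay_le_iff: "0 \<le> C \<Longrightarrow> local_decay N V \<psi> u \<le> ennreal C \<longleftrightarrow>
  (\<forall>k\<in>V. (1 + norm k) ^ N * cmod (local_ft u \<psi> k) \<le> C)"
  by (simp add: local_decay_def SUP_le_iff)

text \<open>Without decay of the transform of \<open>\<alpha> u\<close> only the far terms go into
  test functions, because there \<open>norm k\<close> is controlled by \<open>norm (q j)\<close>. In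
  the near terms \<open>k + q j\<close> stays in the cone on which the decay of the transform of
  \<open>\<beta> v\<close> is measured; the growth of order \<open>M\<close> of the first transform
  raises the order of the seminorm to \<open>N + M\<close>.\<close>

lemma bilinear_series_decaying_right:
  fixes c :: "nat \<Rightarrow> complex" and p q :: "nat \<Rightarrow> 'a::euclidean_space"
  assumes \<kappa>: "norm \<kappa> = 1" and \<epsilon>: "0 < \<epsilon>" "\<epsilon> \<le> 1" and c: "rapid c (\<lambda>j. (p j, q j))"
    and \<alpha>: "\<alpha> \<in> test_functions" and \<beta>: "\<beta> \<in> test_functions" and A: "equicontinuous A"
  obtains B N' C where "bounded_tests B" "0 < C" "\<And>u v k. u \<in> A \<Longrightarrow> v \<in> distributions \<Longrightarrow> k \<in> cone_nbhd \<kappa> (\<epsilon> / 4) \<Longrightarrow>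
    ennreal ((1 + norm k) ^ N * cmod (bilinear_series c p q \<alpha> \<beta> u v k)) \<le> test_sup B v + ennreal C * local_decay N'
      (cone_nbhd \<kappa> \<epsilon>) \<beta> v"
proof -
  obtain M C1 where C1: "0 \<le> C1" "\<And>u k. u \<in> A \<Longrightarrow> cmod (local_ft u \<alpha> k) \<le> C1 * (1 + norm k) ^ M"
    by (rule equicontinuous_local_ft[OF A \<alpha>]) (rule that)
  define near where "near k j \<longleftrightarrow> norm (q j) \<le> \<epsilon> / 4 * norm k" for k :: 'a and j
  define D where "D u k j =
    (if near k j then 0 else complex_of_real ((1 + norm k) ^ N) * (c j * local_ft u \<alpha> (k + p j)))" for u k j
  define S where "S = {(D u k, \<lambda>j. k + q j) | u k. u \<in> A \<and> k \<in> cone_nbhd \<kappa> (\<epsilon> / 4)}"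
  define E where "E m = C1 * (8 / \<epsilon>) ^ (N + m + M)" for m
  define T where "T m j = E m * (cmod (c j) * (1 + norm (p j, q j)) ^ (N + m + M + M + m))" for m j
  have E: "E m \<ge> 0" for m unfolding E_def using C1 \<epsilon> by (intro mult_nonneg_nonneg) auto
  have T: "summable (T m)" for m
    unfolding T_def by (intro summable_mult rapid_summable[OF c])
  have ft: "cmod (local_ft u \<alpha> (k + p j)) \<le> C1 * ((1 + norm k) * (1 + norm (p j, q j))) ^ M" if "u \<in> A" for u k j
  proof -
    have "(1 + norm (k + p j)) ^ M \<le> ((1 + norm k) * (1 + norm (p j, q j))) ^ M"
      using norm_snd_le_Pair by (intro power_mono order_trans[OF one_add_norm_add_le] mult_left_mono add_left_mono) auto
    then show ?thesis using C1(1) by (intro order_trans[OF C1(2)[OF that]] mult_left_mono)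
  qed
  have DQ: "cmod (D' j) * (1 + norm (Q j)) ^ m \<le> T m j" if S: "(D', Q) \<in> S" for D' Q m j
  proof -
    obtain u k where uk: "D' = D u k" "Q = (\<lambda>j. k + q j)" "u \<in> A" "k \<in> cone_nbhd \<kappa> (\<epsilon> / 4)" using S
      by (auto simp: S_def)
    let ?r = "1 + norm (p j, q j)"
    show ?thesis
    proof (cases "near k j")
      case True
      then show ?thesis unfolding uk D_def T_def using E by (auto intro!: mult_nonneg_nonneg)
    next
      case False
      have "1 + norm k \<le> 8 / \<epsilon> * (1 + norm (q j))" using False unfolding near_def by (rule far_frequency[OF \<epsilon>])
      also have "\<dots> \<le> 8 / \<epsilon> * ?r" using \<epsilon> norm_snd_le_Pair by (intro mult_left_mono add_left_mono) auto
      finally have far: "1 + norm k \<le> 8 / \<epsilon> * ?r" .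
      have "(1 + norm (k + q j)) ^ m \<le> ((1 + norm k) * ?r) ^ m"
        using norm_snd_le_Pair
          by (intro power_mono order_trans[OF one_add_norm_add_le] mult_left_mono add_left_mono) auto
      then have "cmod (D' j) * (1 + norm (Q j)) ^ m \<le> cmod (D' j) * ((1 + norm k) * ?r) ^ m"
        unfolding uk by (intro mult_left_mono) auto
      also have "\<dots> = cmod (c j) * ?r ^ m * (1 + norm k) ^ (N + m) * cmod (local_ft u \<alpha> (k + p j))"
        using False unfolding uk D_def
          by (simp add: norm_mult norm_power power_mult_distrib power_add mult_ac del: of_real_power of_real_add)
      also have "\<dots> \<le> cmod (c j) * ?r ^ m * (1 + norm k) ^ (N + m) * (C1 * ((1 + norm k) * ?r) ^ M)"
        by (intro mult_left_mono ft uk) auto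
      also have "\<dots> = cmod (c j) * ?r ^ m * C1 * ?r ^ M * (1 + norm k) ^ (N + m + M)"
        by (simp only: power_mult_distrib power_add mult_ac)
      also have "\<dots> \<le> cmod (c j) * ?r ^ m * C1 * ?r ^ M * (8 / \<epsilon> * ?r) ^ (N + m + M)"
        using far C1(1) by (intro mult_left_mono power_mono mult_nonneg_nonneg) auto
      also have "\<dots> = T m j" unfolding T_def E_def by (simp only: power_mult_distrib power_add mult_ac)
      finally show ?thesis .
    qed
  qed
  have ser1: "bounded_tests ((\<lambda>(D, Q) x. \<beta> x * wave_series D Q x) ` S)"
    by (rule bounded_tests_wave_series(1)[where T = T and S = S, OF \<beta> T]) (rule DQ)
  have ser2: "rapid D' Q" if "(D', Q) \<in> S" for D' Q
    by (rule bounded_tests_wave_series(2)[where T = T and S = S, OF \<beta> T _ that]) (rule DQ)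
  define F where "F j = C1 * 2 ^ (N + M) * (cmod (c j) * (1 + norm (p j, q j)) ^ M)" for j
  have F: "summable F" "\<And>j. 0 \<le> F j" unfolding F_def using C1(1) by (auto intro!: summable_mult rapid_summable[OF c])
  show thesis
  \<comment> \<open>Adding 1 makes the constant positive, so that the bound is infinite, hence
    trivial, whenever \<open>local_decay\<close> is; 0 times infinity would be 0.\<close>
  proof (rule that[OF ser1, of "suminf F + 1" "N + M"])
    show "0 < suminf F + 1" using suminf_nonneg[OF F] by simp
    fix u v :: "('a \<Rightarrow> complex) \<Rightarrow> complex" and k assume u: "u \<in> A" and v: "v \<in> distributions"
      and k: "k \<in> cone_nbhd \<kappa> (\<epsilon> / 4)"
    have S: "(D u k, \<lambda>j. k + q j) \<in> S" using u k by (auto simp: S_def)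
    note sums = distribution_wave_series_sums[OF v \<beta> ser2[OF S]]
    let ?\<phi> = "\<lambda>x. \<beta> x * wave_series (D u k) (\<lambda>j. k + q j) x"
    let ?R = "complex_of_real ((1 + norm k) ^ N)"
    have K: "?R \<noteq> 0" unfolding of_real_eq_0_iff using norm_ge_zero[of k] by (simp add: add_nonneg_eq_0_iff)
    show "ennreal ((1 + norm k) ^ N * cmod (bilinear_series c p q \<alpha> \<beta> u v k)) \<le>
       test_sup ((\<lambda>(D, Q) x. \<beta> x * wave_series D Q x) ` S) v + ennreal (suminf F + 1) * local_decay (N + M) (cone_nbhd
         \<kappa> \<epsilon>) \<beta> v"
    proof (cases "local_decay (N + M) (cone_nbhd \<kappa> \<epsilon>) \<beta> v")
      case top
      have "ennreal (suminf F + 1) \<noteq> 0" using suminf_nonneg[OF F] by simp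
      then show ?thesis unfolding top by (simp add: ennreal_mult_top)
    next
      case (real s)
      then have s: "\<And>l. l \<in> cone_nbhd \<kappa> \<epsilon> \<Longrightarrow> (1 + norm l) ^ (N + M) * cmod (local_ft v \<beta> l) \<le> s"
        using local_decay_le_iff[of s "N + M" "cone_nbhd \<kappa> \<epsilon>" \<beta> v] by auto
      \<comment> \<open>The near terms, which \<open>D u k\<close> leaves out; both families
        together restore the full series.\<close>
      define z where "z j = (if near k j then ?R * (c j * (local_ft u \<alpha> (k + p j) * local_ft v \<beta> (k + q j))) else 0)"
        for j
      have zF: "cmod (z j) \<le> F j * s" for j
      proof (cases "near k j")
        case False
        then show ?thesis using F(2) real by (simp add: z_def)
      next
        case True
        let ?r = "1 + norm (p j, q j)"
        note nr = cone_nbhd_near[OF \<kappa> \<epsilon> k True[unfolded near_def]]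
        have "cmod (z j) = cmod (c j) * ((1 + norm k) ^ N * cmod (local_ft v \<beta> (k + q j)))
          * cmod (local_ft u \<alpha> (k + p j))"
          using True by (simp add: z_def norm_mult norm_power mult_ac del: of_real_power of_real_add)
        also have "\<dots> \<le> cmod (c j) * ((1 + norm k) ^ N * cmod (local_ft v \<beta> (k + q j))) * (C1 * ((1 + norm k) * ?r) ^ M)"
          by (intro mult_left_mono ft u) auto
        also have "\<dots> = C1 * (cmod (c j) * ?r ^ M) * ((1 + norm k) ^ (N + M) * cmod (local_ft v \<beta> (k + q j)))"
          by (simp only: power_mult_distrib power_add mult_ac)
        also have "\<dots> \<le>
          C1 * (cmod (c j) * ?r ^ M) * ((2 * (1 + norm (k + q j))) ^ (N + M) * cmod (local_ft v \<beta> (k + q j)))"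
          using nr(2) C1(1) by (intro mult_left_mono mult_right_mono power_mono) auto
        also have "\<dots> = F j * ((1 + norm (k + q j)) ^ (N + M) * cmod (local_ft v \<beta> (k + q j)))"
          unfolding F_def by (simp only: power_mult_distrib mult_ac)
        also have "\<dots> \<le> F j * s" by (intro mult_left_mono s nr F)
        finally show ?thesis .
      qed
      have zs: "summable (\<lambda>j. cmod (z j))"
        by (rule summable_comparison_test'[OF summable_mult2[OF F(1), of s]]) (use zF in simp)
      have "(\<lambda>j. D u k j * local_ft v \<beta> (k + q j) + z j) sums (v ?\<phi> + suminf z)"
        by (intro sums_add sums summable_sums summable_norm_cancel[OF zs])
      moreover have "D u k j * local_ft v \<beta> (k + q j) + z j =
        ?R * (c j * (local_ft u \<alpha> (k + p j) * local_ft v \<beta> (k + q j)))" for j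
        by (simp add: D_def z_def)
      ultimately have "(\<lambda>j. ?R * (c j * (local_ft u \<alpha> (k + p j) * local_ft v \<beta> (k + q j)))) sums (v ?\<phi> + suminf z)"
        by simp
      then have "(\<lambda>j. c j * (local_ft u \<alpha> (k + p j) * local_ft v \<beta> (k + q j))) sums ((v ?\<phi> + suminf z) / ?R)"
        by (rule sums_mult_cancel[OF K])
      then have "bilinear_series c p q \<alpha> \<beta> u v k = (v ?\<phi> + suminf z) / ?R"
        unfolding bilinear_series_def by (rule sums_unique[symmetric])
      then have "(1 + norm k) ^ N * cmod (bilinear_series c p q \<alpha> \<beta> u v k) = cmod (v ?\<phi> + suminf z)"
        using K by (simp add: norm_divide norm_power del: of_real_power)
      also have "\<dots> \<le> cmod (v ?\<phi>) + suminf F * s"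
      proof (rule norm_triangle_le[OF add_left_mono])
        have "cmod (suminf z) \<le> (\<Sum>j. cmod (z j))" by (rule summable_norm[OF zs])
        also have "\<dots> \<le> (\<Sum>j. F j * s)" by (rule suminf_le[OF zF zs summable_mult2[OF F(1)]])
        also have "\<dots> = suminf F * s" by (rule suminf_mult2[OF F(1), symmetric])
        finally show "cmod (suminf z) \<le> suminf F * s" .
      qed
      also have "ennreal (cmod (v ?\<phi>) + suminf F * s) \<le> ennreal (cmod (v ?\<phi>)) + ennreal (suminf F + 1) * ennreal s"
        using real suminf_nonneg[OF F]
          by (simp add: ennreal_mult[symmetric] ennreal_plus[symmetric] distrib_right del: ennreal_plus)
      also have "\<dots> \<le> test_sup ((\<lambda>(D, Q) x. \<beta> x * wave_series D Q x) ` S) v + ennreal (suminf F + 1) * ennreal s"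
        by (intro add_right_mono test_sup_upper) (use S in force)
      finally show ?thesis unfolding real by (simp add: ennreal_leI)
    qed
  qed
qed

section \<open>Localized Fourier transforms and the wave front set\<close>

text \<open>In place of the cutoff chosen by \<open>dist_pairing\<close> one may take any test
  function that equals 1 near the support of \<open>\<psi>\<close>, and the factor
  \<open>\<psi>\<close> absorbs it.\<close>

lemma dist_fourier_eq:
  assumes u: "u \<in> distributions" and \<psi>: "\<psi> \<in> test_functions"
  shows "dist_fourier (dist_mult u \<psi>) k = local_ft u \<psi> k"
proof -
  have lin: "test_functional u" using u by (rule distributions_test_functional)
  have mult: "(\<lambda>x. \<psi> x * \<phi> x) \<in> test_functions" if "\<phi> \<in> test_functions" for \<phi>
    using that \<psi> by (intro test_functions_mult test_functions_smooth)
  have lin': "test_functional (dist_mult u \<psi>)"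
    unfolding test_functional_def
  proof (intro conjI ballI allI impI)
    fix \<phi> \<phi>' :: "'a \<Rightarrow> complex" assume "\<phi> \<in> test_functions" "\<phi>' \<in> test_functions"
    then show "dist_mult u \<psi> (\<lambda>x. \<phi> x + \<phi>' x) = dist_mult u \<psi> \<phi> + dist_mult u \<psi> \<phi>'"
      using test_functional_add[OF lin mult mult, of \<phi> \<phi>'] by (simp add: dist_mult_def test_functions_add distrib_left)
  next
    fix c and \<phi> :: "'a \<Rightarrow> complex" assume "\<phi> \<in> test_functions"
    then show "dist_mult u \<psi> (\<lambda>x. c * \<phi> x) = c * dist_mult u \<psi> \<phi>"
      using test_functional_cmult[OF lin mult, of \<phi> c]
        by (simp add: dist_mult_def test_functions_cmult mult.left_commute)
  qed (simp add: dist_mult_def)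
  have supp: "supp_dist (dist_mult u \<psi>) \<subseteq> supp_fun \<psi>"
  proof -
    have "dist_mult u \<psi> \<phi> = 0" if \<phi>: "\<phi> \<in> test_functions" "supp_fun \<phi> \<subseteq> - supp_fun \<psi>" for \<phi>
    proof -
      have "(\<lambda>x. \<psi> x * \<phi> x) = (\<lambda>x. 0)" using \<phi>(2) not_in_supp_fun[of _ \<psi>] not_in_supp_fun[of _ \<phi>] by fastforce
      then show ?thesis by (simp add: dist_mult_def test_functional_zero[OF lin])
    qed
    moreover have "open (- supp_fun \<psi>)" by (simp add: open_Compl)
    ultimately show ?thesis unfolding supp_dist_def by blast
  qed
  obtain \<theta> U where \<theta>: "\<theta> \<in> test_functions" "open U" "supp_fun \<psi> \<subseteq> U" "\<And>x. x \<in> U \<Longrightarrow> \<theta> x = 1"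
    by (rule cutoff_compact[OF test_functions_compact[OF \<psi>] open_UNIV subset_UNIV]) (rule that)
  have "dist_fourier (dist_mult u \<psi>) k = dist_pairing (dist_mult u \<psi>) (wave k)"
    unfolding dist_fourier_def wave_def[abs_def] ..
  also have "\<dots> = dist_mult u \<psi> (\<lambda>x. \<theta> x * wave k x)"
    by (rule dist_pairing_eq[OF lin' smooth_wave test_functions_compact[OF \<psi>] _ \<theta>]) (use supp in auto)
  also have "\<dots> = u (\<lambda>x. \<psi> x * (\<theta> x * wave k x))"
    using test_functions_wave[OF \<theta>(1)] by (simp add: dist_mult_def)
  also have "(\<lambda>x. \<psi> x * (\<theta> x * wave k x)) = (\<lambda>x. \<psi> x * wave k x)"
  proof
    fix x show "\<psi> x * (\<theta> x * wave k x) = \<psi> x * wave k x"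
      using \<theta>(3,4) not_in_supp_fun[of x \<psi>] by (cases "x \<in> supp_fun \<psi>") auto
  qed
  finally show ?thesis by (simp add: local_ft_def)
qed

lemma fourier_seminorm_eq:
  "u \<in> distributions \<Longrightarrow> \<psi> \<in> test_functions \<Longrightarrow> fourier_seminorm N V \<psi> u = local_decay N V \<psi> u"
  unfolding fourier_seminorm_def local_decay_def by (simp add: dist_fourier_eq)

section \<open>Cones of directions and finite coverings by them\<close>

lemma cone_nbhdI:
  assumes "norm \<kappa> = 1" "k \<noteq> 0" "norm (k /\<^sub>R norm k - \<kappa>) \<le> \<epsilon>"
  shows "k \<in> cone_nbhd \<kappa> \<epsilon>"
proof -
  have "k - norm k *\<^sub>R \<kappa> = norm k *\<^sub>R (k /\<^sub>R norm k - \<kappa>)" using assms(2) by (simp add: scaleR_diff_right)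
  then have "norm (k - norm k *\<^sub>R \<kappa>) = norm k * norm (k /\<^sub>R norm k - \<kappa>)" by simp
  also have "\<dots> \<le> norm k * \<epsilon>" using assms(3) by (intro mult_left_mono) auto
  finally show ?thesis by (simp add: cone_nbhd_def mult.commute)
qed

lemma cone_nbhdD:
  assumes "k \<noteq> 0" "k \<in> cone_nbhd \<kappa> \<epsilon>"
  shows "norm (k /\<^sub>R norm k - \<kappa>) \<le> \<epsilon>"
proof -
  have "k - norm k *\<^sub>R \<kappa> = norm k *\<^sub>R (k /\<^sub>R norm k - \<kappa>)" using assms(1) by (simp add: scaleR_diff_right)
  then have "norm k * norm (k /\<^sub>R norm k - \<kappa>) \<le> norm k * \<epsilon>" using assms(2) by (simp add: cone_nbhd_def mult.commute)
  then show ?thesis using assms(1) by (simp add: mult_le_cancel_left)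
qed

lemma zero_in_cone_nbhd [simp]: "0 \<in> cone_nbhd \<kappa> \<epsilon>"
  by (simp add: cone_nbhd_def)

lemma closed_cone_nbhd: "closed (cone_nbhd \<kappa> \<epsilon>)"
  unfolding cone_nbhd_def by (intro closed_Collect_le continuous_intros)

lemma cone_cone_nbhd: "cone (cone_nbhd \<kappa> \<epsilon>)"
  unfolding cone_def
proof (intro ballI allI impI)
  fix x and c :: real assume x: "x \<in> cone_nbhd \<kappa> \<epsilon>" and c: "0 \<le> c"
  have "norm (c *\<^sub>R x - norm (c *\<^sub>R x) *\<^sub>R \<kappa>) = norm (c *\<^sub>R (x - norm x *\<^sub>R \<kappa>))"
    using c by (simp add: scaleR_diff_right)
  also have "\<dots> = c * norm (x - norm x *\<^sub>R \<kappa>)" using c by simp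
  also have "\<dots> \<le> c * (\<epsilon> * norm x)" using x c by (intro mult_left_mono) (auto simp: cone_nbhd_def)
  also have "\<dots> = \<epsilon> * norm (c *\<^sub>R x)" using c by simp
  finally show "c *\<^sub>R x \<in> cone_nbhd \<kappa> \<epsilon>" by (simp add: cone_nbhd_def)
qed

lemma cone_nbhd_mono: "\<epsilon> \<le> \<epsilon>' \<Longrightarrow> cone_nbhd \<kappa> \<epsilon> \<subseteq> cone_nbhd \<kappa> \<epsilon>'"
  unfolding cone_nbhd_def by (auto intro: order_trans[OF _ mult_right_mono])

lemma interior_cone_nbhd:
  assumes "norm \<kappa> = 1" "0 < \<epsilon>" "0 < s"
  shows "s *\<^sub>R \<kappa> \<in> interior (cone_nbhd \<kappa> \<epsilon>)"
proof (rule interiorI)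
  show "open {k. norm (k - norm k *\<^sub>R \<kappa>) < \<epsilon> * norm k}"
    by (intro open_Collect_less continuous_intros)
  show "s *\<^sub>R \<kappa> \<in> {k. norm (k - norm k *\<^sub>R \<kappa>) < \<epsilon> * norm k}" using assms by simp
  show "{k. norm (k - norm k *\<^sub>R \<kappa>) < \<epsilon> * norm k} \<subseteq> cone_nbhd \<kappa> \<epsilon>"
    by (auto simp: cone_nbhd_def)
qed

text \<open>The unit vectors of \<open>V\<close> form a compact set. The point 0 is added by hand,
  since it lies in the union only if \<open>T\<close> is nonempty.\<close>

lemma closed_cone_cover:
  assumes V: "closed V" "cone V" and \<epsilon>: "\<And>\<kappa>. \<kappa> \<in> V \<Longrightarrow> norm \<kappa> = 1 \<Longrightarrow> 0 < \<epsilon> \<kappa>"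
  obtains T where "finite T" "T \<subseteq> {\<kappa> \<in> V. norm \<kappa> = 1}" "V \<subseteq> insert 0 (\<Union>\<kappa>\<in>T. cone_nbhd \<kappa> (\<epsilon> \<kappa>))"
proof -
  let ?K = "V \<inter> sphere 0 1"
  have K: "compact ?K" using V(1) by (intro closed_Int_compact) auto
  obtain T where T: "T \<subseteq> ?K" "finite T" "?K \<subseteq> (\<Union>\<kappa>\<in>T. ball \<kappa> (\<epsilon> \<kappa>))"
    by (rule compactE_image[OF K, of ?K "\<lambda>\<kappa>. ball \<kappa> (\<epsilon> \<kappa>)"]) (use \<epsilon> in auto)
  show thesis
  proof (rule that[OF T(2)])
    show "T \<subseteq> {\<kappa> \<in> V. norm \<kappa> = 1}" using T(1) by auto
    show "V \<subseteq> insert 0 (\<Union>\<kappa>\<in>T. cone_nbhd \<kappa> (\<epsilon> \<kappa>))"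
    proof
      fix k assume k: "k \<in> V"
      show "k \<in> insert 0 (\<Union>\<kappa>\<in>T. cone_nbhd \<kappa> (\<epsilon> \<kappa>))"
      proof (cases "k = 0")
        case False
        then have "k /\<^sub>R norm k \<in> ?K" using k V(2) by (auto simp: cone_def)
        then obtain \<kappa> where \<kappa>: "\<kappa> \<in> T" "dist \<kappa> (k /\<^sub>R norm k) < \<epsilon> \<kappa>" using T(3) by auto
        then have "k \<in> cone_nbhd \<kappa> (\<epsilon> \<kappa>)"
          using T(1) False by (intro cone_nbhdI) (auto simp: dist_norm norm_minus_commute)
        then show ?thesis using \<kappa>(1) by auto
      qed simp
    qed
  qed
qed

text \<open>\<open>\<Gamma>\<close> is closed relative to the nonzero covectors and
  \<open>\<kappa>\<close> is nonzero, so a ball around \<open>(x, \<kappa>)\<close> misses the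
  ambient closed set. Radial scaling carries nonzero points of the cone to unit vectors near
  \<open>\<kappa>\<close>; two distances of at most \<open>e / 3\<close> stay below
  \<open>e\<close>.\<close>

lemma good_direction:
  assumes \<Gamma>: "closedin (top_of_set cotangent_dot) \<Gamma>" "fibre_conic \<Gamma>" and \<kappa>: "norm \<kappa> = 1" "(x, \<kappa>) \<notin> \<Gamma>"
  obtains r \<epsilon> where "0 < r" "0 < \<epsilon>" "\<epsilon> \<le> 1" "(cball x r \<times> cone_nbhd \<kappa> \<epsilon>) \<inter> \<Gamma> = {}"
proof -
  obtain C where C: "closed C" "\<Gamma> = cotangent_dot \<inter> C" using \<Gamma>(1) by (auto simp: closedin_closed)
  have "\<kappa> \<noteq> 0" using \<kappa>(1) by auto
  then have "(x, \<kappa>) \<in> - C" using \<kappa>(2) C(2) by (auto simp: cotangent_dot_def)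
  then have "\<exists>e>0. ball (x, \<kappa>) e \<subseteq> - C" using iffD1[OF open_contains_ball, of "- C"] C(1) by (simp add: open_Compl)
  then obtain e where e: "e > 0" "ball (x, \<kappa>) e \<subseteq> - C" by auto
  show thesis
  proof (rule that[of "e / 3" "min 1 (e / 3)"])
    show "(cball x (e / 3) \<times> cone_nbhd \<kappa> (min 1 (e / 3))) \<inter> \<Gamma> = {}"
    proof (rule ccontr)
      assume "\<not> ?thesis"
      then obtain x' k where xk: "dist x x' \<le> e / 3" "k \<in> cone_nbhd \<kappa> (min 1 (e / 3))" "(x', k) \<in> \<Gamma>" by auto
      then have k: "k \<noteq> 0" using C(2) by (auto simp: cotangent_dot_def)
      then have "(x', inverse (norm k) *\<^sub>R k) \<in> \<Gamma>" using \<Gamma>(2) xk(3) unfolding fibre_conic_def by simp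
      then have inC: "(x', k /\<^sub>R norm k) \<in> C" using C(2) by simp
      have "dist (x, \<kappa>) (x', k /\<^sub>R norm k) \<le> dist x x' + dist \<kappa> (k /\<^sub>R norm k)"
        unfolding dist_Pair_Pair by (rule sqrt_sum_squares_le_sum) auto
      also have "dist \<kappa> (k /\<^sub>R norm k) \<le> e / 3" using cone_nbhdD[OF k xk(2)] by (simp add: dist_norm norm_minus_commute)
      finally have "(x', k /\<^sub>R norm k) \<in> ball (x, \<kappa>) e" using xk(1) e(1) by simp
      then show False using e(2) inC by blast
    qed
  qed (use e in auto)
qed

section \<open>Decay of localized Fourier transforms off the wave front set\<close>

lemma equicontinuous_singleton: "u \<in> distributions \<Longrightarrow> equicontinuous {u}"
  unfolding equicontinuous_def
proof (intro conjI allI impI)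
  fix K :: "'a set" assume "u \<in> distributions" "compact K"
  then obtain m C where "0 \<le> C" "dist_bound u K m C" by (rule distribution_dist_bound)
  then show "\<exists>m. \<exists>C\<ge>0. \<forall>u\<in>{u}. dist_bound u K m C" by auto
qed auto

text \<open>Multiplication by \<open>h\<close> superposes shifted copies of the transform of
  \<open>\<psi> u\<close>, with rapidly decaying amplitudes from the expansion of \<open>h\<close>
  on the support of \<open>\<psi>\<close>. The estimate for near and far shifts applies to each
  copy, at the price of a smaller cone.\<close>

lemma local_ft_product_bound:
  fixes u :: "('a::euclidean_space \<Rightarrow> complex) \<Rightarrow> complex"
  assumes u: "u \<in> distributions" and \<psi>: "\<psi> \<in> test_functions" and h: "h \<in> test_functions"
    and \<kappa>: "norm \<kappa> = 1" and \<epsilon>: "0 < \<epsilon>" "\<epsilon> \<le> 1"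
    and C2: "0 \<le> C2" "\<And>k. k \<in> cone_nbhd \<kappa> \<epsilon> \<Longrightarrow> (1 + norm k) ^ N * cmod (local_ft u \<psi> k) \<le> C2"
  shows "\<exists>C\<ge>0. \<forall>k\<in>cone_nbhd \<kappa> (\<epsilon> / 4). (1 + norm k) ^ N * cmod (local_ft u (\<lambda>x. \<psi> x * h x) k) \<le> C"
proof -
  obtain R where R: "\<And>x. x \<in> supp_fun \<psi> \<Longrightarrow> norm x \<le> R"
    using compact_imp_bounded[OF test_functions_compact[OF \<psi>]] by (auto simp: bounded_iff)
  obtain c p where c: "rapid c (p :: nat \<Rightarrow> 'a)" "\<And>x. norm x \<le> R \<Longrightarrow> h x = (\<Sum>j. c j * wave (p j) x)"
    by (rule fourier_expansion[OF h, of R]) (rule that)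
  obtain M C1 where C1: "0 \<le> C1" "\<And>u' k. u' \<in> {u} \<Longrightarrow> cmod (local_ft u' \<psi> k) \<le> C1 * (1 + norm k) ^ M"
    by (rule equicontinuous_local_ft[OF equicontinuous_singleton[OF u] \<psi>]) (rule that)
  define E where "E = 2 ^ N * C2 + C1 * (8 / \<epsilon>) ^ (N + M)"
  define T where "T j = E * (cmod (c j) * (1 + norm (p j)) ^ (N + M + M))" for j
  have T: "summable T" unfolding T_def by (intro summable_mult rapid_summable[OF c(1)])
  have T0: "0 \<le> T j" for j unfolding T_def E_def using C1(1) C2(1) \<epsilon>
    by (intro mult_nonneg_nonneg add_nonneg_nonneg) auto
  have "(1 + norm k) ^ N * cmod (local_ft u (\<lambda>x. \<psi> x * h x) k) \<le> suminf T" if k: "k \<in> cone_nbhd \<kappa> (\<epsilon> / 4)" for k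
  proof -
    have rap: "rapid c (\<lambda>j. k + p j)"
    proof (rule rapid_comparison[OF c(1), where C = 1 and M = 0 and D = "1 + norm k"])
      show "1 + norm (k + p j) \<le> (1 + norm k) * (1 + norm (p j))" for j by (rule one_add_norm_add_le)
    qed auto
    have eq: "(\<lambda>x. \<psi> x * h x * wave k x) = (\<lambda>x. \<psi> x * wave_series c (\<lambda>j. k + p j) x)"
    proof
      fix x
      show "\<psi> x * h x * wave k x = \<psi> x * wave_series c (\<lambda>j. k + p j) x"
      proof (cases "x \<in> supp_fun \<psi>")
        case True
        have "h x * wave k x = (\<Sum>j. c j * wave (p j) x) * wave k x" using c(2)[OF R[OF True]] by simp
        also have "\<dots> = (\<Sum>j. c j * wave (p j) x * wave k x)" by (rule suminf_mult2[OF rapid_summable_wave(2)[OF c(1)]])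
        also have "\<dots> = wave_series c (\<lambda>j. k + p j) x" by (simp add: wave_series_def wave_add mult_ac)
        finally show ?thesis by (simp add: mult.assoc)
      qed (simp add: not_in_supp_fun)
    qed
    have "(\<lambda>j. c j * local_ft u \<psi> (k + p j)) sums local_ft u (\<lambda>x. \<psi> x * h x) k"
      unfolding local_ft_def[of u "\<lambda>x. \<psi> x * h x"] eq by (rule distribution_wave_series_sums[OF u \<psi> rap])
    then have s: "(\<lambda>j. of_real ((1 + norm k) ^ N) * (c j * local_ft u \<psi> (k + p j))) sums
      (of_real ((1 + norm k) ^ N) * local_ft u (\<lambda>x. \<psi> x * h x) k)"
      by (rule sums_mult)
    have bd: "cmod (of_real ((1 + norm k) ^ N) * (c j * local_ft u \<psi> (k + p j))) \<le> T j" for j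
    proof -
      have "(1 + norm k) ^ N * cmod (local_ft u \<psi> (k + p j)) \<le> E * (1 + norm (p j)) ^ (N + M + M)"
        unfolding E_def by (rule near_far_bound[OF \<kappa> \<epsilon>, where a = "\<lambda>k. cmod (local_ft u \<psi> k)"]) (use C1 C2 k in auto)
      then have "cmod (c j) * ((1 + norm k) ^ N * cmod (local_ft u \<psi> (k + p j))) \<le>
        cmod (c j) * (E * (1 + norm (p j)) ^ (N + M + M))"
        by (intro mult_left_mono) auto
      moreover have "cmod (of_real ((1 + norm k) ^ N) * (c j * local_ft u \<psi> (k + p j))) =
        cmod (c j) * ((1 + norm k) ^ N * cmod (local_ft u \<psi> (k + p j)))"
        by (simp only: norm_mult norm_of_real mult_ac) simp
      ultimately show ?thesis unfolding T_def by (simp only: mult_ac)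
    qed
    have "(1 + norm k) ^ N * cmod (local_ft u (\<lambda>x. \<psi> x * h x) k) =
      cmod (of_real ((1 + norm k) ^ N) * local_ft u (\<lambda>x. \<psi> x * h x) k)"
      unfolding norm_mult norm_of_real by simp
    also have "\<dots> = cmod (\<Sum>j. of_real ((1 + norm k) ^ N) * (c j * local_ft u \<psi> (k + p j)))"
      by (simp only: sums_unique[OF s])
    also have "\<dots> \<le> (\<Sum>j. cmod (of_real ((1 + norm k) ^ N) * (c j * local_ft u \<psi> (k + p j))))"
      by (rule summable_norm[OF summable_comparison_test'[OF T]]) (unfold real_norm_def abs_norm_cancel, rule bd)
    also have "\<dots> \<le> suminf T"
      by (rule suminf_le[OF bd summable_comparison_test'[OF T] T]) (unfold real_norm_def abs_norm_cancel, rule bd)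
    finally show ?thesis .
  qed
  moreover have "0 \<le> suminf T" by (rule suminf_nonneg[OF T T0])
  ultimately show ?thesis by blast
qed

text \<open>The definition of the wave front set provides one \<open>\<psi>\<close> with
  \<open>\<psi> x \<noteq> 0\<close>. Near \<open>x\<close> every \<open>\<alpha>\<close> is
  \<open>\<psi>\<close> times \<open>\<alpha> / \<psi>\<close>, so the decay passes to all cutoffs
  supported close to \<open>x\<close>, with a radius and a cone independent of
  \<open>\<alpha>\<close> and \<open>N\<close>.\<close>

lemma not_wave_front_local:
  fixes u :: "('a::euclidean_space \<Rightarrow> complex) \<Rightarrow> complex"
  assumes u: "u \<in> distributions" and \<kappa>: "norm \<kappa> = 1" "(x, \<kappa>) \<notin> wave_front u"
  obtains r \<epsilon> where "0 < r" "0 < \<epsilon>" "\<And>\<alpha> N. \<alpha> \<in> test_functions \<Longrightarrow> supp_fun \<alpha> \<subseteq> cball x r \<Longrightarrow>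
    \<exists>C\<ge>0. \<forall>k\<in>cone_nbhd \<kappa> \<epsilon>. (1 + norm k) ^ N * cmod (local_ft u \<alpha> k) \<le> C"
proof -
  have "\<kappa> \<noteq> 0" using \<kappa>(1) by auto
  then obtain \<psi> V where \<psi>: "\<psi> \<in> test_functions" "\<psi> x \<noteq> 0" and V: "cone V" "\<kappa> \<in> interior V"
    "\<And>N. fourier_seminorm N V \<psi> u < \<infinity>"
    using \<kappa>(2) by (auto simp: wave_front_def)
  obtain e where e: "e > 0" "ball \<kappa> e \<subseteq> V" using V(2) by (auto simp: mem_interior)
  define \<epsilon> where "\<epsilon> = min 1 (e / 2)"
  have \<epsilon>: "0 < \<epsilon>" "\<epsilon> \<le> 1" "\<epsilon> < e" using e(1) by (auto simp: \<epsilon>_def)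
  have cone_V: "k \<in> V" if k: "k \<in> cone_nbhd \<kappa> \<epsilon>" for k
  proof (cases "k = 0")
    case True
    have "\<kappa> \<in> V" using e by auto
    then have "0 *\<^sub>R \<kappa> \<in> V" using V(1) unfolding cone_def by blast
    then show ?thesis using True by simp
  next
    case False
    have "k /\<^sub>R norm k \<in> V" using cone_nbhdD[OF False k] \<epsilon>(3) e(2)
      by (auto simp: dist_norm norm_minus_commute subset_iff)
    then have "norm k *\<^sub>R (k /\<^sub>R norm k) \<in> V" using V(1) unfolding cone_def by (metis norm_ge_zero)
    then show ?thesis using False by simp
  qed
  have fin: "\<exists>C\<ge>0. \<forall>k\<in>cone_nbhd \<kappa> \<epsilon>. (1 + norm k) ^ N * cmod (local_ft u \<psi> k) \<le> C" for N
  proof -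
    have "local_decay N V \<psi> u < \<infinity>" using V(3)[of N] fourier_seminorm_eq[OF u \<psi>(1)] by simp
    then obtain C where C: "0 \<le> C" "local_decay N V \<psi> u = ennreal C" by (cases "local_decay N V \<psi> u") auto
    then show ?thesis using local_decay_le_iff[of C N V \<psi> u] cone_V by (intro exI[of _ C]) auto
  qed
  define c where "c = \<psi> x"
  have c: "cmod c > 0" using \<psi>(2) by (simp add: c_def)
  have sm: "smooth \<psi>" using \<psi>(1) by (rule test_functions_smooth)
  have "isCont \<psi> x" using smooth_continuous_on[OF sm, of UNIV] by (simp add: continuous_on_eq_continuous_at)
  then obtain r0 where r0: "r0 > 0" "\<And>y. dist y x < r0 \<Longrightarrow> dist (\<psi> y) c < cmod c / 2"
    using c unfolding continuous_at_eps_delta c_def by (metis half_gt_zero)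
  have r02: "0 < r0 / 2" using r0 by simp
  obtain \<rho> U where \<rho>: "\<rho> \<in> test_functions" "supp_fun \<rho> \<subseteq> cball x (r0 / 2)" "open U" "x \<in> U"
      "\<And>y. y \<in> U \<Longrightarrow> \<rho> y = 1" "\<And>y. cmod (\<rho> y) \<le> 1"
    by (rule cutoff_ball[OF r02, of x]) (rule that)
  \<comment> \<open>A smooth function without zeros that agrees with \<open>\<psi>\<close> near
    \<open>x\<close>: it stays within \<open>cmod c / 2\<close> of the constant \<open>c\<close>, so
    its reciprocal is smooth on the whole space.\<close>
  define g where "g = (\<lambda>y. c + \<rho> y * (\<psi> y - c))"
  have gsm: "smooth g" unfolding g_def
    by (rule smooth_add[OF smooth_const smooth_mult[OF test_functions_smooth[OF \<rho>(1)] smooth_diff[OF sm smooth_const]]])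
  have g0: "g y \<noteq> 0" for y
  proof -
    have "cmod (\<rho> y * (\<psi> y - c)) \<le> cmod c / 2"
    proof (cases "y \<in> supp_fun \<rho>")
      case True
      then have "dist y x \<le> r0 / 2" using \<rho>(2) by (auto simp: dist_commute)
      then have "cmod (\<psi> y - c) < cmod c / 2" using r0(2)[of y] r0(1) by (simp add: dist_norm)
      then have "cmod (\<psi> y - c) \<le> cmod c / 2" by simp
      then show ?thesis using \<rho>(6)[of y] mult_mono[of "cmod (\<rho> y)" 1 "cmod (\<psi> y - c)" "cmod c / 2"]
        by (simp add: norm_mult)
    qed (simp add: not_in_supp_fun)
    moreover have "\<rho> y * (\<psi> y - c) = - c" if "g y = 0" using that by (simp add: g_def add_eq_0_iff)
    ultimately show ?thesis using c by auto
  qed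
  have "\<exists>r>0. cball x r \<subseteq> U" using iffD1[OF open_contains_cball \<rho>(3)] \<rho>(4) by blast
  then obtain r where r: "r > 0" "cball x r \<subseteq> U" by auto
  show thesis
  proof (rule that[OF r(1), of "\<epsilon> / 4"])
    show "0 < \<epsilon> / 4" using \<epsilon> by simp
    fix \<alpha> :: "'a \<Rightarrow> complex" and N assume \<alpha>: "\<alpha> \<in> test_functions" "supp_fun \<alpha> \<subseteq> cball x r"
    define h where "h = (\<lambda>y. \<alpha> y * inverse (g y))"
    have h: "h \<in> test_functions" unfolding h_def by (rule test_functions_mult[OF \<alpha>(1) smooth_inverse[OF gsm g0]])
    have "(\<lambda>y. \<psi> y * h y) = \<alpha>"
    proof
      fix y show "\<psi> y * h y = \<alpha> y"
      proof (cases "y \<in> supp_fun \<alpha>")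
        case True
        then have "g y = \<psi> y" using \<alpha>(2) r(2) \<rho>(5)[of y] by (auto simp: g_def)
        then show ?thesis using g0[of y] by (simp add: h_def)
      qed (simp add: h_def not_in_supp_fun)
    qed
    moreover obtain C2 where "0 \<le> C2" "\<And>k. k \<in> cone_nbhd \<kappa> \<epsilon> \<Longrightarrow> (1 + norm k) ^ N * cmod (local_ft u \<psi> k) \<le> C2"
      using fin[of N] by auto
    ultimately show "\<exists>C\<ge>0. \<forall>k\<in>cone_nbhd \<kappa> (\<epsilon> / 4). (1 + norm k) ^ N * cmod (local_ft u \<alpha> k) \<le> C"
      using local_ft_product_bound[OF u \<psi>(1) h \<kappa>(1) \<epsilon>(1,2), of C2 N] by simp
  qed
qed

text \<open>Compactness is used twice: over the support of \<open>\<psi>\<close> for a fixed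
  direction, by a partition of unity, and then over the directions in \<open>V\<close>. The result
  makes the Fourier seminorms of the normal topology finite and one-element sets bounded.\<close>

lemma dist_wf_local_decay:
  fixes u :: "('a::euclidean_space \<Rightarrow> complex) \<Rightarrow> complex"
  assumes u: "u \<in> distributions" and \<psi>: "\<psi> \<in> test_functions" and V: "closed V" "cone V"
    and disj: "(supp_fun \<psi> \<times> V) \<inter> wave_front u = {}"
  shows "\<exists>C\<ge>0. \<forall>k\<in>V. (1 + norm k) ^ N * cmod (local_ft u \<psi> k) \<le> C"
proof -
  have lin: "test_functional u" using u by (rule distributions_test_functional)
  have "\<exists>\<epsilon>>0. \<exists>C\<ge>0. \<forall>k\<in>cone_nbhd \<kappa> \<epsilon>. (1 + norm k) ^ N * cmod (local_ft u \<psi> k) \<le> C" if \<kappa>: "\<kappa> \<in> V" "norm \<kappa> = 1" for \<kappa>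
  proof -
    let ?K = "supp_fun \<psi>"
    have "\<exists>\<rho> \<epsilon>. \<rho> \<in> test_functions \<and> 0 < \<epsilon> \<and> (\<exists>U. open U \<and> x \<in> U \<and> (\<forall>y\<in>U. \<rho> y = 1)) \<and>
        (\<forall>\<alpha>\<in>test_functions. supp_fun \<alpha> \<subseteq> supp_fun \<rho> \<longrightarrow> (\<exists>C\<ge>0. \<forall>k\<in>cone_nbhd \<kappa> \<epsilon>. (1 + norm k) ^ N * cmod (local_ft u \<alpha>
          k) \<le> C))"
      if x: "x \<in> ?K" for x
    proof -
      have "(x, \<kappa>) \<notin> wave_front u" using disj x \<kappa>(1) by blast
      then obtain r \<epsilon> where r: "0 < r" "0 < \<epsilon>" "\<And>\<alpha> N. \<alpha> \<in> test_functions \<Longrightarrow> supp_fun \<alpha> \<subseteq> cball x r \<Longrightarrow>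
          \<exists>C\<ge>0. \<forall>k\<in>cone_nbhd \<kappa> \<epsilon>. (1 + norm k) ^ N * cmod (local_ft u \<alpha> k) \<le> C"
        using not_wave_front_local[OF u \<kappa>(2)] by blast
      obtain \<rho> U where \<rho>: "\<rho> \<in> test_functions" "supp_fun \<rho> \<subseteq> cball x r" "open U" "x \<in> U" "\<And>y. y \<in> U \<Longrightarrow> \<rho> y = 1"
        by (rule cutoff_ball[OF r(1), of x]) (rule that)
      show ?thesis
        by (rule exI[of _ \<rho>], rule exI[of _ \<epsilon>], intro conjI ballI impI exI[of _ U]) (use \<rho> r in auto)
    qed
    then have "\<forall>x\<in>?K. \<exists>\<rho> \<epsilon>. \<rho> \<in> test_functions \<and> 0 < \<epsilon> \<and> (\<exists>U. open U \<and> x \<in> U \<and> (\<forall>y\<in>U. \<rho> y = 1)) \<and>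
        (\<forall>\<alpha>\<in>test_functions. supp_fun \<alpha> \<subseteq> supp_fun \<rho> \<longrightarrow> (\<exists>C\<ge>0. \<forall>k\<in>cone_nbhd \<kappa> \<epsilon>. (1 + norm k) ^ N * cmod (local_ft u \<alpha>
          k) \<le> C))"
      by (rule ballI)
    from bchoice[OF this] obtain \<rho> where "\<forall>x\<in>?K. \<exists>\<epsilon>. \<rho> x \<in> test_functions \<and> 0 < \<epsilon> \<and>
      (\<exists>U. open U \<and> x \<in> U \<and> (\<forall>y\<in>U. \<rho> x y = 1)) \<and>
        (\<forall>\<alpha>\<in>test_functions. supp_fun \<alpha> \<subseteq> supp_fun (\<rho> x) \<longrightarrow> (\<exists>C\<ge>0. \<forall>k\<in>cone_nbhd \<kappa> \<epsilon>. (1 + norm k) ^ N * cmod (local_ft u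
          \<alpha> k) \<le> C))" ..
    from bchoice[OF this] obtain \<epsilon> where \<rho>\<epsilon>: "\<forall>x\<in>?K. \<rho> x \<in> test_functions \<and> 0 < \<epsilon> x \<and>
      (\<exists>U. open U \<and> x \<in> U \<and> (\<forall>y\<in>U. \<rho> x y = 1)) \<and>
        (\<forall>\<alpha>\<in>test_functions. supp_fun \<alpha> \<subseteq> supp_fun (\<rho> x) \<longrightarrow> (\<exists>C\<ge>0. \<forall>k\<in>cone_nbhd \<kappa> (\<epsilon> x). (1 + norm k) ^ N * cmod
          (local_ft u \<alpha> k) \<le> C))" ..
    have loc: "smooth (\<rho> x) \<and> (\<exists>U. open U \<and> x \<in> U \<and> (\<forall>y\<in>U. \<rho> x y = 1))" if "x \<in> ?K" for x
      using bspec[OF \<rho>\<epsilon> that] test_functions_smooth[of "\<rho> x"] by simp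
    obtain F G U where F: "finite F" "F \<subseteq> ?K" "\<And>x. x \<in> F \<Longrightarrow> smooth (G x)" "open U" "?K \<subseteq> U"
      "\<And>y. y \<in> U \<Longrightarrow> (\<Sum>x\<in>F. \<rho> x y * G x y) = 1"
      by (rule smooth_localization[OF test_functions_compact[OF \<psi>] loc]) (assumption, rule that)
    define \<alpha> where "\<alpha> x = (\<lambda>y. \<rho> x y * (G x y * \<psi> y))" for x
    have \<alpha>: "\<alpha> x \<in> test_functions" "supp_fun (\<alpha> x) \<subseteq> supp_fun (\<rho> x)" if "x \<in> F" for x
    proof -
      have "\<rho> x \<in> test_functions" using \<rho>\<epsilon> F(2) that by blast
      then show "\<alpha> x \<in> test_functions" unfolding \<alpha>_def
        by (rule test_functions_mult[OF _ smooth_mult[OF F(3)[OF that] test_functions_smooth[OF \<psi>]]])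
      show "supp_fun (\<alpha> x) \<subseteq> supp_fun (\<rho> x)" unfolding \<alpha>_def using supp_fun_mult[of "\<rho> x"] by auto
    qed
    have "\<forall>x\<in>F. \<exists>C. 0 \<le> C \<and> (\<forall>k\<in>cone_nbhd \<kappa> (\<epsilon> x). (1 + norm k) ^ N * cmod (local_ft u (\<alpha> x) k) \<le> C)"
      using \<rho>\<epsilon> \<alpha> F(2) by blast
    from bchoice[OF this] obtain C where C: "\<And>x. x \<in> F \<Longrightarrow> 0 \<le> C x"
      "\<And>x k. x \<in> F \<Longrightarrow> k \<in> cone_nbhd \<kappa> (\<epsilon> x) \<Longrightarrow> (1 + norm k) ^ N * cmod (local_ft u (\<alpha> x) k) \<le> C x" by auto
    define \<delta> where "\<delta> = Min (insert 1 (\<epsilon> ` F))"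
    have \<delta>: "\<delta> > 0" "\<And>x. x \<in> F \<Longrightarrow> \<delta> \<le> \<epsilon> x"
      unfolding \<delta>_def using F(1,2) \<rho>\<epsilon> by (auto intro: Min_le)
    have \<psi>_eq: "\<psi> = (\<lambda>y. \<Sum>x\<in>F. \<alpha> x y)"
    proof
      fix y
      have "(\<Sum>x\<in>F. \<alpha> x y) = (\<Sum>x\<in>F. \<rho> x y * G x y) * \<psi> y" unfolding \<alpha>_def sum_distrib_right by (simp add: mult.assoc)
      also have "\<dots> = \<psi> y"
      proof (cases "y \<in> ?K")
        case True
        then have "y \<in> U" using F(5) by blast
        then show ?thesis by (simp add: F(6))
      qed (simp add: not_in_supp_fun)
      finally show "\<psi> y = (\<Sum>x\<in>F. \<alpha> x y)" ..
    qed
    have "(1 + norm k) ^ N * cmod (local_ft u \<psi> k) \<le> sum C F" if k: "k \<in> cone_nbhd \<kappa> \<delta>" for k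
    proof -
      have "(\<lambda>y. \<psi> y * wave k y) = (\<lambda>y. \<Sum>x\<in>F. \<alpha> x y * wave k y)" by (subst \<psi>_eq) (simp add: sum_distrib_right)
      then have "local_ft u \<psi> k = (\<Sum>x\<in>F. local_ft u (\<alpha> x) k)"
        unfolding local_ft_def using test_functional_sum[OF lin test_functions_wave[OF \<alpha>(1)], of F] by simp
      then have "(1 + norm k) ^ N * cmod (local_ft u \<psi> k) \<le> (1 + norm k) ^ N * (\<Sum>x\<in>F. cmod (local_ft u (\<alpha> x) k))"
        by (simp add: sum_norm_le mult_left_mono)
      also have "\<dots> \<le> sum C F" unfolding sum_distrib_left
      proof (rule sum_mono)
        fix x assume x: "x \<in> F"
        have "k \<in> cone_nbhd \<kappa> (\<epsilon> x)" using k cone_nbhd_mono[OF \<delta>(2)[OF x]] by blast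
        then show "(1 + norm k) ^ N * cmod (local_ft u (\<alpha> x) k) \<le> C x" by (rule C(2)[OF x])
      qed
      finally show ?thesis .
    qed
    moreover have "0 \<le> sum C F" using C(1) by (rule sum_nonneg)
    ultimately show ?thesis using \<delta>(1) by blast
  qed
  then have "\<forall>\<kappa>\<in>{\<kappa> \<in> V. norm \<kappa> = 1}. \<exists>\<epsilon>. 0 < \<epsilon> \<and>
    (\<exists>C\<ge>0. \<forall>k\<in>cone_nbhd \<kappa> \<epsilon>. (1 + norm k) ^ N * cmod (local_ft u \<psi> k) \<le> C)" by auto
  from bchoice[OF this] obtain \<epsilon> where \<epsilon>: "\<forall>\<kappa>\<in>{\<kappa> \<in> V. norm \<kappa> = 1}. 0 < \<epsilon> \<kappa> \<and>
    (\<exists>C\<ge>0. \<forall>k\<in>cone_nbhd \<kappa> (\<epsilon> \<kappa>). (1 + norm k) ^ N * cmod (local_ft u \<psi> k) \<le> C)" ..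
  have pos: "0 < \<epsilon> \<kappa>" if "\<kappa> \<in> V" "norm \<kappa> = 1" for \<kappa> using \<epsilon> that by simp
  obtain T where T: "finite T" "T \<subseteq> {\<kappa> \<in> V. norm \<kappa> = 1}" "V \<subseteq> insert 0 (\<Union>\<kappa>\<in>T. cone_nbhd \<kappa> (\<epsilon> \<kappa>))"
    by (rule closed_cone_cover[OF V pos]) (assumption, assumption, rule that)
  have "\<forall>\<kappa>\<in>T. \<exists>C. 0 \<le> C \<and> (\<forall>k\<in>cone_nbhd \<kappa> (\<epsilon> \<kappa>). (1 + norm k) ^ N * cmod (local_ft u \<psi> k) \<le> C)" using \<epsilon> T(2) by blast
  from bchoice[OF this] obtain C where C: "\<And>\<kappa>. \<kappa> \<in> T \<Longrightarrow> 0 \<le> C \<kappa>"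
    "\<And>\<kappa> k. \<kappa> \<in> T \<Longrightarrow> k \<in> cone_nbhd \<kappa> (\<epsilon> \<kappa>) \<Longrightarrow> (1 + norm k) ^ N * cmod (local_ft u \<psi> k) \<le> C \<kappa>" by auto
  have s0: "0 \<le> sum C T" using C(1) by (rule sum_nonneg)
  \<comment> \<open>The first summand serves \<open>k = 0\<close>, which the covering by cones may
    omit.\<close>
  have "(1 + norm k) ^ N * cmod (local_ft u \<psi> k) \<le> cmod (local_ft u \<psi> 0) + sum C T" if k: "k \<in> V" for k
  proof (cases "k = 0")
    case True
    then show ?thesis using s0 by simp
  next
    case False
    then obtain \<kappa> where \<kappa>: "\<kappa> \<in> T" "k \<in> cone_nbhd \<kappa> (\<epsilon> \<kappa>)" using T(3) k by auto
    have "C \<kappa> \<le> sum C T" using \<kappa>(1) C(1) T(1) by (intro member_le_sum) auto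
    then show ?thesis using C(2)[OF \<kappa>] norm_ge_zero[of "local_ft u \<psi> 0"] by linarith
  qed
  then show ?thesis using s0 by (intro exI[of _ "cmod (local_ft u \<psi> 0) + sum C T"]) auto
qed

section \<open>Expansion of the convolution into products of Fourier transforms\<close>

text \<open>Both functionals act term by term. For fixed \<open>x\<close>, \<open>v\<close> meets
  amplitudes that contain \<open>wave (k + p j) x\<close>; its values grow at most polynomially in
  \<open>q j\<close>, so the resulting coefficients \<open>d\<close> are again rapid and
  \<open>u\<close> can be applied in the same way.\<close>

lemma tensor_bilinear_series:
  fixes \<alpha> \<beta> :: "'a::euclidean_space \<Rightarrow> complex" and p q :: "nat \<Rightarrow> 'a"
  assumes u: "u \<in> distributions" and v: "v \<in> distributions" and \<alpha>: "\<alpha> \<in> test_functions" and \<beta>: "\<beta> \<in> test_functions"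
    and c: "rapid c (\<lambda>j. (p j, q j))"
    and f: "\<And>x y. f x y = \<alpha> x * \<beta> y * (\<Sum>j. c j * wave (p j, q j) (x, y)) * wave k (x + y)"
  shows "u (\<lambda>x. v (\<lambda>y. f x y)) = bilinear_series c p q \<alpha> \<beta> u v k"
proof -
  have rq: "1 + norm (k + q j) \<le> (1 + norm k) * (1 + norm (p j, q j))"
    "1 + norm (k + p j) \<le> (1 + norm k) * (1 + norm (p j, q j))" for j
    by (rule order_trans[OF one_add_norm_add_le mult_left_mono[OF add_left_mono[OF norm_snd_le_Pair(1)]]], simp)
       (rule order_trans[OF one_add_norm_add_le mult_left_mono[OF add_left_mono[OF norm_snd_le_Pair(2)]]], simp)
  obtain M C1 where C1: "0 \<le> C1" "\<And>v' k. v' \<in> {v} \<Longrightarrow> cmod (local_ft v' \<beta> k) \<le> C1 * (1 + norm k) ^ M"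
    by (rule equicontinuous_local_ft[OF equicontinuous_singleton[OF v] \<beta>]) (rule that)
  define d where "d j = c j * local_ft v \<beta> (k + q j)" for j
  have d: "rapid d (\<lambda>j. k + p j)"
  proof (rule rapid_comparison[OF c, where C = "C1 * (1 + norm k) ^ M" and M = M and D = "1 + norm k"])
    fix j
    have "cmod (local_ft v \<beta> (k + q j)) \<le> C1 * ((1 + norm k) * (1 + norm (p j, q j))) ^ M"
      using C1(1) rq(1)[of j] by (intro order_trans[OF C1(2)] mult_left_mono power_mono) auto
    then have "cmod (c j) * cmod (local_ft v \<beta> (k + q j)) \<le>
      cmod (c j) * (C1 * ((1 + norm k) * (1 + norm (p j, q j))) ^ M)"
      by (rule mult_left_mono) simp
    then show "cmod (d j) \<le> C1 * (1 + norm k) ^ M * (cmod (c j) * (1 + norm (p j, q j)) ^ M)"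
      unfolding d_def by (simp add: norm_mult power_mult_distrib mult_ac)
    show "1 + norm (k + p j) \<le> (1 + norm k) * (1 + norm (p j, q j))" by (rule rq)
  qed (use C1(1) in auto)
  have inner: "v (\<lambda>y. f x y) = \<alpha> x * wave_series d (\<lambda>j. k + p j) x" for x
  proof -
    define e where "e j = \<alpha> x * c j * wave (k + p j) x" for j
    have e: "rapid e (\<lambda>j. k + q j)"
    proof (rule rapid_comparison[OF c, where C = "cmod (\<alpha> x)" and M = 0 and D = "1 + norm k"])
      show "1 + norm (k + q j) \<le> (1 + norm k) * (1 + norm (p j, q j))" for j by (rule rq)
    qed (auto simp: e_def norm_mult)
    have "f x = (\<lambda>y. \<beta> y * wave_series e (\<lambda>j. k + q j) y)"
    proof
      fix y
      have "(\<Sum>j. c j * wave (p j, q j) (x, y)) * (\<alpha> x * wave k (x + y)) =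
        (\<Sum>j. c j * wave (p j, q j) (x, y) * (\<alpha> x * wave k (x + y)))"
        by (rule suminf_mult2[OF rapid_summable_wave(2)[OF c]])
      also have "\<dots> = wave_series e (\<lambda>j. k + q j) y"
        by (simp add: wave_series_def e_def wave_add wave_add_right wave_Pair mult_ac)
      finally show "f x y = \<beta> y * wave_series e (\<lambda>j. k + q j) y" unfolding f by (simp add: mult_ac)
    qed
    then have "v (\<lambda>y. f x y) = v (\<lambda>y. \<beta> y * wave_series e (\<lambda>j. k + q j) y)" by simp
    also have "\<dots> = (\<Sum>j. e j * local_ft v \<beta> (k + q j))"
      by (rule sums_unique[OF distribution_wave_series_sums[OF v \<beta> e]])
    also have "\<dots> = (\<Sum>j. \<alpha> x * (d j * wave (k + p j) x))" by (simp add: e_def d_def mult_ac)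
    also have "\<dots> = \<alpha> x * wave_series d (\<lambda>j. k + p j) x"
      unfolding wave_series_def by (rule suminf_mult[OF rapid_summable_wave(2)[OF d]])
    finally show ?thesis .
  qed
  have "u (\<lambda>x. v (\<lambda>y. f x y)) = u (\<lambda>x. \<alpha> x * wave_series d (\<lambda>j. k + p j) x)" by (simp add: inner)
  also have "\<dots> = (\<Sum>j. d j * local_ft u \<alpha> (k + p j))"
    by (rule sums_unique[OF distribution_wave_series_sums[OF u \<alpha> d]])
  also have "\<dots> = bilinear_series c p q \<alpha> \<beta> u v k"
    by (simp add: bilinear_series_def d_def mult_ac)
  finally show ?thesis .
qed

text \<open>One localized term of the split kernel, with its smooth factor given by amplitudes and
  pairs of frequencies. Bundling the data keeps the existence statements about families of pieces
  short.\<close>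

record 'a wave_piece =
  piece_coeff :: "nat \<Rightarrow> complex"
  piece_freq1 :: "nat \<Rightarrow> 'a"
  piece_freq2 :: "nat \<Rightarrow> 'a"
  piece_loc1 :: "'a \<Rightarrow> complex"
  piece_loc2 :: "'a \<Rightarrow> complex"

definition good_piece :: "('a::euclidean_space \<times> 'a) set \<Rightarrow> ('a \<times> 'a) set \<Rightarrow> 'a set \<Rightarrow> 'a wave_piece \<Rightarrow> bool" where
  "good_piece \<Gamma>1 \<Gamma>2 W P \<longleftrightarrow> piece_loc1 P \<in> test_functions \<and> piece_loc2 P \<in> test_functions \<and>
     rapid (piece_coeff P) (\<lambda>j. (piece_freq1 P j, piece_freq2 P j)) \<and>
     ((supp_fun (piece_loc1 P) \<times> W) \<inter> \<Gamma>1 = {} \<or> (supp_fun (piece_loc2 P) \<times> W) \<inter> \<Gamma>2 = {})"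

definition piece_value ::
  "'a wave_piece \<Rightarrow> (('a::euclidean_space \<Rightarrow> complex) \<Rightarrow> complex) \<Rightarrow> (('a \<Rightarrow> complex) \<Rightarrow> complex) \<Rightarrow> 'a \<Rightarrow> complex" where
  "piece_value P = bilinear_series (piece_coeff P) (piece_freq1 P) (piece_freq2 P) (piece_loc1 P) (piece_loc2 P)"

lemma convolution_pieces:
  fixes \<Gamma>1 \<Gamma>2 :: "('a::euclidean_space \<times> 'a) set"
  assumes X: "proper_add X1 X2"
    and \<Gamma>1: "closedin (top_of_set cotangent_dot) \<Gamma>1" "fibre_conic \<Gamma>1"
    and \<Gamma>2: "closedin (top_of_set cotangent_dot) \<Gamma>2" "fibre_conic \<Gamma>2"
    and \<tau>: "\<tau> \<in> test_functions" and \<kappa>: "norm \<kappa> = 1"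
    and off: "\<And>x y. x \<in> X1 \<Longrightarrow> y \<in> X2 \<Longrightarrow> x + y \<in> supp_fun \<tau> \<Longrightarrow> (x, \<kappa>) \<notin> \<Gamma>1 \<or> (y, \<kappa>) \<notin> \<Gamma>2"
  obtains \<epsilon> F P where "0 < \<epsilon>" "\<epsilon> \<le> 1" "finite (F :: ('a \<times> 'a) set)" "\<And>z. z \<in> F \<Longrightarrow> good_piece \<Gamma>1 \<Gamma>2 (cone_nbhd \<kappa> \<epsilon>) (P z)"
    "\<And>u v k. u \<in> dist_on X1 \<Longrightarrow> v \<in> dist_on X2 \<Longrightarrow> local_ft (convolution u v) \<tau> k = (\<Sum>z\<in>F. piece_value (P z) u v k)"
proof -
  let ?K = "add_preimage X1 X2 (supp_fun \<tau>)"
  have K: "compact ?K" by (rule compact_add_preimage[OF X test_functions_compact[OF \<tau>]])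
  \<comment> \<open>\<open>A\<close> is the triple of the two localizers and the opening of the
    cone, packed so that one choice over \<open>?K\<close> yields all three.\<close>
  have "\<exists>A. fst A \<in> test_functions \<and> fst (snd A) \<in> test_functions \<and> 0 < snd (snd A) \<and> snd (snd A) \<le> (1::real) \<and>
      (\<exists>U. open U \<and> z \<in> U \<and> (\<forall>w\<in>U. fst A (fst w) * fst (snd A) (snd w) = 1)) \<and>
      ((supp_fun (fst A) \<times> cone_nbhd \<kappa> (snd (snd A))) \<inter> \<Gamma>1 = {} \<or> (supp_fun (fst (snd A)) \<times> cone_nbhd \<kappa> (snd (snd A)))
        \<inter> \<Gamma>2 = {})"
    if z: "z \<in> ?K" for z
  proof -
    obtain x y where xy: "z = (x, y)" "x \<in> X1" "y \<in> X2" "x + y \<in> supp_fun \<tau>" using z by (auto simp: add_preimage_def)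
    have "\<exists>r s \<epsilon>. 0 < r \<and> 0 < s \<and> 0 < \<epsilon> \<and> \<epsilon> \<le> (1::real) \<and>
      ((cball x r \<times> cone_nbhd \<kappa> \<epsilon>) \<inter> \<Gamma>1 = {} \<or> (cball y s \<times> cone_nbhd \<kappa> \<epsilon>) \<inter> \<Gamma>2 = {})"
      using off[OF xy(2-4)]
    proof
      assume "(x, \<kappa>) \<notin> \<Gamma>1"
      then obtain r \<epsilon> where "0 < r" "0 < \<epsilon>" "\<epsilon> \<le> 1" "(cball x r \<times> cone_nbhd \<kappa> \<epsilon>) \<inter> \<Gamma>1 = {}"
        by (rule good_direction[OF \<Gamma>1 \<kappa>])
      \<comment> \<open>The ball around \<open>y\<close> is unconstrained in this case; its radius 1
        is an arbitrary default.\<close>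
      then show ?thesis by (intro exI[of _ r] exI[of _ 1] exI[of _ \<epsilon>]) auto
    next
      assume "(y, \<kappa>) \<notin> \<Gamma>2"
      then obtain r \<epsilon> where "0 < r" "0 < \<epsilon>" "\<epsilon> \<le> 1" "(cball y r \<times> cone_nbhd \<kappa> \<epsilon>) \<inter> \<Gamma>2 = {}"
        by (rule good_direction[OF \<Gamma>2 \<kappa>])
      then show ?thesis by (intro exI[of _ 1] exI[of _ r] exI[of _ \<epsilon>]) auto
    qed
    then obtain r s \<epsilon> where r: "0 < r" "0 < s" "0 < \<epsilon>" "\<epsilon> \<le> (1::real)"
      "(cball x r \<times> cone_nbhd \<kappa> \<epsilon>) \<inter> \<Gamma>1 = {} \<or> (cball y s \<times> cone_nbhd \<kappa> \<epsilon>) \<inter> \<Gamma>2 = {}" by auto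
    obtain \<alpha> U where \<alpha>: "\<alpha> \<in> test_functions" "supp_fun \<alpha> \<subseteq> cball x r" "open U" "x \<in> U" "\<And>y. y \<in> U \<Longrightarrow> \<alpha> y = 1"
      by (rule cutoff_ball[OF r(1), of x]) (rule that)
    obtain \<beta> V where \<beta>: "\<beta> \<in> test_functions" "supp_fun \<beta> \<subseteq> cball y s" "open V" "y \<in> V" "\<And>y. y \<in> V \<Longrightarrow> \<beta> y = 1"
      by (rule cutoff_ball[OF r(2), of y]) (rule that)
    have "(supp_fun \<alpha> \<times> cone_nbhd \<kappa> \<epsilon>) \<inter> \<Gamma>1 = {} \<or> (supp_fun \<beta> \<times> cone_nbhd \<kappa> \<epsilon>) \<inter> \<Gamma>2 = {}"
      using r(5) \<alpha>(2) \<beta>(2) by blast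
    moreover have "open (U \<times> V)" using \<alpha>(3) \<beta>(3) by (rule open_Times)
    ultimately show ?thesis
      by (intro exI[of _ "(\<alpha>, \<beta>, \<epsilon>)"] conjI exI[of _ "U \<times> V"]) (use \<alpha> \<beta> r xy in auto)
  qed
  then have "\<forall>z\<in>?K. \<exists>A. fst A \<in> test_functions \<and> fst (snd A) \<in> test_functions \<and> 0 < snd (snd A) \<and>
    snd (snd A) \<le> (1::real) \<and>
      (\<exists>U. open U \<and> z \<in> U \<and> (\<forall>w\<in>U. fst A (fst w) * fst (snd A) (snd w) = 1)) \<and>
      ((supp_fun (fst A) \<times> cone_nbhd \<kappa> (snd (snd A))) \<inter> \<Gamma>1 = {} \<or> (supp_fun (fst (snd A)) \<times> cone_nbhd \<kappa> (snd (snd A)))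
        \<inter> \<Gamma>2 = {})"
    by (rule ballI)
  from bchoice[OF this] obtain A where A: "\<forall>z\<in>?K. fst (A z) \<in> test_functions \<and> fst (snd (A z)) \<in> test_functions \<and>
    0 < snd (snd (A z)) \<and> snd (snd (A z)) \<le> (1::real) \<and>
      (\<exists>U. open U \<and> z \<in> U \<and> (\<forall>w\<in>U. fst (A z) (fst w) * fst (snd (A z)) (snd w) = 1)) \<and>
      ((supp_fun (fst (A z)) \<times> cone_nbhd \<kappa> (snd (snd (A z)))) \<inter> \<Gamma>1 = {} \<or> (supp_fun (fst (snd (A z))) \<times> cone_nbhd \<kappa>
        (snd (snd (A z)))) \<inter> \<Gamma>2 = {})" ..
  define \<alpha> where "\<alpha> z = fst (A z)" for z
  define \<beta> where "\<beta> z = fst (snd (A z))" for z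
  define e where "e z = snd (snd (A z))" for z
  have \<alpha>: "\<alpha> z \<in> test_functions" and \<beta>: "\<beta> z \<in> test_functions" and e: "0 < e z" "e z \<le> 1"
    and one: "\<exists>U. open U \<and> z \<in> U \<and> (\<forall>w\<in>U. \<alpha> z (fst w) * \<beta> z (snd w) = 1)"
    and good: "(supp_fun (\<alpha> z) \<times> cone_nbhd \<kappa> (e z)) \<inter> \<Gamma>1 = {} \<or> (supp_fun (\<beta> z) \<times> cone_nbhd \<kappa> (e z)) \<inter> \<Gamma>2 = {}"
    if "z \<in> ?K" for z using bspec[OF A that] unfolding \<alpha>_def \<beta>_def e_def by simp_all
  define \<psi> where "\<psi> z w = \<alpha> z (fst w) * \<beta> z (snd w)" for z w
  have \<psi>sm: "smooth (\<psi> z)" if "z \<in> ?K" for z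
    unfolding \<psi>_def[abs_def]
    by (rule smooth_mult[OF smooth_linear[OF bounded_linear_fst test_functions_smooth[OF \<alpha>[OF that]]] smooth_linear[OF
      bounded_linear_snd test_functions_smooth[OF \<beta>[OF that]]]])
  have \<psi>supp: "supp_fun (\<psi> z) \<subseteq> supp_fun (\<alpha> z) \<times> supp_fun (\<beta> z)" for z
  proof (rule supp_fun_subset)
    show "closed (supp_fun (\<alpha> z) \<times> supp_fun (\<beta> z))" by (intro closed_Times) auto
    fix w assume "w \<notin> supp_fun (\<alpha> z) \<times> supp_fun (\<beta> z)"
    then have "fst w \<notin> supp_fun (\<alpha> z) \<or> snd w \<notin> supp_fun (\<beta> z)" by (cases w) auto
    then show "\<psi> z w = 0" by (auto simp: \<psi>_def not_in_supp_fun)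
  qed
  have cs: "compact (supp_fun (\<alpha> z) \<times> supp_fun (\<beta> z))" if "z \<in> ?K" for z
    using test_functions_compact[OF \<alpha>[OF that]] test_functions_compact[OF \<beta>[OF that]] by (rule compact_Times)
  have \<psi>: "\<psi> z \<in> test_functions" if "z \<in> ?K" for z
    by (rule test_functionsI[OF \<psi>sm[OF that] \<psi>supp cs[OF that]])
  have loc: "smooth (\<psi> z) \<and> (\<exists>U. open U \<and> z \<in> U \<and> (\<forall>w\<in>U. \<psi> z w = 1))" if "z \<in> ?K" for z
    using \<psi>sm[OF that] one[OF that] by (simp add: \<psi>_def)
  obtain F G U where F: "finite F" "F \<subseteq> ?K" "\<And>z. z \<in> F \<Longrightarrow> smooth (G z)" "open U" "?K \<subseteq> U"
    "\<And>w. w \<in> U \<Longrightarrow> (\<Sum>z\<in>F. \<psi> z w * G z w) = 1"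
    by (rule smooth_localization[OF K loc]) (assumption, rule that)
  define \<epsilon> where "\<epsilon> = Min (insert 1 (e ` F))"
  have \<epsilon>: "0 < \<epsilon>" "\<epsilon> \<le> 1" "\<And>z. z \<in> F \<Longrightarrow> \<epsilon> \<le> e z"
    unfolding \<epsilon>_def using F(1,2) e by (auto intro: Min_le)
  define g where "g z w = G z w * \<tau> (fst w + snd w)" for z w
  have g: "smooth (g z)" if "z \<in> F" for z
    unfolding g_def[abs_def] using smooth_mult[OF F(3)[OF that] smooth_add_comp[OF test_functions_smooth[OF \<tau>]]]
    by (simp add: case_prod_unfold)
  have "\<exists>Q. rapid (fst Q) (snd Q) \<and> (\<forall>w\<in>supp_fun (\<alpha> z) \<times> supp_fun (\<beta> z). g z w = (\<Sum>j. fst Q j * wave (snd Q j) w))"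
    if z: "z \<in> F" for z
  proof -
    have zK: "z \<in> ?K" using z F(2) by blast
    \<comment> \<open>\<open>g z\<close> is only smooth. The cutoff makes it a test function, which
      has a Fourier expansion, without changing it on the supports of the localizers.\<close>
    obtain \<omega> O' where \<omega>: "\<omega> \<in> test_functions" "open O'" "supp_fun (\<alpha> z) \<times> supp_fun (\<beta> z) \<subseteq> O'" "\<And>w. w \<in> O' \<Longrightarrow> \<omega> w = 1"
      by (rule cutoff_compact[OF cs[OF zK] open_UNIV subset_UNIV]) (rule that)
    obtain R where R: "\<And>w. w \<in> supp_fun (\<alpha> z) \<times> supp_fun (\<beta> z) \<Longrightarrow> norm w \<le> R"
      using compact_imp_bounded[OF cs[OF zK]] unfolding bounded_iff by blast
    obtain c p where c: "rapid c (p :: nat \<Rightarrow> 'a \<times> 'a)" "\<And>w. norm w \<le> R \<Longrightarrow> \<omega> w * g z w = (\<Sum>j. c j * wave (p j) w)"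
      by (rule fourier_expansion[OF test_functions_mult[OF \<omega>(1) g[OF z]], of R]) (rule that)
    have "g z w = (\<Sum>j. c j * wave (p j) w)" if w: "w \<in> supp_fun (\<alpha> z) \<times> supp_fun (\<beta> z)" for w
      using c(2)[OF R[OF w]] \<omega>(4)[OF subsetD[OF \<omega>(3) w]] by simp
    then show ?thesis using c(1) by (intro exI[of _ "(c, p)"]) auto
  qed
  then have "\<forall>z\<in>F. \<exists>Q. rapid (fst Q) (snd Q) \<and>
    (\<forall>w\<in>supp_fun (\<alpha> z) \<times> supp_fun (\<beta> z). g z w = (\<Sum>j. fst Q j * wave (snd Q j) w))"
    by (rule ballI)
  from bchoice[OF this] obtain Q where Q: "\<And>z. z \<in> F \<Longrightarrow> rapid (fst (Q z)) (snd (Q z))"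
    "\<And>z w. z \<in> F \<Longrightarrow> w \<in> supp_fun (\<alpha> z) \<times> supp_fun (\<beta> z) \<Longrightarrow> g z w = (\<Sum>j. fst (Q z) j * wave (snd (Q z) j) w)"
    by blast
  define P where "P z = \<lparr>piece_coeff = fst (Q z), piece_freq1 = (\<lambda>j. fst (snd (Q z) j)), piece_freq2 =
    (\<lambda>j. snd (snd (Q z) j)),
      piece_loc1 = \<alpha> z, piece_loc2 = \<beta> z\<rparr>" for z
  show thesis
  proof (rule that[OF \<epsilon>(1,2) F(1)])
    fix z assume z: "z \<in> F"
    then have zK: "z \<in> ?K" using F(2) by blast
    have "cone_nbhd \<kappa> \<epsilon> \<subseteq> cone_nbhd \<kappa> (e z)" by (rule cone_nbhd_mono[OF \<epsilon>(3)[OF z]])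
    then have "(supp_fun (\<alpha> z) \<times> cone_nbhd \<kappa> \<epsilon>) \<inter> \<Gamma>1 = {} \<or> (supp_fun (\<beta> z) \<times> cone_nbhd \<kappa> \<epsilon>) \<inter> \<Gamma>2 = {}"
      using good[OF zK] by blast
    then show "good_piece \<Gamma>1 \<Gamma>2 (cone_nbhd \<kappa> \<epsilon>) (P z)"
      using \<alpha>[OF zK] \<beta>[OF zK] Q(1)[OF z] by (simp add: good_piece_def P_def)
  next
    fix u v :: "('a \<Rightarrow> complex) \<Rightarrow> complex" and k assume u: "u \<in> dist_on X1" and v: "v \<in> dist_on X2"
    have ud: "u \<in> distributions" and vd: "v \<in> distributions" using u v by (auto simp: dist_on_def)
    \<comment> \<open>The partition of unity is itself an admissible cutoff for the convolution,
      since it equals 1 near the compact preimage.\<close>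
    define \<theta> where "\<theta> w = (\<Sum>z\<in>F. \<psi> z w * G z w)" for w
    have \<theta>: "\<theta> \<in> test_functions" unfolding \<theta>_def[abs_def]
    proof (rule test_functions_sum)
      fix z assume "z \<in> F"
      then show "(\<lambda>w. \<psi> z w * G z w) \<in> test_functions"
        using F(2) by (intro test_functions_mult \<psi> F(3)) auto
    qed
    have \<theta>1: "\<theta> w = 1" if "w \<in> U" for w unfolding \<theta>_def by (rule F(6)[OF that])
    define f where "f z w = \<psi> z w * (g z w * wave k (fst w + snd w))" for z w
    have f: "f z \<in> test_functions" if "z \<in> F" for z
    proof -
      have "smooth (\<lambda>w. g z w * wave k (fst w + snd w))"
        using smooth_mult[OF g[OF that] smooth_add_comp[OF smooth_wave]] by (simp add: case_prod_unfold)
      then show ?thesis unfolding f_def[abs_def] using F(2) that by (intro test_functions_mult \<psi>) auto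
    qed
    have "local_ft (convolution u v) \<tau> k = u (\<lambda>x. v (\<lambda>y. \<theta> (x, y) * (\<tau> (x + y) * wave k (x + y))))"
      unfolding local_ft_def
      by (rule convolution_eq[OF X u v test_functions_wave[OF \<tau>] _ test_functions_compact[OF \<tau>] \<theta> F(4,5) \<theta>1])
         (use supp_fun_mult[of \<tau> "wave k"] in auto)
    also have "(\<lambda>x y. \<theta> (x, y) * (\<tau> (x + y) * wave k (x + y))) = (\<lambda>x y. \<Sum>z\<in>F. f z (x, y))"
      by (simp add: \<theta>_def f_def g_def sum_distrib_right mult.assoc)
    then have "u (\<lambda>x. v (\<lambda>y. \<theta> (x, y) * (\<tau> (x + y) * wave k (x + y)))) = u (\<lambda>x. v (\<lambda>y. \<Sum>z\<in>F. f z (x, y)))"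
      by (simp add: fun_eq_iff)
    also have "\<dots> = tensor u v (\<lambda>w. \<Sum>z\<in>F. f z w)"
      using test_functions_sum[of F f] f by (simp add: tensor_def)
    also have "\<dots> = (\<Sum>z\<in>F. tensor u v (f z))"
      by (rule test_functional_sum[OF tensor_functional[OF distributions_test_functional[OF ud] vd]]) (rule f)
    also have "\<dots> = (\<Sum>z\<in>F. piece_value (P z) u v k)"
    proof (rule sum.cong[OF refl])
      fix z assume z: "z \<in> F"
      then have zK: "z \<in> ?K" using F(2) by blast
      have "tensor u v (f z) = u (\<lambda>x. v (\<lambda>y. f z (x, y)))" using f[OF z] by (simp add: tensor_def)
      also have "\<dots> = bilinear_series (fst (Q z)) (\<lambda>j. fst (snd (Q z) j)) (\<lambda>j. snd (snd (Q z) j)) (\<alpha> z) (\<beta> z) u v k"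
      proof (rule tensor_bilinear_series[OF ud vd \<alpha>[OF zK] \<beta>[OF zK]])
        show "rapid (fst (Q z)) (\<lambda>j. (fst (snd (Q z) j), snd (snd (Q z) j)))" using Q(1)[OF z] by simp
        fix x y
        show "f z (x, y) = \<alpha> z x * \<beta> z y * (\<Sum>j. fst (Q z) j * wave (fst (snd (Q z) j), snd (snd (Q z) j)) (x, y))
          * wave k (x + y)"
        proof (cases "(x, y) \<in> supp_fun (\<alpha> z) \<times> supp_fun (\<beta> z)")
          case True
          show ?thesis unfolding f_def \<psi>_def Q(2)[OF z True] by (simp add: mult_ac)
        next
          case False
          then have "\<alpha> z x * \<beta> z y = 0" by (auto simp: not_in_supp_fun)
          then show ?thesis by (auto simp: f_def \<psi>_def)
        qed
      qed
      finally show "tensor u v (f z) = piece_value (P z) u v k" by (simp add: piece_value_def P_def)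
    qed
    finally show "local_ft (convolution u v) \<tau> k = (\<Sum>z\<in>F. piece_value (P z) u v k)" .
  qed
qed

section \<open>Bounded sets of distributions\<close>

lemma distributions_linear_combination:
  assumes u: "u \<in> distributions" and v: "v \<in> distributions"
  shows "(\<lambda>\<phi>. a * u \<phi> + b * v \<phi>) \<in> distributions"
proof (rule distributionsI)
  note ul = distributions_test_functional[OF u] and vl = distributions_test_functional[OF v]
  show "test_functional (\<lambda>\<phi>. a * u \<phi> + b * v \<phi>)"
    using ul vl by (auto simp: test_functional_def algebra_simps)
  fix K :: "'a set" assume K: "compact K"
  obtain m C where mC: "0 \<le> C" "dist_bound u K m C" by (rule distribution_dist_bound[OF u K])
  obtain m' C' where mC': "0 \<le> C'" "dist_bound v K m' C'" by (rule distribution_dist_bound[OF v K])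
  have "dist_bound (\<lambda>\<phi>. a * u \<phi> + b * v \<phi>) K (max m m') (cmod a * C + cmod b * C')"
    unfolding dist_bound_def
  proof (intro ballI allI impI)
    fix \<phi> c assume \<phi>: "\<phi> \<in> test_functions" "supp_fun \<phi> \<subseteq> K" "ck_bounded (max m m') UNIV c \<phi>"
    have "cmod (u \<phi>) \<le> C * c" by (rule dist_boundD[OF mC(2) \<phi>(1,2) ck_bounded_mono[OF \<phi>(3)]]) auto
    moreover have "cmod (v \<phi>) \<le> C' * c" by (rule dist_boundD[OF mC'(2) \<phi>(1,2) ck_bounded_mono[OF \<phi>(3)]]) auto
    ultimately have "cmod a * cmod (u \<phi>) + cmod b * cmod (v \<phi>) \<le> cmod a * (C * c) + cmod b * (C' * c)"
      by (intro add_mono mult_left_mono) auto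
    then show "cmod (a * u \<phi> + b * v \<phi>) \<le> (cmod a * C + cmod b * C') * c"
      by (intro order_trans[OF norm_triangle_ineq]) (simp add: norm_mult algebra_simps)
  qed
  then show "\<exists>m C. dist_bound (\<lambda>\<phi>. a * u \<phi> + b * v \<phi>) K m C" by blast
qed

lemma zero_distribution: "(\<lambda>_. 0) \<in> distributions"
proof (rule distributionsI)
  show "test_functional (\<lambda>_. 0)" by (simp add: test_functional_def)
  have "dist_bound (\<lambda>_. 0) K 0 0" for K :: "'a set" by (simp add: dist_bound_def)
  then show "\<exists>m C. dist_bound (\<lambda>_. 0) K m C" for K :: "'a set" by blast
qed

definition normal_seminorms :: "('a::euclidean_space \<times> 'a) set \<Rightarrow> ((('a \<Rightarrow> complex) \<Rightarrow> complex) \<Rightarrow> ennreal) set" where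
  "normal_seminorms \<Gamma> = {test_sup B | B. bounded_tests B} \<union>
     {fourier_seminorm N V \<psi> | N V \<psi>. \<psi> \<in> test_functions \<and> closed V \<and> cone V \<and> (supp_fun \<psi> \<times> V) \<inter> \<Gamma> = {}}"

lemma tvs_bounded_test_iff: "tvs_bounded test_topology B \<longleftrightarrow> bounded_tests B"
  using tvs_bounded_imp_bounded_tests bounded_tests_imp_tvs_bounded by blast

lemma normal_topology_supp_eq:
  "normal_topology_supp \<Gamma> X = subtopology (seminorm_topology (dist_wf \<Gamma>) (normal_seminorms \<Gamma>)) {u. supp_dist u \<subseteq> X}"
  by (simp add: normal_topology_supp_def normal_topology_def normal_seminorms_def tvs_bounded_test_iff
    test_sup_def[abs_def])

lemma topspace_normal_topology_supp: "topspace (normal_topology_supp \<Gamma> X) = dist_wf \<Gamma> \<inter> dist_on X"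
  unfolding normal_topology_supp_eq by (auto simp: dist_wf_def dist_on_def)

lemma normal_seminorms_cases:
  assumes "p \<in> normal_seminorms \<Gamma>"
  obtains B where "bounded_tests B" "p = test_sup B"
  | N V \<psi> where "\<psi> \<in> test_functions" "closed V" "cone V" "(supp_fun \<psi> \<times> V) \<inter> \<Gamma> = {}" "p = fourier_seminorm N V \<psi>"
  using assms unfolding normal_seminorms_def by blast

lemma normal_seminormsI:
  "bounded_tests B \<Longrightarrow> test_sup B \<in> normal_seminorms \<Gamma>"
  "\<psi> \<in> test_functions \<Longrightarrow> closed V \<Longrightarrow> cone V \<Longrightarrow> (supp_fun \<psi> \<times> V) \<inter> \<Gamma> = {} \<Longrightarrow> fourier_seminorm N V \<psi> \<in> normal_seminorms \<Gamma>"
  unfolding normal_seminorms_def by blast+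

lemma normal_seminorm_scale:
  assumes p: "p \<in> normal_seminorms \<Gamma>" and u: "u \<in> distributions"
  shows "p (\<lambda>\<phi>. c * u \<phi>) \<le> ennreal (cmod c) * p u"
  using p
proof (cases rule: normal_seminorms_cases)
  case (1 B)
  show ?thesis unfolding 1(2) test_sup_def
  proof (rule SUP_least)
    fix \<phi> assume "\<phi> \<in> B"
    then have "ennreal (cmod c) * ennreal (cmod (u \<phi>)) \<le> ennreal (cmod c) * (SUP \<phi>\<in>B. ennreal (cmod (u \<phi>)))"
      by (intro mult_left_mono SUP_upper) auto
    then show "ennreal (cmod (c * u \<phi>)) \<le> ennreal (cmod c) * (SUP \<phi>\<in>B. ennreal (cmod (u \<phi>)))"
      by (simp add: norm_mult ennreal_mult)
  qed
next
  case (2 N V \<psi>)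
  have cu: "(\<lambda>\<phi>. c * u \<phi>) \<in> distributions" using distributions_linear_combination[OF u u, of c 0] by simp
  show ?thesis unfolding 2(5) fourier_seminorm_eq[OF u 2(1)] fourier_seminorm_eq[OF cu 2(1)] local_decay_def
  proof (rule SUP_least)
    fix k assume "k \<in> V"
    then have "ennreal (cmod c) * ennreal ((1 + norm k) ^ N * cmod (local_ft u \<psi> k)) \<le>
      ennreal (cmod c) * (SUP k\<in>V. ennreal ((1 + norm k) ^ N * cmod (local_ft u \<psi> k)))"
      by (intro mult_left_mono SUP_upper) auto
    then show "ennreal ((1 + norm k) ^ N * cmod (local_ft (\<lambda>\<phi>. c * u \<phi>) \<psi> k)) \<le>
      ennreal (cmod c) * (SUP k\<in>V. ennreal ((1 + norm k) ^ N * cmod (local_ft u \<psi> k)))"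
      by (simp add: local_ft_def norm_mult ennreal_mult[symmetric] mult_ac)
  qed
qed

lemma normal_seminorm_zero:
  assumes "p \<in> normal_seminorms \<Gamma>"
  shows "p (\<lambda>_. 0) = 0"
  using normal_seminorm_scale[OF assms zero_distribution, of 0] by simp

lemma normal_seminorm_subadditive:
  assumes p: "p \<in> normal_seminorms \<Gamma>"
  shows "subadditive_on (dist_wf \<Gamma>') p"
  unfolding subadditive_on_def
proof (intro ballI)
  fix u v assume "u \<in> dist_wf \<Gamma>'" "v \<in> dist_wf \<Gamma>'"
  then have u: "u \<in> distributions" and v: "v \<in> distributions" by (auto simp: dist_wf_def)
  have vu: "(\<lambda>i. v i - u i) \<in> distributions" using distributions_linear_combination[OF v u, of 1 "-1"] by simp
  show "p v \<le> p (\<lambda>i. v i - u i) + p u"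
    using p
  proof (cases rule: normal_seminorms_cases)
    case (1 B)
    show ?thesis unfolding 1(2) test_sup_def[of B v]
    proof (rule SUP_least)
      fix \<phi> assume \<phi>: "\<phi> \<in> B"
      have "ennreal (cmod (v \<phi>)) \<le> ennreal (cmod (v \<phi> - u \<phi>)) + ennreal (cmod (u \<phi>))"
        using norm_triangle_ineq[of "v \<phi> - u \<phi>" "u \<phi>"]
          by (simp add: ennreal_plus[symmetric] ennreal_leI del: ennreal_plus)
      also have "\<dots> \<le> test_sup B (\<lambda>i. v i - u i) + test_sup B u"
        using test_sup_upper[OF \<phi>, of "\<lambda>i. v i - u i"] test_sup_upper[OF \<phi>, of u] by (rule add_mono)
      finally show "ennreal (cmod (v \<phi>)) \<le> test_sup B (\<lambda>i. v i - u i) + test_sup B u" .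
    qed
  next
    case (2 N V \<psi>)
    show ?thesis unfolding 2(5) fourier_seminorm_eq[OF u 2(1)] fourier_seminorm_eq[OF v 2(1)] fourier_seminorm_eq[OF
      vu 2(1)] local_decay_def[of N V \<psi> v]
    proof (rule SUP_least)
      fix k assume k: "k \<in> V"
      have "(1 + norm k) ^ N * cmod (local_ft v \<psi> k) \<le>
        (1 + norm k) ^ N * (cmod (local_ft (\<lambda>i. v i - u i) \<psi> k) + cmod (local_ft u \<psi> k))"
        using norm_triangle_ineq[of "local_ft v \<psi> k - local_ft u \<psi> k" "local_ft u \<psi> k"]
          by (intro mult_left_mono) (auto simp: local_ft_def)
      then have "ennreal ((1 + norm k) ^ N * cmod (local_ft v \<psi> k)) \<le>
        ennreal ((1 + norm k) ^ N * cmod (local_ft (\<lambda>i. v i - u i) \<psi> k)) + ennreal ((1 + norm k) ^ N * cmod (local_ft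
        u \<psi> k))"
        by (simp add: ennreal_plus[symmetric] ennreal_leI distrib_left del: ennreal_plus)
      also have "\<dots> \<le> local_decay N V \<psi> (\<lambda>i. v i - u i) + local_decay N V \<psi> u"
        unfolding local_decay_def using k by (intro add_mono SUP_upper)
      finally show "ennreal ((1 + norm k) ^ N * cmod (local_ft v \<psi> k)) \<le>
        local_decay N V \<psi> (\<lambda>i. v i - u i) + local_decay N V \<psi> u" .
    qed
  qed
qed

text \<open>Boundedness in the normal topology as the estimates use it: real constants,
  \<open>local_ft\<close> in place of \<open>dist_fourier\<close>, and equicontinuity in place of
  boundedness on bounded sets of test functions.\<close>

definition dist_bounded :: "('a::euclidean_space \<times> 'a) set \<Rightarrow> (('a \<Rightarrow> complex) \<Rightarrow> complex) set \<Rightarrow> bool" where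
  "dist_bounded \<Gamma> A \<longleftrightarrow> equicontinuous A \<and>
     (\<forall>\<psi> V N. \<psi> \<in> test_functions \<longrightarrow> closed V \<longrightarrow> cone V \<longrightarrow> (supp_fun \<psi> \<times> V) \<inter> \<Gamma> = {} \<longrightarrow>
        (\<exists>C\<ge>0. \<forall>u\<in>A. \<forall>k\<in>V. (1 + norm k) ^ N * cmod (local_ft u \<psi> k) \<le> C))"

lemma dist_boundedD:
  assumes "dist_bounded \<Gamma> A" "\<psi> \<in> test_functions" "closed V" "cone V" "(supp_fun \<psi> \<times> V) \<inter> \<Gamma> = {}"
  shows "\<exists>C\<ge>0. \<forall>u\<in>A. \<forall>k\<in>V. (1 + norm k) ^ N * cmod (local_ft u \<psi> k) \<le> C"
  using assms by (simp add: dist_bounded_def)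

text \<open>By \<open>dist_wf_local_decay\<close> the inclusion of the wave front set, a local
  condition, yields all constants. Statements about bounded sets thereby apply to single
  distributions.\<close>

lemma dist_bounded_singleton:
  assumes "u \<in> dist_wf \<Gamma>"
  shows "dist_bounded \<Gamma> {u}"
  unfolding dist_bounded_def
proof (intro conjI allI impI)
  have u: "u \<in> distributions" "wave_front u \<subseteq> \<Gamma>" using assms by (auto simp: dist_wf_def)
  show "equicontinuous {u}" by (rule equicontinuous_singleton[OF u(1)])
  fix \<psi> V N assume \<psi>: "\<psi> \<in> test_functions" "closed V" "cone V" "(supp_fun \<psi> \<times> V) \<inter> \<Gamma> = {}"
  then have "(supp_fun \<psi> \<times> V) \<inter> wave_front u = {}" using u(2) by blast
  from dist_wf_local_decay[OF u(1) \<psi>(1-3) this, of N]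
  show "\<exists>C\<ge>0. \<forall>u\<in>{u}. \<forall>k\<in>V. (1 + norm k) ^ N * cmod (local_ft u \<psi> k) \<le> C" by simp
qed

text \<open>Strong boundedness gives equicontinuity without Baire's theorem: a violating sequence of test
  functions, normalized in stronger and stronger norms, is itself a bounded set.\<close>

lemma equicontinuous_of_strongly_bounded:
  fixes A :: "(('a::euclidean_space \<Rightarrow> complex) \<Rightarrow> complex) set"
  assumes A: "A \<subseteq> distributions" and bd: "\<And>B. bounded_tests B \<Longrightarrow> \<exists>C\<ge>0. \<forall>u\<in>A. test_sup B u \<le> ennreal C"
  shows "equicontinuous A"
  unfolding equicontinuous_def
proof (intro conjI A allI impI)
  fix K :: "'a set" assume K: "compact K"
  show "\<exists>m. \<exists>C\<ge>0. \<forall>u\<in>A. dist_bound u K m C"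
  proof (rule ccontr)
    assume no: "\<not> ?thesis"
    have "\<exists>u \<psi>. u \<in> A \<and> \<psi> \<in> test_functions \<and> supp_fun \<psi> \<subseteq> K \<and> ck_bounded m UNIV 1 \<psi> \<and> cmod (u \<psi>) > real m" for m
    proof -
      have "\<not> (\<forall>u\<in>A. dist_bound u K m (real m))" using no of_nat_0_le_iff by blast
      then obtain u where u: "u \<in> A" "\<not> dist_bound u K m (real m)" by auto
      then obtain \<phi> c where \<phi>: "\<phi> \<in> test_functions" "supp_fun \<phi> \<subseteq> K" "ck_bounded m UNIV c \<phi>" "\<not> cmod (u \<phi>) \<le> real m * c"
        unfolding dist_bound_def by auto
      have lin: "test_functional u" using A u(1) by (intro distributions_test_functional) auto
      have c0: "c \<ge> 0" using ck_bounded_0D[OF \<phi>(3), of 0] order_trans[OF norm_ge_zero] by auto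
      have "c \<noteq> 0"
      proof
        assume "c = 0"
        then have "\<phi> = (\<lambda>x. 0)" using ck_bounded_0D[OF \<phi>(3)] by (intro ext) auto
        then show False using \<phi>(4) \<open>c = 0\<close> test_functional_zero[OF lin] by simp
      qed
      then have c: "c > 0" using c0 by simp
      define \<psi> where "\<psi> = (\<lambda>x. complex_of_real (1 / c) * \<phi> x)"
      have "ck_bounded m UNIV (cmod (complex_of_real (1 / c)) * c) \<psi>"
        unfolding \<psi>_def by (rule ck_bounded_cmult[OF test_functions_smooth[OF \<phi>(1)] \<phi>(3)])
      then have "ck_bounded m UNIV 1 \<psi>" using c by (simp add: norm_divide)
      moreover have "\<psi> \<in> test_functions" unfolding \<psi>_def by (rule test_functions_cmult[OF \<phi>(1)])
      moreover have "supp_fun \<psi> \<subseteq> K" unfolding \<psi>_def using supp_fun_cmult \<phi>(2) by (rule order_trans)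
      moreover have "cmod (u \<psi>) > real m"
        unfolding \<psi>_def test_functional_cmult[OF lin \<phi>(1)] using \<phi>(4) c by (simp add: norm_mult norm_divide field_simps)
      ultimately show ?thesis using u(1) by blast
    qed
    then have "\<forall>m. \<exists>u \<psi>. u \<in> A \<and> \<psi> \<in> test_functions \<and> supp_fun \<psi> \<subseteq> K \<and> ck_bounded m UNIV 1 \<psi> \<and> cmod (u \<psi>) > real m"
      by (rule allI)
    from choice[OF this] obtain u where "\<forall>m. \<exists>\<psi>. u m \<in> A \<and> \<psi> \<in> test_functions \<and> supp_fun \<psi> \<subseteq> K \<and>
      ck_bounded m UNIV 1 \<psi> \<and> cmod (u m \<psi>) > real m" ..
    from choice[OF this] obtain \<psi> where \<psi>: "\<forall>m. u m \<in> A \<and> \<psi> m \<in> test_functions \<and> supp_fun (\<psi> m) \<subseteq> K \<and>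
      ck_bounded m UNIV 1 (\<psi> m) \<and> cmod (u m (\<psi> m)) > real m" ..
    have "bounded_tests (range \<psi>)"
      unfolding bounded_tests_def
    proof (intro conjI allI)
      show "range \<psi> \<subseteq> test_functions" using \<psi> by auto
      show "\<exists>K. compact K \<and> (\<forall>\<phi>\<in>range \<psi>. supp_fun \<phi> \<subseteq> K)" using K \<psi> by auto
      fix j
      have "\<forall>m. \<exists>c. 0 \<le> c \<and> ck_bounded j UNIV c (\<psi> m)" using \<psi> test_function_ck_bounded by blast
      from choice[OF this] obtain c where c: "\<And>m. 0 \<le> c m" "\<And>m. ck_bounded j UNIV (c m) (\<psi> m)" by auto
      define D where "D = 1 + (\<Sum>m<j. c m)"
      have D0: "(\<Sum>m<j. c m) \<ge> 0" using c(1) by (intro sum_nonneg) auto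
      have "ck_bounded j UNIV D (\<psi> m)" for m
      proof (cases "m < j")
        case True
        then have "c m \<le> (\<Sum>m<j. c m)" using c(1) by (intro member_le_sum) auto
        then show ?thesis using ck_bounded_mono[OF c(2)[of m]] by (simp add: D_def)
      next
        case False
        have "ck_bounded m UNIV 1 (\<psi> m)" using spec[OF \<psi>, of m] by (elim conjE)
        then show ?thesis
          by (rule ck_bounded_mono) (use False D0 in \<open>auto simp: D_def\<close>)
      qed
      then show "\<exists>c. \<forall>\<phi>\<in>range \<psi>. ck_bounded j UNIV c \<phi>" by auto
    qed
    then obtain C where C: "C \<ge> 0" "\<forall>u\<in>A. test_sup (range \<psi>) u \<le> ennreal C" using bd by blast
    obtain m where m: "real m > C" using reals_Archimedean2 by blast
    have "ennreal (cmod (u m (\<psi> m))) \<le> test_sup (range \<psi>) (u m)" by (rule test_sup_upper) simp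
    also have "\<dots> \<le> ennreal C" using C(2) \<psi> by blast
    finally have "cmod (u m (\<psi> m)) \<le> C" using C(1) by (simp add: ennreal_le_iff)
    then show False using \<psi> m by (meson less_trans not_less)
  qed
qed

lemma zero_in_normal_space: "(\<lambda>_. 0) \<in> dist_wf \<Gamma> \<inter> {u. supp_dist u \<subseteq> X}"
proof -
  have "supp_dist (\<lambda>_. 0) = ({} :: 'a set)" unfolding supp_dist_def by auto
  moreover have "wave_front (\<lambda>_. 0) = ({} :: ('a \<times> 'a) set)"
  proof -
    have "\<exists>\<psi>\<in>test_functions. \<exists>V. \<psi> x \<noteq> 0 \<and> cone V \<and> \<xi> \<in> interior V \<and> (\<forall>N. fourier_seminorm N V \<psi> (\<lambda>_. 0) < \<infinity>)"
      for x \<xi> :: 'a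
    proof -
      obtain \<psi> U where \<psi>: "\<psi> \<in> test_functions" "supp_fun \<psi> \<subseteq> cball x 1" "open U" "x \<in> U" "\<And>y. y \<in> U \<Longrightarrow> \<psi> y = 1"
        by (rule cutoff_ball[of 1 x]) (simp, rule that)
      have "fourier_seminorm N UNIV \<psi> (\<lambda>_. 0) < \<infinity>" for N
        unfolding fourier_seminorm_eq[OF zero_distribution \<psi>(1)] local_decay_def by (simp add: local_ft_def)
      then show ?thesis using \<psi> by (intro bexI[of _ \<psi>] exI[of _ UNIV]) (auto simp: cone_def)
    qed
    then show ?thesis unfolding wave_front_def by blast
  qed
  ultimately show ?thesis by (simp add: dist_wf_def zero_distribution)
qed

lemma tvs_bounded_imp_dist_bounded:
  assumes "tvs_bounded (normal_topology_supp \<Gamma> X) A"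
  shows "dist_bounded \<Gamma> A" "A \<subseteq> dist_wf \<Gamma> \<inter> dist_on X"
proof -
  show AX: "A \<subseteq> dist_wf \<Gamma> \<inter> dist_on X"
    using assms unfolding tvs_bounded_def topspace_normal_topology_supp by blast
  have sn: "\<exists>C\<ge>0. \<forall>u\<in>A. p u \<le> ennreal C" if p: "p \<in> normal_seminorms \<Gamma>" for p
  proof (rule tvs_bounded_seminorm[OF assms[unfolded normal_topology_supp_eq] p normal_seminorm_subadditive[OF p]
    normal_seminorm_zero[OF p] _ zero_in_normal_space])
    fix t :: real and u assume "u \<in> dist_wf \<Gamma>" "0 < t"
    then show "p (\<lambda>i. complex_of_real t * u i) \<le> ennreal t * p u"
      using normal_seminorm_scale[OF p, of u "of_real t"] by (simp add: dist_wf_def)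
  qed
  have Ad: "A \<subseteq> distributions" using AX by (auto simp: dist_on_def)
  show "dist_bounded \<Gamma> A"
    unfolding dist_bounded_def
  proof (intro conjI allI impI)
    show "equicontinuous A"
      by (rule equicontinuous_of_strongly_bounded[OF Ad]) (rule sn[OF normal_seminormsI(1)])
    fix \<psi> V N assume \<psi>: "\<psi> \<in> test_functions" "closed V" "cone V" "(supp_fun \<psi> \<times> V) \<inter> \<Gamma> = {}"
    obtain C where C: "C \<ge> 0" "\<forall>u\<in>A. fourier_seminorm N V \<psi> u \<le> ennreal C"
      using sn[OF normal_seminormsI(2)[OF \<psi>, of N]] by auto
    have "\<forall>u\<in>A. \<forall>k\<in>V. (1 + norm k) ^ N * cmod (local_ft u \<psi> k) \<le> C"
    proof
      fix u assume u: "u \<in> A"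
      then have ud: "u \<in> distributions" using Ad by (rule subsetD[rotated])
      from bspec[OF C(2) u] have "local_decay N V \<psi> u \<le> ennreal C" unfolding fourier_seminorm_eq[OF ud \<psi>(1)] .
      then show "\<forall>k\<in>V. (1 + norm k) ^ N * cmod (local_ft u \<psi> k) \<le> C" using local_decay_le_iff[OF C(1)] by blast
    qed
    then show "\<exists>C\<ge>0. \<forall>u\<in>A. \<forall>k\<in>V. (1 + norm k) ^ N * cmod (local_ft u \<psi> k) \<le> C" using C(1) by blast
  qed
qed

text \<open>Together with \<open>dominated_finite\<close> this makes dominated quantities finite,
  which is how the wave front set of a convolution is bounded.\<close>

lemma normal_seminorm_finite:
  assumes p: "p \<in> normal_seminorms \<Gamma>" and u: "u \<in> dist_wf \<Gamma>"
  shows "p u < \<infinity>"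
proof -
  have ud: "u \<in> distributions" using u by (simp add: dist_wf_def)
  show ?thesis using p
  proof (cases rule: normal_seminorms_cases)
    case (1 B)
    obtain K where K: "compact K" "\<forall>\<phi>\<in>B. supp_fun \<phi> \<subseteq> K" and Bt: "B \<subseteq> test_functions"
      and bd: "\<forall>m. \<exists>c. \<forall>\<phi>\<in>B. ck_bounded m UNIV c \<phi>"
      using 1(1) unfolding bounded_tests_def by auto
    obtain m C where mC: "0 \<le> C" "dist_bound u K m C" by (rule distribution_dist_bound[OF ud K(1)])
    obtain c where c: "\<forall>\<phi>\<in>B. ck_bounded m UNIV c \<phi>" using bd by blast
    have "test_sup B u \<le> ennreal (C * c)"
      unfolding test_sup_def
    proof (rule SUP_least)
      fix \<phi> assume "\<phi> \<in> B"
      then show "ennreal (cmod (u \<phi>)) \<le> ennreal (C * c)"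
        using K(2) Bt c by (intro ennreal_leI dist_boundD[OF mC(2)]) auto
    qed
    then show ?thesis unfolding 1(2) by (simp add: le_less_trans)
  next
    case (2 N V \<psi>)
    obtain C where C: "C \<ge> 0" "\<forall>k\<in>V. (1 + norm k) ^ N * cmod (local_ft u \<psi> k) \<le> C"
      using dist_boundedD[OF dist_bounded_singleton[OF u] 2(1-4), of N] by auto
    then have "local_decay N V \<psi> u \<le> ennreal C" by (simp add: local_decay_le_iff)
    then show ?thesis unfolding 2(5) fourier_seminorm_eq[OF ud 2(1)] by (simp add: le_less_trans)
  qed
qed

section \<open>Separate domination of seminorms\<close>

text \<open>Hypocontinuity for seminorms: the bound is uniform in the first argument, which ranges over \<open>A\<close>.\<close>

definition dominated :: "('v \<Rightarrow> ennreal) set \<Rightarrow> 'v set \<Rightarrow> 'u set \<Rightarrow> ('u \<Rightarrow> 'v \<Rightarrow> ennreal) \<Rightarrow> bool" where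
  "dominated P E A q \<longleftrightarrow> (\<exists>F C. finite F \<and> F \<subseteq> P \<and> (\<forall>u\<in>A. \<forall>v\<in>E. q u v \<le> ennreal C * (\<Sum>p\<in>F. p v)))"

lemma dominated_mono:
  assumes "dominated P E A q" and "\<And>u v. u \<in> A \<Longrightarrow> v \<in> E' \<Longrightarrow> q' u v \<le> q u v" and "E' \<subseteq> E"
  shows "dominated P E' A q'"
proof -
  obtain F C where F: "finite F" "F \<subseteq> P" "\<forall>u\<in>A. \<forall>v\<in>E. q u v \<le> ennreal C * (\<Sum>p\<in>F. p v)"
    using assms(1) unfolding dominated_def by auto
  have "\<forall>u\<in>A. \<forall>v\<in>E'. q' u v \<le> ennreal C * (\<Sum>p\<in>F. p v)"
    using F(3) assms(2,3) by (meson order_trans subsetD)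
  then show ?thesis unfolding dominated_def using F(1,2) by blast
qed

lemma dominated_single: "p \<in> P \<Longrightarrow> dominated P E A (\<lambda>u v. ennreal C * p v)"
  unfolding dominated_def by (intro exI[of _ "{p}"] exI[of _ C]) auto

lemma dominated_zero: "dominated P E A (\<lambda>u v. 0)"
  unfolding dominated_def by (intro exI[of _ "{}"]) auto

lemma dominated_add:
  assumes "dominated P E A q" and "dominated P E A q'"
  shows "dominated P E A (\<lambda>u v. q u v + q' u v)"
proof -
  obtain F C where F: "finite F" "F \<subseteq> P" "\<forall>u\<in>A. \<forall>v\<in>E. q u v \<le> ennreal C * (\<Sum>p\<in>F. p v)"
    using assms(1) unfolding dominated_def by auto
  obtain F' C' where F': "finite F'" "F' \<subseteq> P" "\<forall>u\<in>A. \<forall>v\<in>E. q' u v \<le> ennreal C' * (\<Sum>p\<in>F'. p v)"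
    using assms(2) unfolding dominated_def by auto
  have le: "r \<le> ennreal (max 0 C) * (\<Sum>p\<in>F \<union> F'. p v)" if "r \<le> ennreal C * (\<Sum>p\<in>G. p v)" "G \<subseteq> F \<union> F'" for r C G v
  proof -
    have "ennreal C * (\<Sum>p\<in>G. p v) \<le> ennreal (max 0 C) * (\<Sum>p\<in>F \<union> F'. p v)"
      using F(1) F'(1) that(2) by (intro mult_mono ennreal_leI sum_mono2) auto
    then show ?thesis using that(1) by (rule order_trans[rotated])
  qed
  have "q u v + q' u v \<le> ennreal (max 0 C + max 0 C') * (\<Sum>p\<in>F \<union> F'. p v)" if "u \<in> A" "v \<in> E" for u v
    using le[of "q u v" C v F] le[of "q' u v" C' v F'] F(3) F'(3) that
    by (simp add: distrib_right add_mono)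
  then show ?thesis unfolding dominated_def using F(1,2) F'(1,2)
    by (intro exI[of _ "F \<union> F'"] exI[of _ "max 0 C + max 0 C'"]) auto
qed

lemma dominated_sum:
  assumes "finite I" and "\<And>i. i \<in> I \<Longrightarrow> dominated P E A (q i)"
  shows "dominated P E A (\<lambda>u v. \<Sum>i\<in>I. q i u v)"
  using assms by (induction I rule: finite_induct) (simp_all add: dominated_zero dominated_add)

lemma dominated_finite:
  assumes "dominated P E A q" "u \<in> A" "v \<in> E" "\<And>p. p \<in> P \<Longrightarrow> p v < \<infinity>"
  shows "q u v < \<infinity>"
proof -
  obtain F C where F: "finite F" "F \<subseteq> P" "\<forall>u\<in>A. \<forall>v\<in>E. q u v \<le> ennreal C * (\<Sum>p\<in>F. p v)"
    using assms(1) unfolding dominated_def by auto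
  have "(\<Sum>p\<in>F. p v) < \<infinity>" using F(1,2) assms(4) by (auto simp: less_top)
  then have "ennreal C * (\<Sum>p\<in>F. p v) < \<infinity>" by (simp add: ennreal_mult_less_top)
  then show ?thesis using F(3) assms(2,3) by (meson le_less_trans)
qed

lemma dominated_small:
  assumes "dominated P E A q" and \<epsilon>: "0 < \<epsilon>"
  obtains F \<delta> where "finite F" "F \<subseteq> P" "(0::real) < \<delta>"
    "\<And>u v. u \<in> A \<Longrightarrow> v \<in> E \<Longrightarrow> \<forall>p\<in>F. p v < ennreal \<delta> \<Longrightarrow> q u v < ennreal \<epsilon>"
proof -
  obtain F C where F: "finite F" "F \<subseteq> P" "\<forall>u\<in>A. \<forall>v\<in>E. q u v \<le> ennreal C * (\<Sum>p\<in>F. p v)"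
    using assms(1) unfolding dominated_def by auto
  \<comment> \<open>The summands 1 keep \<open>M\<close> positive even for \<open>C = 0\<close> or
    empty \<open>F\<close>; the factor 2 in \<open>\<delta>\<close> makes the final inequality
    strict.\<close>
  define M where "M = (\<bar>C\<bar> + 1) * (real (card F) + 1)"
  have M: "M > 0" unfolding M_def by (intro mult_pos_pos) auto
  define \<delta> where "\<delta> = \<epsilon> / (2 * M)"
  have \<delta>: "\<delta> > 0" unfolding \<delta>_def using \<epsilon> M by simp
  have "q u v < ennreal \<epsilon>" if uv: "u \<in> A" "v \<in> E" "\<forall>p\<in>F. p v < ennreal \<delta>" for u v
  proof -
    have "(\<Sum>p\<in>F. p v) \<le> (\<Sum>p\<in>F. ennreal \<delta>)" using uv(3) by (intro sum_mono) (auto intro: less_imp_le)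
    also have "\<dots> = ennreal (real (card F) * \<delta>)" using \<delta> by (simp add: ennreal_mult ennreal_of_nat_eq_real_of_nat)
    also have "\<dots> \<le> ennreal ((real (card F) + 1) * \<delta>)" using \<delta> by (intro ennreal_leI mult_right_mono) auto
    finally have "ennreal C * (\<Sum>p\<in>F. p v) \<le> ennreal (\<bar>C\<bar> + 1) * ennreal ((real (card F) + 1) * \<delta>)"
      by (intro mult_mono ennreal_leI) auto
    also have "\<dots> = ennreal (M * \<delta>)" using \<delta> unfolding M_def mult.assoc by (intro ennreal_mult[symmetric]) auto
    also have "M * \<delta> = \<epsilon> / 2" using M by (simp add: \<delta>_def)
    also have "ennreal (\<epsilon> / 2) < ennreal \<epsilon>" using \<epsilon> by (intro ennreal_lessI) auto
    finally show ?thesis using F(3) uv by (meson le_less_trans)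
  qed
  then show thesis by (rule that[OF F(1,2) \<delta>])
qed

section \<open>Pieces of the convolution\<close>

lemma piece_dominated:
  fixes \<Gamma>1 \<Gamma>2 :: "('a::euclidean_space \<times> 'a) set"
  assumes \<kappa>: "norm \<kappa> = 1" and \<epsilon>: "0 < \<epsilon>" "\<epsilon> \<le> 1" and P: "good_piece \<Gamma>1 \<Gamma>2 (cone_nbhd \<kappa> \<epsilon>) P" and A: "dist_bounded \<Gamma>1 A"
  obtains q where "dominated (normal_seminorms \<Gamma>2) distributions A q"
    "\<And>u v k. u \<in> A \<Longrightarrow> v \<in> distributions \<Longrightarrow> k \<in> cone_nbhd \<kappa> (\<epsilon> / 4) \<Longrightarrow>
      ennreal ((1 + norm k) ^ N * cmod (piece_value P u v k)) \<le> q u v"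
proof -
  let ?W = "cone_nbhd \<kappa> \<epsilon>"
  have P1: "piece_loc1 P \<in> test_functions" and P2: "piece_loc2 P \<in> test_functions"
    and r: "rapid (piece_coeff P) (\<lambda>j. (piece_freq1 P j, piece_freq2 P j))"
    and alt: "(supp_fun (piece_loc1 P) \<times> ?W) \<inter> \<Gamma>1 = {} \<or> (supp_fun (piece_loc2 P) \<times> ?W) \<inter> \<Gamma>2 = {}"
    using iffD1[OF good_piece_def P] by simp_all
  have eq: "equicontinuous A" using A unfolding dist_bounded_def by (elim conjE)
  from alt show thesis
  proof
    assume d: "(supp_fun (piece_loc1 P) \<times> ?W) \<inter> \<Gamma>1 = {}"
    obtain B where B: "bounded_tests B" "\<And>u v k. u \<in> A \<Longrightarrow> v \<in> distributions \<Longrightarrow> k \<in> cone_nbhd \<kappa> (\<epsilon> / 4) \<Longrightarrow>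
      ennreal ((1 + norm k) ^ N * cmod (bilinear_series (piece_coeff P) (piece_freq1 P) (piece_freq2 P) (piece_loc1 P)
        (piece_loc2 P) u v k)) \<le> test_sup B v"
      by (rule bilinear_series_decaying_left[OF \<kappa> \<epsilon> r P1 P2 eq dist_boundedD[OF A P1 closed_cone_nbhd cone_cone_nbhd
        d]]) (rule that)
    show thesis
    proof (rule that)
      show "dominated (normal_seminorms \<Gamma>2) distributions A (\<lambda>u v. ennreal 1 * test_sup B v)"
        by (rule dominated_single[OF normal_seminormsI(1)[OF B(1)]])
    next
      fix u v :: "('a \<Rightarrow> complex) \<Rightarrow> complex" and k assume "u \<in> A" "v \<in> distributions" "k \<in> cone_nbhd \<kappa> (\<epsilon> / 4)"
      from B(2)[OF this] show "ennreal ((1 + norm k) ^ N * cmod (piece_value P u v k)) \<le> ennreal 1 * test_sup B v"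
        by (simp add: piece_value_def)
    qed
  next
    assume d: "(supp_fun (piece_loc2 P) \<times> ?W) \<inter> \<Gamma>2 = {}"
    obtain B N' C where B: "bounded_tests B" "0 < C" "\<And>u v k. u \<in> A \<Longrightarrow> v \<in> distributions \<Longrightarrow> k \<in> cone_nbhd \<kappa> (\<epsilon> / 4) \<Longrightarrow>
      ennreal ((1 + norm k) ^ N * cmod (bilinear_series (piece_coeff P) (piece_freq1 P) (piece_freq2 P) (piece_loc1 P)
        (piece_loc2 P) u v k))
        \<le> test_sup B v + ennreal C * local_decay N' ?W (piece_loc2 P) v"
      by (rule bilinear_series_decaying_right[OF \<kappa> \<epsilon> r P1 P2 eq]) (rule that)
    show thesis
    proof (rule that)
      show "dominated (normal_seminorms \<Gamma>2) distributions A (\<lambda>u v. ennreal 1 * test_sup B v + ennreal C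
        * fourier_seminorm N' ?W (piece_loc2 P) v)"
        by (intro dominated_add dominated_single normal_seminormsI B(1) P2 closed_cone_nbhd cone_cone_nbhd d)
    next
      fix u v :: "('a \<Rightarrow> complex) \<Rightarrow> complex" and k assume uvk: "u \<in> A" "v \<in> distributions" "k \<in> cone_nbhd \<kappa> (\<epsilon> / 4)"
      from B(3)[OF this] show "ennreal ((1 + norm k) ^ N * cmod (piece_value P u v k)) \<le>
        ennreal 1 * test_sup B v + ennreal C * fourier_seminorm N' ?W (piece_loc2 P) v"
        by (simp add: piece_value_def fourier_seminorm_eq[OF uvk(2) P2])
    qed
  qed
qed

lemma pieces_dominated:
  fixes \<Gamma>1 \<Gamma>2 :: "('a::euclidean_space \<times> 'a) set"
  assumes \<kappa>: "norm \<kappa> = 1" and \<epsilon>: "0 < \<epsilon>" "\<epsilon> \<le> 1" and F: "finite F" "\<And>z. z \<in> F \<Longrightarrow> good_piece \<Gamma>1 \<Gamma>2 (cone_nbhd \<kappa> \<epsilon>) (P z)"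
    and A: "dist_bounded \<Gamma>1 A" and E: "E \<subseteq> distributions"
    and w: "\<And>u v k. u \<in> A \<Longrightarrow> v \<in> E \<Longrightarrow> local_ft (w u v) \<tau> k = (\<Sum>z\<in>F. piece_value (P z) u v k)"
  shows "dominated (normal_seminorms \<Gamma>2) E A (\<lambda>u v. local_decay N (cone_nbhd \<kappa> (\<epsilon> / 4)) \<tau> (w u v))"
proof -
  have "\<forall>z\<in>F. \<exists>q. dominated (normal_seminorms \<Gamma>2) distributions A q \<and>
    (\<forall>u\<in>A. \<forall>v\<in>distributions. \<forall>k\<in>cone_nbhd \<kappa> (\<epsilon> / 4). ennreal ((1 + norm k) ^ N * cmod (piece_value (P z) u v k)) \<le> q u
      v)"
  proof
    fix z assume "z \<in> F"
    then obtain q where "dominated (normal_seminorms \<Gamma>2) distributions A q"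
      "\<And>u v k. u \<in> A \<Longrightarrow> v \<in> distributions \<Longrightarrow> k \<in> cone_nbhd \<kappa> (\<epsilon> / 4) \<Longrightarrow>
        ennreal ((1 + norm k) ^ N * cmod (piece_value (P z) u v k)) \<le> q u v"
      using piece_dominated[OF \<kappa> \<epsilon> F(2) A] by blast
    then show "\<exists>q. dominated (normal_seminorms \<Gamma>2) distributions A q \<and>
      (\<forall>u\<in>A. \<forall>v\<in>distributions. \<forall>k\<in>cone_nbhd \<kappa> (\<epsilon> / 4). ennreal ((1 + norm k) ^ N * cmod (piece_value (P z) u v k)) \<le> q
        u v)"
      by (intro exI[of _ q]) auto
  qed
  from bchoice[OF this] obtain q where q0: "\<forall>z\<in>F. dominated (normal_seminorms \<Gamma>2) distributions A (q z) \<and>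
    (\<forall>u\<in>A. \<forall>v\<in>distributions. \<forall>k\<in>cone_nbhd \<kappa> (\<epsilon> / 4). ennreal ((1 + norm k) ^ N * cmod (piece_value (P z) u v k)) \<le> q z
      u v)" ..
  have q: "dominated (normal_seminorms \<Gamma>2) distributions A (q z)" if "z \<in> F" for z
    using bspec[OF q0 that] by (elim conjE)
  have q2: "ennreal ((1 + norm k) ^ N * cmod (piece_value (P z) u v k)) \<le> q z u v"
    if "z \<in> F" "u \<in> A" "v \<in> distributions" "k \<in> cone_nbhd \<kappa> (\<epsilon> / 4)" for z u v k
    using bspec[OF q0 that(1)] that(2-4) by simp
  show ?thesis
  proof (rule dominated_mono[OF dominated_sum[OF F(1) q] _ E])
    fix u v assume uv: "u \<in> A" "v \<in> E"
    show "local_decay N (cone_nbhd \<kappa> (\<epsilon> / 4)) \<tau> (w u v) \<le> (\<Sum>z\<in>F. q z u v)"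
      unfolding local_decay_def
    proof (rule SUP_least)
      fix k assume k: "k \<in> cone_nbhd \<kappa> (\<epsilon> / 4)"
      have "(1 + norm k) ^ N * cmod (local_ft (w u v) \<tau> k) \<le> (\<Sum>z\<in>F. (1 + norm k) ^ N * cmod (piece_value (P z) u v k))"
        unfolding w[OF uv] sum_distrib_left[symmetric] by (intro mult_left_mono norm_sum) auto
      then have "ennreal ((1 + norm k) ^ N * cmod (local_ft (w u v) \<tau> k)) \<le>
        ennreal (\<Sum>z\<in>F. (1 + norm k) ^ N * cmod (piece_value (P z) u v k))"
        by (rule ennreal_leI)
      also have "\<dots> = (\<Sum>z\<in>F. ennreal ((1 + norm k) ^ N * cmod (piece_value (P z) u v k)))"
        by (rule sum_ennreal[symmetric]) simp
      also have "\<dots> \<le> (\<Sum>z\<in>F. q z u v)"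
        using E uv k by (intro sum_mono q2) auto
      finally show "ennreal ((1 + norm k) ^ N * cmod (local_ft (w u v) \<tau> k)) \<le> (\<Sum>z\<in>F. q z u v)" .
    qed
  qed
qed

text \<open>The roles of the two variables are exchanged at the level of the series, where this is
  commutativity of multiplication; the same pieces then serve both halves of hypocontinuity.\<close>

definition swap_piece :: "'a wave_piece \<Rightarrow> 'a wave_piece" where
  "swap_piece P = \<lparr>piece_coeff = piece_coeff P, piece_freq1 = piece_freq2 P, piece_freq2 = piece_freq1 P,
     piece_loc1 = piece_loc2 P, piece_loc2 = piece_loc1 P\<rparr>"

lemma piece_value_swap: "piece_value (swap_piece P) v u = piece_value P u v"
  unfolding piece_value_def swap_piece_def by (simp add: bilinear_series_swap[of _ "piece_freq2 P"])

lemma good_piece_swap: "good_piece \<Gamma>1 \<Gamma>2 W P \<Longrightarrow> good_piece \<Gamma>2 \<Gamma>1 W (swap_piece P)"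
  unfolding good_piece_def swap_piece_def rapid_def by (auto simp: norm_Pair add.commute)

lemma local_ft_0: "local_ft u \<tau> 0 = u \<tau>"
  by (simp add: local_ft_def wave_def)

lemma bounded_tests_singleton: "\<tau> \<in> test_functions \<Longrightarrow> bounded_tests {\<tau>}"
  unfolding bounded_tests_def using test_functions_compact test_function_ck_bounded by blast

text \<open>\<open>w\<close> is abstract so that both orders of the arguments of the convolution are
  covered. Each direction in \<open>V\<close> has its own pieces and finitely many cones suffice;
  the value at \<open>k = 0\<close> is the pairing with \<open>\<tau>\<close>, whence the hypothesis
  on \<open>test_sup {\<tau>}\<close>.\<close>

lemma fourier_dominated:
  fixes \<Gamma>1 \<Gamma>2 :: "('a::euclidean_space \<times> 'a) set"
  assumes A: "dist_bounded \<Gamma>1 A" and E: "E \<subseteq> distributions" and V: "closed V" "cone V"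
    and w: "\<And>\<kappa>. \<kappa> \<in> V \<Longrightarrow> norm \<kappa> = 1 \<Longrightarrow> \<exists>\<epsilon> (F :: 'i set) P. 0 < \<epsilon> \<and> \<epsilon> \<le> 1 \<and> finite F \<and>
      (\<forall>z\<in>F. good_piece \<Gamma>1 \<Gamma>2 (cone_nbhd \<kappa> \<epsilon>) (P z)) \<and>
      (\<forall>u\<in>A. \<forall>v\<in>E. \<forall>k. local_ft (w u v) \<tau> k = (\<Sum>z\<in>F. piece_value (P z) u v k))"
    and test: "dominated (normal_seminorms \<Gamma>2) E A (\<lambda>u v. test_sup {\<tau>} (w u v))"
  shows "dominated (normal_seminorms \<Gamma>2) E A (\<lambda>u v. local_decay N V \<tau> (w u v))"
proof -
  have "\<forall>\<kappa>\<in>{\<kappa> \<in> V. norm \<kappa> = 1}. \<exists>\<epsilon>. 0 < \<epsilon> \<and>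
    dominated (normal_seminorms \<Gamma>2) E A (\<lambda>u v. local_decay N (cone_nbhd \<kappa> \<epsilon>) \<tau> (w u v))"
  proof
    fix \<kappa> assume "\<kappa> \<in> {\<kappa> \<in> V. norm \<kappa> = 1}"
    then have \<kappa>: "\<kappa> \<in> V" "norm \<kappa> = 1" by auto
    obtain \<epsilon> and F :: "'i set" and P where *: "0 < \<epsilon>" "\<epsilon> \<le> 1" "finite F" "\<forall>z\<in>F. good_piece \<Gamma>1 \<Gamma>2 (cone_nbhd \<kappa> \<epsilon>) (P z)"
      "\<forall>u\<in>A. \<forall>v\<in>E. \<forall>k. local_ft (w u v) \<tau> k = (\<Sum>z\<in>F. piece_value (P z) u v k)"
      using w[OF \<kappa>] by (elim exE conjE)
    have "dominated (normal_seminorms \<Gamma>2) E A (\<lambda>u v. local_decay N (cone_nbhd \<kappa> (\<epsilon> / 4)) \<tau> (w u v))"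
      by (rule pieces_dominated[OF \<kappa>(2) *(1-3) _ A E]) (use *(4,5) in auto)
    then show "\<exists>\<epsilon>. 0 < \<epsilon> \<and> dominated (normal_seminorms \<Gamma>2) E A (\<lambda>u v. local_decay N (cone_nbhd \<kappa> \<epsilon>) \<tau> (w u v))"
      using *(1) by (intro exI[of _ "\<epsilon> / 4"]) simp
  qed
  from bchoice[OF this] obtain \<epsilon> where \<epsilon>: "\<And>\<kappa>. \<kappa> \<in> V \<Longrightarrow> norm \<kappa> = 1 \<Longrightarrow> 0 < \<epsilon> \<kappa>"
    "\<And>\<kappa>. \<kappa> \<in> V \<Longrightarrow> norm \<kappa> = 1 \<Longrightarrow> dominated (normal_seminorms \<Gamma>2) E A (\<lambda>u v. local_decay N (cone_nbhd \<kappa> (\<epsilon> \<kappa>)) \<tau> (w u v))"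
    by auto
  obtain T where T: "finite T" "T \<subseteq> {\<kappa> \<in> V. norm \<kappa> = 1}" "V \<subseteq> insert 0 (\<Union>\<kappa>\<in>T. cone_nbhd \<kappa> (\<epsilon> \<kappa>))"
    by (rule closed_cone_cover[OF V \<epsilon>(1)]) (assumption, assumption, rule that)
  have "dominated (normal_seminorms \<Gamma>2) E A
    (\<lambda>u v. test_sup {\<tau>} (w u v) + (\<Sum>\<kappa>\<in>T. local_decay N (cone_nbhd \<kappa> (\<epsilon> \<kappa>)) \<tau> (w u v)))"
    using T by (intro dominated_add dominated_sum test \<epsilon>(2)) auto
  then show ?thesis
  proof (rule dominated_mono[OF _ _ order_refl])
    fix u v assume "u \<in> A" "v \<in> E"
    let ?S = "\<Sum>\<kappa>\<in>T. local_decay N (cone_nbhd \<kappa> (\<epsilon> \<kappa>)) \<tau> (w u v)"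
    show "local_decay N V \<tau> (w u v) \<le> test_sup {\<tau>} (w u v) + ?S"
      unfolding local_decay_def[of N V]
    proof (rule SUP_least)
      fix k assume "k \<in> V"
      then consider "k = 0" | \<kappa> where "\<kappa> \<in> T" "k \<in> cone_nbhd \<kappa> (\<epsilon> \<kappa>)" using T(3) by auto
      then show "ennreal ((1 + norm k) ^ N * cmod (local_ft (w u v) \<tau> k)) \<le> test_sup {\<tau>} (w u v) + ?S"
      proof cases
        case 1
        then have "ennreal ((1 + norm k) ^ N * cmod (local_ft (w u v) \<tau> k)) \<le> test_sup {\<tau>} (w u v)"
          using test_sup_upper[of \<tau> "{\<tau>}" "w u v"] by (simp add: local_ft_0)
        then show ?thesis by (rule order_trans) simp
      next
        case 2
        then have "ennreal ((1 + norm k) ^ N * cmod (local_ft (w u v) \<tau> k)) \<le>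
          local_decay N (cone_nbhd \<kappa> (\<epsilon> \<kappa>)) \<tau> (w u v)"
          unfolding local_decay_def by (intro SUP_upper)
        also have "\<dots> \<le> ?S" using T(1) 2(1) by (intro member_le_sum) auto
        finally show ?thesis by (rule order_trans) simp
      qed
    qed
  qed
qed

section \<open>Bounded families of slices\<close>

lemma bounded_testsE:
  assumes "bounded_tests B"
  obtains K where "B \<subseteq> test_functions" "compact K" "\<And>\<phi>. \<phi> \<in> B \<Longrightarrow> supp_fun \<phi> \<subseteq> K"
    "\<And>m. \<exists>c\<ge>0. \<forall>\<phi>\<in>B. ck_bounded m UNIV c \<phi>"
proof -
  obtain K where K: "B \<subseteq> test_functions" "compact K" "\<forall>\<phi>\<in>B. supp_fun \<phi> \<subseteq> K" and b: "\<forall>m. \<exists>c. \<forall>\<phi>\<in>B. ck_bounded m UNIV c \<phi>"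
    using assms unfolding bounded_tests_def by auto
  have "\<exists>c\<ge>0. \<forall>\<phi>\<in>B. ck_bounded m UNIV c \<phi>" for m
  proof -
    obtain c where "\<forall>\<phi>\<in>B. ck_bounded m UNIV c \<phi>" using b by blast
    then have "\<forall>\<phi>\<in>B. ck_bounded m UNIV (max 0 c) \<phi>" by (auto intro: ck_bounded_mono[of m UNIV c])
    then show ?thesis by (intro exI[of _ "max 0 c"]) simp
  qed
  then show thesis using K by (intro that[of K]) auto
qed

lemma bounded_testsI:
  assumes "B \<subseteq> test_functions" "compact K" "\<And>\<phi>. \<phi> \<in> B \<Longrightarrow> supp_fun \<phi> \<subseteq> K"
    "\<And>m. \<exists>c. \<forall>\<phi>\<in>B. ck_bounded m UNIV c \<phi>"
  shows "bounded_tests B"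
  unfolding bounded_tests_def using assms by auto

lemma bounded_tests_Un:
  assumes "bounded_tests B" and "bounded_tests B'"
  shows "bounded_tests (B \<union> B')"
proof -
  obtain K where K: "B \<subseteq> test_functions" "compact K" "\<And>\<phi>. \<phi> \<in> B \<Longrightarrow> supp_fun \<phi> \<subseteq> K"
    "\<And>m. \<exists>c\<ge>0. \<forall>\<phi>\<in>B. ck_bounded m UNIV c \<phi>" by (rule bounded_testsE[OF assms(1)]) (rule that)
  obtain K' where K': "B' \<subseteq> test_functions" "compact K'" "\<And>\<phi>. \<phi> \<in> B' \<Longrightarrow> supp_fun \<phi> \<subseteq> K'"
    "\<And>m. \<exists>c\<ge>0. \<forall>\<phi>\<in>B'. ck_bounded m UNIV c \<phi>" by (rule bounded_testsE[OF assms(2)]) (rule that)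
  show ?thesis
  proof (rule bounded_testsI[where K = "K \<union> K'"])
    show "B \<union> B' \<subseteq> test_functions" using K(1) K'(1) by (rule Un_least)
    show "compact (K \<union> K')" using K(2) K'(2) by (rule compact_Un)
    show "supp_fun \<phi> \<subseteq> K \<union> K'" if "\<phi> \<in> B \<union> B'" for \<phi> using that K(3)[of \<phi>] K'(3)[of \<phi>] by auto
    fix m
    obtain c c' where c: "c \<ge> 0" "\<forall>\<phi>\<in>B. ck_bounded m UNIV c \<phi>" "c' \<ge> 0" "\<forall>\<phi>\<in>B'. ck_bounded m UNIV c' \<phi>"
      using K(4)[of m] K'(4)[of m] by (elim exE conjE)
    have "ck_bounded m UNIV (c + c') \<phi>" if "\<phi> \<in> B \<union> B'" for \<phi>
      using that
    proof
      assume "\<phi> \<in> B"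
      from bspec[OF c(2) this] show ?thesis by (rule ck_bounded_mono) (use c in auto)
    next
      assume "\<phi> \<in> B'"
      from bspec[OF c(4) this] show ?thesis by (rule ck_bounded_mono) (use c in auto)
    qed
    then show "\<exists>c. \<forall>\<phi>\<in>B \<union> B'. ck_bounded m UNIV c \<phi>" by (intro exI[of _ "c + c'"]) blast
  qed
qed

lemma bounded_tests_empty: "bounded_tests {}"
  unfolding bounded_tests_def using compact_empty by blast

lemma bounded_tests_UN:
  assumes "finite I" "\<And>i. i \<in> I \<Longrightarrow> bounded_tests (B i)"
  shows "bounded_tests (\<Union>i\<in>I. B i)"
  using assms by (induction I rule: finite_induct) (simp_all add: bounded_tests_Un bounded_tests_empty)

lemma test_sup_mono: "B \<subseteq> B' \<Longrightarrow> test_sup B v \<le> test_sup B' v"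
  unfolding test_sup_def by (rule SUP_subset_mono) auto

lemma bounded_tests_slices:
  fixes \<F> :: "('a::euclidean_space \<times> 'b::euclidean_space \<Rightarrow> complex) set"
  assumes "bounded_tests \<F>"
  shows "bounded_tests {\<lambda>y. f (x, y) | f x. f \<in> \<F>}"
proof -
  obtain K where K: "\<F> \<subseteq> test_functions" "compact K" "\<And>f. f \<in> \<F> \<Longrightarrow> supp_fun f \<subseteq> K"
    "\<And>m. \<exists>c\<ge>0. \<forall>f\<in>\<F>. ck_bounded m UNIV c f" by (rule bounded_testsE[OF assms]) (rule that)
  show ?thesis
  proof (rule bounded_testsI[where K = "snd ` K"])
    show "{\<lambda>y. f (x, y) | f x. f \<in> \<F>} \<subseteq> test_functions"
    proof
      fix \<phi> assume "\<phi> \<in> {\<lambda>y. f (x, y) | f x. f \<in> \<F>}"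
      then obtain f x where "\<phi> = (\<lambda>y. f (x, y))" "f \<in> \<F>" by auto
      then show "\<phi> \<in> test_functions" using test_functions_slice[of f x] K(1) by auto
    qed
    show "compact (snd ` K)" using K(2) by (intro compact_continuous_image continuous_on_snd continuous_on_id)
    show "supp_fun \<phi> \<subseteq> snd ` K" if mem: "\<phi> \<in> {\<lambda>y. f (x, y) | f x. f \<in> \<F>}" for \<phi>
    proof -
      obtain f x where f: "\<phi> = (\<lambda>y. f (x, y))" "f \<in> \<F>" using mem by auto
      have "supp_fun \<phi> \<subseteq> snd ` supp_fun f" unfolding f(1) using K(1) f(2) by (intro supp_fun_slice) auto
      also have "\<dots> \<subseteq> snd ` K" using K(3)[OF f(2)] by (rule image_mono)
      finally show ?thesis .
    qed
    fix m
    obtain c where c: "c \<ge> 0" "\<forall>f\<in>\<F>. ck_bounded m UNIV c f" using K(4)[of m] by (elim exE conjE)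
    have "ck_bounded m UNIV c (\<lambda>y. f (x, y))" if "f \<in> \<F>" for f x
      by (rule ck_bounded_slice[OF test_functions_smooth[OF subsetD[OF K(1) that]] c(1) bspec[OF c(2) that]])
    then show "\<exists>c. \<forall>\<phi>\<in>{\<lambda>y. f (x, y) | f x. f \<in> \<F>}. ck_bounded m UNIV c \<phi>"
      by (intro exI[of _ c]) auto
  qed
qed

lemma bounded_tests_partial:
  assumes "bounded_tests \<F>" and b: "b \<in> Basis"
  shows "bounded_tests (partial b ` \<F>)"
proof -
  obtain K where K: "\<F> \<subseteq> test_functions" "compact K" "\<And>f. f \<in> \<F> \<Longrightarrow> supp_fun f \<subseteq> K"
    "\<And>m. \<exists>c\<ge>0. \<forall>f\<in>\<F>. ck_bounded m UNIV c f" by (rule bounded_testsE[OF assms(1)]) (rule that)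
  show ?thesis
  proof (rule bounded_testsI[where K = K])
    show "partial b ` \<F> \<subseteq> test_functions" using K(1) test_functions_partial[OF _ b] by auto
    show "compact K" by fact
    show "supp_fun \<phi> \<subseteq> K" if mem: "\<phi> \<in> partial b ` \<F>" for \<phi>
    proof -
      obtain f where f: "\<phi> = partial b f" "f \<in> \<F>" using mem by auto
      show ?thesis unfolding f(1) by (rule order_trans[OF supp_fun_partial K(3)[OF f(2)]])
    qed
    fix m
    obtain c where c: "c \<ge> 0" "\<forall>f\<in>\<F>. ck_bounded (Suc m) UNIV c f" using K(4)[of "Suc m"] by (elim exE conjE)
    then show "\<exists>c. \<forall>\<phi>\<in>partial b ` \<F>. ck_bounded m UNIV c \<phi>" using b by (intro exI[of _ c]) auto
  qed
qed

text \<open>Here \<open>v\<close> ranges over all distributions. The derivatives in \<open>x\<close>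
  of the pairing pass to \<open>f\<close>, so a single seminorm of \<open>v\<close> controls them:
  the one for the slices of the \<open>x\<close>-derivatives of \<open>f\<close> up to order
  \<open>m\<close>, which again form a bounded set.\<close>

lemma ck_bounded_pairing_test_sup:
  fixes \<F> :: "('a::euclidean_space \<times> 'b::euclidean_space \<Rightarrow> complex) set"
  assumes "bounded_tests \<F>"
  shows "\<exists>B. bounded_tests B \<and> (\<forall>v\<in>distributions. \<forall>f\<in>\<F>. \<forall>s\<ge>0. test_sup B v \<le> ennreal s \<longrightarrow>
    ck_bounded m UNIV s (\<lambda>x. v (\<lambda>y. f (x, y))))"
  using assms
proof (induction m arbitrary: \<F>)
  case 0
  let ?B = "{\<lambda>y. f (x, y) | f x. f \<in> \<F>}"
  have "ck_bounded 0 UNIV s (\<lambda>x. v (\<lambda>y. f (x, y)))" if "f \<in> \<F>" "0 \<le> s" "test_sup ?B v \<le> ennreal s" for v f s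
  proof -
    have "cmod (v (\<lambda>y. f (x, y))) \<le> s" for x
    proof -
      have "ennreal (cmod (v (\<lambda>y. f (x, y)))) \<le> test_sup ?B v" using that(1) by (intro test_sup_upper) auto
      also note that(3)
      finally show ?thesis using that(2) by (simp add: ennreal_le_iff)
    qed
    then show ?thesis by simp
  qed
  then show ?case using bounded_tests_slices[OF 0] by (intro exI[of _ ?B]) simp
next
  case (Suc m)
  obtain B0 where B0: "bounded_tests B0" "\<forall>v\<in>distributions. \<forall>f\<in>\<F>. \<forall>s\<ge>0. test_sup B0 v \<le> ennreal s \<longrightarrow>
    ck_bounded m UNIV s (\<lambda>x. v (\<lambda>y. f (x, y)))"
    using Suc.IH[OF Suc.prems] by (elim exE conjE)
  have "\<forall>b\<in>(Basis :: 'a set). \<exists>B. bounded_tests B \<and>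
    (\<forall>v\<in>distributions. \<forall>f\<in>partial (b, 0) ` \<F>. \<forall>s\<ge>0. test_sup B v \<le> ennreal s \<longrightarrow> ck_bounded m UNIV s (\<lambda>x. v (\<lambda>y. f (x,
    y))))"
    by (intro ballI Suc.IH bounded_tests_partial[OF Suc.prems]) simp
  from bchoice[OF this] obtain B where B: "\<forall>b\<in>(Basis :: 'a set). bounded_tests (B b) \<and>
    (\<forall>v\<in>distributions. \<forall>f\<in>partial (b, 0) ` \<F>. \<forall>s\<ge>0. test_sup (B b) v \<le> ennreal s \<longrightarrow> ck_bounded m UNIV s (\<lambda>x. v (\<lambda>y. f
    (x, y))))" ..
  let ?B = "B0 \<union> (\<Union>b\<in>Basis. B b)"
  have "ck_bounded (Suc m) UNIV s (\<lambda>x. v (\<lambda>y. f (x, y)))"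
    if v: "v \<in> distributions" and f: "f \<in> \<F>" and s: "0 \<le> s" "test_sup ?B v \<le> ennreal s" for v f s
  proof -
    have ft: "f \<in> test_functions" using Suc.prems f unfolding bounded_tests_def by (elim conjE) (rule subsetD)
    have "test_sup B0 v \<le> ennreal s" by (rule order_trans[OF test_sup_mono s(2)]) blast
    then have 0: "ck_bounded m UNIV s (\<lambda>x. v (\<lambda>y. f (x, y)))" using B0(2) v f s(1) by simp
    have "ck_bounded m UNIV s (\<lambda>x. v (\<lambda>y. partial (b, 0) f (x, y)))" if b: "b \<in> Basis" for b
    proof -
      have "test_sup (B b) v \<le> ennreal s" by (rule order_trans[OF test_sup_mono s(2)]) (use b in blast)
      then show ?thesis using conjunct2[OF bspec[OF B b]] v f s(1) by simp
    qed
    then show ?thesis using ck_bounded_0D[OF 0] by (simp add: partial_pairing[OF v ft])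
  qed
  moreover have "bounded_tests ?B"
    using B by (intro bounded_tests_Un bounded_tests_UN B0(1)) auto
  ultimately show ?case by (intro exI[of _ ?B]) simp
qed

text \<open>For \<open>u\<close> in an equicontinuous set the convolution is bounded by finitely
  many derivatives of the inner pairing with \<open>v\<close>, hence by one seminorm of
  \<open>v\<close>.\<close>

lemma test_sup_convolution_dominated_right:
  assumes X: "proper_add X1 X2" and A: "equicontinuous A" "A \<subseteq> dist_on X1" and B: "bounded_tests B"
  shows "dominated (normal_seminorms \<Gamma>) (dist_on X2) A (\<lambda>u v. test_sup B (convolution u v))"
proof -
  obtain K where K: "B \<subseteq> test_functions" "compact K" "\<And>\<phi>. \<phi> \<in> B \<Longrightarrow> supp_fun \<phi> \<subseteq> K"
    "\<And>m. \<exists>c\<ge>0. \<forall>\<phi>\<in>B. ck_bounded m UNIV c \<phi>" by (rule bounded_testsE[OF B]) (rule that)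
  obtain \<theta> where \<theta>: "\<theta> \<in> test_functions" and conv: "\<And>u v \<phi>. u \<in> dist_on X1 \<Longrightarrow> v \<in> dist_on X2 \<Longrightarrow> \<phi> \<in> test_functions \<Longrightarrow>
    supp_fun \<phi> \<subseteq> K \<Longrightarrow>
      convolution u v \<phi> = u (\<lambda>x. v (\<lambda>y. \<theta> (x, y) * \<phi> (x + y)))"
    by (rule convolution_cutoff[OF X K(2)]) (rule that)
  define f where "f \<phi> = (\<lambda>z. \<theta> z * (\<lambda>(x, y). \<phi> (x + y)) z)" for \<phi> :: "'a \<Rightarrow> complex"
  have ft: "f \<phi> \<in> test_functions" if "\<phi> \<in> B" for \<phi>
    unfolding f_def using K(1) that by (intro test_functions_kernel[OF \<theta>]) auto
  have "bounded_tests (f ` B)"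
  proof (rule bounded_testsI[where K = "supp_fun \<theta>"])
    show "f ` B \<subseteq> test_functions" using ft by auto
    show "compact (supp_fun \<theta>)" by (rule test_functions_compact[OF \<theta>])
    show "supp_fun g \<subseteq> supp_fun \<theta>" if mem: "g \<in> f ` B" for g
    proof -
      obtain \<phi> where \<phi>: "g = f \<phi>" using mem by auto
      show ?thesis unfolding \<phi> f_def using supp_fun_mult[of \<theta> "\<lambda>(x, y). \<phi> (x + y)"] by simp
    qed
    fix m
    obtain D where D: "0 \<le> D" "\<And>\<phi> c. \<phi> \<in> test_functions \<Longrightarrow> ck_bounded m UNIV c \<phi> \<Longrightarrow>
      ck_bounded m UNIV (D * c) (\<lambda>z. \<theta> z * (\<lambda>(x, y). \<phi> (x + y)) z)"
      by (rule ck_bounded_kernel[OF \<theta>]) (rule that)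
    obtain c where c: "\<forall>\<phi>\<in>B. ck_bounded m UNIV c \<phi>" using K(4)[of m] by (elim exE conjE)
    have "ck_bounded m UNIV (D * c) (f \<phi>)" if "\<phi> \<in> B" for \<phi>
      unfolding f_def using K(1) that by (intro D(2) bspec[OF c that]) auto
    then show "\<exists>c. \<forall>g\<in>f ` B. ck_bounded m UNIV c g" by (intro exI[of _ "D * c"]) auto
  qed
  note Fb = this
  have cK: "compact (fst ` supp_fun \<theta>)"
    by (intro compact_continuous_image continuous_on_fst continuous_on_id test_functions_compact[OF \<theta>])
  obtain m C where C: "0 \<le> C" "\<And>u. u \<in> A \<Longrightarrow> dist_bound u (fst ` supp_fun \<theta>) m C"
    by (rule equicontinuousD[OF A(1) cK]) (rule that)
  obtain B' where B': "bounded_tests B'" "\<forall>v\<in>distributions. \<forall>g\<in>f ` B. \<forall>s\<ge>0. test_sup B' v \<le> ennreal s \<longrightarrow>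
    ck_bounded m UNIV s (\<lambda>x. v (\<lambda>y. g (x, y)))"
    using ck_bounded_pairing_test_sup[OF Fb, of m] by (elim exE conjE)
  show ?thesis
  proof (rule dominated_mono[OF dominated_single[OF normal_seminormsI(1)[OF B'(1)], of _ UNIV A "C + 1"] _ subset_UNIV])
    fix u v assume u: "u \<in> A" and v: "v \<in> dist_on X2"
    have uX: "u \<in> dist_on X1" and vd: "v \<in> distributions" using A(2) u v by (auto simp: dist_on_def)
    show "test_sup B (convolution u v) \<le> ennreal (C + 1) * test_sup B' v"
    proof (cases "test_sup B' v")
      case (real s)
      show ?thesis unfolding test_sup_def[of B]
      proof (rule SUP_least)
        fix \<phi> assume \<phi>: "\<phi> \<in> B"
        have \<phi>t: "\<phi> \<in> test_functions" using K(1) \<phi> ..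
        have "ck_bounded m UNIV s (\<lambda>x. v (\<lambda>y. f \<phi> (x, y)))"
          using B'(2) vd \<phi> real by simp
        then have "ck_bounded m UNIV s (\<lambda>x. v (\<lambda>y. \<theta> (x, y) * \<phi> (x + y)))" by (simp add: f_def)
        then have "cmod (u (\<lambda>x. v (\<lambda>y. \<theta> (x, y) * \<phi> (x + y)))) \<le> C * s"
          by (rule dist_boundD[OF C(2)[OF u] kernel_pairing_test_function[OF vd \<theta> \<phi>t] supp_fun_kernel_pairing[OF vd \<theta>
            \<phi>t]])
        also have "\<dots> \<le> (C + 1) * s" using real(1) by (intro mult_right_mono) auto
        finally have "ennreal (cmod (convolution u v \<phi>)) \<le> ennreal ((C + 1) * s)"
          unfolding conv[OF uX v \<phi>t K(3)[OF \<phi>]] by (rule ennreal_leI)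
        also have "\<dots> = ennreal (C + 1) * test_sup B' v" unfolding real(2) using C(1) real(1)
          by (intro ennreal_mult) auto
        finally show "ennreal (cmod (convolution u v \<phi>)) \<le> ennreal (C + 1) * test_sup B' v" .
      qed
    next
      case top
      \<comment> \<open>\<open>C\<close> may be 0; the constant \<open>C + 1\<close> keeps the
        right-hand side infinite here.\<close>
      have "0 < ennreal (C + 1)" using C(1) by (simp add: ennreal_less_zero_iff del: ennreal_plus)
      then show ?thesis unfolding top by (simp add: ennreal_mult_top)
    qed
  qed
qed

text \<open>For \<open>v\<close> in an equicontinuous set the inner pairings with all
  \<open>\<phi>\<close> in \<open>B\<close> form a bounded set of test functions, to which
  \<open>u\<close> is applied. The mirror case has a proof of its own because \<open>u\<close> is
  always the outer functional.\<close>

lemma test_sup_convolution_dominated_left: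
  assumes X: "proper_add X1 X2" and A: "equicontinuous A" "A \<subseteq> dist_on X2" and B: "bounded_tests B"
  shows "dominated (normal_seminorms \<Gamma>) (dist_on X1) A (\<lambda>v u. test_sup B (convolution u v))"
proof -
  obtain K where K: "B \<subseteq> test_functions" "compact K" "\<And>\<phi>. \<phi> \<in> B \<Longrightarrow> supp_fun \<phi> \<subseteq> K"
    "\<And>m. \<exists>c\<ge>0. \<forall>\<phi>\<in>B. ck_bounded m UNIV c \<phi>" by (rule bounded_testsE[OF B]) (rule that)
  obtain \<theta> where \<theta>: "\<theta> \<in> test_functions" and conv: "\<And>u v \<phi>. u \<in> dist_on X1 \<Longrightarrow> v \<in> dist_on X2 \<Longrightarrow> \<phi> \<in> test_functions \<Longrightarrow>
    supp_fun \<phi> \<subseteq> K \<Longrightarrow>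
      convolution u v \<phi> = u (\<lambda>x. v (\<lambda>y. \<theta> (x, y) * \<phi> (x + y)))"
    by (rule convolution_cutoff[OF X K(2)]) (rule that)
  define g where "g = (\<lambda>(v :: ('a \<Rightarrow> complex) \<Rightarrow> complex, \<phi>) x. v (\<lambda>y. \<theta> (x, y) * \<phi> (x + y)))"
  have Ad: "A \<subseteq> distributions" using A(2) by (auto simp: dist_on_def)
  have cK: "compact (snd ` supp_fun \<theta>)" "compact (fst ` supp_fun \<theta>)"
    by (intro compact_continuous_image continuous_on_fst continuous_on_snd continuous_on_id test_functions_compact[OF
      \<theta>])+
  obtain m' C where C: "0 \<le> C" "\<And>v. v \<in> A \<Longrightarrow> dist_bound v (snd ` supp_fun \<theta>) m' C"
    by (rule equicontinuousD[OF A(1) cK(1)]) (rule that)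
  have B': "bounded_tests (g ` (A \<times> B))"
  proof (rule bounded_testsI[OF _ cK(2)])
    show "g ` (A \<times> B) \<subseteq> test_functions"
    proof (clarsimp simp: g_def)
      fix v \<phi> assume "v \<in> A" "\<phi> \<in> B"
      then show "(\<lambda>x. v (\<lambda>y. \<theta> (x, y) * \<phi> (x + y))) \<in> test_functions"
        using Ad K(1) by (intro kernel_pairing_test_function[OF _ \<theta>]) auto
    qed
    show "supp_fun h \<subseteq> fst ` supp_fun \<theta>" if mem: "h \<in> g ` (A \<times> B)" for h
    proof -
      obtain v \<phi> where h: "h = g (v, \<phi>)" "v \<in> A" "\<phi> \<in> B" using mem by auto
      show ?thesis unfolding h(1) g_def prod.case using Ad K(1) h by (intro supp_fun_kernel_pairing[OF _ \<theta>]) auto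
    qed
    fix m
    obtain D where D: "0 \<le> D" "\<And>v \<phi> c C. v \<in> distributions \<Longrightarrow> dist_bound v (snd ` supp_fun \<theta>) m' C \<Longrightarrow>
      \<phi> \<in> test_functions \<Longrightarrow> ck_bounded (m + m') UNIV c \<phi> \<Longrightarrow> ck_bounded m UNIV (C * (D * c)) (\<lambda>x. v (\<lambda>y. \<theta> (x, y) * \<phi> (x
        + y)))"
      by (rule kernel_pairing_bound[OF \<theta>]) (rule that)
    obtain c where c: "\<forall>\<phi>\<in>B. ck_bounded (m + m') UNIV c \<phi>" using K(4)[of "m + m'"] by (elim exE conjE)
    have "ck_bounded m UNIV (C * (D * c)) (g (v, \<phi>))" if "v \<in> A" "\<phi> \<in> B" for v \<phi>
      unfolding g_def prod.case
        by (rule D(2)[OF subsetD[OF Ad that(1)] C(2)[OF that(1)] subsetD[OF K(1) that(2)] bspec[OF c that(2)]])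
    then show "\<exists>c. \<forall>h\<in>g ` (A \<times> B). ck_bounded m UNIV c h" by (intro exI[of _ "C * (D * c)"]) auto
  qed
  show ?thesis
  proof (rule dominated_mono[OF dominated_single[OF normal_seminormsI(1)[OF B'], of _ UNIV A 1] _ subset_UNIV])
    fix v u assume v: "v \<in> A" and u: "u \<in> dist_on X1"
    show "test_sup B (convolution u v) \<le> ennreal 1 * test_sup (g ` (A \<times> B)) u"
      unfolding test_sup_def[of B]
    proof (rule SUP_least)
      fix \<phi> assume \<phi>: "\<phi> \<in> B"
      have "convolution u v \<phi> = u (g (v, \<phi>))"
        using conv[OF u subsetD[OF A(2) v] subsetD[OF K(1) \<phi>] K(3)[OF \<phi>]] by (simp add: g_def)
      then show "ennreal (cmod (convolution u v \<phi>)) \<le> ennreal 1 * test_sup (g ` (A \<times> B)) u"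
        using test_sup_upper[of "g (v, \<phi>)" "g ` (A \<times> B)" u] v \<phi> by simp
    qed
  qed
qed

section \<open>Convolution in the normal topology\<close>

abbreviation (input) sum_wf :: "('a::euclidean_space \<times> 'a) set \<Rightarrow> ('a \<times> 'a) set \<Rightarrow> ('a \<times> 'a) set" where
  "sum_wf \<Gamma>1 \<Gamma>2 \<equiv> {(x + y, \<eta>) | x y \<eta>. (x, \<eta>) \<in> \<Gamma>1 \<and> (y, \<eta>) \<in> \<Gamma>2}"

lemma dominated_convolution_right:
  assumes X: "proper_add X1 X2"
    and \<Gamma>1: "closedin (top_of_set cotangent_dot) \<Gamma>1" "fibre_conic \<Gamma>1"
    and \<Gamma>2: "closedin (top_of_set cotangent_dot) \<Gamma>2" "fibre_conic \<Gamma>2"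
    and A: "dist_bounded \<Gamma>1 A" "A \<subseteq> dist_on X1" and p: "p \<in> normal_seminorms (sum_wf \<Gamma>1 \<Gamma>2)"
  shows "dominated (normal_seminorms \<Gamma>2) (dist_on X2) A (\<lambda>u v. p (convolution u v))"
proof -
  have eq: "equicontinuous A" using A(1) unfolding dist_bounded_def by (elim conjE)
  have Ed: "dist_on X2 \<subseteq> distributions" by (auto simp: dist_on_def)
  note test = test_sup_convolution_dominated_right[OF X eq A(2)]
  from p show ?thesis
  proof (cases rule: normal_seminorms_cases)
    case (1 B)
    show ?thesis unfolding 1(2) by (rule test[OF 1(1)])
  next
    case (2 N V \<tau>)
    have "dominated (normal_seminorms \<Gamma>2) (dist_on X2) A (\<lambda>u v. local_decay N V \<tau> (convolution u v))"
    proof (rule fourier_dominated[OF A(1) Ed 2(2,3) _ test[OF bounded_tests_singleton[OF 2(1)]]])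
      fix \<kappa> assume \<kappa>: "\<kappa> \<in> V" "norm \<kappa> = 1"
      have off: "(x, \<kappa>) \<notin> \<Gamma>1 \<or> (y, \<kappa>) \<notin> \<Gamma>2" if "x \<in> X1" "y \<in> X2" "x + y \<in> supp_fun \<tau>" for x y
        using 2(4) \<kappa>(1) that(3) by blast
      obtain \<epsilon> and F :: "('a \<times> 'a) set" and P where *: "0 < \<epsilon>" "\<epsilon> \<le> 1" "finite F"
        "\<And>z. z \<in> F \<Longrightarrow> good_piece \<Gamma>1 \<Gamma>2 (cone_nbhd \<kappa> \<epsilon>) (P z)"
        "\<And>u v k. u \<in> dist_on X1 \<Longrightarrow> v \<in> dist_on X2 \<Longrightarrow> local_ft (convolution u v) \<tau> k = (\<Sum>z\<in>F. piece_value (P z) u v k)"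
        by (rule convolution_pieces[OF X \<Gamma>1 \<Gamma>2 2(1) \<kappa>(2) off]) (assumption, assumption, assumption, rule that)
      have "\<forall>u\<in>A. \<forall>v\<in>dist_on X2. \<forall>k. local_ft (convolution u v) \<tau> k = (\<Sum>z\<in>F. piece_value (P z) u v k)"
        by (intro ballI allI *(5) subsetD[OF A(2)])
      then show "\<exists>\<epsilon> (F :: ('a \<times> 'a) set) P. 0 < \<epsilon> \<and> \<epsilon> \<le> 1 \<and> finite F \<and> (\<forall>z\<in>F. good_piece \<Gamma>1 \<Gamma>2 (cone_nbhd \<kappa> \<epsilon>) (P z)) \<and>
        (\<forall>u\<in>A. \<forall>v\<in>dist_on X2. \<forall>k. local_ft (convolution u v) \<tau> k = (\<Sum>z\<in>F. piece_value (P z) u v k))"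
        using *(1-4) by (intro exI[of _ \<epsilon>] exI[of _ F] exI[of _ P] conjI ballI) (rule *(4) | assumption | simp)+
    qed
    then show ?thesis
    proof (rule dominated_mono[OF _ _ order_refl])
      fix u v assume "u \<in> A" "v \<in> dist_on X2"
      then have "convolution u v \<in> distributions" using A(2) by (intro convolution_distribution[OF X]) auto
      then show "p (convolution u v) \<le> local_decay N V \<tau> (convolution u v)" unfolding 2(5)
        by (simp add: fourier_seminorm_eq[OF _ 2(1)])
    qed
  qed
qed

lemma dominated_convolution_left:
  assumes X: "proper_add X1 X2"
    and \<Gamma>1: "closedin (top_of_set cotangent_dot) \<Gamma>1" "fibre_conic \<Gamma>1"
    and \<Gamma>2: "closedin (top_of_set cotangent_dot) \<Gamma>2" "fibre_conic \<Gamma>2"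
    and A: "dist_bounded \<Gamma>2 A" "A \<subseteq> dist_on X2" and p: "p \<in> normal_seminorms (sum_wf \<Gamma>1 \<Gamma>2)"
  shows "dominated (normal_seminorms \<Gamma>1) (dist_on X1) A (\<lambda>v u. p (convolution u v))"
proof -
  have eq: "equicontinuous A" using A(1) unfolding dist_bounded_def by (elim conjE)
  have Ed: "dist_on X1 \<subseteq> distributions" by (auto simp: dist_on_def)
  note test = test_sup_convolution_dominated_left[OF X eq A(2)]
  from p show ?thesis
  proof (cases rule: normal_seminorms_cases)
    case (1 B)
    show ?thesis unfolding 1(2) by (rule test[OF 1(1)])
  next
    case (2 N V \<tau>)
    have "dominated (normal_seminorms \<Gamma>1) (dist_on X1) A (\<lambda>v u. local_decay N V \<tau> (convolution u v))"
    proof (rule fourier_dominated[OF A(1) Ed 2(2,3) _ test[OF bounded_tests_singleton[OF 2(1)]]])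
      fix \<kappa> assume \<kappa>: "\<kappa> \<in> V" "norm \<kappa> = 1"
      have off: "(x, \<kappa>) \<notin> \<Gamma>1 \<or> (y, \<kappa>) \<notin> \<Gamma>2" if "x \<in> X1" "y \<in> X2" "x + y \<in> supp_fun \<tau>" for x y
        using 2(4) \<kappa>(1) that(3) by blast
      obtain \<epsilon> and F :: "('a \<times> 'a) set" and P where *: "0 < \<epsilon>" "\<epsilon> \<le> 1" "finite F"
        "\<And>z. z \<in> F \<Longrightarrow> good_piece \<Gamma>1 \<Gamma>2 (cone_nbhd \<kappa> \<epsilon>) (P z)"
        "\<And>u v k. u \<in> dist_on X1 \<Longrightarrow> v \<in> dist_on X2 \<Longrightarrow> local_ft (convolution u v) \<tau> k = (\<Sum>z\<in>F. piece_value (P z) u v k)"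
        by (rule convolution_pieces[OF X \<Gamma>1 \<Gamma>2 2(1) \<kappa>(2) off]) (assumption, assumption, assumption, rule that)
      have "\<forall>v\<in>A. \<forall>u\<in>dist_on X1. \<forall>k. local_ft (convolution u v) \<tau> k = (\<Sum>z\<in>F. piece_value (swap_piece (P z)) v u k)"
        unfolding piece_value_swap by (intro ballI allI *(5) subsetD[OF A(2)])
      then show "\<exists>\<epsilon> (F :: ('a \<times> 'a) set) P. 0 < \<epsilon> \<and> \<epsilon> \<le> 1 \<and> finite F \<and> (\<forall>z\<in>F. good_piece \<Gamma>2 \<Gamma>1 (cone_nbhd \<kappa> \<epsilon>) (P z)) \<and>
        (\<forall>v\<in>A. \<forall>u\<in>dist_on X1. \<forall>k. local_ft (convolution u v) \<tau> k = (\<Sum>z\<in>F. piece_value (P z) v u k))"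
        using *(1-3) by (intro exI[of _ \<epsilon>] exI[of _ F] exI[of _ "\<lambda>z. swap_piece (P z)"] conjI ballI) (rule
          good_piece_swap, rule *(4) | assumption | simp)+
    qed
    then show ?thesis
    proof (rule dominated_mono[OF _ _ order_refl])
      fix v u assume "v \<in> A" "u \<in> dist_on X1"
      then have "convolution u v \<in> distributions" using A(2) by (intro convolution_distribution[OF X]) auto
      then show "p (convolution u v) \<le> local_decay N V \<tau> (convolution u v)" unfolding 2(5)
        by (simp add: fourier_seminorm_eq[OF _ 2(1)])
    qed
  qed
qed

lemma closed_direction_preimage:
  assumes "closedin (top_of_set cotangent_dot) \<Gamma>" "\<kappa> \<noteq> 0"
  shows "closed {x. (x, \<kappa>) \<in> \<Gamma>}"
proof -
  obtain T where T: "closed T" "\<Gamma> = cotangent_dot \<inter> T" using assms(1) unfolding closedin_closed by blast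
  have "{x. (x, \<kappa>) \<in> \<Gamma>} = (\<lambda>x. (x, \<kappa>)) -` T" using assms(2) by (auto simp: T(2) cotangent_dot_def)
  also have "closed \<dots>" by (intro closed_vimage T(1) continuous_intros)
  finally show ?thesis .
qed

lemma fibre_conic_iff:
  assumes "fibre_conic \<Gamma>" "0 < c"
  shows "(x, c *\<^sub>R \<xi>) \<in> \<Gamma> \<longleftrightarrow> (x, \<xi>) \<in> \<Gamma>"
proof
  assume "(x, c *\<^sub>R \<xi>) \<in> \<Gamma>"
  moreover have "0 < 1 / c" using assms(2) by simp
  ultimately have "(x, (1 / c) *\<^sub>R (c *\<^sub>R \<xi>)) \<in> \<Gamma>" using assms(1) unfolding fibre_conic_def by blast
  then show "(x, \<xi>) \<in> \<Gamma>" using assms(2) by simp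
next
  assume "(x, \<xi>) \<in> \<Gamma>"
  then show "(x, c *\<^sub>R \<xi>) \<in> \<Gamma>" using assms unfolding fibre_conic_def by blast
qed

text \<open>For a covector over \<open>z\<close> outside the sum set, the sums of points whose
  fibres contain its direction form a closed set that misses \<open>z\<close>, so a cutoff
  \<open>\<tau>\<close> near \<open>z\<close> avoids it. Every piece then has decay in one factor,
  and domination over one-element sets gives finite Fourier seminorms.\<close>

lemma convolution_dist_wf:
  fixes X1 X2 :: "'a::euclidean_space set"
  assumes X: "proper_add X1 X2"
    and \<Gamma>1: "closedin (top_of_set cotangent_dot) \<Gamma>1" "fibre_conic \<Gamma>1"
    and \<Gamma>2: "closedin (top_of_set cotangent_dot) \<Gamma>2" "fibre_conic \<Gamma>2"
    and u: "u \<in> dist_wf \<Gamma>1 \<inter> dist_on X1" and v: "v \<in> dist_wf \<Gamma>2 \<inter> dist_on X2"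
  shows "convolution u v \<in> dist_wf (sum_wf \<Gamma>1 \<Gamma>2)"
proof -
  let ?w = "convolution u v"
  have uX: "u \<in> dist_on X1" and vX: "v \<in> dist_on X2" and uW: "u \<in> dist_wf \<Gamma>1" and vW: "v \<in> dist_wf \<Gamma>2" using u v by auto
  have vd: "v \<in> distributions" using vW by (simp add: dist_wf_def)
  have wd: "?w \<in> distributions" by (rule convolution_distribution[OF X uX vX])
  have "(z, \<eta>) \<in> sum_wf \<Gamma>1 \<Gamma>2" if wf: "(z, \<eta>) \<in> wave_front ?w" for z \<eta>
  proof (rule ccontr)
    assume notin: "(z, \<eta>) \<notin> sum_wf \<Gamma>1 \<Gamma>2"
    have \<eta>: "\<eta> \<noteq> 0" using wf by (simp add: wave_front_def)
    define \<kappa> where "\<kappa> = (1 / norm \<eta>) *\<^sub>R \<eta>"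
    have \<kappa>: "norm \<kappa> = 1" "\<kappa> \<noteq> 0" and \<eta>\<kappa>: "\<eta> = norm \<eta> *\<^sub>R \<kappa>" using \<eta> by (auto simp: \<kappa>_def)
    have \<kappa>\<Gamma>: "(x, \<kappa>) \<in> \<Gamma>1 \<longleftrightarrow> (x, \<eta>) \<in> \<Gamma>1" "(x, \<kappa>) \<in> \<Gamma>2 \<longleftrightarrow> (x, \<eta>) \<in> \<Gamma>2" for x
      unfolding \<kappa>_def using \<eta> by (intro fibre_conic_iff \<Gamma>1(2) \<Gamma>2(2), simp)+
    \<comment> \<open>Only the slices of \<open>\<Gamma>1\<close> and \<open>\<Gamma>2\<close> over
      the fixed direction \<open>\<kappa>\<close> enter. As \<open>\<kappa>\<close> is nonzero,
      relative closedness of the cones makes these slices closed in the whole space.\<close>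
    define C where "C = (X1 \<inter> {x. (x, \<kappa>) \<in> \<Gamma>1}) \<times> (X2 \<inter> {y. (y, \<kappa>) \<in> \<Gamma>2})"
    have "closed X1" "closed X2" using X by (simp_all add: proper_add_def)
    then have "closed C" unfolding C_def
      by (intro closed_Times closed_Int closed_direction_preimage[OF \<Gamma>1(1) \<kappa>(2)] closed_direction_preimage[OF \<Gamma>2(1)
        \<kappa>(2)])
    then have cl: "closed ((\<lambda>(x, y). x + y) ` C)" by (rule closed_add_image[OF X]) (auto simp: C_def)
    have "z \<notin> (\<lambda>(x, y). x + y) ` C" using notin by (auto simp: C_def \<kappa>\<Gamma>)
    then have "z \<in> - (\<lambda>(x, y). x + y) ` C" by simp
    moreover have "open (- (\<lambda>(x, y). x + y) ` C)" using cl by (rule open_Compl)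
    ultimately obtain r where r: "r > 0" "cball z r \<subseteq> - (\<lambda>(x, y). x + y) ` C"
      unfolding open_contains_cball by blast
    obtain \<tau> U where \<tau>: "\<tau> \<in> test_functions" "supp_fun \<tau> \<subseteq> cball z r" "open U" "z \<in> U" "\<And>y. y \<in> U \<Longrightarrow> \<tau> y = 1"
      by (rule cutoff_ball[OF r(1), of z]) (rule that)
    have off: "(x, \<kappa>) \<notin> \<Gamma>1 \<or> (y, \<kappa>) \<notin> \<Gamma>2" if "x \<in> X1" "y \<in> X2" "x + y \<in> supp_fun \<tau>" for x y
    proof (rule ccontr)
      assume "\<not> ?thesis"
      then have "(x, y) \<in> C" using that(1,2) by (simp add: C_def)
      then have "x + y \<in> (\<lambda>(x, y). x + y) ` C" by force
      then show False using that(3) \<tau>(2) r(2) by blast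
    qed
    obtain \<epsilon> and F :: "('a \<times> 'a) set" and P where *: "0 < \<epsilon>" "\<epsilon> \<le> 1" "finite F"
      "\<And>z. z \<in> F \<Longrightarrow> good_piece \<Gamma>1 \<Gamma>2 (cone_nbhd \<kappa> \<epsilon>) (P z)"
      "\<And>u v k. u \<in> dist_on X1 \<Longrightarrow> v \<in> dist_on X2 \<Longrightarrow> local_ft (convolution u v) \<tau> k = (\<Sum>z\<in>F. piece_value (P z) u v k)"
      by (rule convolution_pieces[OF X \<Gamma>1 \<Gamma>2 \<tau>(1) \<kappa>(1) off]) (assumption, assumption, assumption, rule that)
    have "fourier_seminorm N (cone_nbhd \<kappa> (\<epsilon> / 4)) \<tau> ?w < \<infinity>" for N
    proof -
      have vs: "{v} \<subseteq> distributions" using vd by simp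
      have "dominated (normal_seminorms \<Gamma>2) {v} {u} (\<lambda>u v. local_decay N (cone_nbhd \<kappa> (\<epsilon> / 4)) \<tau> (convolution u v))"
        by (rule pieces_dominated[OF \<kappa>(1) *(1-4) dist_bounded_singleton[OF uW] vs]) (assumption, use *(5) uX vX in simp)
      then have "local_decay N (cone_nbhd \<kappa> (\<epsilon> / 4)) \<tau> ?w < \<infinity>"
        by (rule dominated_finite) (simp_all only: insert_iff normal_seminorm_finite[OF _ vW] simp_thms)
      then show ?thesis by (simp add: fourier_seminorm_eq[OF wd \<tau>(1)])
    qed
    moreover have "\<eta> \<in> interior (cone_nbhd \<kappa> (\<epsilon> / 4))"
      using interior_cone_nbhd[OF \<kappa>(1), of "\<epsilon> / 4" "norm \<eta>"] *(1) \<eta> \<eta>\<kappa> by simp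
    moreover have "\<tau> z \<noteq> 0" using \<tau>(4,5) by simp
    ultimately have "\<exists>\<psi>\<in>test_functions. \<exists>V. \<psi> z \<noteq> 0 \<and> cone V \<and> \<eta> \<in> interior V \<and> (\<forall>N. fourier_seminorm N V \<psi> ?w < \<infinity>)"
      using cone_cone_nbhd \<tau>(1) by (intro bexI[of _ \<tau>] exI[of _ "cone_nbhd \<kappa> (\<epsilon> / 4)"] conjI allI)
    then show False using wf unfolding wave_front_def by blast
  qed
  then show ?thesis unfolding dist_wf_def using wd by auto
qed

section \<open>Bilinearity and the passage from seminorms to neighbourhoods\<close>

lemma dist_on_linear_combination:
  assumes X: "closed X" and u: "u \<in> dist_on X" and v: "v \<in> dist_on X"
  shows "(\<lambda>\<phi>. a * u \<phi> + b * v \<phi>) \<in> dist_on X"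
proof -
  have ud: "u \<in> distributions" "supp_dist u \<subseteq> X" and vd: "v \<in> distributions" "supp_dist v \<subseteq> X"
    using u v by (auto simp: dist_on_def)
  have "a * u \<phi> + b * v \<phi> = 0" if \<phi>: "\<phi> \<in> test_functions" "supp_fun \<phi> \<subseteq> - X" for \<phi>
  proof -
    have "u \<phi> = 0" using ud \<phi>(2)
      by (intro test_functional_off_support[OF distributions_test_functional[OF ud(1)] \<phi>(1)]) blast
    moreover have "v \<phi> = 0" using vd \<phi>(2)
      by (intro test_functional_off_support[OF distributions_test_functional[OF vd(1)] \<phi>(1)]) blast
    ultimately show ?thesis by simp
  qed
  moreover have "open (- X)" using X by (rule open_Compl)
  ultimately have "supp_dist (\<lambda>\<phi>. a * u \<phi> + b * v \<phi>) \<subseteq> X" unfolding supp_dist_def by blast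
  then show ?thesis using distributions_linear_combination[OF ud(1) vd(1)] by (simp add: dist_on_def)
qed

lemma convolution_linear_left:
  assumes X: "proper_add X1 X2" and u: "u \<in> dist_on X1" and u': "u' \<in> dist_on X1" and v: "v \<in> dist_on X2"
  shows "convolution (\<lambda>\<phi>. a * u \<phi> + b * u' \<phi>) v = (\<lambda>\<phi>. a * convolution u v \<phi> + b * convolution u' v \<phi>)"
proof
  fix \<phi>
  show "convolution (\<lambda>\<phi>. a * u \<phi> + b * u' \<phi>) v \<phi> = a * convolution u v \<phi> + b * convolution u' v \<phi>"
  proof (cases "\<phi> \<in> test_functions")
    case \<phi>: True
    obtain \<theta> where conv: "\<And>u v \<psi>. u \<in> dist_on X1 \<Longrightarrow> v \<in> dist_on X2 \<Longrightarrow> \<psi> \<in> test_functions \<Longrightarrow> supp_fun \<psi> \<subseteq> supp_fun \<phi> \<Longrightarrow>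
        convolution u v \<psi> = u (\<lambda>x. v (\<lambda>y. \<theta> (x, y) * \<psi> (x + y)))"
      by (rule convolution_cutoff[OF X test_functions_compact[OF \<phi>]]) (rule that)
    have "closed X1" using X unfolding proper_add_def by (elim conjE)
    from dist_on_linear_combination[OF this u u'] show ?thesis
      by (simp only: conv[OF _ v \<phi> order_refl] u u')
  qed (simp add: convolution_def)
qed

lemma convolution_linear_right:
  assumes X: "proper_add X1 X2" and u: "u \<in> dist_on X1" and v: "v \<in> dist_on X2" and v': "v' \<in> dist_on X2"
  shows "convolution u (\<lambda>\<phi>. a * v \<phi> + b * v' \<phi>) = (\<lambda>\<phi>. a * convolution u v \<phi> + b * convolution u v' \<phi>)"
proof
  fix \<phi>
  show "convolution u (\<lambda>\<phi>. a * v \<phi> + b * v' \<phi>) \<phi> = a * convolution u v \<phi> + b * convolution u v' \<phi>"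
  proof (cases "\<phi> \<in> test_functions")
    case \<phi>: True
    obtain \<theta> where \<theta>: "\<theta> \<in> test_functions" and conv: "\<And>u v \<psi>. u \<in> dist_on X1 \<Longrightarrow> v \<in> dist_on X2 \<Longrightarrow> \<psi> \<in> test_functions \<Longrightarrow>
      supp_fun \<psi> \<subseteq> supp_fun \<phi> \<Longrightarrow>
        convolution u v \<psi> = u (\<lambda>x. v (\<lambda>y. \<theta> (x, y) * \<psi> (x + y)))"
      by (rule convolution_cutoff[OF X test_functions_compact[OF \<phi>]]) (rule that)
    have lin: "test_functional u" using u by (intro distributions_test_functional) (simp add: dist_on_def)
    have vd: "v \<in> distributions" "v' \<in> distributions" using v v' by (simp_all add: dist_on_def)
    have "closed X2" using X unfolding proper_add_def by (elim conjE)
    note vv = dist_on_linear_combination[OF this v v', of a b]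
    note t = kernel_pairing_test_function[OF vd(1) \<theta> \<phi>] kernel_pairing_test_function[OF vd(2) \<theta> \<phi>]
    show ?thesis
      unfolding conv[OF u v \<phi> order_refl] conv[OF u v' \<phi> order_refl] conv[OF u vv \<phi> order_refl]
      unfolding test_functional_add[OF lin test_functions_cmult[OF t(1)] test_functions_cmult[OF t(2)]]
      unfolding test_functional_cmult[OF lin t(1)] test_functional_cmult[OF lin t(2)] ..
  qed (simp add: convolution_def)
qed

text \<open>The sum of the finitely many seminorms behind \<open>W\<close> is dominated as one
  quantity, so one finite family and one \<open>\<delta>\<close> serve all \<open>u\<close> in
  \<open>A\<close>.\<close>

lemma dominated_hypocontinuity:
  assumes A: "\<And>p. p \<in> normal_seminorms \<Gamma> \<Longrightarrow> dominated (normal_seminorms \<Gamma>') (dist_on X') A (\<lambda>u v. p (w u v))"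
    and w: "\<And>u v. u \<in> A \<Longrightarrow> v \<in> dist_wf \<Gamma>' \<inter> dist_on X' \<Longrightarrow> w u v \<in> dist_wf \<Gamma> \<inter> dist_on X"
    and W: "zero_nhd (normal_topology_supp \<Gamma> X) W"
  shows "\<exists>V. zero_nhd (normal_topology_supp \<Gamma>' X') V \<and> (\<forall>u\<in>A. \<forall>v\<in>V. w u v \<in> W)"
proof -
  obtain F \<epsilon> where F: "finite F" "F \<subseteq> normal_seminorms \<Gamma>" "(0::real) < \<epsilon>"
    "{v \<in> dist_wf \<Gamma>. \<forall>p\<in>F. p v < ennreal \<epsilon>} \<inter> {u. supp_dist u \<subseteq> X} \<subseteq> W"
    by (rule zero_nhd_seminormD[OF W[unfolded normal_topology_supp_eq]])
  have "dominated (normal_seminorms \<Gamma>') (dist_on X') A (\<lambda>u v. \<Sum>p\<in>F. p (w u v))"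
    using F(2) by (intro dominated_sum[OF F(1)] A) auto
  then obtain F' \<delta> where F': "finite F'" "F' \<subseteq> normal_seminorms \<Gamma>'" "(0::real) < \<delta>"
    "\<And>u v. u \<in> A \<Longrightarrow> v \<in> dist_on X' \<Longrightarrow> \<forall>p\<in>F'. p v < ennreal \<delta> \<Longrightarrow> (\<Sum>p\<in>F. p (w u v)) < ennreal \<epsilon>"
    by (rule dominated_small[OF _ F(3)]) (rule that)
  let ?V = "{v \<in> dist_wf \<Gamma>'. \<forall>p\<in>F'. p v < ennreal \<delta>} \<inter> {u. supp_dist u \<subseteq> X'}"
  have "zero_nhd (normal_topology_supp \<Gamma>' X') ?V"
    unfolding normal_topology_supp_eq
    by (rule zero_nhd_seminorm_ball[OF _ _ F'(1,2) zero_in_normal_space F'(3)])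
      (rule normal_seminorm_subadditive normal_seminorm_zero, erule subsetD[OF F'(2)])+
  moreover have "w u v \<in> W" if u: "u \<in> A" and v: "v \<in> ?V" for u v
  proof -
    have vX: "v \<in> dist_wf \<Gamma>' \<inter> dist_on X'" using v by (auto simp: dist_on_def dist_wf_def)
    have "(\<Sum>p\<in>F. p (w u v)) < ennreal \<epsilon>" using vX v by (intro F'(4) u) auto
    moreover have "p (w u v) \<le> (\<Sum>p\<in>F. p (w u v))" if "p \<in> F" for p
      using that F(1) by (intro member_le_sum) auto
    ultimately have "\<forall>p\<in>F. p (w u v) < ennreal \<epsilon>" by (meson le_less_trans)
    moreover have "w u v \<in> dist_wf \<Gamma>" "supp_dist (w u v) \<subseteq> X" using w[OF u vX] by (auto simp: dist_on_def)
    ultimately show ?thesis using F(4) by blast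
  qed
  ultimately show ?thesis by (intro exI[of _ ?V]) blast
qed

theorem theorem6p5:
  fixes \<Gamma>1 \<Gamma>2 :: "('a::euclidean_space \<times> 'a) set" and X1 X2 :: "'a set"
  assumes "closedin (top_of_set cotangent_dot) \<Gamma>1" and "fibre_conic \<Gamma>1"
    and "closedin (top_of_set cotangent_dot) \<Gamma>2" and "fibre_conic \<Gamma>2"
    and "closed X1" and "closed X2"
    and "proper_map (top_of_set (X1 \<times> X2)) euclidean (\<lambda>(x, y). x + y)"
  shows "hypocontinuous
           (normal_topology_supp \<Gamma>1 X1)
           (normal_topology_supp \<Gamma>2 X2)
           (normal_topology_supp
              {(x + y, \<eta>) | x y \<eta>. (x, \<eta>) \<in> \<Gamma>1 \<and> (y, \<eta>) \<in> \<Gamma>2}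
              {x + y | x y. x \<in> X1 \<and> y \<in> X2})
           convolution"
proof -
  let ?X = "{x + y | x y. x \<in> X1 \<and> y \<in> X2}" and ?\<Gamma> = "sum_wf \<Gamma>1 \<Gamma>2"
  let ?E = "dist_wf \<Gamma>1 \<inter> dist_on X1" and ?F = "dist_wf \<Gamma>2 \<inter> dist_on X2"
  have X: "proper_add X1 X2" unfolding proper_add_def using assms(5-7) by (intro conjI)
  note \<Gamma> = assms(1-4)
  have conv: "convolution u v \<in> dist_wf ?\<Gamma> \<inter> dist_on ?X" if uv: "u \<in> ?E" "v \<in> ?F" for u v
  proof -
    have "u \<in> dist_on X1" "v \<in> dist_on X2" using uv by auto
    then show ?thesis
      using convolution_dist_wf[OF X \<Gamma> uv] supp_dist_convolution[OF X] by (simp add: dist_on_def dist_wf_def)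
  qed
  show ?thesis
    unfolding hypocontinuous_def
  proof (intro conjI allI impI)
    show "bilinear_between (topspace (normal_topology_supp \<Gamma>1 X1)) (topspace (normal_topology_supp \<Gamma>2 X2))
        (topspace (normal_topology_supp ?\<Gamma> ?X)) convolution"
      unfolding bilinear_between_def topspace_normal_topology_supp
    proof (intro conjI ballI allI)
      fix u v u' v' c
      assume "u \<in> ?E" "v \<in> ?F"
      then have u: "u \<in> dist_on X1" and v: "v \<in> dist_on X2" by auto
      show "convolution u v \<in> dist_wf ?\<Gamma> \<inter> dist_on ?X" by (rule conv) fact+
      \<comment> \<open>Homogeneity is the linear combination with second coefficient 0, where
        \<open>u\<close> itself fills the second place.\<close>
      show "convolution (\<lambda>i. c * u i) v = (\<lambda>k. c * convolution u v k)"
        using convolution_linear_left[OF X u u v, of c 0] by simp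
      show "convolution u (\<lambda>i. c * v i) = (\<lambda>k. c * convolution u v k)"
        using convolution_linear_right[OF X u v v, of c 0] by simp
    next
      fix u u' v assume "u \<in> ?E" "u' \<in> ?E" "v \<in> ?F"
      then show "convolution (\<lambda>i. u i + u' i) v = (\<lambda>k. convolution u v k + convolution u' v k)"
        using convolution_linear_left[OF X, of u u' v 1 1] by simp
    next
      fix u v v' assume "u \<in> ?E" "v \<in> ?F" "v' \<in> ?F"
      then show "convolution u (\<lambda>i. v i + v' i) = (\<lambda>k. convolution u v k + convolution u v' k)"
        using convolution_linear_right[OF X, of u v v' 1 1] by simp
    qed
  next
    fix W A assume W: "zero_nhd (normal_topology_supp ?\<Gamma> ?X) W" and "tvs_bounded (normal_topology_supp \<Gamma>1 X1) A"
    note A = tvs_bounded_imp_dist_bounded[OF this(2)]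
    show "\<exists>V. zero_nhd (normal_topology_supp \<Gamma>2 X2) V \<and> (\<forall>u\<in>A. \<forall>v\<in>V. convolution u v \<in> W)"
    proof (rule dominated_hypocontinuity[where w = convolution, OF _ _ W])
      show "dominated (normal_seminorms \<Gamma>2) (dist_on X2) A (\<lambda>u v. p (convolution u v))"
        if "p \<in> normal_seminorms ?\<Gamma>" for p
        by (rule dominated_convolution_right[OF X \<Gamma> A(1) _ that]) (use A(2) in blast)
    qed (rule conv, use A(2) in auto)
  next
    fix W A assume W: "zero_nhd (normal_topology_supp ?\<Gamma> ?X) W" and "tvs_bounded (normal_topology_supp \<Gamma>2 X2) A"
    note A = tvs_bounded_imp_dist_bounded[OF this(2)]
    \<comment> \<open>\<open>dominated_hypocontinuity\<close> lists the bounded variable first, so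
      \<open>w\<close> exchanges the arguments of the convolution and the quantifiers are reordered
      afterwards.\<close>
    have "\<exists>U. zero_nhd (normal_topology_supp \<Gamma>1 X1) U \<and> (\<forall>v\<in>A. \<forall>u\<in>U. convolution u v \<in> W)"
    proof (rule dominated_hypocontinuity[where w = "\<lambda>v u. convolution u v", OF _ _ W])
      show "dominated (normal_seminorms \<Gamma>1) (dist_on X1) A (\<lambda>v u. p (convolution u v))"
        if "p \<in> normal_seminorms ?\<Gamma>" for p
        by (rule dominated_convolution_left[OF X \<Gamma> A(1) _ that]) (use A(2) in blast)
    qed (rule conv, use A(2) in auto)
    then show "\<exists>U. zero_nhd (normal_topology_supp \<Gamma>1 X1) U \<and> (\<forall>u\<in>U. \<forall>v\<in>A. convolution u v \<in> W)" by blast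
  qed
qed

end
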